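(* Let $\Omega\subset\mathbb{R}^N$ be a bounded domain with $C^1$ boundary, $1<p<N$, let $a$ be an operator satisfying the structural hypotheses listed in the context with potential $\Phi$, and let $\rho,V\in L^\infty(\mathbb{R}^N)$ be $Q$-periodic, $Q=[0,1]^N$, with $0<\rho^-\le\rho\le\rho^+<\infty$ and $V\ge V^-$ a.e. for some constant $V^->0$. For $\varepsilon>0$ and $k\ge1$ let $\lambda_k^\varepsilon=\lambda_k^B(\rho_\varepsilon,V_\varepsilon)$ be the $k$-th variational eigenvalue of the problem with eigenvalue dependent boundary condition $$-\mathrm{div}(a(x,\nabla u))+V(\tfrac{x}{\varepsilon})|u|^{p-2}u=\lambda\rho(\tfrac{x}{\varepsilon})|u|^{p-2}u\ \text{ in }\Omega,\qquad a(x,\nabla u)\cdot\nu=\lambda|u|^{p-2}u\ \text{ on }\partial\Omega,$$ and let $\lambda_k=\lambda_k^B(\bar\rho,\bar V)$ be that of the limit problem, in which $\rho(x/\varepsilon),V(x/\varepsilon)$ are replaced by $\bar\rho,\bar V$. Then there exists a constant $C>0$, independent of $\varepsilon$ and $k$, such that $$|\lambda_k^\varepsilon-\lambda_k|\le C\,k^{\frac{2(p-1)}{N-1}}\,\varepsilon\qquad\text{for all }\varepsilon>0,\ k\ge1.$$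
   Context: Notation: $\rho_\varepsilon(x)=\rho(x/\varepsilon)$, $V_\varepsilon(x)=V(x/\varepsilon)$, $\bar\rho=\int_Q\rho\,dy$, $\bar V=\int_Q V\,dy$; $\nu$ is the outer unit normal. Structural hypotheses on $a:\Omega\times\mathbb{R}^N\to\mathbb{R}^N$, with constants $\alpha,\beta_0,c>0$ (for a.e. $x\in\Omega$, all $\xi,\xi_i\in\mathbb{R}^N$): (H0) $a$ is Carathéodory ($a(x,\cdot)$ continuous for a.e. $x$, $a(\cdot,\xi)$ measurable for every $\xi$); (H1) $0\le (a(x,\xi_1)-a(x,\xi_2))\cdot(\xi_1-\xi_2)$; (H2) $\alpha|\xi|^p\le a(x,\xi)\cdot\xi$; (H3) $|a(x,\xi)|\le\beta_0|\xi|^{p-1}$; (H4) $a(x,t\xi)=t^{p-1}a(x,\xi)$ for all $t>0$; (H5) $a(x,-\xi)=-a(x,\xi)$; (H6) $|a(x,\xi_1)-a(x,\xi_2)|\le c\,\Psi(x,\xi_1,\xi_2)^{(p-1-\delta)/p}\,[(a(x,\xi_1)-a(x,\xi_2))\cdot(\xi_1-\xi_2)]^{\delta/p}$, where $\Psi(x,\xi_1,\xi_2)=a(x,\xi_1)\cdot\xi_1+a(x,\xi_2)\cdot\xi_2$ and $\delta=\min\{p/2,p-1\}$; (H7) $\sum_{i=1}^m a(x,\xi_i)\cdot(\xi_{i+1}-\xi_i)\le0$ for all $m\ge1$ and $\xi_1,\dots,\xi_{m+1}$ with $\xi_{m+1}=\xi_1$; (H8) $\alpha|\xi_1-\xi_2|^{\gamma}\Psi(x,\xi_1,\xi_2)^{1-\gamma/p}\le(a(x,\xi_1)-a(x,\xi_2))\cdot(\xi_1-\xi_2)$,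 $\gamma=\max\{2,p\}$ (for $\xi_1=\xi_2$ the left side is read as $0$). Under these hypotheses there is a unique Carathéodory function $\Phi$, even, $p$-homogeneous, strictly convex and differentiable in $\xi$, with $\Phi(x,0)=0$, $\nabla_\xi\Phi(x,\xi)=p\,a(x,\xi)$ and $\alpha|\xi|^p\le\Phi(x,\xi)\le\beta_0|\xi|^p$ (known fact). Variational eigenvalues: put $F(u,w)=\int_\Omega w|u|^p\,dx$, $G(u)=\int_\Omega\Phi(x,\nabla u)\,dx$, $H(u)=\int_{\partial\Omega}|u|^p\,dS$ (traces). Let $\Gamma_k$ be the family of compact sets $C\subset W^{1,p}(\Omega)\setminus\{0\}$ with $C=-C$ and Krasnoselskii genus $\gamma(C)\ge k$, where $\gamma(C)$ is the least $m$ for which there is an odd continuous map $C\to\mathbb{R}^m\setminus\{0\}$ ($+\infty$ if none exists). Then $$\lambda_k^B(w,W)=\inf_{C\in\Gamma_k}\sup_{u\in C}\frac{G(u)+F(u,W)}{H(u)+F(u,w)}.$$ *)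

theory Defs
  imports "HOL-Analysis.Analysis"
begin

section \<open>Smooth functions and domains with \<open>C\<^sup>1\<close> boundary\<close>

definition partial_deriv :: "'n::finite \<Rightarrow> (real^'n \<Rightarrow> real) \<Rightarrow> real^'n \<Rightarrow> real" where
  "partial_deriv i f x = frechet_derivative f (at x) (axis i 1)"

primrec C_fun :: "nat \<Rightarrow> (real^'n::finite \<Rightarrow> real) \<Rightarrow> bool" where
  "C_fun 0 f \<longleftrightarrow> continuous_on UNIV f"
| "C_fun (Suc k) f \<longleftrightarrow> (\<forall>x. f differentiable (at x)) \<and> (\<forall>i. C_fun k (partial_deriv i f))"

definition smooth_fun :: "(real^'n::finite \<Rightarrow> real) \<Rightarrow> bool" where
  "smooth_fun f \<longleftrightarrow> (\<forall>k. C_fun k f)"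

definition test_fun :: "(real^'n::finite) set \<Rightarrow> (real^'n \<Rightarrow> real) \<Rightarrow> bool" where
  "test_fun \<Omega> f \<longleftrightarrow> smooth_fun f \<and> compact (closure {x. f x \<noteq> 0}) \<and> closure {x. f x \<noteq> 0} \<subseteq> \<Omega>"

text \<open>Near every boundary point \<open>\<Omega>\<close> is the region above the graph of a \<open>C\<^sup>1\<close> function over a
  hyperplane. Instead of rotating coordinates we name the unit normal \<open>e\<close> of that hyperplane; a
  function \<open>g\<close> on the hyperplane is evaluated at the orthogonal projection \<open>x - (x \<bullet> e) e\<close>, so
  that only the values of \<open>g\<close> on the hyperplane matter.\<close>

definition C1_boundary :: "(real^'n::finite) set \<Rightarrow> bool" where
  "C1_boundary \<Omega> \<longleftrightarrow> (\<forall>x0\<in>frontier \<Omega>. \<exists>r>0. \<exists>e g. norm e = 1 \<and> C_fun 1 g \<and>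
      \<Omega> \<inter> ball x0 r = {x \<in> ball x0 r. g (x - (x \<bullet> e) *\<^sub>R e) < x \<bullet> e})"

definition bounded_C1_domain :: "(real^'n::finite) set \<Rightarrow> bool" where
  "bounded_C1_domain \<Omega> \<longleftrightarrow> \<Omega> \<noteq> {} \<and> open \<Omega> \<and> connected \<Omega> \<and> bounded \<Omega> \<and> C1_boundary \<Omega>"

section \<open>Surface measure\<close>

text \<open>The surface measure \<open>dS\<close> is the (N-1)-dimensional Hausdorff measure, normalised by the
  volume of the unit ball so that it agrees with Lebesgue measure on hyperplanes. The Hausdorff
  outer measure is a metric outer measure, hence countably additive on the Borel sets, so
  \<^const>\<open>measure_of\<close> is applied to a genuine measure.\<close>

definition hausdorff_premeasure :: "nat \<Rightarrow> real \<Rightarrow> 'a::metric_space set \<Rightarrow> ennreal" where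
  "hausdorff_premeasure d \<delta> A =
     (INF E \<in> {E :: nat \<Rightarrow> 'a set. A \<subseteq> (\<Union>i. E i) \<and> (\<forall>i. bounded (E i) \<and> diameter (E i) \<le> \<delta>)}.
        \<Sum>i. if E i = {} then 0 else ennreal (unit_ball_vol (real d) * (diameter (E i) / 2) ^ d))"

definition hausdorff_outer :: "nat \<Rightarrow> 'a::metric_space set \<Rightarrow> ennreal" where
  "hausdorff_outer d A = (SUP \<delta>\<in>{0<..}. hausdorff_premeasure d \<delta> A)"

definition hausdorff_measure :: "nat \<Rightarrow> 'a::metric_space measure" where
  "hausdorff_measure d = measure_of UNIV (sets borel) (hausdorff_outer d)"

definition surface_measure :: "(real^'n::finite) measure" where
  "surface_measure = hausdorff_measure (CARD('n) - 1)"

section \<open>The Sobolev space \<open>W\<^sup>1\<^sup>,\<^sup>p(\<Omega>)\<close>\<close>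

definition in_Lp :: "real \<Rightarrow> 'a measure \<Rightarrow> ('a \<Rightarrow> 'b::euclidean_space) \<Rightarrow> bool" where
  "in_Lp p M f \<longleftrightarrow> f \<in> borel_measurable M \<and> integrable M (\<lambda>x. norm (f x) powr p)"

definition weak_gradient ::
    "(real^'n::finite) set \<Rightarrow> (real^'n \<Rightarrow> real) \<Rightarrow> (real^'n \<Rightarrow> real^'n) \<Rightarrow> bool" where
  "weak_gradient \<Omega> u g \<longleftrightarrow>
     (\<forall>K. compact K \<and> K \<subseteq> \<Omega> \<longrightarrow> set_integrable lebesgue K u \<and> set_integrable lebesgue K g) \<and>
     (\<forall>f i. test_fun \<Omega> f \<longrightarrow>
        (LINT x|lebesgue_on \<Omega>. u x * partial_deriv i f x) = - (LINT x|lebesgue_on \<Omega>. g x $ i * f x))"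

text \<open>Elements of the space are represented by functions; two functions equal almost everywhere
  on \<open>\<Omega>\<close> represent the same element and are topologically indistinguishable below. Values outside
  \<open>\<Omega>\<close> are irrelevant.\<close>

definition sobolev :: "real \<Rightarrow> (real^'n::finite) set \<Rightarrow> (real^'n \<Rightarrow> real) set" where
  "sobolev p \<Omega> = {u. in_Lp p (lebesgue_on \<Omega>) u \<and>
     (\<exists>g. weak_gradient \<Omega> u g \<and> in_Lp p (lebesgue_on \<Omega>) g)}"

text \<open>The weak gradient is unique up to null sets, so the choice does not affect integrals.\<close>

definition wgrad :: "(real^'n::finite) set \<Rightarrow> (real^'n \<Rightarrow> real) \<Rightarrow> real^'n \<Rightarrow> real^'n" where
  "wgrad \<Omega> u = (SOME g. weak_gradient \<Omega> u g)"

definition sobolev_norm :: "real \<Rightarrow> (real^'n::finite) set \<Rightarrow> (real^'n \<Rightarrow> real) \<Rightarrow> real" where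
  "sobolev_norm p \<Omega> u =
     ((LINT x|lebesgue_on \<Omega>. \<bar>u x\<bar> powr p) + (LINT x|lebesgue_on \<Omega>. norm (wgrad \<Omega> u x) powr p))
       powr (1 / p)"

definition sobolev_topology :: "real \<Rightarrow> (real^'n::finite) set \<Rightarrow> (real^'n \<Rightarrow> real) topology" where
  "sobolev_topology p \<Omega> = topology (\<lambda>U. U \<subseteq> sobolev p \<Omega> \<and>
     (\<forall>u\<in>U. \<exists>r>0. \<forall>v\<in>sobolev p \<Omega>. sobolev_norm p \<Omega> (\<lambda>x. v x - u x) < r \<longrightarrow> v \<in> U))"

lemma openin_sobolev_topology:
  "openin (sobolev_topology p \<Omega>) U \<longleftrightarrow> U \<subseteq> sobolev p \<Omega> \<and>
     (\<forall>u\<in>U. \<exists>r>0. \<forall>v\<in>sobolev p \<Omega>. sobolev_norm p \<Omega> (\<lambda>x. v x - u x) < r \<longrightarrow> v \<in> U)"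
proof -
  have "istopology (\<lambda>U. U \<subseteq> sobolev p \<Omega> \<and>
     (\<forall>u\<in>U. \<exists>r>0. \<forall>v\<in>sobolev p \<Omega>. sobolev_norm p \<Omega> (\<lambda>x. v x - u x) < r \<longrightarrow> v \<in> U))"
    (is "istopology ?P")
    unfolding istopology_def
  proof (intro conjI allI impI)
    fix S T assume S: "?P S" and T: "?P T"
    then show "S \<inter> T \<subseteq> sobolev p \<Omega>" by blast
    show "\<forall>u\<in>S \<inter> T. \<exists>r>0. \<forall>v\<in>sobolev p \<Omega>.
        sobolev_norm p \<Omega> (\<lambda>x. v x - u x) < r \<longrightarrow> v \<in> S \<inter> T"
    proof
      fix u assume "u \<in> S \<inter> T"
      then obtain r s where
        "r > 0" "\<forall>v\<in>sobolev p \<Omega>. sobolev_norm p \<Omega> (\<lambda>x. v x - u x) < r \<longrightarrow> v \<in> S"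
        "s > 0" "\<forall>v\<in>sobolev p \<Omega>. sobolev_norm p \<Omega> (\<lambda>x. v x - u x) < s \<longrightarrow> v \<in> T"
        using S T by blast
      then show "\<exists>r>0. \<forall>v\<in>sobolev p \<Omega>. sobolev_norm p \<Omega> (\<lambda>x. v x - u x) < r \<longrightarrow> v \<in> S \<inter> T"
        by (intro exI[of _ "min r s"]) auto
    qed
  next
    fix \<K> assume K: "\<forall>K\<in>\<K>. ?P K"
    then show "\<Union>\<K> \<subseteq> sobolev p \<Omega>" by blast
    show "\<forall>u\<in>\<Union>\<K>. \<exists>r>0. \<forall>v\<in>sobolev p \<Omega>.
        sobolev_norm p \<Omega> (\<lambda>x. v x - u x) < r \<longrightarrow> v \<in> \<Union>\<K>"
      using K by (meson UnionE UnionI)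
  qed
  then show ?thesis
    by (simp add: sobolev_topology_def topology_inverse')
qed

text \<open>The trace is the continuous extension of the restriction map from smooth functions on the
  closure: it is the \<open>L\<^sup>p(\<partial>\<Omega>)\<close> limit of the restrictions of smooth functions that converge in
  \<open>W\<^sup>1\<^sup>,\<^sup>p(\<Omega>)\<close>. It is unique up to null sets of the surface measure.\<close>

definition is_trace ::
    "real \<Rightarrow> (real^'n::finite) set \<Rightarrow> (real^'n \<Rightarrow> real) \<Rightarrow> (real^'n \<Rightarrow> real) \<Rightarrow> bool" where
  "is_trace p \<Omega> u g \<longleftrightarrow> in_Lp p (restrict_space surface_measure (frontier \<Omega>)) g \<and>
     (\<exists>f :: nat \<Rightarrow> real^'n \<Rightarrow> real. (\<forall>n. smooth_fun (f n)) \<and>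
        (\<lambda>n. sobolev_norm p \<Omega> (\<lambda>x. f n x - u x)) \<longlonglongrightarrow> 0 \<and>
        (\<lambda>n. LINT x|restrict_space surface_measure (frontier \<Omega>). \<bar>f n x - g x\<bar> powr p) \<longlonglongrightarrow> 0)"

definition trace_fun :: "real \<Rightarrow> (real^'n::finite) set \<Rightarrow> (real^'n \<Rightarrow> real) \<Rightarrow> real^'n \<Rightarrow> real" where
  "trace_fun p \<Omega> u = (SOME g. is_trace p \<Omega> u g)"

section \<open>The operator and its potential\<close>

definition caratheodory_fun ::
    "(real^'n::finite) set \<Rightarrow> (real^'n \<Rightarrow> real^'n \<Rightarrow> 'b::euclidean_space) \<Rightarrow> bool" where
  "caratheodory_fun \<Omega> f \<longleftrightarrow> (AE x in lebesgue_on \<Omega>. continuous_on UNIV (f x)) \<and>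
     (\<forall>\<xi>. (\<lambda>x. f x \<xi>) \<in> borel_measurable (lebesgue_on \<Omega>))"

definition Psi_of :: "('a \<Rightarrow> real^'n::finite \<Rightarrow> real^'n) \<Rightarrow> 'a \<Rightarrow> real^'n \<Rightarrow> real^'n \<Rightarrow> real" where
  "Psi_of a x \<xi>\<^sub>1 \<xi>\<^sub>2 = a x \<xi>\<^sub>1 \<bullet> \<xi>\<^sub>1 + a x \<xi>\<^sub>2 \<bullet> \<xi>\<^sub>2"

text \<open>Since \<open>0 powr s = 0\<close> for every \<open>s\<close>, the left side of the last condition is \<open>0\<close> for
  \<open>\<xi>\<^sub>1 = \<xi>\<^sub>2\<close>, also when the exponent of \<open>Psi\<close> is negative and \<open>Psi\<close> vanishes. The convention
  \<open>0 powr 0 = 0\<close> is harmless here: \<open>Psi\<close> vanishes only for \<open>\<xi>\<^sub>1 = \<xi>\<^sub>2 = 0\<close>.\<close>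

definition structural_hyps ::
    "real \<Rightarrow> real \<Rightarrow> real \<Rightarrow> real \<Rightarrow> (real^'n::finite) set \<Rightarrow> (real^'n \<Rightarrow> real^'n \<Rightarrow> real^'n) \<Rightarrow> bool"
  where
  "structural_hyps p \<alpha> \<beta>\<^sub>0 c \<Omega> a \<longleftrightarrow>
     (let \<delta> = min (p / 2) (p - 1); \<gamma> = max 2 p in
     caratheodory_fun \<Omega> a \<and>
     (AE x in lebesgue_on \<Omega>.
       (\<forall>\<xi>\<^sub>1 \<xi>\<^sub>2. 0 \<le> (a x \<xi>\<^sub>1 - a x \<xi>\<^sub>2) \<bullet> (\<xi>\<^sub>1 - \<xi>\<^sub>2)) \<and>
       (\<forall>\<xi>. \<alpha> * norm \<xi> powr p \<le> a x \<xi> \<bullet> \<xi>) \<and>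
       (\<forall>\<xi>. norm (a x \<xi>) \<le> \<beta>\<^sub>0 * norm \<xi> powr (p - 1)) \<and>
       (\<forall>t>0. \<forall>\<xi>. a x (t *\<^sub>R \<xi>) = (t powr (p - 1)) *\<^sub>R a x \<xi>) \<and>
       (\<forall>\<xi>. a x (- \<xi>) = - a x \<xi>) \<and>
       (\<forall>\<xi>\<^sub>1 \<xi>\<^sub>2. norm (a x \<xi>\<^sub>1 - a x \<xi>\<^sub>2) \<le>
          c * Psi_of a x \<xi>\<^sub>1 \<xi>\<^sub>2 powr ((p - 1 - \<delta>) / p)
            * ((a x \<xi>\<^sub>1 - a x \<xi>\<^sub>2) \<bullet> (\<xi>\<^sub>1 - \<xi>\<^sub>2)) powr (\<delta> / p)) \<and>
       (\<forall>m\<ge>1. \<forall>\<xi> :: nat \<Rightarrow> real^'n. \<xi> (m + 1) = \<xi> 1 \<longrightarrow>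
          (\<Sum>i=1..m. a x (\<xi> i) \<bullet> (\<xi> (i + 1) - \<xi> i)) \<le> 0) \<and>
       (\<forall>\<xi>\<^sub>1 \<xi>\<^sub>2. \<alpha> * norm (\<xi>\<^sub>1 - \<xi>\<^sub>2) powr \<gamma> * Psi_of a x \<xi>\<^sub>1 \<xi>\<^sub>2 powr (1 - \<gamma> / p)
          \<le> (a x \<xi>\<^sub>1 - a x \<xi>\<^sub>2) \<bullet> (\<xi>\<^sub>1 - \<xi>\<^sub>2))))"

definition is_potential ::
    "real \<Rightarrow> real \<Rightarrow> real \<Rightarrow> (real^'n::finite) set \<Rightarrow> (real^'n \<Rightarrow> real^'n \<Rightarrow> real^'n) \<Rightarrow>
     (real^'n \<Rightarrow> real^'n \<Rightarrow> real) \<Rightarrow> bool"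
  where
  "is_potential p \<alpha> \<beta>\<^sub>0 \<Omega> a \<Phi> \<longleftrightarrow>
     caratheodory_fun \<Omega> \<Phi> \<and>
     (AE x in lebesgue_on \<Omega>.
       (\<forall>\<xi>. \<Phi> x (- \<xi>) = \<Phi> x \<xi>) \<and>
       (\<forall>t>0. \<forall>\<xi>. \<Phi> x (t *\<^sub>R \<xi>) = t powr p * \<Phi> x \<xi>) \<and>
       (\<forall>\<xi> \<eta> t. \<xi> \<noteq> \<eta> \<and> 0 < t \<and> t < 1 \<longrightarrow>
          \<Phi> x ((1 - t) *\<^sub>R \<xi> + t *\<^sub>R \<eta>) < (1 - t) * \<Phi> x \<xi> + t * \<Phi> x \<eta>) \<and>
       \<Phi> x 0 = 0 \<and>
       (\<forall>\<xi>. (\<Phi> x has_derivative (\<lambda>h. (p *\<^sub>R a x \<xi>) \<bullet> h)) (at \<xi>)) \<and>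
       (\<forall>\<xi>. \<alpha> * norm \<xi> powr p \<le> \<Phi> x \<xi> \<and> \<Phi> x \<xi> \<le> \<beta>\<^sub>0 * norm \<xi> powr p))"

section \<open>Genus and variational eigenvalues\<close>

text \<open>\<^term>\<open>Euclidean_space m\<close> is the library's \<open>\<real>\<^sup>m\<close>, whose points are sequences vanishing from
  index \<open>m\<close> on. The infimum of the empty set in \<^typ>\<open>enat\<close> is \<open>\<infinity>\<close>.\<close>

definition genus :: "('a \<Rightarrow> real) topology \<Rightarrow> ('a \<Rightarrow> real) set \<Rightarrow> enat" where
  "genus T C = (INF m \<in> {m. \<exists>f :: ('a \<Rightarrow> real) \<Rightarrow> nat \<Rightarrow> real.
        continuous_map (subtopology T C) (subtopology (Euclidean_space m) (- {\<lambda>i. 0})) f \<and>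
        (\<forall>u\<in>C. f (\<lambda>x. - u x) = (\<lambda>i. - f u i))}. enat m)"

definition Gamma_family :: "real \<Rightarrow> (real^'n::finite) set \<Rightarrow> nat \<Rightarrow> (real^'n \<Rightarrow> real) set set" where
  "Gamma_family p \<Omega> k = {C. compactin (sobolev_topology p \<Omega>) C \<and>
     (\<forall>u\<in>C. \<not> (AE x in lebesgue_on \<Omega>. u x = 0)) \<and>
     (\<lambda>u x. - u x) ` C = C \<and>
     enat k \<le> genus (sobolev_topology p \<Omega>) C}"

definition F_functional ::
    "real \<Rightarrow> (real^'n::finite) set \<Rightarrow> (real^'n \<Rightarrow> real) \<Rightarrow> (real^'n \<Rightarrow> real) \<Rightarrow> real" where
  "F_functional p \<Omega> u w = (LINT x|lebesgue_on \<Omega>. w x * \<bar>u x\<bar> powr p)"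

definition G_functional ::
    "(real^'n::finite) set \<Rightarrow> (real^'n \<Rightarrow> real^'n \<Rightarrow> real) \<Rightarrow> (real^'n \<Rightarrow> real) \<Rightarrow> real" where
  "G_functional \<Omega> \<Phi> u = (LINT x|lebesgue_on \<Omega>. \<Phi> x (wgrad \<Omega> u x))"

definition H_functional :: "real \<Rightarrow> (real^'n::finite) set \<Rightarrow> (real^'n \<Rightarrow> real) \<Rightarrow> real" where
  "H_functional p \<Omega> u =
     (LINT x|restrict_space surface_measure (frontier \<Omega>). \<bar>trace_fun p \<Omega> u x\<bar> powr p)"

text \<open>The infimum and suprema are taken in the reals: for \<open>w\<close> bounded with a positive lower bound
  and \<open>W\<close> bounded and nonnegative, the quotient is nonnegative and continuous on the compact sets
  involved, which are nonempty for \<open>k \<ge> 1\<close>, and the family is nonempty because \<open>W\<^sup>1\<^sup>,\<^sup>p(\<Omega>)\<close> is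
  infinite-dimensional.\<close>

definition eigenvalue_B ::
    "real \<Rightarrow> (real^'n::finite) set \<Rightarrow> (real^'n \<Rightarrow> real^'n \<Rightarrow> real) \<Rightarrow>
     nat \<Rightarrow> (real^'n \<Rightarrow> real) \<Rightarrow> (real^'n \<Rightarrow> real) \<Rightarrow> real" where
  "eigenvalue_B p \<Omega> \<Phi> k w W =
     (INF C \<in> Gamma_family p \<Omega> k. SUP u \<in> C.
        (G_functional \<Omega> \<Phi> u + F_functional p \<Omega> u W) / (H_functional p \<Omega> u + F_functional p \<Omega> u w))"

section \<open>Periodic coefficients\<close>

definition in_Linf :: "(real^'n::finite \<Rightarrow> real) \<Rightarrow> bool" where
  "in_Linf f \<longleftrightarrow> f \<in> borel_measurable lebesgue \<and> (\<exists>M. AE x in lebesgue. \<bar>f x\<bar> \<le> M)"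

definition Q_periodic :: "(real^'n::finite \<Rightarrow> real) \<Rightarrow> bool" where
  "Q_periodic f \<longleftrightarrow> (\<forall>i. AE x in lebesgue. f (x + axis i 1) = f x)"

definition Q_mean :: "(real^'n::finite \<Rightarrow> real) \<Rightarrow> real" where
  "Q_mean f = (LINT y|lebesgue_on (cbox 0 1). f y)"

definition rescale :: "real \<Rightarrow> (real^'n::finite \<Rightarrow> real) \<Rightarrow> real^'n \<Rightarrow> real" where
  "rescale \<epsilon> f x = f (x /\<^sub>R \<epsilon>)"

end

theory Submission
  imports Defs "HOL-Homology.Homology"
begin

text \<open>The Rayleigh quotients of the two problems are compared on every set of the minimax principle.
  Extended by zero, \<open>|u|\<^sup>p\<close> has bounded variation with variation controlled by the \<open>W\<^sup>1\<^sup>,\<^sup>p\<close> energy of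
  \<open>u\<close>: absolute continuity along lines handles the interior and boundary charts handle the jump across
  \<open>\<partial>\<Omega>\<close>. Subtracting from a periodic weight its mean amounts to averaging over translations by at most one
  cell of size \<open>\<epsilon>\<close>, so the weighted integrals change by \<open>O(\<epsilon>)\<close> times the energy. Hence the quotients satisfy
  \<open>|R\<^sub>\<epsilon> - R| \<le> C \<epsilon> (1 + R)\<^sup>2\<close>, and so do their minimax values.

  It remains to bound the eigenvalues by \<open>C k\<close> to the power \<open>(p - 1) / (N - 1)\<close>. Take \<open>k\<close> disjoint bumps
  centred at points of \<open>\<partial>\<Omega>\<close>, of radius comparable to \<open>k\<close> to the power \<open>-1 / (N - 1)\<close>. The sphere of their
  linear combinations has genus \<open>k\<close> by the Borsuk-Ulam theorem, and on it the boundary term alone bounds the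
  denominator from below. No area formula is used: the surface measure enters only through one-sided
  comparisons with the volume of columns over the boundary.\<close>

section \<open>Hausdorff measure\<close>

text \<open>The error is quadratic in the quotient R for this reason: changing a weight moves
  numerator and denominator by at most a multiple of \<open>\<epsilon>\<close> times the Sobolev
  energy; the energy is bounded by the numerator, hence by R times the denominator, and an error in
  the denominator costs another factor R. The boundary integral is the same in both denominators, so
  it cancels in their difference; for the upper bound on the eigenvalues it must be estimated from
  below. The obstacle there is that \<open>trace_fun\<close> is a choice among functions defined by
  limits, so even a smooth function has to be compared with its own trace. Columns of height
  \<open>T\<close> turn this into a comparison of volume integrals. The exponent comes from scaling:
  a bump of radius s centred on the boundary has energy of order s^(N-p) and boundary mass of order
  s^(N-1), so its quotient is of order s^(1-p), and k disjoint bumps fit if s is of order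
  k^(-1/(N-1)). The square of the quotient doubles the exponent. Infima and suprema are real numbers
  here, so nonemptiness and boundedness have to be proved before any minimax value can be
  estimated.\<close>

lemma hausdorff_premeasure_empty [simp]: "hausdorff_premeasure d \<delta> {} = 0" if "0 \<le> \<delta>"
proof -
  have "hausdorff_premeasure d \<delta> ({}::'a set) \<le> (suminf (\<lambda>i::nat. if ({}::'a set) = {} then 0 else ennreal (unit_ball_vol (real d) * (diameter ({}::'a set) / 2) ^ d)))"
    unfolding hausdorff_premeasure_def
    by (rule INF_lower2[where i="\<lambda>_. {}"]) (use that in auto)
  then show ?thesis by simp
qed

lemma hausdorff_premeasure_antimono:
  "\<delta> \<le> \<delta>' \<Longrightarrow> hausdorff_premeasure d \<delta>' A \<le> hausdorff_premeasure d \<delta> A"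
  unfolding hausdorff_premeasure_def by (rule INF_superset_mono) (auto intro: order_trans)

lemma hausdorff_premeasure_mono:
  "A \<subseteq> B \<Longrightarrow> hausdorff_premeasure d \<delta> A \<le> hausdorff_premeasure d \<delta> B"
  unfolding hausdorff_premeasure_def by (rule INF_superset_mono) auto

text \<open>Nearly optimal covers of the \<open>A i\<close>, with errors halved at each index, are
  merged into one. An infinite premeasure is treated apart because no cover comes strictly below it
  plus an error.\<close>

lemma hausdorff_premeasure_UN:
  fixes A :: "nat \<Rightarrow> 'a::metric_space set"
  shows "hausdorff_premeasure d \<delta> (\<Union>i. A i) \<le> (suminf (\<lambda>i. hausdorff_premeasure d \<delta> (A i)))"
proof (cases "\<exists>i. hausdorff_premeasure d \<delta> (A i) = \<infinity>")
  case True
  then obtain i where "hausdorff_premeasure d \<delta> (A i) = \<infinity>" by auto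
  then have "(suminf (\<lambda>i. hausdorff_premeasure d \<delta> (A i))) = \<infinity>"
    by (metis ennreal_suminf_lessD infinity_ennreal_def less_top)
  then show ?thesis by simp
next
  case False
  define w where "w = (\<lambda>E::'a set. if E = {} then 0 else ennreal (unit_ball_vol (real d) * (diameter E / 2) ^ d))"
  show ?thesis
  proof (rule ennreal_le_epsilon)
    fix e :: real assume e: "0 < e"
    have "\<exists>E. A i \<subseteq> (\<Union>j. E j) \<and> (\<forall>j. bounded (E j) \<and> diameter (E j) \<le> \<delta>) \<and>
        (suminf (\<lambda>j. w (E j))) < hausdorff_premeasure d \<delta> (A i) + ennreal (e * (1/2) ^ Suc i)" for i :: nat
    proof -
      have "hausdorff_premeasure d \<delta> (A i) < hausdorff_premeasure d \<delta> (A i) + ennreal (e * (1/2) ^ Suc i)"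
        using False e by (simp add: ennreal_add_left_cancel_less[where b=0, simplified])
      then show ?thesis
        unfolding hausdorff_premeasure_def w_def INF_less_iff by auto
    qed
    then obtain E where E: "\<And>i. A i \<subseteq> (\<Union>j. E i j)" "\<And>i j. bounded (E i j)" "\<And>i j. diameter (E i j) \<le> \<delta>"
       "\<And>i. (suminf (\<lambda>j. w (E i j))) < hausdorff_premeasure d \<delta> (A i) + ennreal (e * (1/2) ^ Suc i)"
      by metis
    define F where "F = (\<lambda>n. case prod_decode n of (i,j) \<Rightarrow> E i j)"
    have "(\<Union>i. A i) \<subseteq> (\<Union>n. F n)"
    proof
      fix x assume "x \<in> (\<Union>i. A i)"
      then obtain i j where "x \<in> E i j" using E(1) by blast
      then have "x \<in> F (prod_encode (i,j))" by (simp add: F_def)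
      then show "x \<in> (\<Union>n. F n)" by blast
    qed
    then have "hausdorff_premeasure d \<delta> (\<Union>i. A i) \<le> (suminf (\<lambda>n. w (F n)))"
      unfolding hausdorff_premeasure_def w_def
      by (intro INF_lower) (auto simp: F_def E split: prod.split)
    also have "(suminf (\<lambda>n. w (F n))) = (suminf (\<lambda>n. (\<lambda>(i,j). w (E i j)) (prod_decode n)))"
      by (simp add: F_def split_def)
    also have "\<dots> = (suminf (\<lambda>i. suminf (\<lambda>j. w (E i j))))"
      by (rule suminf_ennreal_2dimen) simp
    also have "\<dots> \<le> (suminf (\<lambda>i. hausdorff_premeasure d \<delta> (A i) + ennreal (e * (1/2) ^ Suc i)))"
      using E(4) by (intro suminf_le) (auto intro: less_imp_le)
    also have "\<dots> = (suminf (\<lambda>i. hausdorff_premeasure d \<delta> (A i))) + (suminf (\<lambda>i. ennreal (e * (1/2) ^ Suc i)))"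
      by (simp add: suminf_add)
    also have "(suminf (\<lambda>i. ennreal (e * (1/2) ^ Suc i))) = ennreal e"
    proof -
      have "(\<lambda>i. e * (1/2) ^ Suc i) sums (e * 1)"
        by (intro sums_mult power_half_series)
      then show ?thesis using e
        by (intro suminf_ennreal_eq) auto
    qed
    finally show "hausdorff_premeasure d \<delta> (\<Union>i. A i) \<le> (suminf (\<lambda>i. hausdorff_premeasure d \<delta> (A i))) + ennreal e" .
  qed
qed

lemma hausdorff_premeasure_le_outer: "0 < \<delta> \<Longrightarrow> hausdorff_premeasure d \<delta> A \<le> hausdorff_outer d A"
  unfolding hausdorff_outer_def by (rule SUP_upper) auto

lemma hausdorff_outer_space: "outer_measure_space UNIV (hausdorff_outer d :: 'a::metric_space set \<Rightarrow> ennreal)"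
  unfolding outer_measure_space_def
proof (intro conjI)
  show "positive UNIV (hausdorff_outer d :: 'a set \<Rightarrow> ennreal)"
    by (auto simp: positive_def hausdorff_outer_def intro!: antisym SUP_least)
  show "increasing UNIV (hausdorff_outer d :: 'a set \<Rightarrow> ennreal)"
    unfolding increasing_def hausdorff_outer_def
    by (auto intro!: SUP_mono' hausdorff_premeasure_mono)
  show "countably_subadditive UNIV (hausdorff_outer d :: 'a set \<Rightarrow> ennreal)"
    unfolding countably_subadditive_def
  proof safe
    fix A :: "nat \<Rightarrow> 'a set"
    show "hausdorff_outer d (\<Union> (range A)) \<le> (suminf (\<lambda>i. hausdorff_outer d (A i)))"
      unfolding hausdorff_outer_def[of d "\<Union> (range A)"]
    proof (rule SUP_least)
      fix \<delta> :: real assume "\<delta> \<in> {0<..}"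
      then have "(suminf (\<lambda>i. hausdorff_premeasure d \<delta> (A i))) \<le> (suminf (\<lambda>i. hausdorff_outer d (A i)))"
        by (intro suminf_le) (auto intro: hausdorff_premeasure_le_outer)
      then show "hausdorff_premeasure d \<delta> (\<Union> (range A)) \<le> (suminf (\<lambda>i. hausdorff_outer d (A i)))"
        using hausdorff_premeasure_UN[of d \<delta> A] by simp
    qed
  qed
qed

text \<open>A covering set of diameter below \<open>r\<close> cannot meet both sets, so every fine
  cover of the union splits into a cover of each. Coarse meshes are refined to \<open>r / 2\<close>,
  where the premeasures are at least as large.\<close>

lemma hausdorff_outer_separated:
  fixes A B :: "'a::metric_space set"
  assumes r: "r > 0" and sep: "\<And>x y. x \<in> A \<Longrightarrow> y \<in> B \<Longrightarrow> r \<le> dist x y"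
  shows "hausdorff_outer d A + hausdorff_outer d B \<le> hausdorff_outer d (A \<union> B)"
proof -
  have pre: "hausdorff_premeasure d \<delta> A + hausdorff_premeasure d \<delta> B \<le> hausdorff_premeasure d \<delta> (A \<union> B)"
    if \<delta>: "0 < \<delta>" "\<delta> < r" for \<delta>
    unfolding hausdorff_premeasure_def[of d \<delta> "A \<union> B"]
  proof (rule INF_greatest, clarsimp)
    fix E :: "nat \<Rightarrow> 'a set"
    assume AB: "A \<subseteq> (\<Union> (range E))" "B \<subseteq> (\<Union> (range E))"
      and E: "\<forall>i. bounded (E i) \<and> diameter (E i) \<le> \<delta>"
    define w where "w = (\<lambda>E::'a set. if E = {} then 0 else ennreal (unit_ball_vol (real d) * (diameter E / 2) ^ d))"
    define EA where "EA = (\<lambda>i. if E i \<inter> A = {} then {} else E i)"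
    define EB where "EB = (\<lambda>i. if E i \<inter> B = {} then {} else E i)"
    have "hausdorff_premeasure d \<delta> A \<le> (suminf (\<lambda>i. w (EA i)))"
      unfolding hausdorff_premeasure_def w_def
      by (intro INF_lower) (use AB E \<delta> in \<open>force simp: EA_def\<close>)
    moreover have "hausdorff_premeasure d \<delta> B \<le> (suminf (\<lambda>i. w (EB i)))"
      unfolding hausdorff_premeasure_def w_def
      by (intro INF_lower) (use AB E \<delta> in \<open>force simp: EB_def\<close>)
    moreover have "(suminf (\<lambda>i. w (EA i))) + (suminf (\<lambda>i. w (EB i))) = (suminf (\<lambda>i. w (EA i) + w (EB i)))"
      by (simp add: suminf_add)
    moreover have "(suminf (\<lambda>i. w (EA i) + w (EB i))) \<le> (suminf (\<lambda>i. w (E i)))"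
    proof (rule suminf_le)
      fix i
      have "E i \<inter> A = {} \<or> E i \<inter> B = {}"
      proof (rule ccontr)
        assume "\<not> (E i \<inter> A = {} \<or> E i \<inter> B = {})"
        then obtain x y where "x \<in> E i" "x \<in> A" "y \<in> E i" "y \<in> B" by blast
        then have "r \<le> diameter (E i)"
          using sep[of x y] E diameter_bounded_bound[of "E i" x y] by fastforce
        then show False using E \<delta> by (smt (verit))
      qed
      then show "w (EA i) + w (EB i) \<le> w (E i)"
        by (auto simp: EA_def EB_def w_def)
    qed auto
    ultimately show "hausdorff_premeasure d \<delta> A + hausdorff_premeasure d \<delta> B \<le>
       (suminf (\<lambda>i. if E i = {} then 0 else ennreal (unit_ball_vol (real d) * (diameter (E i) / 2) ^ d)))"
      unfolding w_def by (metis (no_types, lifting) add_mono order_trans)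
  qed
  have "hausdorff_outer d A + hausdorff_outer d B
      = (SUP \<delta>\<in>{0<..}. hausdorff_premeasure d \<delta> A + hausdorff_premeasure d \<delta> B)"
    unfolding hausdorff_outer_def
  proof (rule SUP_add_directed_ennreal[symmetric])
    fix i j :: real assume "i \<in> {0<..}" "j \<in> {0<..}"
    then show "\<exists>k\<in>{0<..}. hausdorff_premeasure d i A + hausdorff_premeasure d j B
       \<le> hausdorff_premeasure d k A + hausdorff_premeasure d k B"
      by (intro bexI[of _ "min i j"] add_mono hausdorff_premeasure_antimono) auto
  qed
  also have "\<dots> \<le> hausdorff_outer d (A \<union> B)"
  proof (rule SUP_least)
    fix \<delta> :: real assume \<delta>: "\<delta> \<in> {0<..}"
    let ?\<delta> = "min \<delta> (r/2)"
    have "hausdorff_premeasure d \<delta> A + hausdorff_premeasure d \<delta> B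
       \<le> hausdorff_premeasure d ?\<delta> A + hausdorff_premeasure d ?\<delta> B"
      by (intro add_mono hausdorff_premeasure_antimono) auto
    also have "\<dots> \<le> hausdorff_premeasure d ?\<delta> (A \<union> B)"
      using \<delta> r by (intro pre) auto
    also have "\<dots> \<le> hausdorff_outer d (A \<union> B)"
      using \<delta> r by (intro hausdorff_premeasure_le_outer) auto
    finally show "hausdorff_premeasure d \<delta> A + hausdorff_premeasure d \<delta> B \<le> hausdorff_outer d (A \<union> B)" .
  qed
  finally show ?thesis .
qed

text \<open>Caratheodory's criterion for metric outer measures. The part \<open>B n\<close> of
  \<open>X\<close> away from the closed set \<open>F\<close> is separated from it; what is left near
  \<open>F\<close> is a union of shells \<open>R i\<close> whose measures form a convergent series,
  so the remainder is a vanishing tail. Because of this, \<open>measure_of\<close> in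
  \<open>hausdorff_measure\<close> does not fall back to the zero measure.\<close>

lemma borel_in_hausdorff_lambda_system:
  "sets borel \<subseteq> lambda_system UNIV UNIV (hausdorff_outer d :: 'a::metric_space set \<Rightarrow> ennreal)"
proof -
  let ?\<mu> = "hausdorff_outer d :: 'a set \<Rightarrow> ennreal"
  interpret UNIV: sigma_algebra UNIV "UNIV :: 'a set set"
    using sigma_algebra_Pow[of "UNIV :: 'a set"] by simp
  have mono: "A \<subseteq> B \<Longrightarrow> ?\<mu> A \<le> ?\<mu> B" for A B
    using hausdorff_outer_space[of d] unfolding outer_measure_space_def increasing_def by auto
  have UNle: "?\<mu> (\<Union>i. A i) \<le> (suminf (\<lambda>i. ?\<mu> (A i)))" for A :: "nat \<Rightarrow> 'a set"
  proof (rule order_trans[OF _ order_refl])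
    show "?\<mu> (\<Union>i. A i) \<le> (suminf (\<lambda>i. ?\<mu> (A i)))"
      unfolding hausdorff_outer_def[of d "\<Union>i. A i"]
    proof (rule SUP_least)
      fix \<delta> :: real assume "\<delta> \<in> {0<..}"
      then have "(suminf (\<lambda>i. hausdorff_premeasure d \<delta> (A i))) \<le> (suminf (\<lambda>i. ?\<mu> (A i)))"
        by (intro suminf_le) (auto intro: hausdorff_premeasure_le_outer)
      then show "hausdorff_premeasure d \<delta> (\<Union>i. A i) \<le> (suminf (\<lambda>i. ?\<mu> (A i)))"
        using hausdorff_premeasure_UN[of d \<delta> A] by simp
    qed
  qed
  have emp: "?\<mu> {} = 0"
    using hausdorff_outer_space[of d] unfolding outer_measure_space_def positive_def by auto
  have Un2: "?\<mu> (A \<union> B) \<le> ?\<mu> A + ?\<mu> B" for A B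
  proof -
    have "?\<mu> (\<Union>i. binaryset A B i) \<le> (suminf (\<lambda>i. ?\<mu> (binaryset A B i)))" by (rule UNle)
    then show ?thesis using suminf_binaryset_eq[of ?\<mu> A B] emp by (simp add: UN_binaryset_eq)
  qed
  have cl: "F \<in> lambda_system UNIV UNIV ?\<mu>" if "closed F" for F
  proof (cases "F = {}")
    case True then show ?thesis by (simp add: lambda_system_def emp)
  next
    case False
    show ?thesis unfolding UNIV.lambda_system_eq
    proof (clarsimp)
      fix X :: "'a set"
      have "?\<mu> (X \<inter> F) + ?\<mu> (X - F) \<le> ?\<mu> X"
      proof (cases "?\<mu> X = \<infinity>")
        case True then show ?thesis by simp
      next
        case fin: False
        define B where "B n = {x\<in>X. 1 / Suc n \<le> infdist x F}" for n :: nat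
        define R where "R n = {x\<in>X. 1 / Suc (Suc n) \<le> infdist x F \<and> infdist x F < 1 / Suc n}" for n :: nat
        have B_le: "?\<mu> (X \<inter> F) + ?\<mu> (B n) \<le> ?\<mu> X" for n
        proof -
          have "?\<mu> (X \<inter> F) + ?\<mu> (B n) \<le> ?\<mu> (X \<inter> F \<union> B n)"
          proof (rule hausdorff_outer_separated[of "1 / Suc n"])
            fix x y assume "x \<in> X \<inter> F" "y \<in> B n"
            then show "1 / real (Suc n) \<le> dist x y"
              using infdist_le[of x F y] by (auto simp: B_def dist_commute)
          qed simp
          also have "\<dots> \<le> ?\<mu> X" by (rule mono) (auto simp: B_def)
          finally show ?thesis .
        qed
        \<comment> \<open>Consecutive shells may touch, but shells whose indices differ by two or
          more are separated; even and odd indices are therefore summed apart.\<close>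
        have R_sep: "(\<Sum>i<n. ?\<mu> (R (2*i+k))) \<le> ?\<mu> (\<Union>i<n. R (2*i+k))" for n k
        proof (induction n)
          case 0 then show ?case by (simp add: emp)
        next
          case (Suc n)
          show ?case
          \<comment> \<open>The gap used below starts from \<open>1 / real (2*n+k)\<close>, which
            for n = k = 0 would be a division by zero, that is 0, and the gap would not be
            positive.\<close>
          proof (cases "n = 0")
            case True then show ?thesis by (simp add: lessThan_Suc)
          next
          case n0: False
          have "(\<Sum>i<Suc n. ?\<mu> (R (2*i+k))) \<le> ?\<mu> (\<Union>i<n. R (2*i+k)) + ?\<mu> (R (2*n+k))"
            using Suc by (simp add: add_mono)
          also have "\<dots> \<le> ?\<mu> ((\<Union>i<n. R (2*i+k)) \<union> R (2*n+k))"
          proof (rule hausdorff_outer_separated[of "1 / real (2*n+k) - 1 / real (Suc (2*n+k))"])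
            show "0 < 1 / real (2*n+k) - 1 / real (Suc (2*n+k))"
              using n0 by (simp add: frac_less2)
          next
            fix x y assume "x \<in> (\<Union>i<n. R (2*i+k))" and y: "y \<in> R (2*n+k)"
            then obtain i where i: "i < n" "x \<in> R (2*i+k)" by auto
            have "1 / real (2*n+k) \<le> 1 / real (Suc (Suc (2*i+k)))"
              using i n0 by (intro frac_le) auto
            then have "1 / real (2*n+k) \<le> infdist x F" using i by (auto simp: R_def)
            moreover have "infdist y F < 1 / real (Suc (2*n+k))" using y by (auto simp: R_def)
            moreover have "infdist x F \<le> infdist y F + dist x y" by (rule infdist_triangle)
            ultimately show "1 / real (2*n+k) - 1 / real (Suc (2*n+k)) \<le> dist x y" by linarith
          qed
          also have "\<dots> = ?\<mu> (\<Union>i<Suc n. R (2*i+k))"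
            by (rule arg_cong[where f="?\<mu>"]) (auto simp: lessThan_Suc)
          finally show ?thesis .
          qed
        qed
        have par: "(suminf (\<lambda>i. ?\<mu> (R (2*i+k)))) \<le> ?\<mu> X" for k
        proof (rule suminf_le_const[OF summableI])
          fix n
          have "?\<mu> (\<Union>i<n. R (2*i+k)) \<le> ?\<mu> X" by (rule mono) (auto simp: R_def)
          with R_sep show "(\<Sum>i<n. ?\<mu> (R (2*i+k))) \<le> ?\<mu> X" by (rule order_trans)
        qed
        have "(suminf (\<lambda>i. ?\<mu> (R i))) \<le> ?\<mu> X + ?\<mu> X"
        proof (rule suminf_le_const[OF summableI])
          fix n
          have "(\<Sum>i<n. ?\<mu> (R i)) \<le> (\<Sum>i<2*n. ?\<mu> (R i))"
            by (rule sum_mono2) auto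
          also have "\<dots> = (\<Sum>i<n. ?\<mu> (R (2*i+0))) + (\<Sum>i<n. ?\<mu> (R (2*i+1)))"
            by (induction n) (auto simp: algebra_simps)
          also have "\<dots> \<le> (suminf (\<lambda>i. ?\<mu> (R (2*i+0)))) + (suminf (\<lambda>i. ?\<mu> (R (2*i+1))))"
            by (intro add_mono sum_le_suminf summableI) auto
          also have "\<dots> \<le> ?\<mu> X + ?\<mu> X" using par[of 0] par[of 1] by (rule add_mono)
          finally show "(\<Sum>i<n. ?\<mu> (R i)) \<le> ?\<mu> X + ?\<mu> X" .
        qed
        then have sumfin: "(suminf (\<lambda>i. ?\<mu> (R i))) \<noteq> \<infinity>"
          using fin by (auto simp: top_unique)
        have dec: "X - F \<subseteq> B n \<union> (\<Union>i. R (i + n))" for n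
        proof
          fix x assume x: "x \<in> X - F"
          then have pos: "infdist x F > 0"
            using \<open>closed F\<close> False by (simp add: infdist_pos_not_in_closed)
          show "x \<in> B n \<union> (\<Union>i. R (i + n))"
          proof (cases "1 / Suc n \<le> infdist x F")
            case True then show ?thesis using x by (auto simp: B_def)
          next
            case False
            obtain m where m: "1 / Suc m < infdist x F"
              using reals_Archimedean[OF pos] by (auto simp: inverse_eq_divide)
            define l where "l = (LEAST m. 1 / Suc m \<le> infdist x F)"
            have l: "1 / Suc l \<le> infdist x F" unfolding l_def by (rule LeastI[of _ m]) (use m in simp)
            have nl: "n < l"
            proof (rule ccontr)
              assume "\<not> n < l"
              then have "1 / real (Suc n) \<le> 1 / Suc l" by (simp add: frac_le)
              with l False show False by simp
            qed
            then have "\<not> 1 / Suc (l-1) \<le> infdist x F" unfolding l_def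
              by (intro not_less_Least) auto
            then have "x \<in> R (l-1)" using l nl x by (auto simp: R_def)
            moreover have "l - 1 = (l - 1 - n) + n" using nl by simp
            ultimately show ?thesis by (metis UN_I UnI2 UNIV_I)
          qed
        qed
        have up: "?\<mu> (X \<inter> F) + ?\<mu> (X - F) \<le> ?\<mu> X + (suminf (\<lambda>i. ?\<mu> (R (i + n))))" for n
        proof -
          have "?\<mu> (X - F) \<le> ?\<mu> (B n) + ?\<mu> (\<Union>i. R (i + n))"
            using mono[OF dec[of n]] Un2 order_trans by blast
          also have "\<dots> \<le> ?\<mu> (B n) + (suminf (\<lambda>i. ?\<mu> (R (i + n))))"
            by (intro add_left_mono UNle)
          finally have "?\<mu> (X \<inter> F) + ?\<mu> (X - F) \<le> (?\<mu> (X \<inter> F) + ?\<mu> (B n)) + (suminf (\<lambda>i. ?\<mu> (R (i + n))))"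
            by (simp add: add.assoc add_left_mono)
          also have "\<dots> \<le> ?\<mu> X + (suminf (\<lambda>i. ?\<mu> (R (i + n))))"
            by (intro add_right_mono B_le)
          finally show ?thesis .
        qed
        let ?L = "?\<mu> (X \<inter> F) + ?\<mu> (X - F)"
        \<comment> \<open>Adding the first \<open>n\<close> terms turns the tail into the whole
          series; in the limit its finite sum cancels, which avoids subtraction in
          \<open>ennreal\<close>.\<close>
        have "?L + (\<Sum>i<n. ?\<mu> (R i)) \<le> ?\<mu> X + (suminf (\<lambda>i. ?\<mu> (R i)))" for n
        proof -
          have "(suminf (\<lambda>i. ?\<mu> (R i))) = (suminf (\<lambda>i. ?\<mu> (R (i + n)))) + (\<Sum>i<n. ?\<mu> (R i))"
            by (rule suminf_offset) simp
          then show ?thesis using up[of n] by (simp add: add_right_mono flip: add.assoc)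
        qed
        moreover have "(\<lambda>n. ?L + (\<Sum>i<n. ?\<mu> (R i))) \<longlonglongrightarrow> ?L + (suminf (\<lambda>i. ?\<mu> (R i)))"
          by (intro tendsto_add tendsto_const summable_LIMSEQ) simp
        ultimately have "?L + (suminf (\<lambda>i. ?\<mu> (R i))) \<le> ?\<mu> X + (suminf (\<lambda>i. ?\<mu> (R i)))"
          by (intro LIMSEQ_le_const2) auto
        then show ?thesis using sumfin by (simp add: add.commute)
      qed
      moreover have "?\<mu> X \<le> ?\<mu> (X \<inter> F) + ?\<mu> (X - F)"
        using Un2[of "X \<inter> F" "X - F"] by (simp add: Int_Diff_Un)
      ultimately show "?\<mu> (X \<inter> F) + ?\<mu> (X - F) = ?\<mu> X" by (rule antisym)
    qed
  qed
  have "sigma_algebra UNIV (lambda_system UNIV UNIV ?\<mu>)"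
    using UNIV.caratheodory_lemma[of ?\<mu>] hausdorff_outer_space[of d, where 'a='a] by (simp add: measure_space_def)
  then show ?thesis
    unfolding borel_eq_closed by (auto dest!: sigma_algebra.sigma_sets_subset[where a="Collect closed"] simp: cl)
qed

lemma sets_hausdorff_measure [simp, measurable_cong]:
  "sets (hausdorff_measure d :: 'a::metric_space measure) = sets borel"
  using sets.sigma_sets_eq[of "borel :: 'a::metric_space measure"]
  by (simp add: hausdorff_measure_def)

lemma space_hausdorff_measure [simp]: "space (hausdorff_measure d) = UNIV"
  by (simp add: hausdorff_measure_def)

lemma emeasure_hausdorff_measure:
  fixes A :: "'a::metric_space set"
  assumes "A \<in> sets borel"
  shows "emeasure (hausdorff_measure d) A = hausdorff_outer d A"
proof -
  interpret UNIV: sigma_algebra UNIV "UNIV :: 'a set set"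
    using sigma_algebra_Pow[of "UNIV :: 'a set"] by simp
  have "measure_space UNIV (lambda_system UNIV UNIV (hausdorff_outer d)) (hausdorff_outer d :: 'a set \<Rightarrow> ennreal)"
    using UNIV.caratheodory_lemma[of "hausdorff_outer d :: 'a set \<Rightarrow> ennreal"]
      hausdorff_outer_space[of d, where 'a='a] by simp
  then have "measure_space UNIV (sets borel) (hausdorff_outer d :: 'a set \<Rightarrow> ennreal)"
    by (rule measure_down) (use borel_in_hausdorff_lambda_system sets.sigma_algebra_axioms[of "borel::'a measure"] in auto)
  then show ?thesis
    unfolding hausdorff_measure_def using assms
    by (intro emeasure_measure_of_sigma) (auto simp: measure_space_def)
qed

section \<open>Smooth functions and test functions\<close>

lemma partial_derivI:
  "(f has_derivative f') (at x) \<Longrightarrow> partial_deriv i f x = f' (axis i 1)"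
  unfolding partial_deriv_def using frechet_derivative_at by metis

lemma has_derivative_partial:
  assumes "f differentiable (at x)"
  shows "(f has_derivative (\<lambda>h. \<Sum>i\<in>UNIV. h $ i * partial_deriv i f x)) (at x)"
proof -
  have d: "(f has_derivative frechet_derivative f (at x)) (at x)"
    using assms by (simp add: frechet_derivative_works)
  then have l: "linear (frechet_derivative f (at x))" by (rule has_derivative_linear)
  have "frechet_derivative f (at x) h = (\<Sum>i\<in>UNIV. h $ i * partial_deriv i f x)" for h
  proof -
    have "frechet_derivative f (at x) (\<Sum>i\<in>UNIV. (h $ i) *\<^sub>R axis i 1) = (\<Sum>i\<in>UNIV. h $ i * partial_deriv i f x)"
      by (simp add: linear_sum[OF l] linear_cmul[OF l] partial_deriv_def)
    then show ?thesis using basis_expansion[of h] by (simp add: scalar_mult_eq_scaleR)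
  qed
  then have "frechet_derivative f (at x) = (\<lambda>h. \<Sum>i\<in>UNIV. h $ i * partial_deriv i f x)" ..
  with d show ?thesis by simp
qed

lemma C_fun_SucD: "C_fun (Suc k) f \<Longrightarrow> C_fun k f"
proof (induction k arbitrary: f)
  case 0
  then show ?case
    by (auto intro!: continuous_at_imp_continuous_on differentiable_imp_continuous_within)
next
  case (Suc k)
  then show ?case by (metis C_fun.simps(2))
qed

lemma C_fun_continuous: "C_fun k f \<Longrightarrow> continuous_on UNIV f"
  by (induction k) (use C_fun_SucD in \<open>auto simp del: C_fun.simps(2)\<close>)

lemma partial_deriv_const [simp]: "partial_deriv i (\<lambda>x. c) = (\<lambda>x. 0)"
  by (rule ext) (rule partial_derivI, rule has_derivative_const)

lemma C_fun_const [simp]: "C_fun k (\<lambda>x. c)"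
  by (induction k arbitrary: c) auto

lemma C_fun_add: "C_fun k f \<Longrightarrow> C_fun k g \<Longrightarrow> C_fun k (\<lambda>x. f x + g x)"
proof (induction k arbitrary: f g)
  case 0 then show ?case by (auto intro: continuous_intros)
next
  case (Suc k)
  have "partial_deriv i (\<lambda>x. f x + g x) = (\<lambda>x. partial_deriv i f x + partial_deriv i g x)" for i
  proof
    fix x
    have "((\<lambda>x. f x + g x) has_derivative (\<lambda>h. frechet_derivative f (at x) h + frechet_derivative g (at x) h)) (at x)"
      using Suc.prems by (intro has_derivative_add) (auto simp: frechet_derivative_works[symmetric])
    then show "partial_deriv i (\<lambda>x. f x + g x) x = partial_deriv i f x + partial_deriv i g x"
      by (subst partial_derivI) (auto simp: partial_deriv_def)
  qed
  with Suc show ?case by auto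
qed

lemma C_fun_mult: "C_fun k f \<Longrightarrow> C_fun k g \<Longrightarrow> C_fun k (\<lambda>x. f x * g x)"
proof (induction k arbitrary: f g)
  case 0 then show ?case by (auto intro: continuous_intros)
next
  case (Suc k)
  have "partial_deriv i (\<lambda>x. f x * g x) = (\<lambda>x. f x * partial_deriv i g x + partial_deriv i f x * g x)" for i
  proof
    fix x
    have "((\<lambda>x. f x * g x) has_derivative (\<lambda>h. f x * frechet_derivative g (at x) h + frechet_derivative f (at x) h * g x)) (at x)"
      using Suc.prems by (intro has_derivative_mult) (auto simp: frechet_derivative_works[symmetric])
    then show "partial_deriv i (\<lambda>x. f x * g x) x = f x * partial_deriv i g x + partial_deriv i f x * g x"
      by (subst partial_derivI) (auto simp: partial_deriv_def)
  qed
  moreover have "C_fun k (\<lambda>x. f x * partial_deriv i g x + partial_deriv i f x * g x)" for i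
    using Suc.prems C_fun_SucD[OF Suc.prems(1)] C_fun_SucD[OF Suc.prems(2)]
    by (intro C_fun_add Suc.IH) auto
  ultimately show ?case using Suc.prems by auto
qed

lemma C_fun_inner:
  fixes v :: "real^'n::finite"
  shows "C_fun k (\<lambda>x. x \<bullet> v)"
proof (cases k)
  case (Suc m)
  have d: "((\<lambda>x. x \<bullet> v) has_derivative (\<lambda>h. h \<bullet> v)) (at x)" for x :: "real^'n"
    by (rule bounded_linear.has_derivative[OF bounded_linear_inner_left has_derivative_ident])
  then have "partial_deriv i (\<lambda>x. x \<bullet> v) = (\<lambda>x. axis i 1 \<bullet> v)" for i
    by (intro ext) (rule partial_derivI)
  with Suc d show ?thesis by (auto simp: differentiable_def)
qed (auto intro: continuous_intros)

lemma C_fun_translate: "C_fun k f \<Longrightarrow> C_fun k (\<lambda>x. f (x + v))"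
proof (induction k arbitrary: f)
  case 0 then show ?case using continuous_on_compose2[of UNIV f UNIV "\<lambda>x. x + v"] by (simp add: continuous_intros)
next
  case (Suc k)
  have d: "((\<lambda>x. f (x + v)) has_derivative frechet_derivative f (at (x + v))) (at x)" for x
  proof -
    have "((f \<circ> (\<lambda>x. x + v)) has_derivative (frechet_derivative f (at (x + v)) \<circ> (\<lambda>h. h))) (at x)"
    proof (rule diff_chain_at)
      show "((\<lambda>x. x + v) has_derivative (\<lambda>h. h)) (at x)" by (auto intro!: derivative_eq_intros)
      show "(f has_derivative frechet_derivative f (at (x + v))) (at (x + v))"
        using Suc.prems by (auto simp: frechet_derivative_works[symmetric])
    qed
    then show ?thesis by (simp add: o_def)
  qed
  have "partial_deriv i (\<lambda>x. f (x + v)) = (\<lambda>x. partial_deriv i f (x + v))" for i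
    by (rule ext, subst partial_derivI[OF d]) (simp add: partial_deriv_def)
  with Suc d show ?case by (auto simp: differentiable_def)
qed

section \<open>Smooth bump functions\<close>

lemma power_times_exp_le: "s ^ m * exp (- s) \<le> fact m" if "0 \<le> (s::real)"
proof -
  have "s ^ m / fact m = (\<Sum>n\<in>{m}. s ^ n /\<^sub>R fact n)" by (simp add: divide_inverse mult.commute)
  also have "\<dots> \<le> exp s" unfolding exp_def
    by (rule sum_le_suminf) (use that summable_exp_generic[of s] in auto)
  finally show ?thesis by (simp add: exp_minus field_simps)
qed

text \<open>\<open>bump_exp 0\<close> is the classical flat function; the other exponents appear in its derivatives.\<close>

definition bump_exp :: "nat \<Rightarrow> real \<Rightarrow> real" where
  "bump_exp n t = (if 0 < t then (1 / t) ^ n * exp (- (1 / t)) else 0)"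

lemma bump_exp_nonneg: "0 \<le> bump_exp n t" and bump_exp_le: "bump_exp n t \<le> fact n"
  using power_times_exp_le[of "1 / t" n] by (auto simp: bump_exp_def)

lemma bump_exp_le_mult: "bump_exp n t \<le> fact (n + m) * t ^ m" if "0 < t"
proof -
  have "bump_exp n t = bump_exp (n + m) t * t ^ m"
    using that by (simp add: bump_exp_def power_add power_divide)
  then show ?thesis using bump_exp_le[of "n+m" t] that by (simp add: mult_right_mono)
qed

text \<open>The derivative is a combination of members of the same family, so smoothness of
  compositions follows by one induction over all exponents. At the origin the difference quotient is
  at most a multiple of \<open>h\<close>, because the exponential beats every power.\<close>

lemma bump_exp_deriv:
  "(bump_exp n has_real_derivative (bump_exp (n + 2) t - real n * bump_exp (n + 1) t)) (at t)"
proof -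
  consider "t > 0" | "t < 0" | "t = 0" by linarith
  then show ?thesis
  proof cases
    case 1
    have "((\<lambda>t. (1 / t) ^ n * exp (- (1 / t))) has_real_derivative (bump_exp (n + 2) t - real n * bump_exp (n + 1) t)) (at t)"
    proof -
      have "((\<lambda>t. exp (- inverse t)) has_real_derivative (exp (- inverse t) * (inverse t)\<^sup>2)) (at t)"
        using 1 by (auto intro!: derivative_eq_intros simp: power2_eq_square)
      moreover have "((\<lambda>t. inverse t ^ n) has_real_derivative (- real n * inverse t ^ (n + 1))) (at t)"
      proof -
        have "((\<lambda>t. inverse t ^ n) has_real_derivative (real n * (- (inverse t ^ Suc (Suc 0)) * inverse t ^ (n - Suc 0)))) (at t)"
          using 1 by (intro DERIV_power DERIV_inverse) auto
        then show ?thesis by (cases n) (simp_all add: algebra_simps)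
      qed
      ultimately have "((\<lambda>t. inverse t ^ n * exp (- inverse t)) has_real_derivative
          (- real n * inverse t ^ (n + 1)) * exp (- inverse t) + (exp (- inverse t) * (inverse t)\<^sup>2) * inverse t ^ n) (at t)"
        by (rule DERIV_mult[rotated, THEN DERIV_cong]) (simp add: algebra_simps)
      then show ?thesis using 1
        by (simp add: bump_exp_def inverse_eq_divide power_add algebra_simps power2_eq_square)
    qed
    then show ?thesis
      by (rule has_field_derivative_transform_within_open[of _ _ _ "{0<..}"])
         (use 1 in \<open>auto simp: bump_exp_def\<close>)
  next
    case 2
    have "((\<lambda>t. 0) has_real_derivative (bump_exp (n + 2) t - real n * bump_exp (n + 1) t)) (at t)"
      using 2 by (simp add: bump_exp_def)
    then show ?thesis
      by (rule has_field_derivative_transform_within_open[of _ _ _ "{..<0}"])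
         (use 2 in \<open>auto simp: bump_exp_def\<close>)
  next
    case 3
    have "((\<lambda>h. bump_exp n h / h) \<longlongrightarrow> 0) (at 0)"
    proof (rule Lim_null_comparison)
      show "\<forall>\<^sub>F h in at 0. norm (bump_exp n h / h) \<le> fact (n + 2) * \<bar>h\<bar>"
      proof (intro always_eventually allI)
        fix h :: real
        show "norm (bump_exp n h / h) \<le> fact (n + 2) * \<bar>h\<bar>"
        proof (cases "h > 0")
          case True
          then show ?thesis using bump_exp_le_mult[OF True, of n 2] bump_exp_nonneg[of n h]
            by (simp add: field_simps power2_eq_square)
        next
          case False
          then have "bump_exp n h = 0" by (simp add: bump_exp_def)
          then show ?thesis by simp
        qed
      qed
      show "((\<lambda>h. fact (n + 2) * \<bar>h\<bar>) \<longlongrightarrow> (0::real)) (at 0)"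
        by (auto intro!: tendsto_eq_intros)
    qed
    then show ?thesis unfolding has_field_derivative_iff 3 by (simp add: bump_exp_def)
  qed
qed

lemma C_fun_bump_exp:
  assumes "\<And>k. C_fun k Q"
  shows "C_fun k (\<lambda>x. bump_exp n (Q x))"
proof (induction k arbitrary: n)
  case 0
  have "continuous_on UNIV (bump_exp n)"
    by (rule DERIV_continuous_on) (rule DERIV_subset[OF bump_exp_deriv], simp)
  then show ?case using C_fun_continuous[OF assms] by (auto intro: continuous_on_compose2)
next
  case (Suc k)
  have dQ: "(Q has_derivative frechet_derivative Q (at x)) (at x)" for x
    using assms[of "Suc 0"] by (simp add: frechet_derivative_works[symmetric])
  have d: "((\<lambda>x. bump_exp n (Q x)) has_derivative (\<lambda>h. (bump_exp (n + 2) (Q x) - real n * bump_exp (n + 1) (Q x)) * frechet_derivative Q (at x) h)) (at x)" for x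
    using has_derivative_compose[OF dQ, of "bump_exp n" "(*) (bump_exp (n + 2) (Q x) - real n * bump_exp (n + 1) (Q x))"]
      bump_exp_deriv[of n "Q x"] by (simp add: has_field_derivative_def)
  have pd: "partial_deriv i (\<lambda>x. bump_exp n (Q x)) = (\<lambda>x. (bump_exp (n + 2) (Q x) + (- real n) * bump_exp (n + 1) (Q x)) * partial_deriv i Q x)" for i
    by (rule ext, subst partial_derivI[OF d]) (simp add: partial_deriv_def)
  have "C_fun k (partial_deriv i Q)" for i using assms[of "Suc k"] by simp
  then have "C_fun k (partial_deriv i (\<lambda>x. bump_exp n (Q x)))" for i
    unfolding pd by (intro C_fun_mult C_fun_add C_fun_const Suc)
  with d show ?case by (auto simp: differentiable_def)
qed

lemma smooth_fun_const: "smooth_fun (\<lambda>x. c)"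
  and smooth_fun_add: "smooth_fun f \<Longrightarrow> smooth_fun g \<Longrightarrow> smooth_fun (\<lambda>x. f x + g x)"
  and smooth_fun_mult: "smooth_fun f \<Longrightarrow> smooth_fun g \<Longrightarrow> smooth_fun (\<lambda>x. f x * g x)"
  and smooth_fun_inner: "smooth_fun (\<lambda>x. x \<bullet> v)"
  and smooth_fun_translate: "smooth_fun f \<Longrightarrow> smooth_fun (\<lambda>x. f (x + v))"
  and smooth_fun_bump_exp: "smooth_fun f \<Longrightarrow> smooth_fun (\<lambda>x. bump_exp n (f x))"
  by (auto simp: smooth_fun_def intro: C_fun_add C_fun_mult C_fun_inner C_fun_translate C_fun_bump_exp)

lemma smooth_fun_sum: "(\<And>i. i \<in> I \<Longrightarrow> smooth_fun (f i)) \<Longrightarrow> smooth_fun (\<lambda>x. \<Sum>i\<in>I. f i x)"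
  by (induction I rule: infinite_finite_induct) (auto intro: smooth_fun_const smooth_fun_add)

lemma smooth_fun_prod: "(\<And>i. i \<in> I \<Longrightarrow> smooth_fun (f i)) \<Longrightarrow> smooth_fun (\<lambda>x. \<Prod>i\<in>I. f i x)"
  by (induction I rule: infinite_finite_induct) (auto intro: smooth_fun_const smooth_fun_mult)

lemma smooth_fun_differentiable: "smooth_fun f \<Longrightarrow> f differentiable (at x)"
  unfolding smooth_fun_def by (metis C_fun.simps(2))

lemma smooth_fun_partial: "smooth_fun f \<Longrightarrow> smooth_fun (partial_deriv i f)"
  unfolding smooth_fun_def by (metis C_fun.simps(2))

lemma smooth_fun_continuous: "smooth_fun f \<Longrightarrow> continuous_on UNIV f"
  unfolding smooth_fun_def using C_fun_continuous by blast

lemma test_funI: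
  assumes "smooth_fun f" "compact K" "K \<subseteq> \<Omega>" "\<And>x. x \<notin> K \<Longrightarrow> f x = 0"
  shows "test_fun \<Omega> f"
proof -
  have "closure {x. f x \<noteq> 0} \<subseteq> K"
    using assms by (intro closure_minimal compact_imp_closed) auto
  moreover from this have "compact (closure {x. f x \<noteq> 0})"
    using assms(2) by (metis closed_closure compact_Int_closed inf.absorb_iff2)
  ultimately show ?thesis using assms by (auto simp: test_fun_def)
qed

text \<open>Since \<open>bump_exp 0\<close> tends to 1 at infinity, the growing slope
  \<open>Suc n\<close> makes the product converge to the indicator of the open box while the support
  stays in the fixed closed box.\<close>

definition box_bump :: "real^'n::finite \<Rightarrow> real^'n \<Rightarrow> nat \<Rightarrow> real^'n \<Rightarrow> real" where
  "box_bump a b n x = (\<Prod>i\<in>UNIV. bump_exp 0 (real (Suc n) * (x $ i - a $ i)) * bump_exp 0 (real (Suc n) * (b $ i - x $ i)))"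

lemma smooth_box_bump: "smooth_fun (box_bump a b n)"
proof -
  have *: "smooth_fun (\<lambda>x. real (Suc n) * (x $ i - c))" "smooth_fun (\<lambda>x. real (Suc n) * (c - x $ i))" for i c
  proof -
    have "smooth_fun (\<lambda>x. real (Suc n) * (x \<bullet> axis i 1 + (-c)))" "smooth_fun (\<lambda>x. real (Suc n) * (c + (-1) * (x \<bullet> axis i 1)))"
      by (intro smooth_fun_mult smooth_fun_add smooth_fun_const smooth_fun_inner)+
    then show "smooth_fun (\<lambda>x. real (Suc n) * (x $ i - c))" "smooth_fun (\<lambda>x. real (Suc n) * (c - x $ i))"
      by (simp_all add: inner_axis)
  qed
  have "box_bump a b n = (\<lambda>x. (\<Prod>i\<in>UNIV. bump_exp 0 (real (Suc n) * (x $ i - a $ i)) * bump_exp 0 (real (Suc n) * (b $ i - x $ i))))"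
    by (simp add: fun_eq_iff box_bump_def)
  then show ?thesis
    by (simp only:) (intro smooth_fun_prod smooth_fun_mult smooth_fun_bump_exp *)
qed

lemma box_bump_range: "0 \<le> box_bump a b n x" "box_bump a b n x \<le> 1"
proof -
  show "0 \<le> box_bump a b n x" unfolding box_bump_def by (intro prod_nonneg) (simp add: bump_exp_nonneg)
  have "0 \<le> bump_exp 0 s * bump_exp 0 t \<and> bump_exp 0 s * bump_exp 0 t \<le> 1" for s t
    using bump_exp_nonneg[of 0] bump_exp_le[of 0] by (auto intro: mult_le_one)
  then show "box_bump a b n x \<le> 1" unfolding box_bump_def by (intro prod_le_1) auto
qed

lemma box_bump_outside: "x \<notin> box a b \<Longrightarrow> box_bump a b n x = 0"
proof -
  assume "x \<notin> box a b"
  then obtain i where "\<not> (a $ i < x $ i \<and> x $ i < b $ i)" by (auto simp: mem_box_cart)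
  then have "bump_exp 0 (real (Suc n) * (x $ i - a $ i)) * bump_exp 0 (real (Suc n) * (b $ i - x $ i)) = 0"
    by (auto simp: bump_exp_def zero_less_mult_iff)
  then show ?thesis unfolding box_bump_def by (subst prod_zero_iff) auto
qed

lemma box_bump_tendsto: "(\<lambda>n. box_bump a b n x) \<longlonglongrightarrow> indicator (box a b) x"
proof (cases "x \<in> box a b")
  case True
  have *: "(\<lambda>n. bump_exp 0 (real (Suc n) * t)) \<longlonglongrightarrow> 1" if "t > 0" for t
  proof -
    have "(\<lambda>n. exp (- (inverse (real (Suc n)) * inverse t))) \<longlonglongrightarrow> exp (- (0 * inverse t))"
      by (intro tendsto_intros LIMSEQ_inverse_real_of_nat)
    then show ?thesis using that by (simp add: bump_exp_def divide_inverse)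
  qed
  have "(\<lambda>n. box_bump a b n x) \<longlonglongrightarrow> (\<Prod>i\<in>(UNIV::'a set). 1 * 1)"
    unfolding box_bump_def using True
    by (intro tendsto_prod tendsto_mult *) (auto simp: mem_box_cart)
  with True show ?thesis by simp
qed (simp add: box_bump_outside)

lemma test_box_bump: "cbox a b \<subseteq> U \<Longrightarrow> test_fun U (box_bump a b n)"
  by (rule test_funI[OF smooth_box_bump compact_cbox]) (use box_bump_outside box_subset_cbox in blast)+

section \<open>The fundamental lemma of the calculus of variations over Borel functions\<close>

lemma zero_box_integrals_imp_AE_zero:
  fixes w :: "'a::euclidean_space \<Rightarrow> real"
  assumes w: "integrable lborel w"
    and box: "\<And>c d. box c d \<subseteq> box a b \<Longrightarrow> (LINT x:box c d|lborel. w x) = 0"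
  shows "AE x in lborel. x \<in> box a b \<longrightarrow> w x = 0"
proof -
  define f where "f x = indicator (box a b) x * w x" for x
  have f: "integrable lborel f"
    unfolding f_def using integrable_mult_indicator[OF _ w, of "box a b"] by simp
  have fA: "set_lebesgue_integral lborel A f = (LINT x:(A \<inter> box a b)|lborel. w x)" for A
    unfolding set_lebesgue_integral_def f_def
    by (intro Bochner_Integration.integral_cong) (auto split: split_indicator)
  have si: "set_integrable lborel A f" if "A \<in> sets lborel" for A
    unfolding set_integrable_def using integrable_mult_indicator[OF that f] .
  let ?G = "range (\<lambda>(a, b). box a b :: 'a set)"
  have eq: "sets lborel = sigma_sets UNIV ?G"
    by (simp add: borel_eq_box)
  \<comment> \<open>Boxes are stable under intersection and generate the Borel sets, so the
    vanishing of box integrals extends to all Borel sets by Dynkin's theorem.\<close>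
  have "set_lebesgue_integral lborel A f = 0" if "A \<in> sigma_sets UNIV ?G" for A
  proof -
    have "Int_stable ?G" by (auto simp: Int_stable_def box_Int_box)
    moreover have "?G \<subseteq> Pow UNIV" by simp
    ultimately show ?thesis using that
  proof (induction rule: sigma_sets_induct_disjoint)
    case (basic A)
    then obtain c d where A: "A = box c d" by auto
    obtain c' d' where "A \<inter> box a b = box c' d'" unfolding A box_Int_box by blast
    then show ?case using box[of c' d'] by (metis fA inf_le2)
  next
    case empty then show ?case by (simp add: set_lebesgue_integral_def)
  next
    case (compl A)
    then have A: "A \<in> sets lborel" using eq by simp
    have "set_lebesgue_integral lborel (UNIV - A) f + set_lebesgue_integral lborel A f = set_lebesgue_integral lborel UNIV f"
      using A by (subst set_integral_Un[symmetric]) (auto intro!: si)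
    moreover have "set_lebesgue_integral lborel UNIV f = 0" using fA[of UNIV] box[of a b] by simp
    ultimately show ?case using compl by simp
  next
    case (union A)
    have A: "\<And>i. A i \<in> sets lborel" using union eq by auto
    have "set_lebesgue_integral lborel (\<Union>i. A i) f = (suminf (\<lambda>i. set_lebesgue_integral lborel (A i) f))"
      using union A by (intro lebesgue_integral_countable_add si) (auto simp: disjoint_family_on_def)
    then show ?case using union by simp
  qed
  qed
  then have "AE x in lborel. f x = 0"
    using eq by (intro density_unique_real[OF f, of "\<lambda>_. 0"]) (auto simp: set_lebesgue_integral_def)
  then show ?thesis by eventually_elim (auto simp: f_def)
qed

text \<open>Box bumps are admissible test functions and converge boundedly to indicators of boxes,
  so dominated convergence makes all box integrals of \<open>w\<close> vanish.\<close>

lemma fundamental_lemma_lborel: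
  fixes w :: "real^'n::finite \<Rightarrow> real"
  assumes w: "integrable lborel w" and ab: "cbox a b \<subseteq> U"
    and test: "\<And>f. test_fun U f \<Longrightarrow> (LINT x|lborel. w x * f x) = 0"
  shows "AE x in lborel. x \<in> cbox a b \<longrightarrow> w x = 0"
proof -
  have [measurable]: "w \<in> borel_measurable borel" using w by auto
  have [measurable]: "box_bump c d n \<in> borel_measurable borel" for c d :: "real^'n" and n
    using smooth_fun_continuous[OF smooth_box_bump] by (rule borel_measurable_continuous_onI)
  have "AE x in lborel. x \<in> box a b \<longrightarrow> w x = 0"
  proof (rule zero_box_integrals_imp_AE_zero[OF w])
    fix c d :: "real^'n" assume cd: "box c d \<subseteq> box a b"
    show "(LINT x:box c d|lborel. w x) = 0"
    proof (cases "box c d = {}")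
      case False
      then have "cbox c d \<subseteq> cbox a b" using cd
        by (metis closure_box closure_mono box_eq_empty(1) subset_empty)
      then have "cbox c d \<subseteq> U" using ab by simp
      then have zero: "(LINT x|lborel. w x * box_bump c d n x) = 0" for n
        by (intro test test_box_bump)
      have "(\<lambda>n. LINT x|lborel. w x * box_bump c d n x) \<longlonglongrightarrow> (LINT x|lborel. w x * indicator (box c d) x)"
      proof (rule integral_dominated_convergence[where w="\<lambda>x. \<bar>w x\<bar>"])
        show "AE x in lborel. (\<lambda>n. w x * box_bump c d n x) \<longlonglongrightarrow> w x * indicator (box c d) x"
          by (intro AE_I2 tendsto_mult tendsto_const box_bump_tendsto)
        show "AE x in lborel. norm (w x * box_bump c d n x) \<le> \<bar>w x\<bar>" for n
          using box_bump_range[of c d n] by (intro AE_I2) (simp add: abs_mult mult_left_le)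
      qed (use w in auto)
      then show ?thesis unfolding zero set_lebesgue_integral_def
        by (simp add: LIMSEQ_const_iff mult.commute)
    qed (simp add: set_lebesgue_integral_def)
  qed
  moreover have "AE x in lborel. x \<notin> cbox a b - box a b"
    by (intro AE_not_in) (simp add: null_sets_def emeasure_Diff emeasure_lborel_cbox_eq emeasure_lborel_box_eq box_subset_cbox)
  ultimately show ?thesis by eventually_elim auto
qed

lemma fundamental_lemma_lborel_open:
  fixes w :: "real^'n::finite \<Rightarrow> real"
  assumes w: "integrable lborel w" and U: "open U"
    and test: "\<And>f. test_fun U f \<Longrightarrow> (LINT x|lborel. w x * f x) = 0"
  shows "AE x in lborel. x \<in> U \<longrightarrow> w x = 0"
proof -
  obtain D where D: "countable D" "\<And>X. X \<in> D \<Longrightarrow> X \<subseteq> U" "\<And>X. X \<in> D \<Longrightarrow> \<exists>a b. X = cbox a b" "\<Union>D = U"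
    by (rule open_countable_Union_open_cbox[OF U]) blast
  have "AE x in lborel. \<forall>X\<in>D. x \<in> X \<longrightarrow> w x = 0"
  proof (subst AE_ball_countable[OF D(1)], rule ballI)
    fix X assume X: "X \<in> D"
    then obtain a b where ab: "X = cbox a b" using D(3) by blast
    show "AE x in lborel. x \<in> X \<longrightarrow> w x = 0"
      unfolding ab by (rule fundamental_lemma_lborel[OF w _ test]) (use D(2)[OF X] ab in auto)
  qed
  then show ?thesis by eventually_elim (use D(4) in blast)
qed

text \<open>Sobolev functions are measurable for the completed measure, while Fubini and
  translations are applied over \<open>lborel\<close>; Borel representatives connect the
  two.\<close>

lemma lebesgue_real_ex_borel:
  fixes f :: "'a::euclidean_space \<Rightarrow> real"
  assumes "f \<in> borel_measurable lebesgue"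
  obtains f' where "f' \<in> borel_measurable borel" "AE x in lborel. f x = f' x"
proof -
  obtain f' where "f' \<in> borel_measurable lborel" "AE x in lborel. f x = f' x"
    using completion_ex_borel_measurable_real[OF assms] by blast
  then show ?thesis by (intro that[of f']) auto
qed

lemma lebesgue_vec_ex_borel:
  fixes f :: "'a::euclidean_space \<Rightarrow> real^'n::finite"
  assumes "f \<in> borel_measurable lebesgue"
  obtains f' where "f' \<in> borel_measurable borel" "AE x in lborel. f x = f' x"
proof -
  have "\<exists>h. h \<in> borel_measurable borel \<and> (AE x in lborel. f x $ i = h x)" for i
  proof -
    have "(\<lambda>x. f x $ i) \<in> borel_measurable lebesgue"
      using borel_measurable_inner[OF assms, of "\<lambda>x. axis i 1"] by (simp add: inner_axis)
    then obtain h where "h \<in> borel_measurable borel" "AE x in lborel. f x $ i = h x"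
      by (rule lebesgue_real_ex_borel)
    then show ?thesis by blast
  qed
  then obtain h where h: "\<And>i. h i \<in> borel_measurable borel" "\<And>i. AE x in lborel. f x $ i = h i x" by metis
  have "(\<lambda>x. \<chi> i. h i x) = (\<lambda>x. \<Sum>i\<in>UNIV. h i x *\<^sub>R axis i 1)"
    by (simp add: fun_eq_iff vec_eq_iff axis_def if_distrib cong: if_cong)
  then have "(\<lambda>x. \<chi> i. h i x) \<in> borel_measurable borel"
    using h(1) by simp
  moreover have "AE x in lborel. \<forall>i. f x $ i = h i x"
    using h(2) by (subst AE_all_countable) auto
  then have "AE x in lborel. f x = (\<chi> i. h i x)" by eventually_elim (simp add: vec_eq_iff)
  ultimately show ?thesis using that by blast
qed

lemma test_fun_support:
  assumes "test_fun \<Omega> f"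
  shows "\<exists>K. compact K \<and> K \<subseteq> \<Omega> \<and> (\<forall>x. x \<notin> K \<longrightarrow> f x = 0) \<and> (\<forall>x i. x \<notin> K \<longrightarrow> partial_deriv i f x = 0)"
proof -
  define K where "K = closure {x. f x \<noteq> 0}"
  have 1: "compact K" "K \<subseteq> \<Omega>" using assms unfolding test_fun_def K_def by blast+
  have sub: "{x. f x \<noteq> 0} \<subseteq> K" unfolding K_def by (rule closure_subset)
  have 2: "f x = 0" if "x \<notin> K" for x using that sub by blast
  have op: "open (- K)" unfolding K_def by (rule open_Compl[OF closed_closure])
  have 3: "partial_deriv i f x = 0" if x: "x \<notin> K" for x i
  proof -
    have "((\<lambda>x. 0) has_derivative (\<lambda>h. 0)) (at x)" by (rule has_derivative_const)
    then have "(f has_derivative (\<lambda>h. 0)) (at x)"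
      by (rule has_derivative_transform_within_open[OF _ op]) (use x 2 in simp_all)
    from partial_derivI[OF this, of i] show ?thesis .
  qed
  show ?thesis using 1 2 3 by blast
qed

lemma continuous_compact_support_bounded:
  fixes f :: "real^'n::finite \<Rightarrow> real"
  assumes "continuous_on UNIV f" "compact K" "\<And>x. x \<notin> K \<Longrightarrow> f x = 0"
  shows "\<exists>B\<ge>0. \<forall>x. \<bar>f x\<bar> \<le> B"
proof -
  have "bounded (f ` K)"
    using assms by (intro compact_imp_bounded compact_continuous_image) (auto intro: continuous_on_subset)
  then obtain B where B: "\<And>x. x \<in> K \<Longrightarrow> \<bar>f x\<bar> \<le> B" by (auto simp: bounded_iff)
  then have "\<bar>f x\<bar> \<le> max 0 B" for x using assms(3)[of x] by (cases "x \<in> K") (auto intro: max.coboundedI2)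
  then show ?thesis by (intro exI[of _ "max 0 B"]) auto
qed

lemma test_fun_bounds:
  fixes f :: "real^'n::finite \<Rightarrow> real"
  assumes "test_fun \<Omega> f"
  shows "\<exists>B\<ge>0. (\<forall>x. \<bar>f x\<bar> \<le> B) \<and> (\<forall>x i. \<bar>partial_deriv i f x\<bar> \<le> B)"
proof -
  obtain K where K0: "compact K" "K \<subseteq> \<Omega>" "\<And>x. x \<notin> K \<Longrightarrow> f x = 0" "\<And>x i. x \<notin> K \<Longrightarrow> partial_deriv i f x = 0"
    using test_fun_support[OF assms] by blast
  note K = K0(1,3,4)
  have sm: "smooth_fun f" using assms by (simp add: test_fun_def)
  obtain B0 where B0: "B0 \<ge> 0" "\<And>x. \<bar>f x\<bar> \<le> B0"
    using continuous_compact_support_bounded[OF smooth_fun_continuous[OF sm] K(1) K(2)] by blast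
  have "\<exists>B. B \<ge> 0 \<and> (\<forall>x. \<bar>partial_deriv i f x\<bar> \<le> B)" for i
    by (rule continuous_compact_support_bounded[OF smooth_fun_continuous[OF smooth_fun_partial[OF sm, of i]] K(1)]) (rule K(3))
  then obtain B1 where B1: "\<And>i. B1 i \<ge> 0" "\<And>i x. \<bar>partial_deriv i f x\<bar> \<le> B1 i" by metis
  show ?thesis
  proof (intro exI[of _ "B0 + sum B1 UNIV"] conjI allI)
    show "0 \<le> B0 + sum B1 UNIV" using B0 B1 by (simp add: sum_nonneg)
    have sb: "B1 i \<le> sum B1 UNIV" for i by (rule member_le_sum) (use B1 in auto)
    show "\<bar>f x\<bar> \<le> B0 + sum B1 UNIV" for x using B0(2)[of x] B1 by (simp add: add_increasing2 sum_nonneg)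
    show "\<bar>partial_deriv i f x\<bar> \<le> B0 + sum B1 UNIV" for x i
      using B0(1) B1(2)[of i x] sb[of i] by linarith
  qed
qed

text \<open>Difference quotients integrate to zero by translation invariance, and they converge to
  the partial derivative under a common integrable bound. For a product of functions this is
  integration by parts.\<close>

lemma integral_partial_deriv_eq_0:
  fixes f :: "real^'n::finite \<Rightarrow> real"
  assumes "test_fun UNIV f"
  shows "(LINT x|lborel. partial_deriv i f x) = 0"
proof -
  obtain K where K0: "compact K" "K \<subseteq> UNIV" "\<And>x. x \<notin> K \<Longrightarrow> f x = 0" "\<And>x i. x \<notin> K \<Longrightarrow> partial_deriv i f x = 0"
    using test_fun_support[OF assms] by blast
  note K = K0(1,3,4)
  obtain B where B: "B \<ge> 0" "\<And>x. \<bar>f x\<bar> \<le> B" "\<And>x i. \<bar>partial_deriv i f x\<bar> \<le> B"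
    using test_fun_bounds[OF assms] by blast
  obtain R where R: "\<And>x. x \<in> K \<Longrightarrow> norm x \<le> R" using compact_imp_bounded[OF K(1)] by (auto simp: bounded_iff)
  have sm: "smooth_fun f" using assms by (simp add: test_fun_def)
  have [measurable]: "f \<in> borel_measurable borel"
    by (rule borel_measurable_continuous_onI[OF smooth_fun_continuous[OF sm]])
  have [measurable]: "partial_deriv i f \<in> borel_measurable borel"
    by (rule borel_measurable_continuous_onI[OF smooth_fun_continuous[OF smooth_fun_partial[OF sm]]])
  \<comment> \<open>Steps of length at most 1 keep the supports of all difference quotients in the
    ball of radius \<open>R + 1\<close>.\<close>
  define t where "t n = 1 / real (Suc n)" for n
  have t: "0 < t n" "t n \<le> 1" for n by (auto simp: t_def)
  define q where "q n x = (f (x + t n *\<^sub>R axis i 1) - f x) / t n" for n x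
  have line: "((\<lambda>s. f (x + s *\<^sub>R axis i 1)) has_real_derivative partial_deriv i f (x + s *\<^sub>R axis i 1)) (at s)" for x s
  proof -
    have "(f has_derivative frechet_derivative f (at (x + s *\<^sub>R axis i 1))) (at (x + s *\<^sub>R axis i 1))"
      using smooth_fun_differentiable[OF sm] by (simp add: frechet_derivative_works[symmetric])
    moreover have "((\<lambda>s. x + s *\<^sub>R axis i 1) has_derivative (\<lambda>h. h *\<^sub>R axis i 1)) (at s)"
      by (auto intro!: derivative_eq_intros)
    ultimately have "((\<lambda>s. f (x + s *\<^sub>R axis i 1)) has_derivative (\<lambda>h. frechet_derivative f (at (x + s *\<^sub>R axis i 1)) (h *\<^sub>R axis i 1))) (at s)"
      by (rule has_derivative_compose[rotated])
    moreover have "linear (frechet_derivative f (at (x + s *\<^sub>R axis i 1)))"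
      using smooth_fun_differentiable[OF sm] linear_frechet_derivative by blast
    ultimately show ?thesis
      by (simp add: has_field_derivative_def linear_cmul partial_deriv_def mult_commute_abs)
  qed
  have f_int: "integrable lborel f"
  proof (rule Bochner_Integration.integrable_bound)
    show "integrable lborel (\<lambda>x::real^'n. indicator (cball 0 R) x * B)"
      using emeasure_bounded_finite[OF bounded_cball, of "0::real^'n" R] emeasure_bounded_finite[OF bounded_cball, of "0::real^'n" "R + 1"]
      by (intro integrable_mult_left integrable_real_indicator) auto
    show "AE x in lborel. norm (f x) \<le> norm (indicator (cball 0 R) x * B)"
      using B K(2) R by (intro AE_I2) (force split: split_indicator)
  qed simp
  have q0: "(LINT x|lborel. q n x) = 0" for n
  proof -
    have d: "distr lborel borel ((+) (t n *\<^sub>R axis i 1)) = (lborel :: (real^'n) measure)" by (rule lborel_distr_plus)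
    have "integrable lborel (\<lambda>x. f (t n *\<^sub>R axis i 1 + x))"
      using f_int integrable_distr_eq[of "(+) (t n *\<^sub>R axis i 1)" lborel borel f] by (simp add: d)
    moreover have "(LINT x|lborel. f (t n *\<^sub>R axis i 1 + x)) = (LINT x|lborel. f x)"
      using integral_distr[of "(+) (t n *\<^sub>R axis i 1)" lborel borel f] by (simp add: d)
    ultimately show ?thesis using f_int by (simp add: q_def add.commute)
  qed
  have "(\<lambda>n. LINT x|lborel. q n x) \<longlonglongrightarrow> (LINT x|lborel. partial_deriv i f x)"
  proof (rule integral_dominated_convergence[where w="\<lambda>x. indicator (cball 0 (R + 1)) x * B"])
    show "integrable lborel (\<lambda>x::real^'n. indicator (cball 0 (R + 1)) x * B)"
      using emeasure_bounded_finite[OF bounded_cball, of "0::real^'n" R] emeasure_bounded_finite[OF bounded_cball, of "0::real^'n" "R + 1"]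
      by (intro integrable_mult_left integrable_real_indicator) auto
    show "AE x in lborel. (\<lambda>n. q n x) \<longlonglongrightarrow> partial_deriv i f x"
    proof (intro AE_I2)
      fix x
      have "((\<lambda>s. (f (x + s *\<^sub>R axis i 1) - f x) / s) \<longlongrightarrow> partial_deriv i f x) (at 0)"
        using line[of x 0] by (simp add: has_field_derivative_iff)
      moreover have "filterlim t (at 0) sequentially"
      proof -
        have "t = (\<lambda>n. inverse (real (Suc n)))" by (simp add: fun_eq_iff t_def inverse_eq_divide)
        then have "t \<longlonglongrightarrow> 0" using LIMSEQ_inverse_real_of_nat by simp
        then show ?thesis unfolding filterlim_at using t(1) by (auto simp: less_imp_neq[symmetric])
      qed
      ultimately show "(\<lambda>n. q n x) \<longlonglongrightarrow> partial_deriv i f x"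
        unfolding q_def by (rule filterlim_compose)
    qed
    show "AE x in lborel. norm (q n x) \<le> indicator (cball 0 (R + 1)) x * B" for n
    proof (intro AE_I2)
      fix x
      obtain s where s: "0 < s" "s < t n" "f (x + t n *\<^sub>R axis i 1) - f (x + 0 *\<^sub>R axis i 1) = (t n - 0) * partial_deriv i f (x + s *\<^sub>R axis i 1)"
        using MVT2[OF t(1)[of n], of "\<lambda>s. f (x + s *\<^sub>R axis i 1)" "\<lambda>s. partial_deriv i f (x + s *\<^sub>R axis i 1)"] line by blast
      then have q: "q n x = partial_deriv i f (x + s *\<^sub>R axis i 1)" using t(1)[of n] by (simp add: q_def)
      show "norm (q n x) \<le> indicator (cball 0 (R + 1)) x * B"
      proof (cases "x \<in> cball 0 (R + 1)")
        case False
        have "norm x \<le> norm (x + s *\<^sub>R axis i 1) + norm (s *\<^sub>R axis i (1::real) :: real^'n)"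
          using norm_triangle_ineq4[of "x + s *\<^sub>R axis i 1" "s *\<^sub>R axis i 1"] by simp
        then have "norm (x + s *\<^sub>R axis i 1) > R" using False s t(2)[of n] by simp
        then have "x + s *\<^sub>R axis i 1 \<notin> K" using R by force
        then show ?thesis using q K(3) B(1) by simp
      qed (use q B in simp)
    qed
  qed (simp_all add: q_def)
  then show ?thesis by (simp add: q0 LIMSEQ_const_iff)
qed

section \<open>Sobolev functions\<close>

lemma borel_imp_lebesgue_measurable: "f \<in> borel_measurable borel \<Longrightarrow> f \<in> borel_measurable lebesgue"
  by (rule measurable_completion) simp

lemma integrable_vec_nth: "integrable M f \<Longrightarrow> integrable M (\<lambda>x. (f x :: real^'n::finite) $ i)"
  using integrable_inner_left[of "axis i 1" M f] by (simp add: inner_axis)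

lemma set_integrable_vec_nth: "set_integrable M K f \<Longrightarrow> set_integrable M K (\<lambda>x. (f x :: real^'n::finite) $ i)"
  unfolding set_integrable_def using integrable_vec_nth[of M "\<lambda>x. indicator K x *\<^sub>R f x" i] by simp

lemma integrable_mult_test:
  fixes w \<phi> :: "real^'n::finite \<Rightarrow> real"
  assumes om: "open \<Omega>" and K: "compact K" "K \<subseteq> \<Omega>" and w: "set_integrable lebesgue K w"
    and \<phi>: "continuous_on UNIV \<phi>" "\<And>x. x \<notin> K \<Longrightarrow> \<phi> x = 0"
  shows "integrable lebesgue (\<lambda>x. w x * \<phi> x)" "integrable (lebesgue_on \<Omega>) (\<lambda>x. w x * \<phi> x)"
    "(LINT x|lebesgue_on \<Omega>. w x * \<phi> x) = (LINT x|lebesgue. w x * \<phi> x)"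
proof -
  obtain B where B: "B \<ge> 0" "\<And>x. \<bar>\<phi> x\<bar> \<le> B"
    using continuous_compact_support_bounded[OF \<phi>(1) K(1) \<phi>(2)] by blast
  have [measurable]: "\<phi> \<in> borel_measurable lebesgue"
    by (rule borel_imp_lebesgue_measurable[OF borel_measurable_continuous_onI[OF \<phi>(1)]])
  have i: "integrable lebesgue (\<lambda>x. indicator K x * w x)" using w by (simp add: set_integrable_def)
  then have [measurable]: "(\<lambda>x. indicator K x * w x) \<in> borel_measurable lebesgue" by auto
  have eq: "w x * \<phi> x = (indicator K x * w x) * \<phi> x" for x using \<phi>(2)[of x] by (auto split: split_indicator)
  have "integrable lebesgue (\<lambda>x. (indicator K x * w x) * \<phi> x)"
  proof (rule Bochner_Integration.integrable_bound[OF integrable_mult_right[OF i, of B]])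
    show "AE x in lebesgue. norm (indicator K x * w x * \<phi> x) \<le> norm (B * (indicator K x * w x))"
      using B by (intro AE_I2) (simp add: abs_mult mult.commute mult_right_mono)
  qed measurable
  then show I: "integrable lebesgue (\<lambda>x. w x * \<phi> x)" by (simp add: eq)
  have eq2: "indicator \<Omega> x * (w x * \<phi> x) = w x * \<phi> x" for x using \<phi>(2)[of x] K by (auto split: split_indicator)
  show "integrable (lebesgue_on \<Omega>) (\<lambda>x. w x * \<phi> x)" using om I by (simp add: integrable_restrict_space eq2)
  show "(LINT x|lebesgue_on \<Omega>. w x * \<phi> x) = (LINT x|lebesgue. w x * \<phi> x)"
    using om by (simp add: integral_restrict_space eq2)
qed

text \<open>On a closed box inside \<Omega> the function is integrable and may be replaced by a
  Borel representative; countably many such boxes fill \<Omega>.\<close>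

lemma fundamental_lemma:
  fixes w :: "real^'n::finite \<Rightarrow> real"
  assumes om: "open \<Omega>" and w: "\<And>K. compact K \<Longrightarrow> K \<subseteq> \<Omega> \<Longrightarrow> set_integrable lebesgue K w"
    and test: "\<And>f. test_fun \<Omega> f \<Longrightarrow> (LINT x|lebesgue_on \<Omega>. w x * f x) = 0"
  shows "AE x in lebesgue. x \<in> \<Omega> \<longrightarrow> w x = 0"
proof -
  obtain D where D: "countable D" "\<And>X. X \<in> D \<Longrightarrow> X \<subseteq> \<Omega>" "\<And>X. X \<in> D \<Longrightarrow> \<exists>a b. X = cbox a b" "\<Union>D = \<Omega>"
    by (rule open_countable_Union_open_cbox[OF om]) blast
  have cb: "AE x in lebesgue. x \<in> cbox a b \<longrightarrow> w x = 0" if ab: "cbox a b \<subseteq> \<Omega>" for a b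
  proof -
    have i: "integrable lebesgue (\<lambda>x. indicator (cbox a b) x * w x)"
      using w[OF compact_cbox ab] by (simp add: set_integrable_def)
    then obtain w' where w': "w' \<in> borel_measurable borel" "AE x in lborel. indicator (cbox a b) x * w x = w' x"
      using lebesgue_real_ex_borel by blast
    have ae: "AE x in lebesgue. indicator (cbox a b) x * w x = w' x"
      using w'(2) by (rule AE_completion)
    have "integrable lebesgue w'"
      by (rule integrable_cong_AE_imp[OF i borel_imp_lebesgue_measurable[OF w'(1)]]) (use ae in \<open>eventually_elim, simp\<close>)
    then have iw: "integrable lborel w'" using w'(1) by (simp add: integrable_completion)
    have "AE x in lborel. x \<in> box a b \<longrightarrow> w' x = 0"
    proof (rule fundamental_lemma_lborel_open[OF iw open_box])
      fix f assume f: "test_fun (box a b) f"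
      then have f\<Omega>: "test_fun \<Omega> f" using ab box_subset_cbox by (fastforce simp: test_fun_def)
      obtain K where K: "compact K" "K \<subseteq> box a b" "\<And>x. x \<notin> K \<Longrightarrow> f x = 0" "\<And>x i. x \<notin> K \<Longrightarrow> partial_deriv i f x = 0"
        using test_fun_support[OF f] by blast
      have cf: "continuous_on UNIV f" using f smooth_fun_continuous by (auto simp: test_fun_def)
      have [measurable]: "f \<in> borel_measurable borel" by (rule borel_measurable_continuous_onI[OF cf])
      have z: "f x = 0" if "x \<notin> cbox a b" for x using that K box_subset_cbox by blast
      have "(LINT x|lborel. w' x * f x) = (LINT x|lebesgue. w' x * f x)"
        using w'(1) by (intro integral_completion[symmetric]) auto
      also have "\<dots> = (LINT x|lebesgue. w x * f x)"
      proof (rule integral_cong_AE)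
        show "(\<lambda>x. w' x * f x) \<in> borel_measurable lebesgue"
          using w'(1) by (intro borel_imp_lebesgue_measurable) auto
        show "(\<lambda>x. w x * f x) \<in> borel_measurable lebesgue"
          using integrable_mult_test(1)[OF om compact_cbox ab w[OF compact_cbox ab] cf z] by auto
        show "AE x in lebesgue. w' x * f x = w x * f x"
          using ae by eventually_elim (metis z indicator_simps(1) mult_1 mult_zero_right)
      qed
      also have "\<dots> = (LINT x|lebesgue_on \<Omega>. w x * f x)"
        using integrable_mult_test(3)[OF om compact_cbox ab w[OF compact_cbox ab] cf z] by simp
      also have "\<dots> = 0" by (rule test[OF f\<Omega>])
      finally show "(LINT x|lborel. w' x * f x) = 0" .
    qed
    moreover have "AE x in lborel. x \<notin> cbox a b - box a b"
      by (intro AE_not_in) (simp add: null_sets_def emeasure_Diff emeasure_lborel_cbox_eq emeasure_lborel_box_eq box_subset_cbox)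
    ultimately have "AE x in lborel. x \<in> cbox a b \<longrightarrow> w' x = 0"
      by eventually_elim auto
    from AE_completion[OF this] ae show ?thesis by eventually_elim auto
  qed
  have "AE x in lebesgue. \<forall>X\<in>D. x \<in> X \<longrightarrow> w x = 0"
  proof (subst AE_ball_countable[OF D(1)], rule ballI)
    fix X assume X: "X \<in> D"
    then obtain a b where "X = cbox a b" using D(3) by blast
    then show "AE x in lebesgue. x \<in> X \<longrightarrow> w x = 0" using cb[of a b] D(2)[OF X] by simp
  qed
  then show ?thesis by eventually_elim (use D(4) in blast)
qed

lemma test_fun_continuous: "test_fun \<Omega> f \<Longrightarrow> continuous_on UNIV f"
  and test_fun_continuous_partial: "test_fun \<Omega> f \<Longrightarrow> continuous_on UNIV (partial_deriv i f)"
  by (auto simp: test_fun_def intro: smooth_fun_continuous smooth_fun_partial)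

lemma weak_gradient_integrable:
  assumes om: "open \<Omega>" and wg: "weak_gradient \<Omega> u g" and f: "test_fun \<Omega> f"
  shows "integrable (lebesgue_on \<Omega>) (\<lambda>x. u x * partial_deriv i f x)"
    "integrable (lebesgue_on \<Omega>) (\<lambda>x. g x $ i * f x)"
proof -
  obtain K where K: "compact K" "K \<subseteq> \<Omega>" "\<And>x. x \<notin> K \<Longrightarrow> f x = 0" "\<And>x i. x \<notin> K \<Longrightarrow> partial_deriv i f x = 0"
    using test_fun_support[OF f] by blast
  have "set_integrable lebesgue K u" "set_integrable lebesgue K g"
    using wg K by (auto simp: weak_gradient_def)
  then show "integrable (lebesgue_on \<Omega>) (\<lambda>x. u x * partial_deriv i f x)"
    "integrable (lebesgue_on \<Omega>) (\<lambda>x. g x $ i * f x)"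
    using K om test_fun_continuous[OF f] test_fun_continuous_partial[OF f]
    by (auto intro!: integrable_mult_test(2)[of \<Omega> K] set_integrable_vec_nth)
qed

lemma weak_gradient_lincomb:
  assumes om: "open \<Omega>" and u: "weak_gradient \<Omega> u g" and v: "weak_gradient \<Omega> v h"
  shows "weak_gradient \<Omega> (\<lambda>x. a * u x + b * v x) (\<lambda>x. a *\<^sub>R g x + b *\<^sub>R h x)"
  unfolding weak_gradient_def
proof (intro conjI allI impI)
  fix K :: "(real^'a) set" assume K: "compact K \<and> K \<subseteq> \<Omega>"
  then have *: "set_integrable lebesgue K u" "set_integrable lebesgue K v" "set_integrable lebesgue K g" "set_integrable lebesgue K h"
    using u v by (auto simp: weak_gradient_def)
  show "set_integrable lebesgue K (\<lambda>x. a * u x + b * v x)"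
    using * by (intro set_integral_add(1) set_integrable_mult_right) auto
  show "set_integrable lebesgue K (\<lambda>x. a *\<^sub>R g x + b *\<^sub>R h x)"
    using * by (intro set_integral_add(1) set_integrable_scaleR_right) auto
next
  fix f i assume f: "test_fun \<Omega> f"
  note i = weak_gradient_integrable[OF om u f, of i] weak_gradient_integrable[OF om v f, of i]
  have "(LINT x|lebesgue_on \<Omega>. u x * partial_deriv i f x) = - (LINT x|lebesgue_on \<Omega>. g x $ i * f x)"
    "(LINT x|lebesgue_on \<Omega>. v x * partial_deriv i f x) = - (LINT x|lebesgue_on \<Omega>. h x $ i * f x)"
    using u v f by (auto simp: weak_gradient_def)
  moreover have "(\<lambda>x. (a * u x + b * v x) * partial_deriv i f x) = (\<lambda>x. a * (u x * partial_deriv i f x) + b * (v x * partial_deriv i f x))"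
    "(\<lambda>x. (a *\<^sub>R g x + b *\<^sub>R h x) $ i * f x) = (\<lambda>x. a * (g x $ i * f x) + b * (h x $ i * f x))"
    by (auto simp: algebra_simps)
  ultimately show "(LINT x|lebesgue_on \<Omega>. (a * u x + b * v x) * partial_deriv i f x) = - (LINT x|lebesgue_on \<Omega>. (a *\<^sub>R g x + b *\<^sub>R h x) $ i * f x)"
    using i by simp
qed

lemma weak_gradient_unique:
  assumes om: "open \<Omega>" and u: "weak_gradient \<Omega> u g" and v: "weak_gradient \<Omega> u h"
  shows "AE x in lebesgue. x \<in> \<Omega> \<longrightarrow> g x = h x"
proof -
  have w: "weak_gradient \<Omega> (\<lambda>x. 0) (\<lambda>x. g x - h x)"
    using weak_gradient_lincomb[OF om u v, of 1 "-1"] by simp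
  have "AE x in lebesgue. x \<in> \<Omega> \<longrightarrow> (g x - h x) $ i = 0" for i
  proof (rule fundamental_lemma[OF om])
    show "set_integrable lebesgue K (\<lambda>x. (g x - h x) $ i)" if "compact K" "K \<subseteq> \<Omega>" for K
      using w that by (intro set_integrable_vec_nth) (auto simp: weak_gradient_def)
    show "(LINT x|lebesgue_on \<Omega>. (g x - h x) $ i * f x) = 0" if "test_fun \<Omega> f" for f
      using w that by (auto simp: weak_gradient_def)
  qed
  then have "AE x in lebesgue. \<forall>i. x \<in> \<Omega> \<longrightarrow> (g x - h x) $ i = 0" by (subst AE_all_countable) auto
  then show ?thesis by eventually_elim (auto simp: vec_eq_iff)
qed

lemma AE_lebesgue_on_iff: "open \<Omega> \<Longrightarrow> (AE x in lebesgue_on \<Omega>. P x) \<longleftrightarrow> (AE x in lebesgue. x \<in> \<Omega> \<longrightarrow> P x)"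
  by (rule AE_restrict_space_iff) auto

lemma wgrad_weak_gradient: "weak_gradient \<Omega> u g \<Longrightarrow> weak_gradient \<Omega> u (wgrad \<Omega> u)"
  unfolding wgrad_def by (metis someI)

lemma wgrad_AE:
  assumes "open \<Omega>" "weak_gradient \<Omega> u g"
  shows "AE x in lebesgue_on \<Omega>. wgrad \<Omega> u x = g x"
  using weak_gradient_unique[OF assms(1) wgrad_weak_gradient[OF assms(2)] assms(2)] assms(1)
  by (simp add: AE_lebesgue_on_iff)

text \<open>Completeness of Lebesgue measure. It lets measurability pass from a known weak gradient
  to the one chosen by \<open>wgrad\<close>.\<close>

lemma measurable_lebesgue_on_AE:
  fixes f g :: "'a::euclidean_space \<Rightarrow> 'b::euclidean_space"
  assumes om: "open \<Omega>" and f: "f \<in> borel_measurable (lebesgue_on \<Omega>)" and eq: "AE x in lebesgue_on \<Omega>. f x = g x"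
  shows "g \<in> borel_measurable (lebesgue_on \<Omega>)"
proof -
  have "(\<lambda>x. indicator \<Omega> x *\<^sub>R f x) \<in> borel_measurable lebesgue"
    using f om by (simp add: borel_measurable_restrict_space_iff)
  moreover have "AE x in lebesgue. indicator \<Omega> x *\<^sub>R f x = indicator \<Omega> x *\<^sub>R g x"
    using eq unfolding AE_lebesgue_on_iff[OF om] by eventually_elim (auto split: split_indicator)
  ultimately have "(\<lambda>x. indicator \<Omega> x *\<^sub>R g x) \<in> borel_measurable lebesgue"
    by (rule borel_measurable_AE)
  then show ?thesis using om by (simp add: borel_measurable_restrict_space_iff)
qed

lemma in_Lp_AE:
  fixes f g :: "'a::euclidean_space \<Rightarrow> 'b::euclidean_space"
  assumes om: "open \<Omega>" and f: "in_Lp p (lebesgue_on \<Omega>) f" and eq: "AE x in lebesgue_on \<Omega>. f x = g x"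
  shows "in_Lp p (lebesgue_on \<Omega>) g"
proof -
  have g: "g \<in> borel_measurable (lebesgue_on \<Omega>)"
    using measurable_lebesgue_on_AE[OF om _ eq] f by (simp add: in_Lp_def)
  moreover have "integrable (lebesgue_on \<Omega>) (\<lambda>x. norm (g x) powr p)"
  proof (rule integrable_cong_AE_imp)
    show "integrable (lebesgue_on \<Omega>) (\<lambda>x. norm (f x) powr p)" using f by (simp add: in_Lp_def)
    show "AE x in lebesgue_on \<Omega>. norm (f x) powr p = norm (g x) powr p" using eq by eventually_elim simp
  qed (use g in measurable)
  ultimately show ?thesis by (simp add: in_Lp_def)
qed

lemma sobolev_wgrad:
  assumes "open \<Omega>" "u \<in> sobolev p \<Omega>"
  shows "weak_gradient \<Omega> u (wgrad \<Omega> u)" "in_Lp p (lebesgue_on \<Omega>) u" "in_Lp p (lebesgue_on \<Omega>) (wgrad \<Omega> u)"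
proof -
  obtain g where g: "weak_gradient \<Omega> u g" "in_Lp p (lebesgue_on \<Omega>) g" using assms by (auto simp: sobolev_def)
  show "weak_gradient \<Omega> u (wgrad \<Omega> u)" by (rule wgrad_weak_gradient[OF g(1)])
  show "in_Lp p (lebesgue_on \<Omega>) u" using assms by (simp add: sobolev_def)
  have "AE x in lebesgue_on \<Omega>. g x = wgrad \<Omega> u x"
    using wgrad_AE[OF assms(1) g(1)] by eventually_elim simp
  then show "in_Lp p (lebesgue_on \<Omega>) (wgrad \<Omega> u)" by (rule in_Lp_AE[OF assms(1) g(2)])
qed

lemma powr_add_le:
  assumes "0 \<le> (x::real)" "0 \<le> y" "0 \<le> p"
  shows "(x + y) powr p \<le> 2 powr p * (x powr p + y powr p)"
proof -
  have "(x + y) powr p \<le> (2 * max x y) powr p" using assms by (intro powr_mono2) auto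
  also have "\<dots> = 2 powr p * max x y powr p" using assms by (simp add: powr_mult)
  also have "\<dots> \<le> 2 powr p * (x powr p + y powr p)"
    by (intro mult_left_mono) (auto simp: max_def)
  finally show ?thesis .
qed

lemma in_Lp_lincomb:
  fixes f g :: "'a \<Rightarrow> 'b::euclidean_space"
  assumes p: "0 \<le> p" and f: "in_Lp p M f" and g: "in_Lp p M g"
  shows "in_Lp p M (\<lambda>x. a *\<^sub>R f x + b *\<^sub>R g x)"
proof -
  have [measurable]: "f \<in> borel_measurable M" "g \<in> borel_measurable M" using f g by (auto simp: in_Lp_def)
  have "integrable M (\<lambda>x. 2 powr p * (\<bar>a\<bar> powr p * norm (f x) powr p + \<bar>b\<bar> powr p * norm (g x) powr p))"
    using f g by (auto simp: in_Lp_def)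
  then have "integrable M (\<lambda>x. norm (a *\<^sub>R f x + b *\<^sub>R g x) powr p)"
  proof (rule Bochner_Integration.integrable_bound)
    show "AE x in M. norm (norm (a *\<^sub>R f x + b *\<^sub>R g x) powr p) \<le> norm (2 powr p * (\<bar>a\<bar> powr p * norm (f x) powr p + \<bar>b\<bar> powr p * norm (g x) powr p))"
    proof (intro AE_I2)
      fix x
      have "norm (a *\<^sub>R f x + b *\<^sub>R g x) powr p \<le> (norm (a *\<^sub>R f x) + norm (b *\<^sub>R g x)) powr p"
        using p by (intro powr_mono2 norm_triangle_ineq) auto
      also have "\<dots> \<le> 2 powr p * (norm (a *\<^sub>R f x) powr p + norm (b *\<^sub>R g x) powr p)"
        using p by (intro powr_add_le) auto
      finally show "norm (norm (a *\<^sub>R f x + b *\<^sub>R g x) powr p) \<le> norm (2 powr p * (\<bar>a\<bar> powr p * norm (f x) powr p + \<bar>b\<bar> powr p * norm (g x) powr p))"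
        by (simp add: powr_mult)
    qed
  qed measurable
  then show ?thesis by (simp add: in_Lp_def)
qed

lemma sobolev_lincomb:
  assumes om: "open \<Omega>" and p: "0 \<le> p" and u: "u \<in> sobolev p \<Omega>" and v: "v \<in> sobolev p \<Omega>"
  shows "(\<lambda>x. a * u x + b * v x) \<in> sobolev p \<Omega>"
    "AE x in lebesgue_on \<Omega>. wgrad \<Omega> (\<lambda>x. a * u x + b * v x) x = a *\<^sub>R wgrad \<Omega> u x + b *\<^sub>R wgrad \<Omega> v x"
proof -
  note U = sobolev_wgrad[OF om u] and V = sobolev_wgrad[OF om v]
  have g: "weak_gradient \<Omega> (\<lambda>x. a * u x + b * v x) (\<lambda>x. a *\<^sub>R wgrad \<Omega> u x + b *\<^sub>R wgrad \<Omega> v x)"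
    by (rule weak_gradient_lincomb[OF om U(1) V(1)])
  then show "AE x in lebesgue_on \<Omega>. wgrad \<Omega> (\<lambda>x. a * u x + b * v x) x = a *\<^sub>R wgrad \<Omega> u x + b *\<^sub>R wgrad \<Omega> v x"
    by (rule wgrad_AE[OF om])
  show "(\<lambda>x. a * u x + b * v x) \<in> sobolev p \<Omega>"
    using g in_Lp_lincomb[OF p U(2) V(2), of a b] in_Lp_lincomb[OF p U(3) V(3), of a b]
    by (auto simp: sobolev_def)
qed

definition gradient :: "(real^'n::finite \<Rightarrow> real) \<Rightarrow> real^'n \<Rightarrow> real^'n" where
  "gradient f x = (\<chi> i. partial_deriv i f x)"

lemma continuous_gradient: "smooth_fun f \<Longrightarrow> continuous_on UNIV (gradient f)"
  unfolding gradient_def by (intro continuous_on_vec_lambda smooth_fun_continuous smooth_fun_partial)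

lemma has_derivative_gradient: "smooth_fun f \<Longrightarrow> (f has_derivative (\<lambda>h. gradient f x \<bullet> h)) (at x)"
  using has_derivative_partial[OF smooth_fun_differentiable, of f x]
  by (simp add: gradient_def inner_vec_def mult.commute)

lemma set_integrable_continuous_compact:
  fixes f :: "'a::euclidean_space \<Rightarrow> 'b::euclidean_space"
  assumes "continuous_on UNIV f" "compact K"
  shows "set_integrable lebesgue K f"
proof -
  have "integrable lborel (\<lambda>x. indicator K x *\<^sub>R f x)"
    using borel_integrable_compact[OF assms(2), of f] assms(1) by (auto intro: continuous_on_subset)
  then show ?thesis unfolding set_integrable_def by (intro integrable_completion[THEN iffD2]) auto
qed

text \<open>The product with a test function has compact support, so its partial derivative
  integrates to zero; the product rule splits it.\<close>

lemma smooth_weak_gradient: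
  fixes f :: "real^'n::finite \<Rightarrow> real"
  assumes om: "open \<Omega>" and f: "smooth_fun f"
  shows "weak_gradient \<Omega> f (gradient f)"
  unfolding weak_gradient_def
proof (intro conjI allI impI)
  fix K :: "(real^'n) set" assume K: "compact K \<and> K \<subseteq> \<Omega>"
  then show "set_integrable lebesgue K f" "set_integrable lebesgue K (gradient f)"
    using smooth_fun_continuous[OF f] continuous_gradient[OF f] by (auto intro: set_integrable_continuous_compact)
next
  fix h i assume h: "test_fun \<Omega> h"
  obtain K where K: "compact K" "K \<subseteq> \<Omega>" "\<And>x. x \<notin> K \<Longrightarrow> h x = 0" "\<And>x i. x \<notin> K \<Longrightarrow> partial_deriv i h x = 0"
    using test_fun_support[OF h] by blast
  have sh: "smooth_fun h" using h by (simp add: test_fun_def)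
  have cf: "continuous_on UNIV f" "continuous_on UNIV (partial_deriv i f)" "continuous_on UNIV h" "continuous_on UNIV (partial_deriv i h)"
    using f sh by (auto intro: smooth_fun_continuous smooth_fun_partial)
  have s: "set_integrable lebesgue K f" "set_integrable lebesgue K (partial_deriv i f)"
    using K cf by (auto intro: set_integrable_continuous_compact)
  have t: "test_fun UNIV (\<lambda>x. f x * h x)"
    using K by (intro test_funI[OF smooth_fun_mult[OF f sh] K(1)]) auto
  have pd: "partial_deriv i (\<lambda>x. f x * h x) x = f x * partial_deriv i h x + partial_deriv i f x * h x" for x
  proof -
    have "((\<lambda>x. f x * h x) has_derivative (\<lambda>k. f x * frechet_derivative h (at x) k + frechet_derivative f (at x) k * h x)) (at x)"
      using f sh by (intro has_derivative_mult) (auto simp: frechet_derivative_works[symmetric] intro: smooth_fun_differentiable)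
    then show ?thesis by (subst partial_derivI) (auto simp: partial_deriv_def)
  qed
  note A = integrable_mult_test[OF om K(1,2) s(1) cf(4) K(4)] and B = integrable_mult_test[OF om K(1,2) s(2) cf(3) K(3)]
  have m: "partial_deriv i (\<lambda>x. f x * h x) \<in> borel_measurable borel"
    using t by (intro borel_measurable_continuous_onI test_fun_continuous_partial)
  have "0 = (LINT x|lebesgue. partial_deriv i (\<lambda>x. f x * h x) x)"
    using integral_partial_deriv_eq_0[OF t, of i] integral_completion[of "partial_deriv i (\<lambda>x. f x * h x)" lborel] m by simp
  also have "\<dots> = (LINT x|lebesgue. f x * partial_deriv i h x) + (LINT x|lebesgue. partial_deriv i f x * h x)"
    unfolding pd using A(1) B(1) by simp
  finally show "(LINT x|lebesgue_on \<Omega>. f x * partial_deriv i h x) = - (LINT x|lebesgue_on \<Omega>. gradient f x $ i * h x)"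
    using A(3) B(3) by (simp add: gradient_def)
qed

lemma in_Lp_continuous_bounded:
  fixes f :: "'a::euclidean_space \<Rightarrow> 'b::euclidean_space"
  assumes p: "0 < p" and om: "open \<Omega>" "bounded \<Omega>" and f: "continuous_on UNIV f"
  shows "in_Lp p (lebesgue_on \<Omega>) f"
proof -
  have [measurable]: "f \<in> borel_measurable borel" by (rule borel_measurable_continuous_onI[OF f])
  have m: "f \<in> borel_measurable (lebesgue_on \<Omega>)"
    by (intro measurable_restrict_space1 borel_imp_lebesgue_measurable) simp
  have "continuous_on UNIV (\<lambda>x. norm (f x) powr p)"
    using f p by (intro continuous_on_powr' continuous_intros) auto
  then have "set_integrable lebesgue (closure \<Omega>) (\<lambda>x. norm (f x) powr p)"
    using om by (intro set_integrable_continuous_compact) auto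
  then have "set_integrable lebesgue \<Omega> (\<lambda>x. norm (f x) powr p)"
    by (rule set_integrable_subset) (use om closure_subset in auto)
  then have "integrable (lebesgue_on \<Omega>) (\<lambda>x. norm (f x) powr p)"
    using om by (simp add: integrable_restrict_space set_integrable_def)
  with m show ?thesis by (simp add: in_Lp_def)
qed

lemma smooth_sobolev:
  assumes "0 < p" "open \<Omega>" "bounded \<Omega>" "smooth_fun f"
  shows "f \<in> sobolev p \<Omega>" "AE x in lebesgue_on \<Omega>. wgrad \<Omega> f x = gradient f x"
proof -
  have g: "weak_gradient \<Omega> f (gradient f)" by (rule smooth_weak_gradient[OF assms(2,4)])
  then show "AE x in lebesgue_on \<Omega>. wgrad \<Omega> f x = gradient f x" by (rule wgrad_AE[OF assms(2)])
  show "f \<in> sobolev p \<Omega>"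
    unfolding sobolev_def
    using g in_Lp_continuous_bounded[OF assms(1,2,3) smooth_fun_continuous[OF assms(4)]]
      in_Lp_continuous_bounded[OF assms(1,2,3) continuous_gradient[OF assms(4)]] by blast
qed

section \<open>Energy, homogeneity and the triangle inequality\<close>

definition sobolev_energy :: "real \<Rightarrow> (real^'n::finite) set \<Rightarrow> (real^'n \<Rightarrow> real) \<Rightarrow> real" where
  "sobolev_energy p \<Omega> u = (LINT x|lebesgue_on \<Omega>. \<bar>u x\<bar> powr p) + (LINT x|lebesgue_on \<Omega>. norm (wgrad \<Omega> u x) powr p)"

lemma sobolev_energy_nonneg: "0 \<le> sobolev_energy p \<Omega> u"
  unfolding sobolev_energy_def by (intro add_nonneg_nonneg integral_nonneg_AE) auto

lemma sobolev_norm_energy: "sobolev_norm p \<Omega> u = sobolev_energy p \<Omega> u powr (1 / p)"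
  by (simp add: sobolev_norm_def sobolev_energy_def)

lemma powr_convex_comb:
  assumes "1 \<le> p" "0 \<le> x" "0 \<le> y" "0 \<le> t" "t \<le> 1"
  shows "((1 - t) * x + t * y) powr p \<le> (1 - t) * x powr p + t * y powr (p::real)"
proof -
  have *: "(s * z) powr p \<le> s * z powr p" if "0 \<le> s" "s \<le> 1" "0 \<le> z" for s z :: real
  proof -
    have "s powr p \<le> s"
    proof (cases "s = 0")
      case False
      then have "s powr p \<le> s powr 1" using that assms(1) by (intro powr_mono') auto
      then show ?thesis using False that by simp
    qed (use assms(1) in simp)
    then show ?thesis using that by (simp add: powr_mult mult_right_mono)
  qed
  consider "x = 0" | "y = 0" | "0 < x" "0 < y" using assms by linarith
  then show ?thesis
  proof cases
    case 3
    have "convex_on {0<..} (\<lambda>x::real. x powr p)" by (rule powr_convex[OF assms(1)])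
    from convex_onD[OF this, of t x y] show ?thesis using assms 3 by simp
  qed (use *[of t y] *[of "1 - t" x] assms in auto)
qed

text \<open>The set where \<open>E\<close> is at most 1 is convex and \<open>E\<close> is
  homogeneous of degree \<open>p\<close>, so its \<open>p\<close>-th root is the gauge of a convex
  set. This yields Minkowski's inequality for the Sobolev norm and for the \<open>L^p\<close> norm
  at once.\<close>

lemma powr_modular_triangle:
  fixes E :: "('a \<Rightarrow> real) \<Rightarrow> real"
  assumes p: "1 \<le> p" and nonneg: "\<And>u. u \<in> S \<Longrightarrow> 0 \<le> E u"
    and S: "\<And>u c. u \<in> S \<Longrightarrow> (\<lambda>x. c * u x) \<in> S"
    and hom: "\<And>u c. u \<in> S \<Longrightarrow> 0 < c \<Longrightarrow> E (\<lambda>x. c * u x) = c powr p * E u"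
    and Sadd: "\<And>u v. u \<in> S \<Longrightarrow> v \<in> S \<Longrightarrow> (\<lambda>x. u x + v x) \<in> S"
    and conv: "\<And>u v t. u \<in> S \<Longrightarrow> v \<in> S \<Longrightarrow> 0 < t \<Longrightarrow> t < 1 \<Longrightarrow> E (\<lambda>x. (1 - t) * u x + t * v x) \<le> (1 - t) * E u + t * E v"
    and uv: "u \<in> S" "v \<in> S"
  shows "E (\<lambda>x. u x + v x) powr (1 / p) \<le> E u powr (1 / p) + E v powr (1 / p)"
proof (rule field_le_epsilon)
  fix e :: real assume e: "0 < e"
  \<comment> \<open>The extra \<open>e / 2\<close> keeps the normalising factors positive even where
    \<open>E\<close> vanishes.\<close>
  define a where "a = E u powr (1 / p) + e / 2"
  define b where "b = E v powr (1 / p) + e / 2"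
  have ab: "0 < a" "0 < b" using e by (auto simp: a_def b_def intro: add_nonneg_pos)
  have le1: "E (\<lambda>x. (1 / a) * w x) \<le> 1" if w: "w \<in> S" "E w powr (1 / p) \<le> a" "0 < a" for w a
  proof -
    have "E w = (E w powr (1 / p)) powr p" using nonneg[OF w(1)] p by (simp add: powr_powr)
    also have "\<dots> \<le> a powr p" using w p by (intro powr_mono2) auto
    finally have "E w \<le> a powr p" .
    moreover have "a powr p * E (\<lambda>x. (1 / a) * w x) = E w" using hom[OF w(1), of "1 / a"] w(3) by (simp add: powr_divide)
    ultimately have "a powr p * E (\<lambda>x. (1 / a) * w x) \<le> a powr p * 1" by simp
    then show ?thesis using w(3) by (subst (asm) mult_le_cancel_left_pos) auto
  qed
  \<comment> \<open>With this weight the convex combination of the two normalised functions is a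
    multiple of their unnormalised sum.\<close>
  define t where "t = b / (a + b)"
  have t: "0 < t" "t < 1" "1 - t = a / (a + b)" using ab by (auto simp: t_def field_simps)
  have "E (\<lambda>x. (1 - t) * ((1 / a) * u x) + t * ((1 / b) * v x)) \<le> (1 - t) * E (\<lambda>x. (1 / a) * u x) + t * E (\<lambda>x. (1 / b) * v x)"
    by (intro conv S uv t)
  also have "\<dots> \<le> (1 - t) * 1 + t * 1"
    using t e uv ab by (intro add_mono mult_left_mono le1) (auto simp: a_def b_def)
  finally have *: "E (\<lambda>x. (1 - t) * ((1 / a) * u x) + t * ((1 / b) * v x)) \<le> 1" by simp
  have eq: "(1 - t) * ((1 / a) * u x) + t * ((1 / b) * v x) = (1 / (a + b)) * (u x + v x)" for x
  proof -
    have "a / (a + b) * ((1 / a) * u x) = u x / (a + b)" "b / (a + b) * ((1 / b) * v x) = v x / (a + b)"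
      using ab by simp_all
    then show ?thesis unfolding t(3) by (simp add: t_def add_divide_distrib)
  qed
  have "E (\<lambda>x. (1 / (a + b)) * (u x + v x)) = (1 / (a + b)) powr p * E (\<lambda>x. u x + v x)"
    using ab by (intro hom Sadd uv) auto
  then have e1: "E (\<lambda>x. u x + v x) = (a + b) powr p * E (\<lambda>x. (1 / (a + b)) * (u x + v x))"
    using ab by (simp add: powr_divide)
  have "E (\<lambda>x. u x + v x) \<le> (a + b) powr p"
    unfolding e1 using * unfolding eq by (intro mult_left_le) auto
  then have "E (\<lambda>x. u x + v x) powr (1 / p) \<le> ((a + b) powr p) powr (1 / p)"
    using p nonneg[OF Sadd[OF uv]] by (intro powr_mono2) auto
  also have "\<dots> = a + b" using ab p by (simp add: powr_powr)
  finally show "E (\<lambda>x. u x + v x) powr (1 / p) \<le> E u powr (1 / p) + E v powr (1 / p) + e"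
    by (simp add: a_def b_def)
qed

lemma in_Lp_convex:
  fixes f g :: "'a \<Rightarrow> 'b::euclidean_space"
  assumes p: "1 \<le> p" and f: "in_Lp p M f" and g: "in_Lp p M g" and t: "0 \<le> t" "t \<le> 1"
  shows "(LINT x|M. norm ((1 - t) *\<^sub>R f x + t *\<^sub>R g x) powr p)
    \<le> (1 - t) * (LINT x|M. norm (f x) powr p) + t * (LINT x|M. norm (g x) powr p)"
proof -
  have "(LINT x|M. norm ((1 - t) *\<^sub>R f x + t *\<^sub>R g x) powr p) \<le> (LINT x|M. (1 - t) * norm (f x) powr p + t * norm (g x) powr p)"
  proof (rule integral_mono)
    show "integrable M (\<lambda>x. norm ((1 - t) *\<^sub>R f x + t *\<^sub>R g x) powr p)"
      using in_Lp_lincomb[OF _ f g, of "1 - t" t] p by (simp add: in_Lp_def)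
    show "integrable M (\<lambda>x. (1 - t) * norm (f x) powr p + t * norm (g x) powr p)"
      using f g by (simp add: in_Lp_def)
    fix x
    have "norm ((1 - t) *\<^sub>R f x + t *\<^sub>R g x) powr p \<le> ((1 - t) * norm (f x) + t * norm (g x)) powr p"
      using p t norm_triangle_ineq[of "(1 - t) *\<^sub>R f x" "t *\<^sub>R g x"] by (intro powr_mono2) auto
    also have "\<dots> \<le> (1 - t) * norm (f x) powr p + t * norm (g x) powr p"
      using p t by (intro powr_convex_comb) auto
    finally show "norm ((1 - t) *\<^sub>R f x + t *\<^sub>R g x) powr p \<le> (1 - t) * norm (f x) powr p + t * norm (g x) powr p" .
  qed
  also have "\<dots> = (1 - t) * (LINT x|M. norm (f x) powr p) + t * (LINT x|M. norm (g x) powr p)"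
    using f g by (simp add: in_Lp_def)
  finally show ?thesis .
qed

lemma borel_measurable_lebesgue_on_wgrad:
  "open \<Omega> \<Longrightarrow> u \<in> sobolev p \<Omega> \<Longrightarrow> wgrad \<Omega> u \<in> borel_measurable (lebesgue_on \<Omega>)"
  using sobolev_wgrad(3) by (auto simp: in_Lp_def)

lemma sobolev_energy_lincomb:
  assumes om: "open \<Omega>" and p: "0 \<le> p" and u: "u \<in> sobolev p \<Omega>" and v: "v \<in> sobolev p \<Omega>"
  shows "sobolev_energy p \<Omega> (\<lambda>x. a * u x + b * v x) =
    (LINT x|lebesgue_on \<Omega>. norm (a *\<^sub>R u x + b *\<^sub>R v x) powr p) +
    (LINT x|lebesgue_on \<Omega>. norm (a *\<^sub>R wgrad \<Omega> u x + b *\<^sub>R wgrad \<Omega> v x) powr p)"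
proof -
  note [measurable] = borel_measurable_lebesgue_on_wgrad[OF om u] borel_measurable_lebesgue_on_wgrad[OF om v]
    borel_measurable_lebesgue_on_wgrad[OF om sobolev_lincomb(1)[OF om p u v, of a b]]
  have "(LINT x|lebesgue_on \<Omega>. norm (wgrad \<Omega> (\<lambda>x. a * u x + b * v x) x) powr p) =
    (LINT x|lebesgue_on \<Omega>. norm (a *\<^sub>R wgrad \<Omega> u x + b *\<^sub>R wgrad \<Omega> v x) powr p)"
  proof (rule integral_cong_AE)
    show "AE x in lebesgue_on \<Omega>. norm (wgrad \<Omega> (\<lambda>x. a * u x + b * v x) x) powr p = norm (a *\<^sub>R wgrad \<Omega> u x + b *\<^sub>R wgrad \<Omega> v x) powr p"
      using sobolev_lincomb(2)[OF om p u v, of a b] by eventually_elim simp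
  qed measurable
  then show ?thesis by (simp add: sobolev_energy_def)
qed

lemma sobolev_energy_convex:
  assumes om: "open \<Omega>" and p: "1 \<le> p" and u: "u \<in> sobolev p \<Omega>" and v: "v \<in> sobolev p \<Omega>" and t: "0 \<le> t" "t \<le> 1"
  shows "sobolev_energy p \<Omega> (\<lambda>x. (1 - t) * u x + t * v x) \<le> (1 - t) * sobolev_energy p \<Omega> u + t * sobolev_energy p \<Omega> v"
proof -
  note U = sobolev_wgrad[OF om u] and V = sobolev_wgrad[OF om v]
  show ?thesis
    using in_Lp_convex[OF p U(2) V(2) t] in_Lp_convex[OF p U(3) V(3) t]
      sobolev_energy_lincomb[OF om _ u v, of "1 - t" t] p
    by (simp add: sobolev_energy_def algebra_simps)
qed

lemma sobolev_energy_scale: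
  assumes om: "open \<Omega>" and p: "0 \<le> p" and u: "u \<in> sobolev p \<Omega>"
  shows "sobolev_energy p \<Omega> (\<lambda>x. c * u x) = \<bar>c\<bar> powr p * sobolev_energy p \<Omega> u"
  using sobolev_energy_lincomb[OF om p u u, of c 0]
  by (simp add: sobolev_energy_def powr_mult abs_mult algebra_simps)

lemma sobolev_scale: "open \<Omega> \<Longrightarrow> 0 \<le> p \<Longrightarrow> u \<in> sobolev p \<Omega> \<Longrightarrow> (\<lambda>x. c * u x) \<in> sobolev p \<Omega>"
  using sobolev_lincomb(1)[of \<Omega> p u u c 0] by simp

lemma sobolev_add: "open \<Omega> \<Longrightarrow> 0 \<le> p \<Longrightarrow> u \<in> sobolev p \<Omega> \<Longrightarrow> v \<in> sobolev p \<Omega> \<Longrightarrow> (\<lambda>x. u x + v x) \<in> sobolev p \<Omega>"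
  using sobolev_lincomb(1)[of \<Omega> p u v 1 1] by simp

lemma sobolev_diff: "open \<Omega> \<Longrightarrow> 0 \<le> p \<Longrightarrow> u \<in> sobolev p \<Omega> \<Longrightarrow> v \<in> sobolev p \<Omega> \<Longrightarrow> (\<lambda>x. u x - v x) \<in> sobolev p \<Omega>"
  using sobolev_lincomb(1)[of \<Omega> p u v 1 "-1"] by simp

lemma sobolev_norm_triangle:
  assumes om: "open \<Omega>" and p: "1 \<le> p" and u: "u \<in> sobolev p \<Omega>" and v: "v \<in> sobolev p \<Omega>"
  shows "sobolev_norm p \<Omega> (\<lambda>x. u x + v x) \<le> sobolev_norm p \<Omega> u + sobolev_norm p \<Omega> v"
  unfolding sobolev_norm_energy
proof (rule powr_modular_triangle[OF p, where S="sobolev p \<Omega>"])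
  show "sobolev_energy p \<Omega> (\<lambda>x. (1 - t) * u x + t * v x) \<le> (1 - t) * sobolev_energy p \<Omega> u + t * sobolev_energy p \<Omega> v"
    if "u \<in> sobolev p \<Omega>" "v \<in> sobolev p \<Omega>" "0 < t" "t < 1" for u v t
    using sobolev_energy_convex[OF om p that(1,2)] that by simp
qed (use om p u v in \<open>auto simp: sobolev_energy_nonneg sobolev_energy_scale intro: sobolev_scale sobolev_add\<close>)

definition Lp_norm :: "real \<Rightarrow> (real^'n::finite) set \<Rightarrow> (real^'n \<Rightarrow> real) \<Rightarrow> real" where
  "Lp_norm p \<Omega> u = (LINT x|lebesgue_on \<Omega>. \<bar>u x\<bar> powr p) powr (1 / p)"

lemma Lp_norm_triangle:
  assumes om: "open \<Omega>" and p: "1 \<le> p" and u: "u \<in> sobolev p \<Omega>" and v: "v \<in> sobolev p \<Omega>"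
  shows "Lp_norm p \<Omega> (\<lambda>x. u x + v x) \<le> Lp_norm p \<Omega> u + Lp_norm p \<Omega> v"
  unfolding Lp_norm_def
proof (rule powr_modular_triangle[OF p, where S="sobolev p \<Omega>" and E="\<lambda>u. LINT x|lebesgue_on \<Omega>. \<bar>u x\<bar> powr p"])
  show "(LINT x|lebesgue_on \<Omega>. \<bar>(1 - t) * u x + t * v x\<bar> powr p) \<le> (1 - t) * (LINT x|lebesgue_on \<Omega>. \<bar>u x\<bar> powr p) + t * (LINT x|lebesgue_on \<Omega>. \<bar>v x\<bar> powr p)"
    if "u \<in> sobolev p \<Omega>" "v \<in> sobolev p \<Omega>" "0 < t" "t < 1" for u v t
    using in_Lp_convex[OF p sobolev_wgrad(2)[OF om that(1)] sobolev_wgrad(2)[OF om that(2)], of t] that by simp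
qed (use om p u v in \<open>auto simp: powr_mult abs_mult intro: sobolev_scale sobolev_add\<close>)

lemma Lp_norm_le_sobolev_norm: "0 < p \<Longrightarrow> Lp_norm p \<Omega> u \<le> sobolev_norm p \<Omega> u"
  unfolding Lp_norm_def sobolev_norm_def by (intro powr_mono2) (auto intro!: integral_nonneg_AE)

section \<open>Absolute continuity along lines\<close>

lemma lebesgue_on_borel_transfer:
  fixes f f0 :: "'a::euclidean_space \<Rightarrow> 'b::euclidean_space"
  assumes om: "open \<Omega>" and f0: "f0 \<in> borel_measurable borel" "\<And>x. x \<notin> \<Omega> \<Longrightarrow> f0 x = 0"
    and eq: "AE x in lebesgue. x \<in> \<Omega> \<longrightarrow> f x = f0 x"
  shows "integrable (lebesgue_on \<Omega>) f \<longleftrightarrow> integrable lborel f0"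
    and "(LINT x|lebesgue_on \<Omega>. f x) = (LINT x|lborel. f0 x)"
proof -
  have ae: "AE x in lebesgue_on \<Omega>. f0 x = f x" using eq unfolding AE_lebesgue_on_iff[OF om] by eventually_elim auto
  have m0: "f0 \<in> borel_measurable (lebesgue_on \<Omega>)"
    by (intro measurable_restrict_space1 borel_imp_lebesgue_measurable f0)
  have m: "f \<in> borel_measurable (lebesgue_on \<Omega>)" by (rule measurable_lebesgue_on_AE[OF om m0 ae])
  have ae': "AE x in lebesgue_on \<Omega>. f x = f0 x" using ae by eventually_elim simp
  have ind: "(\<lambda>x. indicator \<Omega> x *\<^sub>R f0 x) = f0" using f0(2) by (auto split: split_indicator)
  have "integrable (lebesgue_on \<Omega>) f \<longleftrightarrow> integrable (lebesgue_on \<Omega>) f0" by (rule integrable_cong_AE[OF m m0 ae'])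
  also have "\<dots> \<longleftrightarrow> integrable lebesgue f0" using om ind by (simp add: integrable_restrict_space)
  also have "\<dots> \<longleftrightarrow> integrable lborel f0" using f0 by (simp add: integrable_completion)
  finally show "integrable (lebesgue_on \<Omega>) f \<longleftrightarrow> integrable lborel f0" .
  have "(LINT x|lebesgue_on \<Omega>. f x) = (LINT x|lebesgue_on \<Omega>. f0 x)" by (rule integral_cong_AE[OF m m0 ae'])
  also have "\<dots> = (LINT x|lebesgue. f0 x)" using om ind by (simp add: integral_restrict_space)
  also have "\<dots> = (LINT x|lborel. f0 x)" using f0 by (simp add: integral_completion)
  finally show "(LINT x|lebesgue_on \<Omega>. f x) = (LINT x|lborel. f0 x)" .
qed

lemma lebesgue_on_real_ex_borel:
  fixes f :: "'a::euclidean_space \<Rightarrow> real"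
  assumes om: "open \<Omega>" and f: "f \<in> borel_measurable (lebesgue_on \<Omega>)"
  shows "\<exists>f0\<in>borel_measurable borel. (\<forall>x. x \<notin> \<Omega> \<longrightarrow> f0 x = 0) \<and> (AE x in lebesgue. x \<in> \<Omega> \<longrightarrow> f x = f0 x)"
proof -
  have "(\<lambda>x. indicator \<Omega> x *\<^sub>R f x) \<in> borel_measurable lebesgue"
    using f om by (simp add: borel_measurable_restrict_space_iff)
  then obtain f1 where f1: "f1 \<in> borel_measurable borel" "AE x in lborel. indicator \<Omega> x *\<^sub>R f x = f1 x"
    by (rule lebesgue_real_ex_borel)
  have "(\<lambda>x. indicator \<Omega> x *\<^sub>R f1 x) \<in> borel_measurable borel" using f1 om by simp
  moreover have "AE x in lebesgue. x \<in> \<Omega> \<longrightarrow> f x = indicator \<Omega> x *\<^sub>R f1 x"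
    using AE_completion[OF f1(2)] by eventually_elim (auto split: split_indicator_asm)
  ultimately show ?thesis by (intro bexI[of _ "\<lambda>x. indicator \<Omega> x *\<^sub>R f1 x"] conjI) auto
qed

lemma lebesgue_on_vec_ex_borel:
  fixes f :: "'a::euclidean_space \<Rightarrow> real^'n::finite"
  assumes om: "open \<Omega>" and f: "f \<in> borel_measurable (lebesgue_on \<Omega>)"
  shows "\<exists>f0\<in>borel_measurable borel. (\<forall>x. x \<notin> \<Omega> \<longrightarrow> f0 x = 0) \<and> (AE x in lebesgue. x \<in> \<Omega> \<longrightarrow> f x = f0 x)"
proof -
  have "(\<lambda>x. indicator \<Omega> x *\<^sub>R f x) \<in> borel_measurable lebesgue"
    using f om by (simp add: borel_measurable_restrict_space_iff)
  then obtain f1 where f1: "f1 \<in> borel_measurable borel" "AE x in lborel. indicator \<Omega> x *\<^sub>R f x = f1 x"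
    by (rule lebesgue_vec_ex_borel)
  have "(\<lambda>x. indicator \<Omega> x *\<^sub>R f1 x) \<in> borel_measurable borel" using f1 om by simp
  moreover have "AE x in lebesgue. x \<in> \<Omega> \<longrightarrow> f x = indicator \<Omega> x *\<^sub>R f1 x"
    using AE_completion[OF f1(2)] by eventually_elim (auto split: split_indicator_asm)
  ultimately show ?thesis by (intro bexI[of _ "\<lambda>x. indicator \<Omega> x *\<^sub>R f1 x"] conjI) auto
qed

text \<open>A Borel representative of a Sobolev function, extended by zero. Since \<open>g\<close>
  is extended by zero too, it is in general not the distributional gradient of the extension, which
  may jump across the boundary; the weak formulation is therefore tested in \<Omega> only.\<close>

definition borel_sobolev :: "real \<Rightarrow> (real^'n::finite) set \<Rightarrow> (real^'n \<Rightarrow> real) \<Rightarrow> (real^'n \<Rightarrow> real^'n) \<Rightarrow> bool" where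
  "borel_sobolev p \<Omega> u g \<longleftrightarrow> u \<in> borel_measurable borel \<and> g \<in> borel_measurable borel \<and>
     (\<forall>x. x \<notin> \<Omega> \<longrightarrow> u x = 0 \<and> g x = 0) \<and> integrable lborel u \<and> integrable lborel g \<and>
     integrable lborel (\<lambda>x. \<bar>u x\<bar> powr p) \<and> integrable lborel (\<lambda>x. norm (g x) powr p) \<and>
     (\<forall>f i. test_fun \<Omega> f \<longrightarrow> (LINT x|lborel. u x * partial_deriv i f x) = - (LINT x|lborel. g x $ i * f x))"

lemma le_one_plus_powr: "0 \<le> x \<Longrightarrow> 1 \<le> p \<Longrightarrow> x \<le> 1 + x powr (p::real)"
proof -
  assume *: "0 \<le> x" "1 \<le> p"
  show ?thesis
  proof (cases "x \<le> 1")
    case False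
    then have "x powr 1 \<le> x powr p" using * by (intro powr_mono) auto
    then show ?thesis using False by simp
  qed (use powr_ge_zero[of x p] in linarith)
qed

lemma integrable_of_powr:
  fixes f :: "'a::euclidean_space \<Rightarrow> 'b::euclidean_space"
  assumes "open \<Omega>" "bounded \<Omega>" "1 \<le> p" "f \<in> borel_measurable borel" "\<And>x. x \<notin> \<Omega> \<Longrightarrow> f x = 0"
    "integrable lborel (\<lambda>x. norm (f x) powr p)"
  shows "integrable lborel f"
proof (rule Bochner_Integration.integrable_bound)
  have "integrable lborel (\<lambda>x. indicator \<Omega> x :: real)"
    using assms emeasure_bounded_finite[OF assms(2)] by (intro integrable_real_indicator) auto
  then show "integrable lborel (\<lambda>x. indicator \<Omega> x + norm (f x) powr p)" using assms by simp
  show "AE x in lborel. norm (f x) \<le> norm (indicator \<Omega> x + norm (f x) powr p)"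
    using assms le_one_plus_powr[of "norm (f _)" p] by (intro AE_I2) (auto split: split_indicator)
qed (use assms in simp)

lemma sobolev_ex_borel:
  fixes \<Omega> :: "(real^'n::finite) set"
  assumes om: "open \<Omega>" "bounded \<Omega>" and p: "1 \<le> p" and u: "u \<in> sobolev p \<Omega>"
  shows "\<exists>u0 g0. borel_sobolev p \<Omega> u0 g0 \<and> (AE x in lebesgue. x \<in> \<Omega> \<longrightarrow> u x = u0 x) \<and>
    sobolev_energy p \<Omega> u = (LINT x|lborel. \<bar>u0 x\<bar> powr p) + (LINT x|lborel. norm (g0 x) powr p)"
proof -
  note U = sobolev_wgrad[OF om(1) u]
  obtain u0 where u0: "u0 \<in> borel_measurable borel" "\<And>x. x \<notin> \<Omega> \<Longrightarrow> u0 x = 0" "AE x in lebesgue. x \<in> \<Omega> \<longrightarrow> u x = u0 x"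
    using lebesgue_on_real_ex_borel[OF om(1), of u] U(2) by (auto simp: in_Lp_def)
  obtain g0 where g0: "g0 \<in> borel_measurable borel" "\<And>x. x \<notin> \<Omega> \<Longrightarrow> g0 x = 0" "AE x in lebesgue. x \<in> \<Omega> \<longrightarrow> wgrad \<Omega> u x = g0 x"
    using lebesgue_on_vec_ex_borel[OF om(1), of "wgrad \<Omega> u"] U(3) by (auto simp: in_Lp_def)
  have aeu: "AE x in lebesgue. x \<in> \<Omega> \<longrightarrow> \<bar>u x\<bar> powr p = \<bar>u0 x\<bar> powr p" using u0(3) by eventually_elim auto
  have aeg: "AE x in lebesgue. x \<in> \<Omega> \<longrightarrow> norm (wgrad \<Omega> u x) powr p = norm (g0 x) powr p" using g0(3) by eventually_elim auto
  have mu: "(\<lambda>x. \<bar>u0 x\<bar> powr p) \<in> borel_measurable borel" using u0 by measurable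
  have mg: "(\<lambda>x. norm (g0 x) powr p) \<in> borel_measurable borel" using g0 by measurable
  note tu = lebesgue_on_borel_transfer[OF om(1) mu _ aeu] and tg = lebesgue_on_borel_transfer[OF om(1) mg _ aeg]
  have pu: "integrable lborel (\<lambda>x. \<bar>u0 x\<bar> powr p)" using tu(1) U(2) u0(2) by (simp add: in_Lp_def)
  have pg: "integrable lborel (\<lambda>x. norm (g0 x) powr p)" using tg(1) U(3) g0(2) by (simp add: in_Lp_def)
  have "(LINT x|lborel. u0 x * partial_deriv i f x) = - (LINT x|lborel. g0 x $ i * f x)" if f: "test_fun \<Omega> f" for f i
  proof -
    have [measurable]: "f \<in> borel_measurable borel" "partial_deriv i f \<in> borel_measurable borel"
      using test_fun_continuous[OF f] test_fun_continuous_partial[OF f] by (auto intro: borel_measurable_continuous_onI)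
    have [measurable]: "(\<lambda>x. g0 x $ i) \<in> borel_measurable borel"
      using borel_measurable_inner[OF g0(1), of "\<lambda>x. axis i 1"] by (simp add: inner_axis)
    have "(LINT x|lebesgue_on \<Omega>. u x * partial_deriv i f x) = (LINT x|lborel. u0 x * partial_deriv i f x)"
    proof (rule lebesgue_on_borel_transfer(2)[OF om(1)])
      show "AE x in lebesgue. x \<in> \<Omega> \<longrightarrow> u x * partial_deriv i f x = u0 x * partial_deriv i f x"
        using u0(3) by eventually_elim auto
    qed (use u0 in auto)
    moreover have "(LINT x|lebesgue_on \<Omega>. wgrad \<Omega> u x $ i * f x) = (LINT x|lborel. g0 x $ i * f x)"
    proof (rule lebesgue_on_borel_transfer(2)[OF om(1)])
      show "AE x in lebesgue. x \<in> \<Omega> \<longrightarrow> wgrad \<Omega> u x $ i * f x = g0 x $ i * f x"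
        using g0(3) by eventually_elim auto
    qed (use g0 in auto)
    ultimately show ?thesis using U(1) f by (simp add: weak_gradient_def)
  qed
  then have "borel_sobolev p \<Omega> u0 g0"
    unfolding borel_sobolev_def
    using u0 g0 pu pg integrable_of_powr[OF om p u0(1,2)] integrable_of_powr[OF om p g0(1,2)] by simp
  moreover have "sobolev_energy p \<Omega> u = (LINT x|lborel. \<bar>u0 x\<bar> powr p) + (LINT x|lborel. norm (g0 x) powr p)"
    unfolding sobolev_energy_def using tu(2) tg(2) u0(2) g0(2) by simp
  ultimately show ?thesis using u0(3) by blast
qed

lemma lborel_shift:
  fixes f :: "'a::euclidean_space \<Rightarrow> 'b::euclidean_space"
  assumes [measurable]: "f \<in> borel_measurable borel"
  shows "integrable lborel (\<lambda>x. f (x + v)) \<longleftrightarrow> integrable lborel f"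
    and "(LINT x|lborel. f (x + v)) = (LINT x|lborel. f x)"
proof -
  have d: "distr lborel borel ((+) v) = (lborel :: 'a measure)" by (rule lborel_distr_plus)
  show "integrable lborel (\<lambda>x. f (x + v)) \<longleftrightarrow> integrable lborel f"
    using integrable_distr_eq[of "(+) v" lborel borel f] by (simp add: d add.commute)
  show "(LINT x|lborel. f (x + v)) = (LINT x|lborel. f x)"
    using integral_distr[of "(+) v" lborel borel f] by (simp add: d add.commute)
qed

lemma nn_integral_lborel_shift:
  fixes f :: "'a::euclidean_space \<Rightarrow> ennreal"
  assumes [measurable]: "f \<in> borel_measurable borel"
  shows "(\<integral>\<^sup>+x. f (x + v) \<partial>lborel) = (\<integral>\<^sup>+x. f x \<partial>lborel)"
proof -
  have d: "distr lborel borel ((+) v) = (lborel :: 'a measure)" by (rule lborel_distr_plus)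
  show ?thesis
    using nn_integral_distr[of "(+) v" lborel borel f] by (simp add: d add.commute)
qed

lemma integrable_pair_interval:
  fixes f :: "real \<times> 'a::euclidean_space \<Rightarrow> real"
  assumes f: "f \<in> borel_measurable (lborel \<Otimes>\<^sub>M lborel)"
    and c: "c < \<infinity>" and bound: "\<And>s. (\<integral>\<^sup>+y. ennreal \<bar>f (s, y)\<bar> \<partial>lborel) \<le> c * indicator {0..1} s"
  shows "integrable (lborel \<Otimes>\<^sub>M lborel) f"
proof (rule integrableI_bounded[OF f])
  have "(\<integral>\<^sup>+z. ennreal (norm (f z)) \<partial>(lborel \<Otimes>\<^sub>M lborel)) = (\<integral>\<^sup>+s. \<integral>\<^sup>+y. ennreal (norm (f (s, y))) \<partial>lborel \<partial>lborel)"
    by (rule lborel.nn_integral_fst[symmetric]) (intro measurable_compose[OF f], measurable)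
  also have "\<dots> \<le> (\<integral>\<^sup>+s. c * indicator {0..1::real} s \<partial>lborel)"
    using bound by (intro nn_integral_mono) simp
  also have "\<dots> = c" by (subst nn_integral_cmult_indicator) auto
  finally show "(\<integral>\<^sup>+z. ennreal (norm (f z)) \<partial>(lborel \<Otimes>\<^sub>M lborel)) < \<infinity>" using c by (rule le_less_trans)
qed

lemma test_fun_translate:
  assumes f: "test_fun U f" and U: "\<And>x. x \<in> U \<Longrightarrow> x - v \<in> \<Omega>"
  shows "test_fun \<Omega> (\<lambda>x. f (x + v))" "partial_deriv i (\<lambda>x. f (x + v)) x = partial_deriv i f (x + v)"
proof -
  obtain K where K: "compact K" "K \<subseteq> U" "\<And>x. x \<notin> K \<Longrightarrow> f x = 0" using test_fun_support[OF f] by blast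
  have sm: "smooth_fun f" using f by (simp add: test_fun_def)
  show "test_fun \<Omega> (\<lambda>x. f (x + v))"
  proof (rule test_funI[where K="(\<lambda>x. x - v) ` K"])
    show "smooth_fun (\<lambda>x. f (x + v))" by (rule smooth_fun_translate[OF sm])
    show "compact ((\<lambda>x. x - v) ` K)" using K(1) by (intro compact_continuous_image continuous_intros)
    show "(\<lambda>x. x - v) ` K \<subseteq> \<Omega>" using K(2) U by blast
    show "f (x + v) = 0" if "x \<notin> (\<lambda>x. x - v) ` K" for x
      using that K(3)[of "x + v"] by (metis add_diff_cancel image_eqI)
  qed
  have d: "((\<lambda>x. f (x + v)) has_derivative (\<lambda>h. gradient f (x + v) \<bullet> h)) (at x)"
    by (rule has_derivative_compose[where g=f and f="\<lambda>x. x + v" and f'="\<lambda>h. h", OF _ has_derivative_gradient[OF sm]])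
       (auto intro!: derivative_eq_intros)
  show "partial_deriv i (\<lambda>x. f (x + v)) x = partial_deriv i f (x + v)"
    by (subst partial_derivI[OF d]) (simp add: inner_axis gradient_def)
qed

lemma borel_measurable_gradient: "smooth_fun f \<Longrightarrow> gradient f \<in> borel_measurable borel"
  by (rule borel_measurable_continuous_onI[OF continuous_gradient])

lemma smooth_line_FTC:
  assumes f: "smooth_fun f"
  shows "(LINT s|lborel. indicator {0..1} s * (gradient f (y + s *\<^sub>R v) \<bullet> v)) = f (y + v) - f y"
proof -
  have "(LINT s|lborel. indicator {0..1} s *\<^sub>R (gradient f (y + s *\<^sub>R v) \<bullet> v)) = f (y + 1 *\<^sub>R v) - f (y + 0 *\<^sub>R v)"
  proof (rule integral_FTC_atLeastAtMost)
    fix s :: real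
    have "((\<lambda>s. f (y + s *\<^sub>R v)) has_derivative (\<lambda>h. gradient f (y + s *\<^sub>R v) \<bullet> (h *\<^sub>R v))) (at s within {0..1})"
      by (rule has_derivative_compose[where g=f and f="\<lambda>s. y + s *\<^sub>R v" and f'="\<lambda>h. h *\<^sub>R v", OF _ has_derivative_gradient[OF f]])
         (auto intro!: derivative_eq_intros)
    then show "((\<lambda>s. f (y + s *\<^sub>R v)) has_vector_derivative (gradient f (y + s *\<^sub>R v) \<bullet> v)) (at s within {0..1})"
      by (simp add: has_vector_derivative_def)
  next
    show "continuous_on {0..1} (\<lambda>s. gradient f (y + s *\<^sub>R v) \<bullet> v)"
      by (intro continuous_intros continuous_on_compose2[OF continuous_gradient[OF f]]) auto
  qed simp
  then show ?thesis by simp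
qed

lemma gradient_support:
  assumes "test_fun U f"
  shows "\<exists>B\<ge>0. \<forall>x. norm (gradient f x) \<le> B"
proof -
  obtain B where B: "B \<ge> 0" "\<And>x i. \<bar>partial_deriv i f x\<bar> \<le> B" using test_fun_bounds[OF assms] by blast
  have "norm (gradient f x) \<le> real CARD('a) * B" for x
  proof -
    have "norm (gradient f x) \<le> (\<Sum>i\<in>UNIV. \<bar>gradient f x $ i\<bar>)" by (rule norm_le_l1_cart)
    also have "\<dots> \<le> (\<Sum>i\<in>(UNIV::'a set). B)" using B by (intro sum_mono) (simp add: gradient_def)
    finally show ?thesis by simp
  qed
  then show ?thesis using B(1) by (intro exI[of _ "real CARD('a) * B"]) auto
qed

text \<open>Absolute continuity along lines, obtained by testing the difference quotient: translating
  a test function along the segment keeps it a test function of \<open>\<Omega>\<close>.\<close>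

lemma borel_sobolev_FTC:
  fixes \<Omega> :: "(real^'n::finite) set"
  assumes om: "open \<Omega>" and b: "borel_sobolev p \<Omega> u g"
  shows "AE x in lborel. closed_segment x (x + v) \<subseteq> \<Omega> \<longrightarrow>
     u (x + v) - u x = (LINT s|lborel. indicator {0..1} s * (g (x + s *\<^sub>R v) \<bullet> v))"
proof -
  have [measurable]: "u \<in> borel_measurable borel" "g \<in> borel_measurable borel" using b by (auto simp: borel_sobolev_def)
  have iu: "integrable lborel u" and ig: "integrable lborel g" using b by (auto simp: borel_sobolev_def)
  define U where "U = {x. closed_segment x (x + v) \<subseteq> \<Omega>}"
  have seg: "x + s *\<^sub>R v \<in> \<Omega>" if "x \<in> U" "0 \<le> s" "s \<le> 1" for x s
  proof -
    have "x + s *\<^sub>R v \<in> closed_segment x (x + v)" using that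
      by (auto simp: in_segment intro!: exI[of _ s] simp: algebra_simps)
    then show ?thesis using that by (auto simp: U_def)
  qed
  \<comment> \<open>The complement of \<open>U\<close> is the sum of the closed set
    \<open>- \<Omega>\<close> and a compact segment, hence closed.\<close>
  have U: "open U"
  proof -
    have "closed (\<Union>s\<in>{0..1}. (\<lambda>y. y - s *\<^sub>R v) ` (- \<Omega>))"
    proof -
      have "(\<Union>s\<in>{0..1}. (\<lambda>y. y - s *\<^sub>R v) ` (- \<Omega>)) = (\<Union>x\<in>- \<Omega>. \<Union>y\<in>(\<lambda>s. - s *\<^sub>R v) ` {0..1}. {x + y})"
        by auto
      moreover have "closed (\<Union>x\<in>- \<Omega>. \<Union>y\<in>(\<lambda>s. - s *\<^sub>R v) ` {0..1}. {x + y})"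
        using om by (intro closed_compact_sums compact_continuous_image continuous_intros) auto
      ultimately show ?thesis by simp
    qed
    moreover have "U = - (\<Union>s\<in>{0..1}. (\<lambda>y. y - s *\<^sub>R v) ` (- \<Omega>))"
    proof (intro Set.set_eqI iffI)
      fix x assume "x \<in> U" then show "x \<in> - (\<Union>s\<in>{0..1}. (\<lambda>y. y - s *\<^sub>R v) ` (- \<Omega>))"
        using seg[of x] by auto (metis diff_add_cancel)
    next
      fix x assume x: "x \<in> - (\<Union>s\<in>{0..1}. (\<lambda>y. y - s *\<^sub>R v) ` (- \<Omega>))"
      have "x + s *\<^sub>R v \<in> \<Omega>" if "0 \<le> s" "s \<le> 1" for s
      proof (rule ccontr)
        assume "x + s *\<^sub>R v \<notin> \<Omega>"
        then have "x \<in> (\<lambda>y. y - s *\<^sub>R v) ` (- \<Omega>)" by (intro image_eqI[of _ _ "x + s *\<^sub>R v"]) auto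
        then show False using x that by auto
      qed
      then show "x \<in> U" unfolding U_def by (auto simp: in_segment algebra_simps)
    qed
    ultimately show ?thesis by (simp add: open_closed)
  qed
  define D where "D x = (LINT s|lborel. indicator {0..1} s * (g (x + s *\<^sub>R v) \<bullet> v))" for x
  have gv[measurable]: "(\<lambda>x. g x \<bullet> v) \<in> borel_measurable borel" by measurable
  have igv: "integrable lborel (\<lambda>x. g x \<bullet> v)" using ig by simp
  have pair: "integrable (lborel \<Otimes>\<^sub>M lborel) (\<lambda>(s, x). indicator {0..1} s * (g (x + s *\<^sub>R v) \<bullet> v) * h x)"
    if h[measurable]: "h \<in> borel_measurable borel" and B: "B \<ge> 0" "\<And>x. \<bar>h x\<bar> \<le> B" for h :: "real^'n \<Rightarrow> real" and B
  proof (rule integrable_pair_interval)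
    show "(\<lambda>(s, x). indicator {0..1} s * (g (x + s *\<^sub>R v) \<bullet> v) * h x) \<in> borel_measurable (lborel \<Otimes>\<^sub>M lborel)"
      by measurable
    let ?c = "(\<integral>\<^sup>+x. ennreal (B * \<bar>g x \<bullet> v\<bar>) \<partial>lborel)"
    show "?c < \<infinity>"
      using integrable_iff_bounded[of lborel "\<lambda>x. B * (g x \<bullet> v)"] igv B(1) by (simp add: abs_mult)
    fix s :: real
    have "(\<integral>\<^sup>+x. ennreal \<bar>indicator {0..1} s * (g (x + s *\<^sub>R v) \<bullet> v) * h x\<bar> \<partial>lborel)
      \<le> (\<integral>\<^sup>+x. indicator {0..1} s * ennreal (B * \<bar>g (x + s *\<^sub>R v) \<bullet> v\<bar>) \<partial>lborel)"
    proof (rule nn_integral_mono)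
      fix x
      have "\<bar>g (x + s *\<^sub>R v) \<bullet> v\<bar> * \<bar>h x\<bar> \<le> B * \<bar>g (x + s *\<^sub>R v) \<bullet> v\<bar>"
        using B(2)[of x] by (simp add: mult.commute mult_right_mono)
      then show "ennreal \<bar>indicator {0..1} s * (g (x + s *\<^sub>R v) \<bullet> v) * h x\<bar> \<le> indicator {0..1} s * ennreal (B * \<bar>g (x + s *\<^sub>R v) \<bullet> v\<bar>)"
        by (auto simp: abs_mult intro!: ennreal_leI split: split_indicator)
    qed
    also have "\<dots> = indicator {0..1} s * (\<integral>\<^sup>+x. ennreal (B * \<bar>g (x + s *\<^sub>R v) \<bullet> v\<bar>) \<partial>lborel)"
      by (rule nn_integral_cmult) measurable
    also have "\<dots> = indicator {0..1} s * ?c"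
      by (subst nn_integral_lborel_shift[where f="\<lambda>x. ennreal (B * \<bar>g x \<bullet> v\<bar>)"]) auto
    finally show "(\<integral>\<^sup>+x. ennreal \<bar>(case (s, x) of (s, x) \<Rightarrow> indicator {0..1} s * (g (x + s *\<^sub>R v) \<bullet> v) * h x)\<bar> \<partial>lborel) \<le> ?c * indicator {0..1} s"
      by (simp add: mult.commute)
  qed
  have D_int: "integrable lborel D"
    using lborel_pair.integrable_snd[OF pair[of "\<lambda>_. 1" 1]] by (simp add: D_def[abs_def])
  have w_int: "integrable lborel (\<lambda>x. u (x + v) - u x - D x)"
    using iu D_int lborel_shift(1)[of u v] by simp
  have "AE x in lborel. x \<in> U \<longrightarrow> u (x + v) - u x - D x = 0"
  proof (rule fundamental_lemma_lborel_open[OF w_int U])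
    fix f assume f: "test_fun U f"
    have sm: "smooth_fun f" using f by (simp add: test_fun_def)
    have [measurable]: "f \<in> borel_measurable borel" using test_fun_continuous[OF f] by (rule borel_measurable_continuous_onI)
    have [measurable]: "gradient f \<in> borel_measurable borel" by (rule borel_measurable_gradient[OF sm])
    obtain B where B: "B \<ge> 0" "\<And>x. \<bar>f x\<bar> \<le> B" using test_fun_bounds[OF f] by blast
    obtain B' where B': "B' \<ge> 0" "\<And>x. norm (gradient f x) \<le> B'" using gradient_support[OF f] by blast
    have bdd: "integrable lborel (\<lambda>x. h x * k x)" if "integrable lborel h" "k \<in> borel_measurable borel" "\<And>x. \<bar>k x\<bar> \<le> c"
      for h k :: "real^'n \<Rightarrow> real" and c
    proof (rule Bochner_Integration.integrable_bound[OF integrable_mult_right[OF that(1), of c]])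
      have "c \<ge> 0" using that(3)[of 0] by (meson abs_ge_zero order_trans)
      then show "AE x in lborel. norm (h x * k x) \<le> norm (c * h x)"
        using that(3) by (intro AE_I2) (simp add: abs_mult mult.commute[of c] mult_left_mono)
    qed (use that in measurable)
    have pair2: "integrable (lborel \<Otimes>\<^sub>M lborel) (\<lambda>(s, y). indicator {0..1} s * (u y * - (gradient f (y + s *\<^sub>R (- v)) \<bullet> v)))"
    proof (rule integrable_pair_interval)
      show "(\<lambda>(s, y). indicator {0..1} s * (u y * - (gradient f (y + s *\<^sub>R (- v)) \<bullet> v))) \<in> borel_measurable (lborel \<Otimes>\<^sub>M lborel)"
        by measurable
      let ?c = "(\<integral>\<^sup>+y. ennreal ((B' * norm v) * \<bar>u y\<bar>) \<partial>lborel)"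
      show "?c < \<infinity>"
        using integrable_iff_bounded[of lborel "\<lambda>y. (B' * norm v) * u y"] iu B'(1) by (simp add: abs_mult)
      fix s :: real
      have "(\<integral>\<^sup>+y. ennreal \<bar>indicator {0..1} s * (u y * - (gradient f (y + s *\<^sub>R (- v)) \<bullet> v))\<bar> \<partial>lborel)
        \<le> (\<integral>\<^sup>+y. indicator {0..1} s * ennreal ((B' * norm v) * \<bar>u y\<bar>) \<partial>lborel)"
      proof (rule nn_integral_mono)
        fix y
        have "\<bar>gradient f (y + s *\<^sub>R (- v)) \<bullet> v\<bar> \<le> B' * norm v"
          using Cauchy_Schwarz_ineq2[of "gradient f (y + s *\<^sub>R (- v))" v] B'(2)[of "y + s *\<^sub>R (- v)"]
          by (meson mult_right_mono norm_ge_zero order_trans)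
        then have "\<bar>u y\<bar> * \<bar>gradient f (y + s *\<^sub>R (- v)) \<bullet> v\<bar> \<le> (B' * norm v) * \<bar>u y\<bar>"
          by (simp add: mult.commute mult_left_mono)
        then show "ennreal \<bar>indicator {0..1} s * (u y * - (gradient f (y + s *\<^sub>R (- v)) \<bullet> v))\<bar> \<le> indicator {0..1} s * ennreal ((B' * norm v) * \<bar>u y\<bar>)"
          by (auto simp: abs_mult intro!: ennreal_leI split: split_indicator)
      qed
      also have "\<dots> = indicator {0..1} s * ?c"
        by (rule nn_integral_cmult) measurable
      finally show "(\<integral>\<^sup>+y. ennreal \<bar>(case (s, y) of (s, y) \<Rightarrow> indicator {0..1} s * (u y * - (gradient f (y + s *\<^sub>R (- v)) \<bullet> v)))\<bar> \<partial>lborel) \<le> ?c * indicator {0..1} s"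
        by (simp add: mult.commute)
    qed
    have weak: "(LINT y|lborel. u y * - (gradient f (y + s *\<^sub>R (- v)) \<bullet> v)) = (LINT x|lborel. (g (x + s *\<^sub>R v) \<bullet> v) * f x)"
      if s: "0 \<le> s" "s \<le> 1" for s
    proof -
      let ?h = "\<lambda>x. f (x + s *\<^sub>R (- v))"
      have h: "test_fun \<Omega> ?h" and pd: "\<And>i x. partial_deriv i ?h x = partial_deriv i f (x + s *\<^sub>R (- v))"
        using test_fun_translate[OF f, of "s *\<^sub>R (- v)" \<Omega>] seg s by auto
      have [measurable]: "?h \<in> borel_measurable borel" "\<And>i. partial_deriv i ?h \<in> borel_measurable borel"
        using test_fun_continuous[OF h] test_fun_continuous_partial[OF h] by (auto intro: borel_measurable_continuous_onI)
      obtain C where C: "\<And>x. \<bar>?h x\<bar> \<le> C" "\<And>i x. \<bar>partial_deriv i ?h x\<bar> \<le> C" using test_fun_bounds[OF h] by blast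
      have i1: "integrable lborel (\<lambda>y. u y * partial_deriv i ?h y)" for i by (rule bdd[OF iu _ C(2)]) measurable
      have i2: "integrable lborel (\<lambda>y. g y $ i * ?h y)" for i by (rule bdd[OF integrable_vec_nth[OF ig] _ C(1)]) measurable
      have e1: "u y * - (gradient f (y + s *\<^sub>R (- v)) \<bullet> v) = (\<Sum>i\<in>UNIV. - (v $ i) * (u y * partial_deriv i ?h y))" for y
        unfolding pd gradient_def inner_vec_def by (simp add: sum_distrib_left sum_negf algebra_simps)
      have e2: "(\<Sum>i\<in>UNIV. v $ i * (g y $ i * ?h y)) = (g y \<bullet> v) * ?h y" for y
        unfolding inner_vec_def by (simp add: sum_distrib_left sum_distrib_right algebra_simps)
      have "(LINT y|lborel. u y * - (gradient f (y + s *\<^sub>R (- v)) \<bullet> v)) = (\<Sum>i\<in>UNIV. - (v $ i) * (LINT y|lborel. u y * partial_deriv i ?h y))"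
        unfolding e1 using i1 by (subst Bochner_Integration.integral_sum) auto
      also have "\<dots> = (\<Sum>i\<in>UNIV. v $ i * (LINT y|lborel. g y $ i * ?h y))"
        using b h by (simp add: borel_sobolev_def)
      also have "\<dots> = (LINT y|lborel. (\<Sum>i\<in>UNIV. v $ i * (g y $ i * ?h y)))"
        using i2 by (subst Bochner_Integration.integral_sum) auto
      also have "\<dots> = (LINT y|lborel. (g y \<bullet> v) * ?h y)" unfolding e2 ..
      also have "\<dots> = (LINT x|lborel. (g (x + s *\<^sub>R v) \<bullet> v) * f x)"
        using lborel_shift(2)[of "\<lambda>y. (g y \<bullet> v) * ?h y" "s *\<^sub>R v"] by simp
      finally show ?thesis .
    qed
    have sh: "(LINT x|lborel. u (x + v) * f x) = (LINT y|lborel. u y * f (y + (- v)))"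
      using lborel_shift(2)[of "\<lambda>y. u y * f (y + (- v))" v] by simp
    have i1: "integrable lborel (\<lambda>x. u (x + v) * f x)"
      by (rule bdd[OF _ _ B(2)]) (use iu lborel_shift(1)[of u v] in auto)
    have i2: "integrable lborel (\<lambda>x. u x * f x)" by (rule bdd[OF iu _ B(2)]) measurable
    have i3: "integrable lborel (\<lambda>x. D x * f x)" by (rule bdd[OF D_int _ B(2)]) measurable
    have i4: "integrable lborel (\<lambda>y. u y * f (y + (- v)))" by (rule bdd[OF iu _ B(2)]) measurable
    \<comment> \<open>The translation is moved onto \<open>f\<close>, where the difference is the
      integral of a smooth derivative. Fubini, the weak gradient tested with each translate of
      \<open>f\<close>, and a shift back produce \<open>D\<close>.\<close>
    have "(LINT x|lborel. u (x + v) * f x) - (LINT x|lborel. u x * f x) = (LINT y|lborel. u y * (f (y + (- v)) - f y))"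
      unfolding sh using i2 i4 by (simp add: algebra_simps)
    also have "\<dots> = (LINT y|lborel. LINT s|lborel. indicator {0..1} s * (u y * - (gradient f (y + s *\<^sub>R (- v)) \<bullet> v)))"
    proof (rule Bochner_Integration.integral_cong[OF refl])
      fix y
      have "u y * (f (y + (- v)) - f y) = u y * (LINT s|lborel. indicator {0..1} s * (gradient f (y + s *\<^sub>R (- v)) \<bullet> (- v)))"
        by (simp only: smooth_line_FTC[OF sm])
      also have "\<dots> = (LINT s|lborel. u y * (indicator {0..1} s * (gradient f (y + s *\<^sub>R (- v)) \<bullet> (- v))))" by simp
      also have "\<dots> = (LINT s|lborel. indicator {0..1} s * (u y * - (gradient f (y + s *\<^sub>R (- v)) \<bullet> v)))"
        by (intro Bochner_Integration.integral_cong) auto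
      finally show "u y * (f (y + (- v)) - f y) = (LINT s|lborel. indicator {0..1} s * (u y * - (gradient f (y + s *\<^sub>R (- v)) \<bullet> v)))" .
    qed
    also have "\<dots> = (LINT s|lborel. LINT y|lborel. indicator {0..1} s * (u y * - (gradient f (y + s *\<^sub>R (- v)) \<bullet> v)))"
      by (rule lborel_pair.Fubini_integral[OF pair2])
    also have "\<dots> = (LINT s|lborel. LINT x|lborel. indicator {0..1} s * (g (x + s *\<^sub>R v) \<bullet> v) * f x)"
    proof (rule Bochner_Integration.integral_cong[OF refl])
      fix s :: real
      show "(LINT y|lborel. indicator {0..1} s * (u y * - (gradient f (y + s *\<^sub>R (- v)) \<bullet> v))) = (LINT x|lborel. indicator {0..1} s * (g (x + s *\<^sub>R v) \<bullet> v) * f x)"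
        using weak[of s] by (auto split: split_indicator)
    qed
    also have "\<dots> = (LINT x|lborel. LINT s|lborel. indicator {0..1} s * (g (x + s *\<^sub>R v) \<bullet> v) * f x)"
      by (rule lborel_pair.Fubini_integral[OF pair[OF _ B], symmetric]) measurable
    also have "\<dots> = (LINT x|lborel. D x * f x)" by (simp add: D_def)
    finally show "(LINT x|lborel. (u (x + v) - u x - D x) * f x) = 0"
      using i1 i2 i3 by (simp add: left_diff_distrib)
  qed
  then show ?thesis unfolding U_def D_def by eventually_elim auto
qed

section \<open>Oscillation of powers of Sobolev functions\<close>

lemma powr_minus_1_mult: "0 \<le> a \<Longrightarrow> a powr (p - 1) * a = a powr (p::real)"
  by (cases "a = 0") (simp_all add: powr_diff)

lemma powr_diff_le:
  assumes ab: "0 \<le> a" "0 \<le> b" and p: "1 \<le> (p::real)"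
  shows "\<bar>b powr p - a powr p\<bar> \<le> p * (a powr (p - 1) + b powr (p - 1)) * \<bar>b - a\<bar>"
proof -
  have *: "y powr p - x powr p \<le> p * y powr (p - 1) * (y - x)" if xy: "0 \<le> x" "x < y" for x y :: real
  proof (cases "x = 0")
    case True
    have "1 * (y powr (p - 1) * y) \<le> p * (y powr (p - 1) * y)" using xy p by (intro mult_right_mono) auto
    then show ?thesis using True xy powr_minus_1_mult[of y p] by (simp add: mult.assoc)
  next
    case False
    then obtain z where z: "x < z" "z < y" "y powr p - x powr p = (y - x) * (p * z powr (p - 1))"
      using MVT2[of x y "\<lambda>x. x powr p" "\<lambda>z. p * z powr (p - 1)"] xy has_real_derivative_powr[of _ p] by fastforce
    moreover have "z powr (p - 1) \<le> y powr (p - 1)" using z xy p by (intro powr_mono2) auto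
    ultimately show ?thesis using xy p by (simp add: mult_left_mono mult.commute)
  qed
  have m: "x powr p \<le> y powr p" if "0 \<le> x" "x \<le> y" for x y :: real using that p by (intro powr_mono2) auto
  have pos: "0 \<le> p * x powr (p - 1) * z" if "0 \<le> z" for x z using p that by simp
  consider "a < b" | "b < a" | "a = b" by linarith
  then show ?thesis
  proof cases
    case 1 then show ?thesis using *[of a b] m[of a b] ab pos[of "b - a" a] by (simp add: algebra_simps)
  next
    case 2 then show ?thesis using *[of b a] m[of b a] ab pos[of "a - b" b] by (simp add: algebra_simps)
  qed simp
qed

text \<open>A crude Young inequality: the larger of \<open>a\<close> and \<open>f\<close> dominates
  the product.\<close>

lemma powr_mult_le:
  assumes "0 \<le> a" "0 \<le> f" "1 \<le> (p::real)"
  shows "a powr (p - 1) * f \<le> a powr p + f powr p"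
proof (cases "f \<le> a")
  case True
  then have "a powr (p - 1) * f \<le> a powr (p - 1) * a" by (intro mult_left_mono) auto
  then show ?thesis using powr_minus_1_mult[OF assms(1), of p] powr_ge_zero[of f p] by linarith
next
  case False
  then have "a powr (p - 1) * f \<le> f powr (p - 1) * f" using assms by (intro mult_right_mono powr_mono2) auto
  then show ?thesis using powr_minus_1_mult[OF assms(2), of p] powr_ge_zero[of a p] by linarith
qed

lemma nn_integral_unit_interval: "(\<integral>\<^sup>+s. indicator {0..1::real} s * c \<partial>lborel) = c"
  using nn_integral_cmult_indicator[of "{0..1::real}" lborel c] by (simp add: mult.commute)

text \<open>In use, \<open>c\<close> is the length of a segment, \<open>a\<close> and
  \<open>b\<close> are the values at its ends, and \<open>f\<close> is the size of the gradient
  along it, so \<open>d\<close> is the fundamental theorem on that segment. Young's inequality is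
  applied under the integral.\<close>

lemma pointwise_powr_osc:
  fixes f :: "real \<Rightarrow> real"
  assumes p: "1 \<le> p" and c: "0 \<le> c" and f[measurable]: "f \<in> borel_measurable borel" "\<And>s. 0 \<le> f s"
    and d: "ennreal \<bar>b - a\<bar> \<le> ennreal c * (\<integral>\<^sup>+s. indicator {0..1} s * ennreal (f s) \<partial>lborel)"
  shows "ennreal \<bar>\<bar>b\<bar> powr p - \<bar>a\<bar> powr p\<bar> \<le> ennreal (p * c) *
    (ennreal (\<bar>a\<bar> powr p) + ennreal (\<bar>b\<bar> powr p) + 2 * (\<integral>\<^sup>+s. indicator {0..1} s * ennreal (f s powr p) \<partial>lborel))"
proof -
  let ?I = "\<integral>\<^sup>+s. indicator {0..1} s * ennreal (f s) \<partial>lborel"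
  let ?R = "\<integral>\<^sup>+s. indicator {0..1} s * ennreal (f s powr p) \<partial>lborel"
  have *: "ennreal (\<bar>x\<bar> powr (p - 1)) * ?I \<le> ennreal (\<bar>x\<bar> powr p) + ?R" for x
  proof -
    have "ennreal (\<bar>x\<bar> powr (p - 1)) * ?I = (\<integral>\<^sup>+s. ennreal (\<bar>x\<bar> powr (p - 1)) * (indicator {0..1} s * ennreal (f s)) \<partial>lborel)"
      by (rule nn_integral_cmult[symmetric]) measurable
    also have "\<dots> \<le> (\<integral>\<^sup>+s. indicator {0..1} s * ennreal (\<bar>x\<bar> powr p) + indicator {0..1} s * ennreal (f s powr p) \<partial>lborel)"
    proof (rule nn_integral_mono)
      fix s
      show "ennreal (\<bar>x\<bar> powr (p - 1)) * (indicator {0..1} s * ennreal (f s)) \<le> indicator {0..1} s * ennreal (\<bar>x\<bar> powr p) + indicator {0..1} s * ennreal (f s powr p)"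
        using powr_mult_le[of "\<bar>x\<bar>" "f s" p] f(2)[of s] p
        by (auto split: split_indicator simp: ennreal_mult[symmetric] ennreal_plus[symmetric] simp del: ennreal_plus intro!: ennreal_leI)
    qed
    also have "\<dots> = (\<integral>\<^sup>+s. indicator {0..1::real} s * ennreal (\<bar>x\<bar> powr p) \<partial>lborel) + ?R"
      by (rule nn_integral_add) measurable
    finally show ?thesis by (simp only: nn_integral_unit_interval)
  qed
  have "\<bar>\<bar>b\<bar> powr p - \<bar>a\<bar> powr p\<bar> \<le> p * (\<bar>a\<bar> powr (p - 1) + \<bar>b\<bar> powr (p - 1)) * \<bar>\<bar>b\<bar> - \<bar>a\<bar>\<bar>"
    by (rule powr_diff_le) (use p in auto)
  also have "\<dots> \<le> p * (\<bar>a\<bar> powr (p - 1) + \<bar>b\<bar> powr (p - 1)) * \<bar>b - a\<bar>"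
    using p by (intro mult_left_mono) auto
  finally have "ennreal \<bar>\<bar>b\<bar> powr p - \<bar>a\<bar> powr p\<bar> \<le> ennreal (p * (\<bar>a\<bar> powr (p - 1) + \<bar>b\<bar> powr (p - 1)) * \<bar>b - a\<bar>)"
    by (rule ennreal_leI)
  also have "\<dots> = ennreal p * (ennreal (\<bar>a\<bar> powr (p - 1)) + ennreal (\<bar>b\<bar> powr (p - 1))) * ennreal \<bar>b - a\<bar>"
    using p by (simp add: ennreal_mult ennreal_plus[symmetric] del: ennreal_plus)
  also have "\<dots> \<le> ennreal p * (ennreal (\<bar>a\<bar> powr (p - 1)) + ennreal (\<bar>b\<bar> powr (p - 1))) * (ennreal c * ?I)"
    by (rule mult_left_mono[OF d]) simp
  also have "\<dots> = ennreal p * ennreal c * (ennreal (\<bar>a\<bar> powr (p - 1)) * ?I + ennreal (\<bar>b\<bar> powr (p - 1)) * ?I)"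
    by (simp add: algebra_simps)
  also have "\<dots> \<le> ennreal p * ennreal c * ((ennreal (\<bar>a\<bar> powr p) + ?R) + (ennreal (\<bar>b\<bar> powr p) + ?R))"
    by (intro mult_left_mono add_mono *) auto
  also have "\<dots> = ennreal (p * c) * (ennreal (\<bar>a\<bar> powr p) + ennreal (\<bar>b\<bar> powr p) + 2 * ?R)"
    using p c by (simp add: ennreal_mult algebra_simps mult_2)
  finally show ?thesis .
qed

text \<open>With \<open>p * c \<le> 1 / 2\<close>, half of the power of \<open>a\<close> is absorbed
  on the left: (1 + 1/2) / (1 - 1/2) is the factor 3, and the factor 2 p c of the integral doubles
  to 4 p c. One endpoint is thus controlled by the other, which permits moving away from the
  boundary.\<close>

lemma pointwise_powr_absorb:
  fixes f :: "real \<Rightarrow> real"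
  assumes p: "1 \<le> p" and c: "0 \<le> c" "p * c \<le> 1 / 2" and f: "f \<in> borel_measurable borel" "\<And>s. 0 \<le> f s"
    and d: "ennreal \<bar>b - a\<bar> \<le> ennreal c * (\<integral>\<^sup>+s. indicator {0..1} s * ennreal (f s) \<partial>lborel)"
  shows "ennreal (\<bar>a\<bar> powr p) \<le> 3 * ennreal (\<bar>b\<bar> powr p) +
    ennreal (4 * p) * (ennreal c * (\<integral>\<^sup>+s. indicator {0..1} s * ennreal (f s powr p) \<partial>lborel))"
proof -
  let ?R = "\<integral>\<^sup>+s. indicator {0..1} s * ennreal (f s powr p) \<partial>lborel"
  have osc: "ennreal \<bar>\<bar>b\<bar> powr p - \<bar>a\<bar> powr p\<bar> \<le> ennreal (p * c) * (ennreal (\<bar>a\<bar> powr p) + ennreal (\<bar>b\<bar> powr p) + 2 * ?R)"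
    by (rule pointwise_powr_osc[OF p c(1) f d])
  show ?thesis
  proof (cases "ennreal c * ?R = \<infinity>")
    case True
    then show ?thesis using p by (simp add: ennreal_mult_top)
  next
    case fin: False
    show ?thesis
    proof (cases "?R = \<infinity>")
      case True
      \<comment> \<open>An infinite integral with a finite product forces \<open>c = 0\<close>,
        because 0 times infinity is 0 in \<open>ennreal\<close>.\<close>
      then have "c = 0" using fin c(1) by (auto simp: ennreal_mult_eq_top_iff)
      then have "\<bar>b\<bar> powr p = \<bar>a\<bar> powr p" using osc by (simp add: ennreal_eq_0_iff)
      then have "\<bar>a\<bar> powr p \<le> 3 * \<bar>b\<bar> powr p" using powr_ge_zero[of "\<bar>a\<bar>" p] by linarith
      then have "ennreal (\<bar>a\<bar> powr p) \<le> 3 * ennreal (\<bar>b\<bar> powr p)"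
        by (metis ennreal_leI ennreal_mult ennreal_numeral powr_ge_zero zero_le_numeral)
      then show ?thesis by (simp add: add_increasing2)
    next
      case False
      then obtain R where R: "?R = ennreal R" "0 \<le> R" by (metis ennreal_cases infinity_ennreal_def)
      have "ennreal \<bar>\<bar>b\<bar> powr p - \<bar>a\<bar> powr p\<bar> \<le> ennreal (p * c * (\<bar>a\<bar> powr p + \<bar>b\<bar> powr p + 2 * R))"
      proof -
        have e: "ennreal (2 * R) = 2 * ennreal R" using R by (simp add: ennreal_mult)
        show ?thesis using osc p c(1) R
          by (simp add: e[symmetric] ennreal_mult[symmetric] ennreal_plus[symmetric] del: ennreal_plus)
      qed
      then have "\<bar>\<bar>b\<bar> powr p - \<bar>a\<bar> powr p\<bar> \<le> p * c * (\<bar>a\<bar> powr p + \<bar>b\<bar> powr p + 2 * R)"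
        using p c(1) R by (subst (asm) ennreal_le_iff) auto
      then have "\<bar>a\<bar> powr p \<le> \<bar>b\<bar> powr p + p * c * (\<bar>a\<bar> powr p + \<bar>b\<bar> powr p) + 2 * (p * c * R)"
        by (simp add: algebra_simps)
      moreover have "p * c * (\<bar>a\<bar> powr p + \<bar>b\<bar> powr p) \<le> 1 / 2 * (\<bar>a\<bar> powr p + \<bar>b\<bar> powr p)"
        using c(2) by (intro mult_right_mono) auto
      ultimately have "\<bar>a\<bar> powr p \<le> 3 * \<bar>b\<bar> powr p + (4 * p) * (c * R)" by simp
      then have "ennreal (\<bar>a\<bar> powr p) \<le> ennreal (3 * \<bar>b\<bar> powr p + (4 * p) * (c * R))" by (rule ennreal_leI)
      also have "\<dots> = 3 * ennreal (\<bar>b\<bar> powr p) + ennreal (4 * p) * (ennreal c * ennreal R)"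
        using p c R by (simp add: ennreal_mult)
      finally show ?thesis using R by simp
    qed
  qed
qed

locale borel_sobolev_function =
  fixes \<Omega> :: "(real^'n::finite) set" and p :: real and u :: "real^'n \<Rightarrow> real" and g :: "real^'n \<Rightarrow> real^'n"
  assumes om: "open \<Omega>" and p: "1 \<le> p" and bs: "borel_sobolev p \<Omega> u g"
begin

abbreviation "E x \<equiv> ennreal (\<bar>u x\<bar> powr p)"
abbreviation "Fp x \<equiv> ennreal (norm (g x) powr p)"
definition "J = (\<integral>\<^sup>+x. E x \<partial>lborel) + (\<integral>\<^sup>+x. Fp x \<partial>lborel)"

lemma meas[measurable]: "u \<in> borel_measurable borel" "g \<in> borel_measurable borel"
  using bs by (auto simp: borel_sobolev_def)

lemma outside: "x \<notin> \<Omega> \<Longrightarrow> u x = 0" "x \<notin> \<Omega> \<Longrightarrow> g x = 0"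
  using bs by (auto simp: borel_sobolev_def)

lemma FTC_bound: "AE x in lborel. closed_segment x (x + v) \<subseteq> \<Omega> \<longrightarrow>
   ennreal \<bar>u (x + v) - u x\<bar> \<le> ennreal (norm v) * (\<integral>\<^sup>+s. indicator {0..1} s * ennreal (norm (g (x + s *\<^sub>R v))) \<partial>lborel)"
  using borel_sobolev_FTC[OF om bs, of v]
proof eventually_elim
  case (elim x)
  show ?case
  proof
    assume "closed_segment x (x + v) \<subseteq> \<Omega>"
    then have eq: "u (x + v) - u x = (LINT s|lborel. indicator {0..1} s * (g (x + s *\<^sub>R v) \<bullet> v))" using elim by simp
    have "ennreal \<bar>LINT s|lborel. indicator {0..1} s * (g (x + s *\<^sub>R v) \<bullet> v)\<bar> \<le> (\<integral>\<^sup>+s. ennreal \<bar>indicator {0..1} s * (g (x + s *\<^sub>R v) \<bullet> v)\<bar> \<partial>lborel)"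
    \<comment> \<open>A function that is not integrable has integral 0, so the bound is then
      trivial.\<close>
    proof (cases "integrable lborel (\<lambda>s. indicator {0..1} s * (g (x + s *\<^sub>R v) \<bullet> v))")
      case True from integral_norm_bound_ennreal[OF this] show ?thesis by simp
    qed (simp add: not_integrable_integral_eq)
    also have "\<dots> \<le> (\<integral>\<^sup>+s. ennreal (norm v) * (indicator {0..1} s * ennreal (norm (g (x + s *\<^sub>R v)))) \<partial>lborel)"
      using Cauchy_Schwarz_ineq2[of "g (x + _ *\<^sub>R v)" v]
      by (intro nn_integral_mono) (auto split: split_indicator simp: ennreal_mult[symmetric] mult.commute intro!: ennreal_leI)
    also have "\<dots> = ennreal (norm v) * (\<integral>\<^sup>+s. indicator {0..1} s * ennreal (norm (g (x + s *\<^sub>R v))) \<partial>lborel)"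
      by (rule nn_integral_cmult) measurable
    finally show "ennreal \<bar>u (x + v) - u x\<bar> \<le> ennreal (norm v) * (\<integral>\<^sup>+s. indicator {0..1} s * ennreal (norm (g (x + s *\<^sub>R v))) \<partial>lborel)"
      unfolding eq .
  qed
qed

lemma nn_integral_sweep:
  assumes [measurable]: "h \<in> borel_measurable borel"
  shows "(\<integral>\<^sup>+x. (\<integral>\<^sup>+s. indicator {0..1} s * h (x + s *\<^sub>R v) \<partial>lborel) \<partial>lborel) = (\<integral>\<^sup>+x. h (x :: real^'n) \<partial>lborel)"
proof -
  have "(\<integral>\<^sup>+x. (\<integral>\<^sup>+s. indicator {0..1} s * h (x + s *\<^sub>R v) \<partial>lborel) \<partial>lborel) = (\<integral>\<^sup>+s. (\<integral>\<^sup>+x. indicator {0..1} s * h (x + s *\<^sub>R v) \<partial>lborel) \<partial>lborel)"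
    by (rule lborel_pair.Fubini') measurable
  also have "\<dots> = (\<integral>\<^sup>+s. indicator {0..1::real} s * (\<integral>\<^sup>+x. h x \<partial>lborel) \<partial>lborel)"
  proof (rule nn_integral_cong)
    fix s :: real
    have "(\<integral>\<^sup>+x. indicator {0..1} s * h (x + s *\<^sub>R v) \<partial>lborel) = indicator {0..1} s * (\<integral>\<^sup>+x. h (x + s *\<^sub>R v) \<partial>lborel)"
      by (rule nn_integral_cmult) measurable
    then show "(\<integral>\<^sup>+x. indicator {0..1} s * h (x + s *\<^sub>R v) \<partial>lborel) = indicator {0..1} s * (\<integral>\<^sup>+x. h x \<partial>lborel)"
      by (simp add: nn_integral_lborel_shift)
  qed
  finally show ?thesis by (simp only: nn_integral_unit_interval)
qed

text \<open>The pointwise bound is integrated: translations preserve the integrals of the endpoint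
  terms, and by Fubini the sweep along the segments contributes just the integral of the gradient
  power.\<close>

lemma osc_inside:
  assumes A[measurable]: "A \<in> sets borel" and seg: "\<And>x. x \<in> A \<Longrightarrow> closed_segment x (x + v) \<subseteq> \<Omega>"
  shows "(\<integral>\<^sup>+x. indicator A x * ennreal \<bar>\<bar>u (x + v)\<bar> powr p - \<bar>u x\<bar> powr p\<bar> \<partial>lborel) \<le> ennreal (2 * p * norm v) * J"
proof -
  have "(\<integral>\<^sup>+x. indicator A x * ennreal \<bar>\<bar>u (x + v)\<bar> powr p - \<bar>u x\<bar> powr p\<bar> \<partial>lborel)
    \<le> (\<integral>\<^sup>+x. ennreal (p * norm v) * (E x + E (x + v) + 2 * (\<integral>\<^sup>+s. indicator {0..1} s * Fp (x + s *\<^sub>R v) \<partial>lborel)) \<partial>lborel)"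
  proof (rule nn_integral_mono_AE)
    show "AE x in lborel. indicator A x * ennreal \<bar>\<bar>u (x + v)\<bar> powr p - \<bar>u x\<bar> powr p\<bar> \<le> ennreal (p * norm v) * (E x + E (x + v) + 2 * (\<integral>\<^sup>+s. indicator {0..1} s * Fp (x + s *\<^sub>R v) \<partial>lborel))"
      using FTC_bound[of v]
    proof eventually_elim
      case (elim x)
      show ?case
      proof (cases "x \<in> A")
        case True
        have "ennreal \<bar>\<bar>u (x + v)\<bar> powr p - \<bar>u x\<bar> powr p\<bar> \<le> ennreal (p * norm v) * (E x + E (x + v) + 2 * (\<integral>\<^sup>+s. indicator {0..1} s * Fp (x + s *\<^sub>R v) \<partial>lborel))"
          by (rule pointwise_powr_osc[OF p, where f="\<lambda>s. norm (g (x + s *\<^sub>R v))"]) (use elim seg[OF True] in auto)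
        then show ?thesis using True by simp
      qed simp
    qed
  qed
  also have "\<dots> = ennreal (p * norm v) * ((\<integral>\<^sup>+x. E x \<partial>lborel) + (\<integral>\<^sup>+x. E (x + v) \<partial>lborel) + 2 * (\<integral>\<^sup>+x. (\<integral>\<^sup>+s. indicator {0..1} s * Fp (x + s *\<^sub>R v) \<partial>lborel) \<partial>lborel))"
    by (subst nn_integral_cmult, measurable, subst nn_integral_add, measurable, subst nn_integral_add, measurable, subst nn_integral_cmult, measurable)
  also have "\<dots> = ennreal (p * norm v) * ((\<integral>\<^sup>+x. E x \<partial>lborel) + (\<integral>\<^sup>+x. E x \<partial>lborel) + 2 * (\<integral>\<^sup>+x. Fp x \<partial>lborel))"
    by (simp add: nn_integral_sweep[of Fp] nn_integral_lborel_shift[of E])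
  also have "\<dots> = ennreal (2 * p * norm v) * J"
    using p by (simp add: J_def ennreal_mult algebra_simps mult_2)
  finally show ?thesis .
qed

text \<open>\<open>A\<close> is a thin layer along the boundary from which one can move a distance
  \<open>T\<close> in direction \<open>e\<close> inside \<Omega>. The value at \<open>x\<close> is
  compared with those at \<open>x + \<tau> e\<close> and averaged over \<tau>. After Fubini each
  point \<open>z\<close> is counted only for those \<sigma> that lead back into \<open>A\<close>, a
  set of length at most \<open>l\<close>; the gain is the quotient \<open>l / T\<close>.\<close>

lemma layer_bound:
  assumes A[measurable]: "A \<in> sets borel" and e: "norm e = 1" and T: "0 < T" "p * T \<le> 1 / 2" and l: "0 \<le> l"
    and seg: "\<And>x \<sigma>. x \<in> A \<Longrightarrow> 0 \<le> \<sigma> \<Longrightarrow> \<sigma> \<le> T \<Longrightarrow> x + \<sigma> *\<^sub>R e \<in> \<Omega>"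
    and sweep: "\<And>z. emeasure lborel {\<sigma>\<in>{0..T}. z - \<sigma> *\<^sub>R e \<in> A} \<le> ennreal l"
  shows "(\<integral>\<^sup>+x. indicator A x * E x \<partial>lborel) \<le> ennreal (5 * l / T) * J"
proof -
  let ?X = "\<integral>\<^sup>+x. indicator A x * E x \<partial>lborel"
  define S where "S h x = (\<integral>\<^sup>+\<sigma>. indicator {0..T} \<sigma> * h (x + \<sigma> *\<^sub>R e) \<partial>lborel)" for h :: "real^'n \<Rightarrow> ennreal" and x
  have [measurable]: "S h \<in> borel_measurable borel" if [measurable]: "h \<in> borel_measurable borel" for h
    unfolding S_def[abs_def] by measurable
  have Sl: "(\<integral>\<^sup>+x. indicator A x * S h x \<partial>lborel) \<le> ennreal l * (\<integral>\<^sup>+x. h x \<partial>lborel)"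
    if [measurable]: "h \<in> borel_measurable borel" for h
  proof -
    have "(\<integral>\<^sup>+x. indicator A x * S h x \<partial>lborel) = (\<integral>\<^sup>+x. \<integral>\<^sup>+\<sigma>. indicator A x * (indicator {0..T} \<sigma> * h (x + \<sigma> *\<^sub>R e)) \<partial>lborel \<partial>lborel)"
      unfolding S_def by (intro nn_integral_cong nn_integral_cmult[symmetric]) measurable
    also have "\<dots> = (\<integral>\<^sup>+\<sigma>. \<integral>\<^sup>+x. indicator A x * (indicator {0..T} \<sigma> * h (x + \<sigma> *\<^sub>R e)) \<partial>lborel \<partial>lborel)"
      by (rule lborel_pair.Fubini') measurable
    also have "\<dots> = (\<integral>\<^sup>+\<sigma>. \<integral>\<^sup>+z. indicator A (z - \<sigma> *\<^sub>R e) * (indicator {0..T} \<sigma> * h z) \<partial>lborel \<partial>lborel)"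
    proof (rule nn_integral_cong)
      fix \<sigma> :: real
      show "(\<integral>\<^sup>+x. indicator A x * (indicator {0..T} \<sigma> * h (x + \<sigma> *\<^sub>R e)) \<partial>lborel) = (\<integral>\<^sup>+z. indicator A (z - \<sigma> *\<^sub>R e) * (indicator {0..T} \<sigma> * h z) \<partial>lborel)"
        using nn_integral_lborel_shift[of "\<lambda>z. indicator A (z - \<sigma> *\<^sub>R e) * (indicator {0..T} \<sigma> * h z)" "\<sigma> *\<^sub>R e"] by simp
    qed
    also have "\<dots> = (\<integral>\<^sup>+z. \<integral>\<^sup>+\<sigma>. indicator A (z - \<sigma> *\<^sub>R e) * (indicator {0..T} \<sigma> * h z) \<partial>lborel \<partial>lborel)"
      by (rule lborel_pair.Fubini') measurable
    also have "\<dots> = (\<integral>\<^sup>+z. h z * emeasure lborel {\<sigma>\<in>{0..T}. z - \<sigma> *\<^sub>R e \<in> A} \<partial>lborel)"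
    proof (rule nn_integral_cong)
      fix z
      have [measurable]: "{\<sigma>\<in>{0..T}. z - \<sigma> *\<^sub>R e \<in> A} \<in> sets borel"
      proof -
        have "(\<lambda>\<sigma>. z - \<sigma> *\<^sub>R e) -` A \<inter> {0..T} \<in> sets borel" using measurable_sets[of "\<lambda>\<sigma>. z - \<sigma> *\<^sub>R e" borel borel A] A by auto
        moreover have "(\<lambda>\<sigma>. z - \<sigma> *\<^sub>R e) -` A \<inter> {0..T} = {\<sigma>\<in>{0..T}. z - \<sigma> *\<^sub>R e \<in> A}" by auto
        ultimately show ?thesis by simp
      qed
      have "(\<integral>\<^sup>+\<sigma>. indicator A (z - \<sigma> *\<^sub>R e) * (indicator {0..T} \<sigma> * h z) \<partial>lborel) = (\<integral>\<^sup>+\<sigma>. h z * indicator {\<sigma>\<in>{0..T}. z - \<sigma> *\<^sub>R e \<in> A} \<sigma> \<partial>lborel)"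
        by (intro nn_integral_cong) (auto split: split_indicator)
      also have "\<dots> = h z * emeasure lborel {\<sigma>\<in>{0..T}. z - \<sigma> *\<^sub>R e \<in> A}"
        by (rule nn_integral_cmult_indicator) simp
      finally show "(\<integral>\<^sup>+\<sigma>. indicator A (z - \<sigma> *\<^sub>R e) * (indicator {0..T} \<sigma> * h z) \<partial>lborel) = h z * emeasure lborel {\<sigma>\<in>{0..T}. z - \<sigma> *\<^sub>R e \<in> A}" .
    qed
    also have "\<dots> \<le> (\<integral>\<^sup>+z. ennreal l * h z \<partial>lborel)"
      using sweep by (intro nn_integral_mono) (metis mult.commute mult_left_mono zero_le)
    also have "\<dots> = ennreal l * (\<integral>\<^sup>+x. h x \<partial>lborel)" by (rule nn_integral_cmult) measurable
    finally show ?thesis .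
  qed
  have step: "?X \<le> 3 * (\<integral>\<^sup>+x. indicator A x * E (x + \<tau> *\<^sub>R e) \<partial>lborel) + ennreal (4 * p) * (\<integral>\<^sup>+x. indicator A x * S Fp x \<partial>lborel)"
    if \<tau>: "0 \<le> \<tau>" "\<tau> \<le> T" for \<tau>
  proof -
    have "?X \<le> (\<integral>\<^sup>+x. 3 * (indicator A x * E (x + \<tau> *\<^sub>R e)) + ennreal (4 * p) * (indicator A x * S Fp x) \<partial>lborel)"
    proof (rule nn_integral_mono_AE)
      show "AE x in lborel. indicator A x * E x \<le> 3 * (indicator A x * E (x + \<tau> *\<^sub>R e)) + ennreal (4 * p) * (indicator A x * S Fp x)"
        using FTC_bound[of "\<tau> *\<^sub>R e"]
      proof eventually_elim
        case (elim x)
        show ?case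
        proof (cases "x \<in> A")
          case True
          have "closed_segment x (x + \<tau> *\<^sub>R e) \<subseteq> \<Omega>"
          proof
            fix y assume "y \<in> closed_segment x (x + \<tau> *\<^sub>R e)"
            then obtain s where s: "0 \<le> s" "s \<le> 1" "y = x + (s * \<tau>) *\<^sub>R e" by (auto simp: in_segment algebra_simps)
            have "s * \<tau> \<le> T" using s \<tau> mult_left_le_one_le[of \<tau> s] by linarith
            then show "y \<in> \<Omega>" using seg[OF True, of "s * \<tau>"] s \<tau> by simp
          qed
          then have d: "ennreal \<bar>u (x + \<tau> *\<^sub>R e) - u x\<bar> \<le> ennreal \<tau> * (\<integral>\<^sup>+s. indicator {0..1} s * ennreal (norm (g (x + s *\<^sub>R \<tau> *\<^sub>R e))) \<partial>lborel)"
            using elim e \<tau> by simp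
          have "p * \<tau> \<le> 1 / 2" using \<tau> T(2) p mult_left_mono[of \<tau> T p] by linarith
          then have "E x \<le> 3 * E (x + \<tau> *\<^sub>R e) + ennreal (4 * p) * (ennreal \<tau> * (\<integral>\<^sup>+s. indicator {0..1} s * Fp (x + s *\<^sub>R \<tau> *\<^sub>R e) \<partial>lborel))"
            using \<tau> by (intro pointwise_powr_absorb[OF p \<tau>(1) _ _ _ d]) auto
          also have "ennreal \<tau> * (\<integral>\<^sup>+s. indicator {0..1} s * Fp (x + s *\<^sub>R \<tau> *\<^sub>R e) \<partial>lborel) \<le> S Fp x"
          proof (cases "\<tau> = 0")
            case False
            have "S Fp x \<ge> (\<integral>\<^sup>+\<sigma>. indicator {0..\<tau>} \<sigma> * Fp (x + \<sigma> *\<^sub>R e) \<partial>lborel)"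
              unfolding S_def using \<tau> by (intro nn_integral_mono) (auto split: split_indicator)
            also have "(\<integral>\<^sup>+\<sigma>. indicator {0..\<tau>} \<sigma> * Fp (x + \<sigma> *\<^sub>R e) \<partial>lborel) = \<bar>\<tau>\<bar> * (\<integral>\<^sup>+s. indicator {0..\<tau>} (0 + \<tau> * s) * Fp (x + (0 + \<tau> * s) *\<^sub>R e) \<partial>lborel)"
              by (rule nn_integral_real_affine) (use False in auto)
            also have "(\<integral>\<^sup>+s. indicator {0..\<tau>} (0 + \<tau> * s) * Fp (x + (0 + \<tau> * s) *\<^sub>R e) \<partial>lborel) = (\<integral>\<^sup>+s. indicator {0..1} s * Fp (x + s *\<^sub>R \<tau> *\<^sub>R e) \<partial>lborel)"
              using False \<tau> by (intro nn_integral_cong) (auto split: split_indicator simp: zero_le_mult_iff mult_le_cancel_left1 mult.commute)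
            finally show ?thesis using \<tau> by simp
          qed simp
          finally show ?thesis using True by (simp add: mult_left_mono)
        qed simp
      qed
    qed
    also have "\<dots> = 3 * (\<integral>\<^sup>+x. indicator A x * E (x + \<tau> *\<^sub>R e) \<partial>lborel) + ennreal (4 * p) * (\<integral>\<^sup>+x. indicator A x * S Fp x \<partial>lborel)"
      by (subst nn_integral_add, measurable, subst nn_integral_cmult, measurable, subst nn_integral_cmult, measurable)
    finally show ?thesis .
  qed
  have SE: "(\<integral>\<^sup>+\<tau>. indicator {0..T} \<tau> * (\<integral>\<^sup>+x. indicator A x * E (x + \<tau> *\<^sub>R e) \<partial>lborel) \<partial>lborel) = (\<integral>\<^sup>+x. indicator A x * S E x \<partial>lborel)"
  proof -
    have "(\<integral>\<^sup>+\<tau>. indicator {0..T} \<tau> * (\<integral>\<^sup>+x. indicator A x * E (x + \<tau> *\<^sub>R e) \<partial>lborel) \<partial>lborel) = (\<integral>\<^sup>+\<tau>. \<integral>\<^sup>+x. indicator {0..T} \<tau> * (indicator A x * E (x + \<tau> *\<^sub>R e)) \<partial>lborel \<partial>lborel)"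
      by (intro nn_integral_cong nn_integral_cmult[symmetric]) measurable
    also have "\<dots> = (\<integral>\<^sup>+x. \<integral>\<^sup>+\<tau>. indicator {0..T} \<tau> * (indicator A x * E (x + \<tau> *\<^sub>R e)) \<partial>lborel \<partial>lborel)"
      by (rule lborel_pair.Fubini') measurable
    also have "\<dots> = (\<integral>\<^sup>+x. indicator A x * S E x \<partial>lborel)"
    proof (rule nn_integral_cong)
      fix x
      have "(\<integral>\<^sup>+\<tau>. indicator {0..T} \<tau> * (indicator A x * E (x + \<tau> *\<^sub>R e)) \<partial>lborel) = (\<integral>\<^sup>+\<tau>. indicator A x * (indicator {0..T} \<tau> * E (x + \<tau> *\<^sub>R e)) \<partial>lborel)"
        by (intro nn_integral_cong) (simp add: ac_simps)
      also have "\<dots> = indicator A x * S E x" unfolding S_def by (rule nn_integral_cmult) measurable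
      finally show "(\<integral>\<^sup>+\<tau>. indicator {0..T} \<tau> * (indicator A x * E (x + \<tau> *\<^sub>R e)) \<partial>lborel) = indicator A x * S E x" .
    qed
    finally show ?thesis .
  qed
  let ?Y = "\<integral>\<^sup>+x. indicator A x * S Fp x \<partial>lborel"
  have "ennreal T * ?X = (\<integral>\<^sup>+\<tau>. ?X * indicator {0..T} \<tau> \<partial>lborel)"
    using T(1) by (subst nn_integral_cmult_indicator) (auto simp: mult.commute)
  also have "\<dots> \<le> (\<integral>\<^sup>+\<tau>. 3 * (indicator {0..T} \<tau> * (\<integral>\<^sup>+x. indicator A x * E (x + \<tau> *\<^sub>R e) \<partial>lborel)) + (ennreal (4 * p) * ?Y) * indicator {0..T} \<tau> \<partial>lborel)"
    using step by (intro nn_integral_mono) (auto split: split_indicator)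
  also have "\<dots> = 3 * (\<integral>\<^sup>+x. indicator A x * S E x \<partial>lborel) + (ennreal (4 * p) * ?Y) * ennreal T"
    unfolding SE[symmetric] using T(1)
    by (subst nn_integral_add, measurable, subst nn_integral_cmult, measurable) (simp add: nn_integral_cmult_indicator)
  also have "(ennreal (4 * p) * ?Y) * ennreal T = ennreal (4 * p * T) * ?Y"
    using p T by (simp add: ennreal_mult ac_simps)
  also have "\<dots> \<le> ennreal 5 * ?Y" using T(2) by (intro mult_right_mono ennreal_leI) auto
  finally have "ennreal T * ?X \<le> 3 * (\<integral>\<^sup>+x. indicator A x * S E x \<partial>lborel) + 5 * ?Y" by (simp add: add_left_mono)
  also have "\<dots> \<le> 5 * (\<integral>\<^sup>+x. indicator A x * S E x \<partial>lborel) + 5 * ?Y"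
    by (intro add_right_mono mult_right_mono) auto
  also have "\<dots> \<le> 5 * (ennreal l * (\<integral>\<^sup>+x. E x \<partial>lborel)) + 5 * (ennreal l * (\<integral>\<^sup>+x. Fp x \<partial>lborel))"
    by (intro add_mono mult_left_mono Sl) auto
  also have "\<dots> = ennreal (5 * l) * J" using l by (simp add: J_def ennreal_mult algebra_simps)
  finally have "ennreal T * ?X \<le> ennreal (5 * l) * J" .
  then have "ennreal (1 / T) * (ennreal T * ?X) \<le> ennreal (1 / T) * (ennreal (5 * l) * J)" by (rule mult_left_mono) simp
  moreover have "ennreal (1 / T) * (ennreal T * ?X) = ?X"
    using T(1) by (simp add: mult.assoc[symmetric] ennreal_mult[symmetric])
  moreover have "ennreal (1 / T) * (ennreal (5 * l) * J) = ennreal (5 * l / T) * J"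
    using T(1) l by (simp add: mult.assoc[symmetric] ennreal_mult[symmetric])
  ultimately show ?thesis by simp
qed
end

text \<open>An inward cone of fixed opening at all points of \<Omega> near \<open>x0\<close>. Away
  from the boundary, inside or outside \<Omega>, every direction satisfies this, so all points of
  space can be treated alike.\<close>

definition cone_at :: "(real^'n::finite) set \<Rightarrow> real^'n \<Rightarrow> real^'n \<Rightarrow> real \<Rightarrow> real \<Rightarrow> bool" where
  "cone_at \<Omega> x0 e \<kappa> r \<longleftrightarrow> norm e = 1 \<and> 1 \<le> \<kappa> \<and> 0 < r \<and>
    (\<forall>y t w. y \<in> \<Omega> \<inter> ball x0 r \<and> \<kappa> * norm w \<le> t \<and> y + t *\<^sub>R e + w \<in> ball x0 r \<longrightarrow> y + t *\<^sub>R e + w \<in> \<Omega>)"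

lemma ennreal_add_mult: "0 \<le> a \<Longrightarrow> 0 \<le> b \<Longrightarrow> ennreal a * x + ennreal b * x = ennreal (a + b) * x"
  by (simp add: distrib_right)

context borel_sobolev_function
begin

text \<open>A translation by a vector of the cone does not leave \<Omega> near \<open>x0\<close>.
  Points of \<Omega> fall under \<open>osc_inside\<close>. Points outside contribute only if they
  enter \<Omega>, and their images form a layer whose sections in direction \<open>e\<close> have
  length of order \<open>t\<close>.\<close>

lemma osc_cone:
  assumes cone: "cone_at \<Omega> x0 e \<kappa> r" and kw: "\<kappa> * norm w \<le> t" and small: "2 * t \<le> r / 4"
    and T: "0 < T" "T \<le> r / 4" "p * T \<le> 1 / 2"
  shows "(\<integral>\<^sup>+y. indicator (ball x0 (r / 2)) y * ennreal \<bar>\<bar>u (y + (t *\<^sub>R e + w))\<bar> powr p - \<bar>u y\<bar> powr p\<bar> \<partial>lborel)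
    \<le> ennreal ((4 * p + 20 / T) * t) * J"
proof -
  define v where "v = t *\<^sub>R e + w"
  have e: "norm e = 1" and k: "1 \<le> \<kappa>" and r: "0 < r"
    and cn: "\<And>y t w. y \<in> \<Omega> \<Longrightarrow> y \<in> ball x0 r \<Longrightarrow> \<kappa> * norm w \<le> t \<Longrightarrow> y + t *\<^sub>R e + w \<in> ball x0 r \<Longrightarrow> y + t *\<^sub>R e + w \<in> \<Omega>"
    using cone by (auto simp: cone_at_def)
  have "norm w \<le> \<kappa> * norm w" using k mult_right_mono[of 1 \<kappa> "norm w"] by simp
  then have w: "norm w \<le> t" using kw by linarith
  then have t: "0 \<le> t" using norm_ge_zero[of w] by linarith
  have v: "norm v \<le> 2 * t" unfolding v_def using norm_triangle_ineq[of "t *\<^sub>R e" w] e w t by simp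
  have near: "y \<in> ball x0 r" if "z \<in> ball x0 a" "norm (y - z) \<le> b" "a + b \<le> r" for y z a b
  proof -
    have "dist x0 y \<le> dist x0 z + dist z y" by (rule dist_triangle)
    then show ?thesis using that by (simp add: dist_norm norm_minus_commute)
  qed
  define A1 where "A1 = \<Omega> \<inter> ball x0 (r / 2)"
  define A where "A = {z \<in> \<Omega>. z - v \<in> ball x0 (r / 2) \<and> z - v \<notin> \<Omega>}"
  have [measurable]: "A1 \<in> sets borel" unfolding A1_def using om by simp
  have mA[measurable]: "A \<in> sets borel"
  proof -
    have "(\<lambda>z. z - v) -` (ball x0 (r / 2) - \<Omega>) \<in> sets borel"
      using measurable_sets_borel[of "\<lambda>z. z - v" borel "ball x0 (r / 2) - \<Omega>"] om by simp
    then have "\<Omega> \<inter> (\<lambda>z. z - v) -` (ball x0 (r / 2) - \<Omega>) \<in> sets borel" using om by simp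
    moreover have "A = \<Omega> \<inter> (\<lambda>z. z - v) -` (ball x0 (r / 2) - \<Omega>)" by (auto simp: A_def)
    ultimately show ?thesis by simp
  qed
  have I1: "(\<integral>\<^sup>+x. indicator A1 x * ennreal \<bar>\<bar>u (x + v)\<bar> powr p - \<bar>u x\<bar> powr p\<bar> \<partial>lborel) \<le> ennreal (2 * p * norm v) * J"
  proof (rule osc_inside)
    fix x assume x: "x \<in> A1"
    show "closed_segment x (x + v) \<subseteq> \<Omega>"
    proof
      fix y assume "y \<in> closed_segment x (x + v)"
      then obtain s where s: "0 \<le> s" "s \<le> 1" "y = x + s *\<^sub>R v" by (auto simp: in_segment algebra_simps)
      have y: "y = x + (s * t) *\<^sub>R e + s *\<^sub>R w" using s by (simp add: v_def algebra_simps)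
      have "norm (s *\<^sub>R v) \<le> 2 * t" using s v mult_left_le_one_le[of "norm v" s] by simp
      then have "y \<in> ball x0 r" using near[of x "r/2" y "2 * t"] x small r s by (simp add: A1_def)
      moreover have "x \<in> ball x0 r" using x r by (simp add: A1_def)
      moreover have "\<kappa> * norm (s *\<^sub>R w) \<le> s * t" using mult_left_mono[OF kw s(1)] s by (simp add: ac_simps)
      ultimately show "y \<in> \<Omega>" unfolding y using x by (intro cn) (auto simp: A1_def)
    qed
  qed measurable
  have I2: "(\<integral>\<^sup>+x. indicator A x * E x \<partial>lborel) \<le> ennreal (5 * (4 * t) / T) * J"
  proof (rule layer_bound[OF mA e T(1,3)])
    fix x \<sigma> assume x: "x \<in> A" and \<sigma>: "0 \<le> \<sigma>" "\<sigma> \<le> T"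
    have "x \<in> ball x0 r" using near[of "x - v" "r/2" x "2 * t"] x small r v by (simp add: A_def)
    moreover have "x + \<sigma> *\<^sub>R e + 0 \<in> ball x0 r"
    proof (rule near[of "x - v" "r/2" _ "2 * t + \<sigma>"])
      show "norm (x + \<sigma> *\<^sub>R e + 0 - (x - v)) \<le> 2 * t + \<sigma>"
        using norm_triangle_ineq[of "\<sigma> *\<^sub>R e" v] v \<sigma> e by (simp add: algebra_simps)
    qed (use x small T \<sigma> in \<open>auto simp: A_def\<close>)
    ultimately have "x + \<sigma> *\<^sub>R e + 0 \<in> \<Omega>" using x \<sigma> by (intro cn) (auto simp: A_def)
    then show "x + \<sigma> *\<^sub>R e \<in> \<Omega>" by simp
  next
    fix z
    let ?S = "{\<sigma>\<in>{0..T}. z - \<sigma> *\<^sub>R e \<in> A}"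
    \<comment> \<open>If two points of the layer on one line in direction \<open>e\<close> were
      farther apart than \<open>2 * t\<close>, the cone at the lower one would contain the preimage
      of the upper one, which lies outside \<Omega>.\<close>
    have gap: "s2 - s1 \<le> 2 * t" if s: "s1 \<in> ?S" "s2 \<in> ?S" for s1 s2
    proof (rule ccontr)
      assume "\<not> s2 - s1 \<le> 2 * t"
      then have g: "\<kappa> * norm (- w) \<le> s2 - s1 - t" using kw by simp
      let ?y = "z - s2 *\<^sub>R e"
      have y: "?y \<in> \<Omega>" "?y - v \<in> ball x0 (r/2)" using s by (auto simp: A_def)
      have y2: "z - s1 *\<^sub>R e - v \<in> ball x0 (r/2)" "z - s1 *\<^sub>R e - v \<notin> \<Omega>" using s by (auto simp: A_def)
      have eq: "?y + (s2 - s1 - t) *\<^sub>R e + - w = z - s1 *\<^sub>R e - v" by (simp add: v_def algebra_simps)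
      have "?y \<in> ball x0 r" using near[of "?y - v" "r/2" ?y "2 * t"] y small r v by simp
      moreover have "?y + (s2 - s1 - t) *\<^sub>R e + - w \<in> ball x0 r" unfolding eq using y2 r by simp
      ultimately have "?y + (s2 - s1 - t) *\<^sub>R e + - w \<in> \<Omega>" using y g by (intro cn) auto
      then show False using y2 unfolding eq by simp
    qed
    show "emeasure lborel ?S \<le> ennreal (4 * t)"
    proof (cases "?S = {}")
      case False
      then obtain s0 where s0: "s0 \<in> ?S" by blast
      have "?S \<subseteq> {s0 - 2 * t..s0 + 2 * t}" using gap s0 by force
      then have "emeasure lborel ?S \<le> emeasure lborel {s0 - 2 * t..s0 + 2 * t}" by (rule emeasure_mono) simp
      then show ?thesis using t by simp
    qed (simp only: emeasure_empty zero_le)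
  qed (use t in simp)
  have "(\<integral>\<^sup>+y. indicator (ball x0 (r / 2)) y * ennreal \<bar>\<bar>u (y + v)\<bar> powr p - \<bar>u y\<bar> powr p\<bar> \<partial>lborel)
    \<le> (\<integral>\<^sup>+x. indicator A1 x * ennreal \<bar>\<bar>u (x + v)\<bar> powr p - \<bar>u x\<bar> powr p\<bar> + indicator A (x + v) * E (x + v) \<partial>lborel)"
    using outside(1) by (intro nn_integral_mono) (auto simp: A1_def A_def split: split_indicator)
  also have "\<dots> = (\<integral>\<^sup>+x. indicator A1 x * ennreal \<bar>\<bar>u (x + v)\<bar> powr p - \<bar>u x\<bar> powr p\<bar> \<partial>lborel) + (\<integral>\<^sup>+x. indicator A (x + v) * E (x + v) \<partial>lborel)"
    by (rule nn_integral_add) measurable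
  also have "(\<integral>\<^sup>+x. indicator A (x + v) * E (x + v) \<partial>lborel) = (\<integral>\<^sup>+x. indicator A x * E x \<partial>lborel)"
    by (rule nn_integral_lborel_shift[where f="\<lambda>x. indicator A x * E x"]) measurable
  also have "(\<integral>\<^sup>+x. indicator A1 x * ennreal \<bar>\<bar>u (x + v)\<bar> powr p - \<bar>u x\<bar> powr p\<bar> \<partial>lborel) + (\<integral>\<^sup>+x. indicator A x * E x \<partial>lborel)
     \<le> ennreal (2 * p * norm v) * J + ennreal (5 * (4 * t) / T) * J"
    by (intro add_mono I1 I2)
  also have "\<dots> \<le> ennreal (4 * p * t) * J + ennreal (20 * t / T) * J"
    using v p by (intro add_mono mult_right_mono ennreal_leI) auto
  also have "\<dots> = ennreal ((4 * p + 20 / T) * t) * J"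
    using p t T(1) by (subst distrib_right[symmetric], subst ennreal_plus[symmetric]) (auto simp: algebra_simps)
  finally show ?thesis unfolding v_def .
qed

text \<open>An arbitrary translation is a difference of two inward ones: \<open>x\<close> and
  \<open>x + h\<close> are both compared with \<open>x + t e\<close>, where
  \<open>t = \<kappa> * norm h\<close> puts \<open>t e - h\<close> into the cone.\<close>

lemma osc_ball:
  assumes cone: "cone_at \<Omega> x0 e \<kappa> r" and small: "8 * \<kappa> * norm h \<le> r"
    and T: "0 < T" "T \<le> r / 4" "p * T \<le> 1 / 2"
  shows "(\<integral>\<^sup>+x. indicator (ball x0 (r / 4)) x * ennreal \<bar>\<bar>u (x + h)\<bar> powr p - \<bar>u x\<bar> powr p\<bar> \<partial>lborel)
    \<le> ennreal (2 * (4 * p + 20 / T) * \<kappa> * norm h) * J"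
proof -
  define t where "t = \<kappa> * norm h"
  have k: "1 \<le> \<kappa>" and r: "0 < r" using cone by (auto simp: cone_at_def)
  have t: "0 \<le> t" using k by (simp add: t_def)
  have hs: "norm h \<le> r / 8" using small k mult_right_mono[of 1 \<kappa> "norm h"] by simp
  have [measurable]: "ball x0 (r / 2) \<in> sets borel" by simp
  let ?d = "\<lambda>y v. ennreal \<bar>\<bar>u (y + v)\<bar> powr p - \<bar>u y\<bar> powr p\<bar>"
  let ?C = "ennreal ((4 * p + 20 / T) * t) * J"
  have 1: "(\<integral>\<^sup>+y. indicator (ball x0 (r / 2)) y * ?d y (t *\<^sub>R e + 0) \<partial>lborel) \<le> ?C"
    by (rule osc_cone[OF cone _ _ T]) (use t small in \<open>auto simp: t_def\<close>)
  have 2: "(\<integral>\<^sup>+y. indicator (ball x0 (r / 2)) y * ?d y (t *\<^sub>R e + (- h)) \<partial>lborel) \<le> ?C"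
    by (rule osc_cone[OF cone _ _ T]) (use t small in \<open>auto simp: t_def\<close>)
  have "(\<integral>\<^sup>+x. indicator (ball x0 (r / 4)) x * ?d x h \<partial>lborel)
    \<le> (\<integral>\<^sup>+x. indicator (ball x0 (r / 2)) (x + h) * ?d (x + h) (t *\<^sub>R e + (- h)) + indicator (ball x0 (r / 2)) x * ?d x (t *\<^sub>R e + 0) \<partial>lborel)"
  proof (rule nn_integral_mono)
    fix x
    show "indicator (ball x0 (r / 4)) x * ?d x h \<le> indicator (ball x0 (r / 2)) (x + h) * ?d (x + h) (t *\<^sub>R e + (- h)) + indicator (ball x0 (r / 2)) x * ?d x (t *\<^sub>R e + 0)"
    proof (cases "x \<in> ball x0 (r / 4)")
      case True
      have "dist x0 (x + h) \<le> dist x0 x + norm h" using dist_triangle[of x0 "x + h" x] by (simp add: dist_norm)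
      then have in2: "x + h \<in> ball x0 (r / 2)" "x \<in> ball x0 (r / 2)" using True hs r by auto
      have eq: "x + h + (t *\<^sub>R e + (- h)) = x + t *\<^sub>R e" by simp
      have "?d x h \<le> ?d (x + h) (t *\<^sub>R e + (- h)) + ?d x (t *\<^sub>R e + 0)"
      proof -
        have tri: "\<bar>a - c\<bar> \<le> \<bar>b - a\<bar> + \<bar>b - c\<bar>" for a b c :: real by linarith
        show ?thesis unfolding eq by (simp add: ennreal_plus[symmetric] tri del: ennreal_plus)
      qed
      then show ?thesis using in2 True by simp
    qed simp
  qed
  also have "\<dots> = (\<integral>\<^sup>+x. indicator (ball x0 (r / 2)) (x + h) * ?d (x + h) (t *\<^sub>R e + (- h)) \<partial>lborel) + (\<integral>\<^sup>+x. indicator (ball x0 (r / 2)) x * ?d x (t *\<^sub>R e + 0) \<partial>lborel)"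
    by (rule nn_integral_add) measurable
  also have "(\<integral>\<^sup>+x. indicator (ball x0 (r / 2)) (x + h) * ?d (x + h) (t *\<^sub>R e + (- h)) \<partial>lborel) = (\<integral>\<^sup>+x. indicator (ball x0 (r / 2)) x * ?d x (t *\<^sub>R e + (- h)) \<partial>lborel)"
    by (rule nn_integral_lborel_shift[where f="\<lambda>x. indicator (ball x0 (r / 2)) x * ?d x (t *\<^sub>R e + (- h))"]) measurable
  also have "\<dots> + (\<integral>\<^sup>+x. indicator (ball x0 (r / 2)) x * ?d x (t *\<^sub>R e + 0) \<partial>lborel) \<le> ?C + ?C"
    by (rule add_mono[OF 2 1])
  also have "\<dots> = ennreal ((4 * p + 20 / T) * t + (4 * p + 20 / T) * t) * J"
  proof -
    have "0 \<le> (4 * p + 20 / T) * t" using p T(1) t by (intro mult_nonneg_nonneg add_nonneg_nonneg) auto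
    then show ?thesis by (intro ennreal_add_mult)
  qed
  also have "(4 * p + 20 / T) * t + (4 * p + 20 / T) * t = 2 * (4 * p + 20 / T) * \<kappa> * norm h"
    by (simp add: t_def algebra_simps)
  finally show ?thesis .
qed

end

section \<open>Boundary charts and the global variation estimate\<close>

lemma C_fun_1_lipschitz_on_ball:
  fixes g :: "real^'n::finite \<Rightarrow> real"
  assumes "C_fun 1 g"
  shows "\<exists>L\<ge>0. \<forall>x\<in>ball c r. \<forall>y\<in>ball c r. \<bar>g x - g y\<bar> \<le> L * norm (x - y)"
proof -
  have d: "\<And>x. g differentiable (at x)" and c: "\<And>i. continuous_on UNIV (partial_deriv i g)"
    using assms by auto
  have "continuous_on UNIV (gradient g)" unfolding gradient_def by (intro continuous_on_vec_lambda c)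
  then have "bounded (gradient g ` cball c r)"
    by (intro compact_imp_bounded compact_continuous_image) (auto intro: continuous_on_subset)
  then obtain B where "\<forall>y\<in>gradient g ` cball c r. norm y \<le> B" unfolding bounded_iff by blast
  then have B: "norm (gradient g x) \<le> B" if "x \<in> cball c r" for x using that by blast
  have der: "(g has_derivative (\<lambda>h. gradient g x \<bullet> h)) (at x)" for x
    using has_derivative_partial[OF d, of x] by (simp add: gradient_def inner_vec_def mult.commute)
  have "\<bar>g x - g y\<bar> \<le> max 0 B * norm (x - y)" if "x \<in> ball c r" "y \<in> ball c r" for x y
  proof -
    have "norm (g x - g y) \<le> max 0 B * norm (x - y)"
    proof (rule differentiable_bound[of "ball c r" g "\<lambda>x h. gradient g x \<bullet> h"])
      show "(g has_derivative (\<bullet>) (gradient g x)) (at x within ball c r)" for x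
        using der by (rule has_derivative_at_withinI)
      show "onorm ((\<bullet>) (gradient g x)) \<le> max 0 B" if "x \<in> ball c r" for x
      proof (rule onorm_le)
        fix h
        have "norm (gradient g x \<bullet> h) \<le> norm (gradient g x) * norm h" using Cauchy_Schwarz_ineq2 by simp
        also have "\<dots> \<le> max 0 B * norm h" using B[of x] that by (intro mult_right_mono) auto
        finally show "norm (gradient g x \<bullet> h) \<le> max 0 B * norm h" .
      qed
    qed (use that in auto)
    then show ?thesis by simp
  qed
  then show ?thesis by (intro exI[of _ "max 0 B"]) auto
qed

text \<open>\<open>\<gamma>\<close> is the height above the graph, measured in the direction \<open>e\<close>.\<close>

definition boundary_chart :: "(real^'n::finite) set \<Rightarrow> real^'n \<Rightarrow> real \<Rightarrow> real^'n \<Rightarrow> (real^'n \<Rightarrow> real) \<Rightarrow> real \<Rightarrow> bool" where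
  "boundary_chart \<Omega> x0 r e \<gamma> L \<longleftrightarrow> 0 < r \<and> norm e = 1 \<and> 0 \<le> L \<and> continuous_on UNIV \<gamma> \<and>
     (\<forall>x t. \<gamma> (x + t *\<^sub>R e) = \<gamma> x + t) \<and>
     (\<forall>x\<in>ball x0 r. \<forall>y\<in>ball x0 r. \<bar>\<gamma> x - \<gamma> y - (x - y) \<bullet> e\<bar> \<le> L * norm ((x - y) - ((x - y) \<bullet> e) *\<^sub>R e)) \<and>
     \<Omega> \<inter> ball x0 r = {x \<in> ball x0 r. 0 < \<gamma> x}"

lemma norm_proj_le:
  fixes x e :: "'a::real_inner"
  assumes "norm e = 1"
  shows "norm (x - (x \<bullet> e) *\<^sub>R e) \<le> norm x"
proof -
  have e: "e \<bullet> e = 1" using assms by (simp add: dot_square_norm)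
  have "(norm (x - (x \<bullet> e) *\<^sub>R e))\<^sup>2 = (norm x)\<^sup>2 - (x \<bullet> e)\<^sup>2"
    unfolding power2_norm_eq_inner by (simp add: inner_diff_left inner_diff_right e inner_commute power2_eq_square algebra_simps)
  then have "(norm (x - (x \<bullet> e) *\<^sub>R e))\<^sup>2 \<le> (norm x)\<^sup>2" by simp
  then show ?thesis by (rule power2_le_imp_le) simp
qed

lemma C1_boundary_chart:
  assumes "C1_boundary \<Omega>" "x0 \<in> frontier \<Omega>"
  shows "\<exists>r e \<gamma> L. boundary_chart \<Omega> x0 r e \<gamma> L"
proof -
  obtain r e g where r: "r > 0" and e: "norm e = 1" and g: "C_fun 1 g"
    and eq: "\<Omega> \<inter> ball x0 r = {x \<in> ball x0 r. g (x - (x \<bullet> e) *\<^sub>R e) < x \<bullet> e}"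
    using assms unfolding C1_boundary_def by blast
  have ee: "e \<bullet> e = 1" using e by (simp add: dot_square_norm)
  define \<pi> where "\<pi> x = x - (x \<bullet> e) *\<^sub>R e" for x
  define \<gamma> where "\<gamma> x = x \<bullet> e - g (\<pi> x)" for x
  have pd: "\<pi> x - \<pi> y = \<pi> (x - y)" for x y by (simp add: \<pi>_def inner_diff_left algebra_simps)
  have pn: "norm (\<pi> x) \<le> norm x" for x unfolding \<pi>_def by (rule norm_proj_le[OF e])
  obtain L where L: "L \<ge> 0" "\<And>x y. x \<in> ball (\<pi> x0) r \<Longrightarrow> y \<in> ball (\<pi> x0) r \<Longrightarrow> \<bar>g x - g y\<bar> \<le> L * norm (x - y)"
    using C_fun_1_lipschitz_on_ball[OF g, of "\<pi> x0" r] by blast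
  have inb: "\<pi> x \<in> ball (\<pi> x0) r" if "x \<in> ball x0 r" for x
    using that pn[of "x0 - x"] by (simp add: dist_norm pd)
  have "boundary_chart \<Omega> x0 r e \<gamma> L"
    unfolding boundary_chart_def
  proof (intro conjI allI ballI)
    have "continuous_on UNIV g" using C_fun_continuous[OF g] .
    moreover have "continuous_on UNIV \<pi>" unfolding \<pi>_def[abs_def] by (intro continuous_intros)
    ultimately have "continuous_on UNIV (\<lambda>x. g (\<pi> x))" by (rule continuous_on_compose2) simp
    then show "continuous_on UNIV \<gamma>" unfolding \<gamma>_def[abs_def]
      by (intro continuous_on_diff continuous_on_inner continuous_on_id continuous_on_const)
    show "\<gamma> (x + t *\<^sub>R e) = \<gamma> x + t" for x t
      by (simp add: \<gamma>_def \<pi>_def inner_add_left ee algebra_simps)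
    show "\<bar>\<gamma> x - \<gamma> y - (x - y) \<bullet> e\<bar> \<le> L * norm ((x - y) - ((x - y) \<bullet> e) *\<^sub>R e)" if "x \<in> ball x0 r" "y \<in> ball x0 r" for x y
    proof -
      have e1: "\<gamma> x - \<gamma> y - (x - y) \<bullet> e = - (g (\<pi> x) - g (\<pi> y))" by (simp add: \<gamma>_def inner_diff_left)
      have e2: "(x - y) - ((x - y) \<bullet> e) *\<^sub>R e = \<pi> x - \<pi> y" unfolding pd by (simp add: \<pi>_def)
      show ?thesis unfolding e1 e2 abs_minus_cancel by (rule L(2)[OF inb[OF that(1)] inb[OF that(2)]])
    qed
    show "\<Omega> \<inter> ball x0 r = {x \<in> ball x0 r. 0 < \<gamma> x}" unfolding eq by (simp add: \<gamma>_def \<pi>_def)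
  qed (use r e L in auto)
  then show ?thesis by blast
qed

lemma boundary_chart_lipschitz:
  assumes "boundary_chart \<Omega> x0 r e \<gamma> L" "x \<in> ball x0 r" "y \<in> ball x0 r"
  shows "\<bar>\<gamma> x - \<gamma> y\<bar> \<le> (L + 1) * norm (x - y)"
proof -
  have e: "norm e = 1" and L: "0 \<le> L" using assms by (auto simp: boundary_chart_def)
  have "\<bar>\<gamma> x - \<gamma> y - (x - y) \<bullet> e\<bar> \<le> L * norm ((x - y) - ((x - y) \<bullet> e) *\<^sub>R e)"
    using assms by (auto simp: boundary_chart_def)
  also have "\<dots> \<le> L * norm (x - y)" by (intro mult_left_mono norm_proj_le e L)
  finally have "\<bar>\<gamma> x - \<gamma> y - (x - y) \<bullet> e\<bar> \<le> L * norm (x - y)" .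
  moreover have "\<bar>(x - y) \<bullet> e\<bar> \<le> norm (x - y)" using Cauchy_Schwarz_ineq2[of "x - y" e] e by simp
  ultimately show ?thesis by (simp add: algebra_simps)
qed

text \<open>The height \<gamma> rises at unit rate along \<open>e\<close>, and an additional
  displacement \<open>w\<close> lowers it by at most \<open>(L + 1) * norm w\<close>.\<close>

lemma boundary_chart_cone:
  assumes ch: "boundary_chart \<Omega> x0 r e \<gamma> L"
  shows "cone_at \<Omega> x0 e (L + 1) r"
  unfolding cone_at_def
proof (intro conjI allI impI)
  have L: "0 \<le> L" "0 < r" and e: "norm e = 1" and sh: "\<And>x t. \<gamma> (x + t *\<^sub>R e) = \<gamma> x + t"
    and om: "\<And>x. x \<in> ball x0 r \<Longrightarrow> x \<in> \<Omega> \<longleftrightarrow> 0 < \<gamma> x"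
    and lip: "\<And>x y. x \<in> ball x0 r \<Longrightarrow> y \<in> ball x0 r \<Longrightarrow> \<bar>\<gamma> x - \<gamma> y - (x - y) \<bullet> e\<bar> \<le> L * norm ((x - y) - ((x - y) \<bullet> e) *\<^sub>R e)"
    using ch by (auto simp: boundary_chart_def)
  show "norm e = 1" "1 \<le> L + 1" "0 < r" using e L by auto
  have ee: "e \<bullet> e = 1" using e by (simp add: dot_square_norm)
  fix y t w assume a: "y \<in> \<Omega> \<inter> ball x0 r \<and> (L + 1) * norm w \<le> t \<and> y + t *\<^sub>R e + w \<in> ball x0 r"
  let ?z = "y + t *\<^sub>R e + w"
  have eq: "?z - y - ((?z - y) \<bullet> e) *\<^sub>R e = w - (w \<bullet> e) *\<^sub>R e"
    by (simp add: inner_add_left ee algebra_simps)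
  have "\<bar>\<gamma> ?z - \<gamma> y - (?z - y) \<bullet> e\<bar> \<le> L * norm (w - (w \<bullet> e) *\<^sub>R e)"
    using lip[of ?z y] a unfolding eq by auto
  also have "\<dots> \<le> L * norm w" by (intro mult_left_mono norm_proj_le e L)
  finally have *: "\<bar>\<gamma> ?z - \<gamma> y - (?z - y) \<bullet> e\<bar> \<le> L * norm w" .
  have eq2: "(?z - y) \<bullet> e = t + w \<bullet> e" by (simp add: inner_add_left ee)
  have "\<bar>\<gamma> ?z - \<gamma> y - (t + w \<bullet> e)\<bar> \<le> L * norm w" using * unfolding eq2 .
  moreover have "L * norm w + norm w \<le> t" using a by (simp add: distrib_right)
  moreover have "\<bar>w \<bullet> e\<bar> \<le> norm w" using Cauchy_Schwarz_ineq2[of w e] e by simp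
  moreover have "0 < \<gamma> y" using a om by auto
  ultimately have "0 < \<gamma> ?z" by linarith
  then show "?z \<in> \<Omega>" using a om by auto
qed

lemma cone_at_exists:
  fixes \<Omega> :: "(real^'n::finite) set"
  assumes "bounded_C1_domain \<Omega>"
  shows "\<exists>e \<kappa> r. cone_at \<Omega> x0 e \<kappa> r"
proof -
  have ax: "norm (axis undefined 1 :: real^'n) = 1" by simp
  consider "x0 \<in> \<Omega>" | "x0 \<in> frontier \<Omega>" | "x0 \<notin> closure \<Omega>"
    using assms by (auto simp: frontier_def bounded_C1_domain_def interior_open)
  then show ?thesis
  proof cases
    case 1
    then obtain r where "r > 0" "ball x0 r \<subseteq> \<Omega>" using assms by (auto simp: bounded_C1_domain_def open_contains_ball)
    then have "cone_at \<Omega> x0 (axis undefined 1) 1 r" using ax by (auto simp: cone_at_def)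
    then show ?thesis by blast
  next
    case 2
    then show ?thesis using C1_boundary_chart[of \<Omega> x0] boundary_chart_cone assms by (metis bounded_C1_domain_def)
  next
    case 3
    then obtain r where "r > 0" "ball x0 r \<subseteq> - closure \<Omega>"
      using open_contains_ball[of "- closure \<Omega>"] by auto
    then have "cone_at \<Omega> x0 (axis undefined 1) 1 r" using ax closure_subset[of \<Omega>] by (auto simp: cone_at_def)
    then show ?thesis by blast
  qed
qed

text \<open>Compactness turns the local estimates into a global one for short translations. For long
  ones the trivial bound by twice the integral of the power is already linear in
  \<open>norm h\<close>.\<close>

lemma bv_estimate:
  fixes \<Omega> :: "(real^'n::finite) set"
  assumes dom: "bounded_C1_domain \<Omega>" and p: "1 \<le> p"
  shows "\<exists>C\<ge>0. \<forall>u g h. borel_sobolev p \<Omega> u g \<longrightarrow>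
    (\<integral>\<^sup>+x. ennreal \<bar>\<bar>u (x + h)\<bar> powr p - \<bar>u x\<bar> powr p\<bar> \<partial>lborel) \<le>
    ennreal (C * norm h) * ((\<integral>\<^sup>+x. ennreal (\<bar>u x\<bar> powr p) \<partial>lborel) + (\<integral>\<^sup>+x. ennreal (norm (g x) powr p) \<partial>lborel))"
proof -
  have om: "open \<Omega>" and bd: "bounded \<Omega>" using dom by (auto simp: bounded_C1_domain_def)
  obtain R where R: "\<And>x. x \<in> \<Omega> \<Longrightarrow> norm x \<le> R" using bd by (auto simp: bounded_iff)
  obtain e \<kappa> r where c: "\<And>x0. cone_at \<Omega> x0 (e x0) (\<kappa> x0) (r x0)" using cone_at_exists[OF dom] by metis
  have rp: "0 < r x0" "1 \<le> \<kappa> x0" for x0 using c[of x0] by (auto simp: cone_at_def)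
  have cpt: "compact (cball (0::real^'n) (R + 1))" by simp
  have op: "open (ball x0 (r x0 / 4))" if "x0 \<in> UNIV" for x0 by simp
  have cov: "cball 0 (R + 1) \<subseteq> (\<Union>x0\<in>UNIV. ball x0 (r x0 / 4))" 
  proof
    fix x :: "real^'n"
    have "x \<in> ball x (r x / 4)" using rp(1)[of x] by simp
    then show "x \<in> (\<Union>x0\<in>UNIV. ball x0 (r x0 / 4))" by blast
  qed
  obtain X where "X \<subseteq> UNIV" and X: "finite X" "cball 0 (R + 1) \<subseteq> (\<Union>x0\<in>X. ball x0 (r x0 / 4))"
    by (rule compactE_image[OF cpt op cov])
  define T where "T x0 = min (r x0 / 4) (1 / (2 * p))" for x0
  have T: "0 < T x0" "T x0 \<le> r x0 / 4" "p * T x0 \<le> 1 / 2" for x0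
  proof -
    show "0 < T x0" "T x0 \<le> r x0 / 4" using rp[of x0] p by (auto simp: T_def)
    have "p * T x0 \<le> p * (1 / (2 * p))" using p by (intro mult_left_mono) (auto simp: T_def)
    then show "p * T x0 \<le> 1 / 2" using p by simp
  qed
  define C0 where "C0 x0 = 2 * (4 * p + 20 / T x0) * \<kappa> x0" for x0
  have C0: "0 \<le> C0 x0" for x0 unfolding C0_def using T[of x0] rp[of x0] p by simp
  \<comment> \<open>Below \<delta> every local estimate applies, and \<delta> \<le> 1 keeps
    \<open>x\<close> and \<open>x + h\<close> outside \<Omega> whenever \<open>x\<close> is outside
    the ball of radius \<open>R + 1\<close>.\<close>
  define \<delta> where "\<delta> = Min (insert 1 ((\<lambda>x0. r x0 / (8 * \<kappa> x0)) ` X))"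
  have \<delta>: "0 < \<delta>" "\<delta> \<le> 1" "\<And>x0. x0 \<in> X \<Longrightarrow> \<delta> \<le> r x0 / (8 * \<kappa> x0)"
  proof -
    have "0 < r x0 / (8 * \<kappa> x0)" for x0 using rp[of x0] by simp
    then show "0 < \<delta>" using X(1) by (simp add: \<delta>_def)
    show "\<delta> \<le> 1" using X(1) by (simp add: \<delta>_def)
    show "\<delta> \<le> r x0 / (8 * \<kappa> x0)" if "x0 \<in> X" for x0
      unfolding \<delta>_def by (rule Min_le) (use X(1) that in auto)
  qed
  \<comment> \<open>The summand \<open>2 / \<delta>\<close> serves the translations of length at
    least \<delta>.\<close>
  define C where "C = sum C0 X + 2 / \<delta>"
  have C: "0 \<le> C" unfolding C_def using C0 \<delta>(1) by (simp add: sum_nonneg)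
  show ?thesis
  proof (intro exI[of _ C] conjI allI impI C)
    fix u g h assume b: "borel_sobolev p \<Omega> u g"
    interpret borel_sobolev_function \<Omega> p u g by unfold_locales (use om p b in auto)
    have [measurable]: "ball x0 a \<in> sets borel" for x0 :: "real^'n" and a by simp
    let ?d = "\<lambda>x. ennreal \<bar>\<bar>u (x + h)\<bar> powr p - \<bar>u x\<bar> powr p\<bar>"
    have "(\<integral>\<^sup>+x. ?d x \<partial>lborel) \<le> ennreal (C * norm h) * J"
    proof (cases "norm h < \<delta>")
      case True
      have "(\<integral>\<^sup>+x. ?d x \<partial>lborel) \<le> (\<integral>\<^sup>+x. (\<Sum>x0\<in>X. indicator (ball x0 (r x0 / 4)) x * ?d x) \<partial>lborel)"
      proof (rule nn_integral_mono)
        fix x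
        show "?d x \<le> (\<Sum>x0\<in>X. indicator (ball x0 (r x0 / 4)) x * ?d x)"
        proof (cases "x \<in> cball 0 (R + 1)")
          case True
          then obtain x0 where x0: "x0 \<in> X" "x \<in> ball x0 (r x0 / 4)" using X(2) by blast
          have "?d x = indicator (ball x0 (r x0 / 4)) x * ?d x" using x0 by simp
          also have "\<dots> \<le> (\<Sum>x0\<in>X. indicator (ball x0 (r x0 / 4)) x * ?d x)"
            using X(1) x0(1) by (intro member_le_sum) auto
          finally show ?thesis .
        next
          case False
          have "norm x \<le> norm (x + h) + norm h" using norm_triangle_ineq4[of "x + h" h] by simp
          then have "x \<notin> \<Omega>" "x + h \<notin> \<Omega>" using False R[of x] R[of "x + h"] True \<delta>(2) by auto
          then show ?thesis using outside by simp
        qed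
      qed
      also have "\<dots> = (\<Sum>x0\<in>X. \<integral>\<^sup>+x. indicator (ball x0 (r x0 / 4)) x * ?d x \<partial>lborel)"
        by (rule nn_integral_sum) measurable
      also have "\<dots> \<le> (\<Sum>x0\<in>X. ennreal (C0 x0 * norm h) * J)"
      proof (rule sum_mono)
        fix x0 assume x0: "x0 \<in> X"
        have "8 * \<kappa> x0 * norm h \<le> 8 * \<kappa> x0 * \<delta>" using True rp[of x0] by (intro mult_left_mono) auto
        also have "\<dots> \<le> r x0" using \<delta>(3)[OF x0] rp[of x0] by (simp add: field_simps)
        finally have "8 * \<kappa> x0 * norm h \<le> r x0" .
        from osc_ball[OF c this T]
        show "(\<integral>\<^sup>+x. indicator (ball x0 (r x0 / 4)) x * ?d x \<partial>lborel) \<le> ennreal (C0 x0 * norm h) * J"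
          by (simp add: C0_def)
      qed
      also have "\<dots> = ennreal (sum C0 X * norm h) * J"
        using C0 by (simp add: sum_distrib_right[symmetric] sum_ennreal)
      also have "\<dots> \<le> ennreal (C * norm h) * J"
        using \<delta>(1) by (intro mult_right_mono ennreal_leI) (auto simp: C_def)
      finally show ?thesis .
    next
      case False
      have "(\<integral>\<^sup>+x. ?d x \<partial>lborel) \<le> (\<integral>\<^sup>+x. E (x + h) + E x \<partial>lborel)"
      proof (rule nn_integral_mono)
        fix x
        have "\<bar>a - b\<bar> \<le> a + b" if "0 \<le> a" "0 \<le> b" for a b :: real using that by linarith
        then show "?d x \<le> E (x + h) + E x"
          by (simp add: ennreal_plus[symmetric] del: ennreal_plus)
      qed
      also have "\<dots> = (\<integral>\<^sup>+x. E (x + h) \<partial>lborel) + (\<integral>\<^sup>+x. E x \<partial>lborel)" by (rule nn_integral_add) measurable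
      also have "\<dots> = 2 * (\<integral>\<^sup>+x. E x \<partial>lborel)" by (simp add: nn_integral_lborel_shift[of E] mult_2)
      also have "\<dots> \<le> ennreal 2 * J" by (intro mult_mono) (auto simp: J_def)
      also have "\<dots> \<le> ennreal (C * norm h) * J"
      proof (intro mult_right_mono ennreal_leI)
        have "2 \<le> 2 / \<delta> * norm h" using False \<delta>(1) by (simp add: field_simps)
        also have "\<dots> \<le> C * norm h" using C0 by (intro mult_right_mono) (auto simp: C_def sum_nonneg)
        finally show "2 \<le> C * norm h" .
      qed simp
      finally show ?thesis .
    qed
    then show "(\<integral>\<^sup>+x. ?d x \<partial>lborel) \<le> ennreal (C * norm h) * ((\<integral>\<^sup>+x. E x \<partial>lborel) + (\<integral>\<^sup>+x. Fp x \<partial>lborel))"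
      by (simp add: J_def)
  qed
qed

section \<open>Periodic weights\<close>

text \<open>The cell is half open, so that shifted cells are cut into exactly disjoint slabs and
  indicator identities hold at every point.\<close>

definition hbox :: "real^'n::finite \<Rightarrow> (real^'n) set" where
  "hbox a = {y. \<forall>i. a $ i < y $ i \<and> y $ i \<le> a $ i + 1}"

lemma hbox_borel [measurable]: "hbox a \<in> sets borel"
proof -
  have "hbox a = (\<Inter>i. {y. a $ i < y $ i \<and> y $ i \<le> a $ i + 1})" by (auto simp: hbox_def)
  moreover have "{y. a $ i < y $ i \<and> y $ i \<le> a $ i + 1} \<in> sets borel" for i by measurable
  ultimately show ?thesis by (auto intro!: sets.countable_INT')
qed

lemma hbox_between: "box a (a + 1) \<subseteq> hbox a" "hbox a \<subseteq> cbox a (a + 1)"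
proof -
  show "box a (a + 1) \<subseteq> hbox a" by (auto simp: hbox_def mem_box_cart less_imp_le)
  show "hbox a \<subseteq> cbox a (a + 1)" by (auto simp: hbox_def mem_box_cart less_imp_le)
qed

lemma cbox_minus_box_null: "cbox a b - box a b \<in> null_sets lborel"
  by (simp add: null_sets_def emeasure_Diff emeasure_lborel_cbox_eq emeasure_lborel_box_eq box_subset_cbox)

lemma AE_hbox_iff: "AE y in lborel. y \<in> hbox a \<longleftrightarrow> y \<in> cbox a (a + 1)"
proof -
  have "AE y in lborel. y \<notin> cbox a (a + 1) - box a (a + 1)" by (intro AE_not_in cbox_minus_box_null)
  then show ?thesis by eventually_elim (use hbox_between[of a] in blast)
qed

lemma emeasure_hbox: "emeasure lborel (hbox a) = 1"
proof -
  have "emeasure lborel (hbox a) = emeasure lborel (cbox a (a + 1))"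
    by (rule emeasure_eq_AE) (use AE_hbox_iff in auto)
  also have "\<dots> = ennreal (\<Prod>b\<in>Basis. (a + 1 - a) \<bullet> b)"
    by (subst emeasure_lborel_cbox) (auto simp: inner_add_left Basis_vec_def inner_axis)
  also have "(\<Prod>b\<in>Basis. (a + 1 - a) \<bullet> b) = 1"
    by (intro prod.neutral) (auto simp: Basis_vec_def inner_axis)
  finally show ?thesis by simp
qed

lemma integrable_hbox_bounded:
  fixes \<rho> :: "real^'n::finite \<Rightarrow> real"
  assumes "\<rho> \<in> borel_measurable borel" "\<And>x. \<bar>\<rho> x\<bar> \<le> B" "A \<in> sets borel" "bounded A"
  shows "integrable lborel (\<lambda>y. indicator A y * \<rho> y)"
proof (rule Bochner_Integration.integrable_bound)
  show "integrable lborel (\<lambda>y. indicator A y * B)"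
    using assms emeasure_bounded_finite[OF assms(4)] by (intro integrable_mult_left integrable_real_indicator) auto
  have "0 \<le> B" using assms(2)[of 0] by linarith
  then show "AE x in lborel. norm (indicator A x * \<rho> x) \<le> norm (indicator A x * B)"
    using assms(2) by (intro AE_I2) (auto split: split_indicator)
qed (use assms in measurable)

context
  fixes \<rho> :: "real^'n::finite \<Rightarrow> real" and B :: real
  assumes \<rho>[measurable]: "\<rho> \<in> borel_measurable borel" and B: "\<And>x. \<bar>\<rho> x\<bar> \<le> B"
    and per: "\<And>i. AE x in lborel. \<rho> (x + axis i 1) = \<rho> x"
begin

text \<open>Shifting the cell by \<open>t\<close> drops a slab at one end and adds the translate of
  this slab by one period at the other.\<close>

lemma hbox_integral_shift_small:
  assumes t: "0 \<le> t" "t \<le> 1"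
  shows "(LINT y|lborel. indicator (hbox (a + t *\<^sub>R axis i 1)) y * \<rho> y) = (LINT y|lborel. indicator (hbox a) y * \<rho> y)"
proof -
  define P where "P = {y. \<forall>j. j \<noteq> i \<longrightarrow> a $ j < y $ j \<and> y $ j \<le> a $ j + 1}"
  define S where "S l h = P \<inter> {y. l < y $ i \<and> y $ i \<le> h}" for l h :: real
  have P[measurable]: "P \<in> sets borel"
  proof -
    have "P = (\<Inter>j\<in>- {i}. {y. a $ j < y $ j \<and> y $ j \<le> a $ j + 1})" by (auto simp: P_def)
    moreover have "{y::real^'n. a $ j < y $ j \<and> y $ j \<le> a $ j + 1} \<in> sets borel" for j by measurable
    ultimately show ?thesis by (auto intro!: sets.countable_INT'')
  qed
  have S[measurable]: "S l h \<in> sets borel" for l h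
  proof -
    have "{y::real^'n. l < y $ i \<and> y $ i \<le> h} \<in> sets borel" by measurable
    then show ?thesis unfolding S_def using P by blast
  qed
  have bS: "bounded (S l h)" if "a $ i \<le> l" "h \<le> a $ i + 2" for l h
  proof (rule bounded_subset[OF bounded_cbox[of a "a + 2"]])
    show "S l h \<subseteq> cbox a (a + 2)"
    proof
      fix y assume y: "y \<in> S l h"
      have "a $ j \<le> y $ j \<and> y $ j \<le> a $ j + 2" for j
        using y that by (cases "j = i") (force simp: S_def P_def)+
      then show "y \<in> cbox a (a + 2)" by (simp add: mem_box_cart)
    qed
  qed
  have int: "integrable lborel (\<lambda>y. indicator (S l h) y * \<rho> y)" if "a $ i \<le> l" "h \<le> a $ i + 2" for l h
    by (rule integrable_hbox_bounded[OF \<rho> B S bS[OF that]])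
  have d1: "indicator (hbox (a + t *\<^sub>R axis i 1)) y = (indicator (S (a $ i + t) (a $ i + 1)) y + indicator (S (a $ i + 1) (a $ i + 1 + t)) y :: real)" for y
  proof -
    have "y \<in> hbox (a + t *\<^sub>R axis i 1) \<longleftrightarrow> y \<in> S (a $ i + t) (a $ i + 1 + t)"
      unfolding hbox_def S_def P_def by (auto simp: axis_def split: if_splits)
    then show ?thesis using t by (auto simp: S_def split: split_indicator)
  qed
  have d2: "indicator (hbox a) y = (indicator (S (a $ i + t) (a $ i + 1)) y + indicator (S (a $ i) (a $ i + t)) y :: real)" for y
  proof -
    have "y \<in> hbox a \<longleftrightarrow> y \<in> S (a $ i) (a $ i + 1)"
      unfolding hbox_def S_def P_def by auto
    then show ?thesis using t by (auto simp: S_def split: split_indicator)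
  qed
  have "(LINT y|lborel. indicator (S (a $ i + 1) (a $ i + 1 + t)) y * \<rho> y) = (LINT y|lborel. indicator (S (a $ i + 1) (a $ i + 1 + t)) (y + axis i 1) * \<rho> (y + axis i 1))"
    by (rule lborel_shift(2)[symmetric]) measurable
  also have "\<dots> = (LINT y|lborel. indicator (S (a $ i) (a $ i + t)) y * \<rho> y)"
  proof (rule integral_cong_AE)
    have sh: "indicator (S (a $ i + 1) (a $ i + 1 + t)) (y + axis i 1) = (indicator (S (a $ i) (a $ i + t)) y :: real)" for y
      by (auto simp: S_def P_def axis_def split: split_indicator)
    show "AE y in lborel. indicator (S (a $ i + 1) (a $ i + 1 + t)) (y + axis i 1) * \<rho> (y + axis i 1) = indicator (S (a $ i) (a $ i + t)) y * \<rho> y"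
      using per[of i] by eventually_elim (simp add: sh)
  qed measurable
  finally have "(LINT y|lborel. indicator (S (a $ i + 1) (a $ i + 1 + t)) y * \<rho> y) = (LINT y|lborel. indicator (S (a $ i) (a $ i + t)) y * \<rho> y)" .
  then show ?thesis unfolding d1 d2 distrib_right using int t by simp
qed

text \<open>Unit steps give integer shifts, the fractional part supplies the rest, and a negative
  shift is read backwards.\<close>

lemma hbox_integral_shift_axis:
  "(LINT y|lborel. indicator (hbox (a + t *\<^sub>R axis i 1)) y * \<rho> y) = (LINT y|lborel. indicator (hbox a) y * \<rho> y)"
proof -
  let ?I = "\<lambda>a. LINT y|lborel. indicator (hbox a) y * \<rho> y"
  have n: "?I (a + real n *\<^sub>R axis i 1) = ?I a" for a n
  proof (induction n)
    case (Suc n)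
    have "?I (a + real n *\<^sub>R axis i 1 + 1 *\<^sub>R axis i 1) = ?I (a + real n *\<^sub>R axis i 1)"
      by (rule hbox_integral_shift_small) auto
    then show ?case using Suc by (simp add: algebra_simps)
  qed simp
  have pos: "?I (a + t *\<^sub>R axis i 1) = ?I a" if t: "0 \<le> t" for a t
  proof -
    have "?I (a + real (nat \<lfloor>t\<rfloor>) *\<^sub>R axis i 1 + frac t *\<^sub>R axis i 1) = ?I (a + real (nat \<lfloor>t\<rfloor>) *\<^sub>R axis i 1)"
      by (rule hbox_integral_shift_small) (auto simp: frac_lt_1 less_imp_le)
    moreover have "a + real (nat \<lfloor>t\<rfloor>) *\<^sub>R axis i 1 + frac t *\<^sub>R axis i 1 = a + t *\<^sub>R axis i 1"
      using t by (simp add: frac_def scaleR_left_diff_distrib)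
    ultimately show ?thesis using n[of a] by simp
  qed
  show ?thesis
  proof (cases "0 \<le> t")
    case False
    then show ?thesis using pos[of "- t" "a + t *\<^sub>R axis i 1"] by simp
  qed (rule pos)
qed

lemma hbox_integral_shift:
  "(LINT y|lborel. indicator (hbox v) y * \<rho> y) = (LINT y|lborel. indicator (hbox 0) y * \<rho> y)"
proof -
  let ?I = "\<lambda>a. LINT y|lborel. indicator (hbox a) y * \<rho> y"
  have "?I (\<Sum>i\<in>S. v $ i *\<^sub>R axis i 1) = ?I 0" if "finite S" for S
    using that
  proof (induction S)
    case (insert i S)
    have "(\<Sum>j\<in>insert i S. v $ j *\<^sub>R axis j 1) = (\<Sum>j\<in>S. v $ j *\<^sub>R axis j 1) + v $ i *\<^sub>R axis i (1::real)"
      using insert by simp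
    then show ?case by (simp only: hbox_integral_shift_axis insert.IH)
  qed simp
  from this[of UNIV] show ?thesis using basis_expansion[of v] by (simp add: scalar_mult_eq_scaleR)
qed

lemma norm_hbox_0: "y \<in> hbox 0 \<Longrightarrow> norm y \<le> real CARD('n)" for y :: "real^'n"
proof -
  assume y: "y \<in> hbox 0"
  have "norm y \<le> (\<Sum>i\<in>UNIV. \<bar>y $ i\<bar>)" by (rule norm_le_l1_cart)
  also have "\<dots> \<le> (\<Sum>i\<in>(UNIV::'n set). 1)" using y by (intro sum_mono) (auto simp: hbox_def abs_if dest: spec less_imp_le, metis less_le_not_le less_trans not_less)
  finally show ?thesis by simp
qed

text \<open>Every value of the mean is the average of \<open>\<rho>(x/\<epsilon> + y)\<close> over \<open>y\<close> in a period cell, so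
  subtracting the mean amounts to translating \<open>w\<close> by at most one cell of size \<open>\<epsilon>\<close>.\<close>

lemma periodic_oscillation:
  fixes w :: "real^'n \<Rightarrow> real"
  assumes w: "integrable lborel w" and D: "0 \<le> D" and eps: "0 < \<epsilon>"
    and mod: "\<And>h. (\<integral>\<^sup>+x. ennreal \<bar>w (x + h) - w x\<bar> \<partial>lborel) \<le> ennreal (D * norm h)"
  shows "\<bar>(LINT x|lborel. \<rho> (x /\<^sub>R \<epsilon>) * w x) - (LINT y|lborel. indicator (hbox 0) y * \<rho> y) * (LINT x|lborel. w x)\<bar>
    \<le> B * real CARD('n) * \<epsilon> * D"
proof -
  have [measurable]: "w \<in> borel_measurable borel" using w by auto
  have B0: "0 \<le> B" using B[of 0] by linarith
  define m where "m = (LINT y|lborel. indicator (hbox 0) y * \<rho> y)"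
  let ?I = "LINT x|lborel. \<rho> (x /\<^sub>R \<epsilon>) * w x"
  have bdd: "integrable lborel (\<lambda>x. k x * h x)" if "integrable lborel h" "k \<in> borel_measurable borel" "\<And>x. \<bar>k x\<bar> \<le> B"
    for h k :: "real^'n \<Rightarrow> real"
  proof (rule Bochner_Integration.integrable_bound[OF integrable_mult_right[OF that(1), of B]])
    show "AE x in lborel. norm (k x * h x) \<le> norm (B * h x)"
      using that(3) B0 by (intro AE_I2) (simp add: abs_mult mult_right_mono)
  qed (use that in measurable)
  have mean: "(LINT y|lborel. indicator (hbox 0) y * \<rho> (y + z)) = m" for z
  proof -
    have "(LINT y|lborel. indicator (hbox 0) y * \<rho> (y + z)) = (LINT y|lborel. indicator (hbox z) (y + z) * \<rho> (y + z))"
      by (intro Bochner_Integration.integral_cong) (auto simp: hbox_def split: split_indicator)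
    also have "\<dots> = (LINT y|lborel. indicator (hbox z) y * \<rho> y)" by (rule lborel_shift(2)) measurable
    also have "\<dots> = m" unfolding m_def by (rule hbox_integral_shift)
    finally show ?thesis .
  qed
  have pair: "integrable (lborel \<Otimes>\<^sub>M lborel) (\<lambda>(y, x). indicator (hbox 0) y * (\<rho> (y + x /\<^sub>R \<epsilon>) * w x))"
  proof (rule integrableI_bounded)
    show "(\<lambda>(y, x). indicator (hbox 0) y * (\<rho> (y + x /\<^sub>R \<epsilon>) * w x)) \<in> borel_measurable (lborel \<Otimes>\<^sub>M lborel)" by measurable
    have "(\<integral>\<^sup>+z. ennreal (norm (case z of (y, x) \<Rightarrow> indicator (hbox 0) y * (\<rho> (y + x /\<^sub>R \<epsilon>) * w x))) \<partial>(lborel \<Otimes>\<^sub>M lborel))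
      = (\<integral>\<^sup>+y. \<integral>\<^sup>+x. ennreal (norm (indicator (hbox 0) y * (\<rho> (y + x /\<^sub>R \<epsilon>) * w x))) \<partial>lborel \<partial>lborel)"
      by (subst lborel.nn_integral_fst[symmetric]) auto
    also have "\<dots> \<le> (\<integral>\<^sup>+y. (\<integral>\<^sup>+x. ennreal (B * \<bar>w x\<bar>) \<partial>lborel) * indicator (hbox 0 :: (real^'n) set) y \<partial>lborel)"
    proof (rule nn_integral_mono)
      fix y :: "real^'n"
      show "(\<integral>\<^sup>+x. ennreal (norm (indicator (hbox 0) y * (\<rho> (y + x /\<^sub>R \<epsilon>) * w x))) \<partial>lborel) \<le> (\<integral>\<^sup>+x. ennreal (B * \<bar>w x\<bar>) \<partial>lborel) * indicator (hbox 0) y"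
        using B by (cases "y \<in> hbox 0") (auto simp: abs_mult intro!: nn_integral_mono ennreal_leI mult_right_mono)
    qed
    also have "\<dots> = (\<integral>\<^sup>+x. ennreal (B * \<bar>w x\<bar>) \<partial>lborel)"
      by (subst nn_integral_cmult_indicator) (auto simp: emeasure_hbox)
    also have "\<dots> < \<infinity>"
      using integrable_iff_bounded[of lborel "\<lambda>x. B * w x"] w B0 by (simp add: abs_mult)
    finally show "(\<integral>\<^sup>+z. ennreal (norm (case z of (y, x) \<Rightarrow> indicator (hbox 0) y * (\<rho> (y + x /\<^sub>R \<epsilon>) * w x))) \<partial>(lborel \<Otimes>\<^sub>M lborel)) < \<infinity>" .
  qed
  \<comment> \<open>\<open>q y\<close> is the integral against the translate of \<open>w\<close> by
    \<open>\<epsilon> y\<close>: a substitution moves the shift from the argument of the weight onto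
    \<open>w\<close>.\<close>
  define q where "q y = (LINT x|lborel. \<rho> (x /\<^sub>R \<epsilon>) * w (x + (- \<epsilon>) *\<^sub>R y))" for y
  have inner: "(LINT x|lborel. indicator (hbox 0) y * (\<rho> (y + x /\<^sub>R \<epsilon>) * w x)) = indicator (hbox 0) y * q y" for y
  proof -
    have "(LINT x|lborel. \<rho> (y + x /\<^sub>R \<epsilon>) * w x) = (LINT x|lborel. \<rho> ((x + \<epsilon> *\<^sub>R y) /\<^sub>R \<epsilon>) * w ((x + \<epsilon> *\<^sub>R y) + (- \<epsilon>) *\<^sub>R y))"
      using eps by (simp add: algebra_simps)
    also have "\<dots> = q y" unfolding q_def
      by (rule lborel_shift(2)[where f="\<lambda>x. \<rho> (x /\<^sub>R \<epsilon>) * w (x + (- \<epsilon>) *\<^sub>R y)"]) measurable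
    finally show ?thesis by simp
  qed
  have qi: "integrable lborel (\<lambda>y. indicator (hbox 0) y * q y)"
  proof -
    have "integrable lborel (\<lambda>y. LINT x|lborel. indicator (hbox 0) y * (\<rho> (y + x /\<^sub>R \<epsilon>) * w x))"
      by (rule lborel_pair.integrable_fst[OF pair])
    then show ?thesis by (simp only: inner)
  qed
  have ci: "integrable lborel (\<lambda>y::real^'n. indicator (hbox 0) y * ?I)"
    by (intro integrable_mult_left integrable_real_indicator) (auto simp: emeasure_hbox)
  have c: "(LINT y|lborel. indicator (hbox 0 :: (real^'n) set) y * k) = k" for k :: real
    by (simp add: measure_def emeasure_hbox)
  have "m * (LINT x|lborel. w x) = (LINT x|lborel. m * w x)" by simp
  also have "\<dots> = (LINT x|lborel. LINT y|lborel. indicator (hbox 0) y * (\<rho> (y + x /\<^sub>R \<epsilon>) * w x))"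
  proof (rule Bochner_Integration.integral_cong[OF refl])
    fix x
    have "(LINT y|lborel. (indicator (hbox 0) y * \<rho> (y + x /\<^sub>R \<epsilon>)) * w x) = m * w x"
      by (simp add: mean)
    then show "m * w x = (LINT y|lborel. indicator (hbox 0) y * (\<rho> (y + x /\<^sub>R \<epsilon>) * w x))" by (simp only: mult.assoc)
  qed
  also have "\<dots> = (LINT y|lborel. LINT x|lborel. indicator (hbox 0) y * (\<rho> (y + x /\<^sub>R \<epsilon>) * w x))"
    by (rule lborel_pair.Fubini_integral[OF pair])
  also have "\<dots> = (LINT y|lborel. indicator (hbox 0) y * q y)" by (simp only: inner)
  finally have "?I - m * (LINT x|lborel. w x) = (LINT y|lborel. indicator (hbox 0 :: (real^'n) set) y * ?I) - (LINT y|lborel. indicator (hbox 0) y * q y)"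
    by (simp only: c)
  also have "\<dots> = (LINT y|lborel. indicator (hbox 0) y * ?I - indicator (hbox 0) y * q y)"
    by (rule Bochner_Integration.integral_diff[OF ci qi, symmetric])
  finally have eq: "?I - m * (LINT x|lborel. w x) = (LINT y|lborel. indicator (hbox 0) y * ?I - indicator (hbox 0) y * q y)" .
  have diff: "\<bar>?I - q y\<bar> \<le> B * (D * (\<epsilon> * norm y))" for y
  proof -
    have i1: "integrable lborel (\<lambda>x. \<rho> (x /\<^sub>R \<epsilon>) * w x)" by (rule bdd[OF w _ B]) measurable
    have wi: "integrable lborel (\<lambda>x. w (x + (- \<epsilon>) *\<^sub>R y))"
      using w by (subst lborel_shift(1)) measurable
    have i2: "integrable lborel (\<lambda>x. \<rho> (x /\<^sub>R \<epsilon>) * w (x + (- \<epsilon>) *\<^sub>R y))" by (rule bdd[OF wi _ B]) measurable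
    have di: "integrable lborel (\<lambda>x. \<bar>w (x + (- \<epsilon>) *\<^sub>R y) - w x\<bar>)" using wi w by simp
    have "\<bar>?I - q y\<bar> = \<bar>LINT x|lborel. \<rho> (x /\<^sub>R \<epsilon>) * w x - \<rho> (x /\<^sub>R \<epsilon>) * w (x + (- \<epsilon>) *\<^sub>R y)\<bar>"
      unfolding q_def using i1 i2 by simp
    also have "\<dots> \<le> (LINT x|lborel. \<bar>\<rho> (x /\<^sub>R \<epsilon>) * w x - \<rho> (x /\<^sub>R \<epsilon>) * w (x + (- \<epsilon>) *\<^sub>R y)\<bar>)"
      by (rule integral_abs_bound)
    also have "\<dots> \<le> (LINT x|lborel. B * \<bar>w (x + (- \<epsilon>) *\<^sub>R y) - w x\<bar>)"
    proof (rule integral_mono)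
      show "integrable lborel (\<lambda>x. \<bar>\<rho> (x /\<^sub>R \<epsilon>) * w x - \<rho> (x /\<^sub>R \<epsilon>) * w (x + (- \<epsilon>) *\<^sub>R y)\<bar>)" using i1 i2 by simp
      show "integrable lborel (\<lambda>x. B * \<bar>w (x + (- \<epsilon>) *\<^sub>R y) - w x\<bar>)" using di by simp
      fix x
      have "\<bar>\<rho> (x /\<^sub>R \<epsilon>) * w x - \<rho> (x /\<^sub>R \<epsilon>) * w (x + (- \<epsilon>) *\<^sub>R y)\<bar> = \<bar>\<rho> (x /\<^sub>R \<epsilon>)\<bar> * \<bar>w (x + (- \<epsilon>) *\<^sub>R y) - w x\<bar>"
        by (simp add: right_diff_distrib[symmetric] abs_mult abs_minus_commute del: scaleR_minus_left)
      also have "\<dots> \<le> B * \<bar>w (x + (- \<epsilon>) *\<^sub>R y) - w x\<bar>" by (intro mult_right_mono B) simp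
      finally show "\<bar>\<rho> (x /\<^sub>R \<epsilon>) * w x - \<rho> (x /\<^sub>R \<epsilon>) * w (x + (- \<epsilon>) *\<^sub>R y)\<bar> \<le> B * \<bar>w (x + (- \<epsilon>) *\<^sub>R y) - w x\<bar>" .
    qed
    also have "\<dots> = B * (LINT x|lborel. \<bar>w (x + (- \<epsilon>) *\<^sub>R y) - w x\<bar>)" by simp
    also have "\<dots> \<le> B * (D * (\<epsilon> * norm y))"
    proof (rule mult_left_mono[OF _ B0])
      have "ennreal (LINT x|lborel. \<bar>w (x + (- \<epsilon>) *\<^sub>R y) - w x\<bar>) = (\<integral>\<^sup>+x. ennreal \<bar>w (x + (- \<epsilon>) *\<^sub>R y) - w x\<bar> \<partial>lborel)"
        by (rule nn_integral_eq_integral[symmetric]) (use di in auto)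
      also have "\<dots> \<le> ennreal (D * norm ((- \<epsilon>) *\<^sub>R y))" by (rule mod)
      finally show "(LINT x|lborel. \<bar>w (x + (- \<epsilon>) *\<^sub>R y) - w x\<bar>) \<le> D * (\<epsilon> * norm y)"
        using D eps by (subst (asm) ennreal_le_iff) auto
    qed
    finally show ?thesis .
  qed
  have "\<bar>?I - m * (LINT x|lborel. w x)\<bar> \<le> (LINT y|lborel. \<bar>indicator (hbox 0) y * ?I - indicator (hbox 0) y * q y\<bar>)"
    unfolding eq by (rule integral_abs_bound)
  also have "\<dots> \<le> (LINT y|lborel. indicator (hbox 0 :: (real^'n) set) y * (B * (D * (\<epsilon> * real CARD('n)))))"
  proof (rule integral_mono)
    show "integrable lborel (\<lambda>y. \<bar>indicator (hbox 0) y * ?I - indicator (hbox 0) y * q y\<bar>)" using ci qi by simp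
    show "integrable lborel (\<lambda>y. indicator (hbox 0 :: (real^'n) set) y * (B * (D * (\<epsilon> * real CARD('n)))))"
      by (intro integrable_mult_left integrable_real_indicator) (auto simp: emeasure_hbox)
    fix y :: "real^'n"
    show "\<bar>indicator (hbox 0) y * ?I - indicator (hbox 0) y * q y\<bar> \<le> indicator (hbox 0 :: (real^'n) set) y * (B * (D * (\<epsilon> * real CARD('n))))"
    proof (cases "y \<in> hbox 0")
      case True
      have "\<bar>?I - q y\<bar> \<le> B * (D * (\<epsilon> * norm y))" by (rule diff)
      also have "\<dots> \<le> B * (D * (\<epsilon> * real CARD('n)))"
        using norm_hbox_0[OF True] B0 D eps by (intro mult_left_mono) auto
      finally show ?thesis using True by simp
    qed simp
  qed
  also have "\<dots> = B * real CARD('n) * \<epsilon> * D" by (simp only: c) (simp add: ac_simps)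
  finally show ?thesis unfolding m_def .
qed

end

section \<open>Rescaled weights and Borel representatives of periodic functions\<close>

lemma AE_lborel_scale:
  fixes P :: "'a::euclidean_space \<Rightarrow> bool"
  assumes "AE x in lborel. P x" "c \<noteq> 0"
  shows "AE x in lborel. P (c *\<^sub>R x)"
proof -
  let ?D = "distr lborel borel (\<lambda>x::'a. 0 + c *\<^sub>R x)"
  have "AE x in density ?D (\<lambda>_. ennreal (\<bar>c\<bar> ^ DIM('a))). P x"
    using assms(1) unfolding lborel_affine[OF assms(2), of "0::'a", symmetric] .
  then have "AE x in ?D. 0 < ennreal (\<bar>c\<bar> ^ DIM('a)) \<longrightarrow> P x" by (subst (asm) AE_density) auto
  then have "AE x in ?D. P x" using assms(2) by simp
  then have "AE x in lborel. P (0 + c *\<^sub>R x)" by (rule AE_distrD[rotated]) measurable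
  then show ?thesis by simp
qed

lemma AE_lborel_shift:
  fixes P :: "'a::euclidean_space \<Rightarrow> bool"
  assumes "AE x in lborel. P x"
  shows "AE x in lborel. P (x + v)"
proof -
  have d: "distr lborel borel ((+) v) = (lborel :: 'a measure)" by (rule lborel_distr_plus)
  have "AE x in distr lborel borel ((+) v). P x" unfolding d by (rule assms)
  then have "AE x in lborel. P (v + x)" by (rule AE_distrD[rotated]) measurable
  then show ?thesis by (simp add: add.commute)
qed

lemma periodic_ex_borel:
  fixes \<rho> :: "real^'n::finite \<Rightarrow> real"
  assumes m: "\<rho> \<in> borel_measurable lebesgue" and b: "AE x in lebesgue. \<bar>\<rho> x\<bar> \<le> B" and B: "0 \<le> B" and per: "Q_periodic \<rho>"
  shows "\<exists>\<rho>0. \<rho>0 \<in> borel_measurable borel \<and> (\<forall>x. \<bar>\<rho>0 x\<bar> \<le> B) \<and> (\<forall>i. AE x in lborel. \<rho>0 (x + axis i 1) = \<rho>0 x) \<and>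
    (AE x in lborel. \<rho> x = \<rho>0 x) \<and> Q_mean \<rho> = (LINT y|lborel. indicator (hbox 0) y * \<rho>0 y)"
proof -
  obtain \<rho>1 where \<rho>1: "\<rho>1 \<in> borel_measurable borel" "AE x in lborel. \<rho> x = \<rho>1 x" by (rule lebesgue_real_ex_borel[OF m])
  \<comment> \<open>Truncation turns the almost everywhere bound into one that holds at every
    point.\<close>
  define \<rho>0 where "\<rho>0 x = max (- B) (min B (\<rho>1 x))" for x
  have m0[measurable]: "\<rho>0 \<in> borel_measurable borel" unfolding \<rho>0_def[abs_def] using \<rho>1(1) by measurable
  have b0: "\<bar>\<rho>0 x\<bar> \<le> B" for x using B by (auto simp: \<rho>0_def)
  have b': "AE x in lborel. \<bar>\<rho> x\<bar> \<le> B" using b by (simp add: AE_completion_iff)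
  have eq: "AE x in lborel. \<rho> x = \<rho>0 x" using \<rho>1(2) b' by eventually_elim (auto simp: \<rho>0_def)
  have per0: "AE x in lborel. \<rho>0 (x + axis i 1) = \<rho>0 x" for i
  proof -
    have "AE x in lborel. \<rho> (x + axis i 1) = \<rho> x" using per by (simp add: Q_periodic_def AE_completion_iff)
    then show ?thesis using eq AE_lborel_shift[OF eq, of "axis i 1"] by eventually_elim simp
  qed
  have "Q_mean \<rho> = (LINT x|lebesgue. indicator (cbox 0 1) x *\<^sub>R \<rho> x)"
    unfolding Q_mean_def by (rule integral_restrict_space) auto
  also have "\<dots> = (LINT x|lebesgue. indicator (hbox 0) x * \<rho>0 x)"
  proof (rule integral_cong_AE)
    show "(\<lambda>x. indicator (cbox 0 1) x *\<^sub>R \<rho> x) \<in> borel_measurable lebesgue"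
      by (intro borel_measurable_scaleR borel_measurable_indicator m) auto
    show "(\<lambda>x. indicator (hbox 0) x * \<rho>0 x) \<in> borel_measurable lebesgue"
      by (intro borel_imp_lebesgue_measurable) measurable
    show "AE x in lebesgue. indicator (cbox 0 1) x *\<^sub>R \<rho> x = indicator (hbox 0) x * \<rho>0 x"
      using AE_completion[OF eq] AE_completion[OF AE_hbox_iff[of 0]]
      by eventually_elim (auto split: split_indicator)
  qed
  also have "\<dots> = (LINT x|lborel. indicator (hbox 0) x * \<rho>0 x)" by (rule integral_completion) measurable
  finally show ?thesis using m0 b0 per0 eq by blast
qed

text \<open>The translation estimate for the zero extension of \<open>|u|^p\<close>, with modulus
  \<open>D\<close> a multiple of the energy, is inserted into \<open>periodic_oscillation\<close>.
  The constant is fixed before the weight, so it serves \<rho> and \<open>V\<close> alike.\<close>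

lemma oscillation_estimate:
  fixes \<Omega> :: "(real^'n::finite) set"
  assumes dom: "bounded_C1_domain \<Omega>" and p: "1 \<le> p"
  shows "\<exists>C\<ge>0. \<forall>u\<in>sobolev p \<Omega>. \<forall>(\<rho> :: real^'n \<Rightarrow> real) B \<epsilon>. \<rho> \<in> borel_measurable lebesgue \<longrightarrow> (AE x in lebesgue. \<bar>\<rho> x\<bar> \<le> B) \<longrightarrow> 0 \<le> B \<longrightarrow>
    Q_periodic \<rho> \<longrightarrow> 0 < \<epsilon> \<longrightarrow>
    \<bar>F_functional p \<Omega> u (rescale \<epsilon> \<rho>) - F_functional p \<Omega> u (\<lambda>x. Q_mean \<rho>)\<bar> \<le> B * C * \<epsilon> * sobolev_energy p \<Omega> u"
proof -
  have om: "open \<Omega>" "bounded \<Omega>" using dom by (auto simp: bounded_C1_domain_def)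
  obtain C where C: "C \<ge> 0" and bv: "\<And>u g h. borel_sobolev p \<Omega> u g \<Longrightarrow>
    (\<integral>\<^sup>+x. ennreal \<bar>\<bar>u (x + h)\<bar> powr p - \<bar>u x\<bar> powr p\<bar> \<partial>lborel) \<le>
    ennreal (C * norm h) * ((\<integral>\<^sup>+x. ennreal (\<bar>u x\<bar> powr p) \<partial>lborel) + (\<integral>\<^sup>+x. ennreal (norm (g x) powr p) \<partial>lborel))"
    using bv_estimate[OF dom p] by blast
  show ?thesis
  proof (intro exI[of _ "real CARD('n) * C"] conjI ballI allI impI)
    show "0 \<le> real CARD('n) * C" using C by simp
    fix u \<rho> :: "real^'n \<Rightarrow> real" and B \<epsilon> assume u: "u \<in> sobolev p \<Omega>" and m: "\<rho> \<in> borel_measurable lebesgue" and b: "AE x in lebesgue. \<bar>\<rho> x\<bar> \<le> B"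
      and B: "0 \<le> B" and per: "Q_periodic \<rho>" and eps: "0 < (\<epsilon>::real)"
    obtain u0 g0 where bs: "borel_sobolev p \<Omega> u0 g0" and ae: "AE x in lebesgue. x \<in> \<Omega> \<longrightarrow> u x = u0 x"
      and en: "sobolev_energy p \<Omega> u = (LINT x|lborel. \<bar>u0 x\<bar> powr p) + (LINT x|lborel. norm (g0 x) powr p)"
      using sobolev_ex_borel[OF om p u] by blast
    obtain \<rho>0 where \<rho>0[measurable]: "\<rho>0 \<in> borel_measurable borel" and \<rho>0b: "\<And>x. \<bar>\<rho>0 x\<bar> \<le> B"
      and \<rho>0p: "\<And>i. AE x in lborel. \<rho>0 (x + axis i 1) = \<rho>0 x" and \<rho>0e: "AE x in lborel. \<rho> x = \<rho>0 x"
      and mean: "Q_mean \<rho> = (LINT y|lborel. indicator (hbox 0) y * \<rho>0 y)"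
      using periodic_ex_borel[OF m b B per] by blast
    have [measurable]: "u0 \<in> borel_measurable borel" using bs by (simp add: borel_sobolev_def)
    have z: "x \<notin> \<Omega> \<Longrightarrow> u0 x = 0" for x using bs by (simp add: borel_sobolev_def)
    define w where "w x = \<bar>u0 x\<bar> powr p" for x
    have w: "integrable lborel w" using bs by (simp add: borel_sobolev_def w_def[abs_def])
    have gi: "integrable lborel (\<lambda>x. norm (g0 x) powr p)" using bs by (simp add: borel_sobolev_def)
    have F1: "F_functional p \<Omega> u (rescale \<epsilon> \<rho>) = (LINT x|lborel. \<rho>0 (x /\<^sub>R \<epsilon>) * w x)"
      unfolding F_functional_def
    proof (rule lebesgue_on_borel_transfer(2)[OF om(1)])
      show "(\<lambda>x. \<rho>0 (x /\<^sub>R \<epsilon>) * w x) \<in> borel_measurable borel" unfolding w_def by measurable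
      show "\<rho>0 (x /\<^sub>R \<epsilon>) * w x = 0" if "x \<notin> \<Omega>" for x using z[OF that] p by (simp add: w_def)
      have "AE x in lborel. \<rho> (inverse \<epsilon> *\<^sub>R x) = \<rho>0 (inverse \<epsilon> *\<^sub>R x)"
        using eps by (intro AE_lborel_scale[OF \<rho>0e]) auto
      from AE_completion[OF this] ae
      show "AE x in lebesgue. x \<in> \<Omega> \<longrightarrow> rescale \<epsilon> \<rho> x * \<bar>u x\<bar> powr p = \<rho>0 (x /\<^sub>R \<epsilon>) * w x"
        by eventually_elim (auto simp: rescale_def w_def)
    qed
    have F2: "F_functional p \<Omega> u (\<lambda>x. Q_mean \<rho>) = Q_mean \<rho> * (LINT x|lborel. w x)"
    proof -
      have "F_functional p \<Omega> u (\<lambda>x. Q_mean \<rho>) = (LINT x|lborel. Q_mean \<rho> * w x)"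
        unfolding F_functional_def
      proof (rule lebesgue_on_borel_transfer(2)[OF om(1)])
        show "(\<lambda>x. Q_mean \<rho> * w x) \<in> borel_measurable borel" unfolding w_def by measurable
        show "Q_mean \<rho> * w x = 0" if "x \<notin> \<Omega>" for x using z[OF that] p by (simp add: w_def)
        show "AE x in lebesgue. x \<in> \<Omega> \<longrightarrow> Q_mean \<rho> * \<bar>u x\<bar> powr p = Q_mean \<rho> * w x"
          using ae by eventually_elim (auto simp: w_def)
      qed
      then show ?thesis by simp
    qed
    have e0: "0 \<le> sobolev_energy p \<Omega> u" by (rule sobolev_energy_nonneg)
    have mod: "(\<integral>\<^sup>+x. ennreal \<bar>w (x + h) - w x\<bar> \<partial>lborel) \<le> ennreal (C * sobolev_energy p \<Omega> u * norm h)" for h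
    proof -
      have "(\<integral>\<^sup>+x. ennreal (\<bar>u0 x\<bar> powr p) \<partial>lborel) + (\<integral>\<^sup>+x. ennreal (norm (g0 x) powr p) \<partial>lborel) = ennreal (sobolev_energy p \<Omega> u)"
        unfolding en using w gi by (subst (1 2) nn_integral_eq_integral) (auto simp: w_def[abs_def] integral_nonneg_AE)
      then show ?thesis
        using bv[OF bs, of h] C e0 by (simp add: w_def ennreal_mult[symmetric] ac_simps)
    qed
    have "\<bar>(LINT x|lborel. \<rho>0 (x /\<^sub>R \<epsilon>) * w x) - (LINT y|lborel. indicator (hbox 0) y * \<rho>0 y) * (LINT x|lborel. w x)\<bar>
       \<le> B * real CARD('n) * \<epsilon> * (C * sobolev_energy p \<Omega> u)"
      by (rule periodic_oscillation[OF \<rho>0 \<rho>0b \<rho>0p w _ eps mod]) (use C e0 in simp)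
    then show "\<bar>F_functional p \<Omega> u (rescale \<epsilon> \<rho>) - F_functional p \<Omega> u (\<lambda>x. Q_mean \<rho>)\<bar> \<le> B * (real CARD('n) * C) * \<epsilon> * sobolev_energy p \<Omega> u"
      unfolding F1 F2 unfolding mean by (simp add: ac_simps)
  qed
qed

section \<open>Columns over the boundary\<close>

locale chart =
  fixes \<Omega> :: "(real^'n::finite) set" and x0 :: "real^'n" and r :: real and e :: "real^'n" and \<gamma> :: "real^'n \<Rightarrow> real"
    and L p :: real and d :: nat and V :: real
  assumes ch: "boundary_chart \<Omega> x0 r e \<gamma> L" and om: "open \<Omega>" and fr: "x0 \<in> frontier \<Omega>" and p: "1 \<le> p" and N: "2 \<le> CARD('n)"
    and d_def: "d = CARD('n) - 1" and V_def: "V = unit_ball_vol (real CARD('n))"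
begin

text \<open>\<open>P\<close> projects along \<open>e\<close> onto the graph and \<open>K\<close> is
  a collar of height \<open>T\<close> above it; the column over a boundary set \<open>A\<close> is
  the part of \<open>K\<close> that \<open>P\<close> maps into \<open>A\<close>. \<open>S\<close> is
  a smaller boundary patch, so that columns over small balls centred in \<open>S\<close> are not cut
  off by the ball that bounds \<open>K\<close>. \<open>T\<close> is small enough for absorption,
  \<open>p * T \<le> 1 / 2\<close>.\<close>

definition "a = r / 2"
definition "T = min (r / 8) (1 / (2 * p))"
definition "P z = z - \<gamma> z *\<^sub>R e"
definition "K = {z \<in> ball x0 a. 0 < \<gamma> z \<and> \<gamma> z < T}"
definition "S = {x \<in> ball x0 (a / 2). \<gamma> x = 0}"

lemma r: "0 < r" and e: "norm e = 1" and L: "0 \<le> L" and cont: "continuous_on UNIV \<gamma>" and shift: "\<gamma> (x + t *\<^sub>R e) = \<gamma> x + t"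
  and in_om: "x \<in> ball x0 r \<Longrightarrow> x \<in> \<Omega> \<longleftrightarrow> 0 < \<gamma> x"
  using ch by (auto simp: boundary_chart_def)

lemma T: "0 < T" "T \<le> r / 8" "p * T \<le> 1 / 2" "T \<le> a / 4" "0 < a"
proof -
  show "0 < T" "T \<le> r / 8" "T \<le> a / 4" "0 < a" using r p by (auto simp: T_def a_def)
  have "p * T \<le> p * (1 / (2 * p))" using p by (intro mult_left_mono) (auto simp: T_def)
  then show "p * T \<le> 1 / 2" using p by simp
qed

lemma V: "0 < V" by (simp add: V_def)

lemma card_eq: "CARD('n) = Suc d" and d0: "d \<noteq> 0" using N by (auto simp: d_def)

lemma emeasure_balls:
  "0 \<le> \<rho> \<Longrightarrow> emeasure lborel (cball (y :: real^'n) \<rho>) = ennreal (V * \<rho> ^ CARD('n))"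
  "0 \<le> \<rho> \<Longrightarrow> emeasure lborel (ball (y :: real^'n) \<rho>) = ennreal (V * \<rho> ^ CARD('n))"
  by (simp_all add: emeasure_cball emeasure_ball V_def)

lemma surface_measure_eq: "surface_measure = (hausdorff_measure d :: (real^'n) measure)"
  by (simp add: surface_measure_def d_def)

lemma gamma_meas[measurable]: "\<gamma> \<in> borel_measurable borel" by (rule borel_measurable_continuous_onI[OF cont])

lemma P_meas[measurable]: "P \<in> borel_measurable borel" unfolding P_def[abs_def] by measurable

lemma gamma_P[simp]: "\<gamma> (P z) = 0"
  using shift[of z "- \<gamma> z"] by (simp add: P_def)

lemma K_borel[measurable]: "K \<in> sets borel"
proof -
  have "{z. 0 < \<gamma> z \<and> \<gamma> z < T} \<in> sets borel" by measurable
  then have "ball x0 a \<inter> {z. 0 < \<gamma> z \<and> \<gamma> z < T} \<in> sets borel" by simp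
  moreover have "K = ball x0 a \<inter> {z. 0 < \<gamma> z \<and> \<gamma> z < T}" by (auto simp: K_def)
  ultimately show ?thesis by simp
qed

lemma preimage_borel: "A \<in> sets borel \<Longrightarrow> {z \<in> K. P z \<in> A} \<in> sets borel"
proof -
  assume A: "A \<in> sets borel"
  have "{z \<in> K. P z \<in> A} = K \<inter> P -` A" by auto
  then show ?thesis using measurable_sets_borel[OF P_meas A] K_borel by simp
qed

lemma ball_near: "x \<in> ball x0 b \<Longrightarrow> norm (y - x) < c \<Longrightarrow> b + c \<le> s \<Longrightarrow> y \<in> ball x0 s"
  using dist_triangle[of x0 y x] by (simp add: dist_norm norm_minus_commute)

lemma norm_P_diff: "norm (P z - z) = \<bar>\<gamma> z\<bar>"
  using e by (simp add: P_def)

lemma P_near: "z \<in> K \<Longrightarrow> P z \<in> ball x0 (a + T)"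
proof -
  assume z: "z \<in> K"
  have "z \<in> ball x0 a" using z unfolding K_def by blast
  moreover have "norm (P z - z) < T" using z unfolding norm_P_diff K_def by simp
  ultimately show ?thesis by (rule ball_near) simp
qed

lemma line_in_om: "z \<in> K \<Longrightarrow> 0 < \<sigma> \<Longrightarrow> \<sigma> \<le> T \<Longrightarrow> P z + \<sigma> *\<^sub>R e \<in> \<Omega>"
proof -
  assume z: "z \<in> K" and \<sigma>: "0 < \<sigma>" "\<sigma> \<le> T"
  have "P z + \<sigma> *\<^sub>R e \<in> ball x0 r"
  proof (rule ball_near[OF P_near[OF z]])
    show "norm (P z + \<sigma> *\<^sub>R e - P z) < 2 * T" using \<sigma> e T(1) by simp
    show "a + T + 2 * T \<le> r" using T(2) r unfolding a_def by linarith
  qed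
  then show ?thesis using \<sigma> shift[of "P z" \<sigma>] in_om by simp
qed

lemma zero_in_frontier: "x \<in> ball x0 r \<Longrightarrow> \<gamma> x = 0 \<Longrightarrow> x \<in> frontier \<Omega>"
proof -
  assume x: "x \<in> ball x0 r" "\<gamma> x = 0"
  have "x \<notin> \<Omega>" using x in_om by simp
  moreover have "x \<in> closure \<Omega>"
  proof (rule closure_approachable[THEN iffD2], intro allI impI)
    fix \<epsilon> :: real assume eps: "0 < \<epsilon>"
    define t where "t = min (\<epsilon> / 2) ((r - dist x0 x) / 2)"
    have t: "0 < t" "t < \<epsilon>" "t < r - dist x0 x" using eps x by (auto simp: t_def min_def)
    have "dist x0 (x + t *\<^sub>R e) \<le> dist x0 x + t" using dist_triangle[of x0 "x + t *\<^sub>R e" x] t e by (simp add: dist_norm)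
    then have "x + t *\<^sub>R e \<in> ball x0 r" using t by simp
    then have "x + t *\<^sub>R e \<in> \<Omega>" using in_om shift[of x t] x t by simp
    moreover have "dist (x + t *\<^sub>R e) x < \<epsilon>" using t e by (simp add: dist_norm)
    ultimately show "\<exists>y\<in>\<Omega>. dist y x < \<epsilon>" by blast
  qed
  ultimately show ?thesis using om by (simp add: frontier_def interior_open)
qed

lemma frontier_zero: "x \<in> ball x0 r \<Longrightarrow> x \<in> frontier \<Omega> \<Longrightarrow> \<gamma> x = 0"
proof -
  assume x: "x \<in> ball x0 r" "x \<in> frontier \<Omega>"
  have "x \<notin> \<Omega>" using x om by (simp add: frontier_def interior_open)
  then have le: "\<gamma> x \<le> 0" using in_om x(1) by fastforce
  have "\<not> \<gamma> x < 0"
  proof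
    assume neg: "\<gamma> x < 0"
    have "open ({y. \<gamma> y < 0} \<inter> ball x0 r)" using cont by (intro open_Int open_Collect_less continuous_on_const) auto
    moreover have "x \<in> {y. \<gamma> y < 0} \<inter> ball x0 r" using neg x by simp
    moreover have "x \<in> closure \<Omega>" using x by (simp add: frontier_def)
    ultimately have "\<Omega> \<inter> ({y. \<gamma> y < 0} \<inter> ball x0 r) \<noteq> {}"
      using open_Int_closure_eq_empty by (metis disjoint_iff Int_commute)
    then show False using in_om by fastforce
  qed
  with le show ?thesis by simp
qed

lemma P_frontier: "z \<in> K \<Longrightarrow> P z \<in> frontier \<Omega>"
proof (rule zero_in_frontier)
  assume "z \<in> K"
  then have "P z \<in> ball x0 (a + T)" by (rule P_near)
  moreover have "a + T \<le> r" using T r by (simp add: a_def)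
  ultimately show "P z \<in> ball x0 r" by simp
qed simp

section \<open>Volume of columns compared with surface measure\<close>

definition "c1 = 3 * T * V * 2 * 2 ^ d"

lemma c1: "0 < c1" unfolding c1_def using T V by simp

text \<open>A column over a ball of radius \<delta> is covered by about \<open>T / \<delta>\<close>
  balls of radius \<open>2 * \<delta>\<close> stacked along \<open>e\<close>. One factor \<delta> of
  their volume cancels against their number, which leaves the power \<open>d\<close>.\<close>

lemma column_cball_pos:
  assumes \<delta>: "0 < \<delta>" "\<delta> \<le> T"
  shows "emeasure lborel {z \<in> K. P z \<in> cball y \<delta>} \<le> ennreal (c1 * \<delta> ^ d)"
proof -
  define m where "m = nat \<lceil>T / \<delta>\<rceil>"
  have cov: "{z \<in> K. P z \<in> cball y \<delta>} \<subseteq> (\<Union>j\<in>{..m}. cball (y + (real j * \<delta>) *\<^sub>R e) (2 * \<delta>))"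
  proof
    fix z assume z: "z \<in> {z \<in> K. P z \<in> cball y \<delta>}"
    then have g: "0 < \<gamma> z" "\<gamma> z < T" by (auto simp: K_def)
    define j where "j = nat \<lfloor>\<gamma> z / \<delta>\<rfloor>"
    have fl: "real j = of_int \<lfloor>\<gamma> z / \<delta>\<rfloor>" using g \<delta> by (simp add: j_def)
    have "\<gamma> z / \<delta> \<le> T / \<delta>" using g \<delta> by (simp add: divide_right_mono)
    then have "j \<le> m" unfolding j_def m_def by (intro nat_mono) linarith
    moreover have "real j \<le> \<gamma> z / \<delta>" "\<gamma> z / \<delta> < real j + 1" unfolding fl by linarith+
    then have "real j * \<delta> \<le> \<gamma> z" "\<gamma> z < real j * \<delta> + \<delta>" using \<delta> by (simp_all add: field_simps)
    then have "\<bar>\<gamma> z - real j * \<delta>\<bar> \<le> \<delta>" by simp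
    moreover have eqz: "z - (y + (real j * \<delta>) *\<^sub>R e) = (P z - y) + (\<gamma> z - real j * \<delta>) *\<^sub>R e"
      by (simp add: P_def algebra_simps)
    moreover have "norm (z - (y + (real j * \<delta>) *\<^sub>R e)) \<le> norm (P z - y) + norm ((\<gamma> z - real j * \<delta>) *\<^sub>R e)"
      unfolding eqz by (rule norm_triangle_ineq)
    moreover have "norm ((\<gamma> z - real j * \<delta>) *\<^sub>R e) = \<bar>\<gamma> z - real j * \<delta>\<bar>" using e by simp
    moreover have "norm (P z - y) \<le> \<delta>" using z by (simp add: dist_norm norm_minus_commute)
    ultimately have "norm (z - (y + (real j * \<delta>) *\<^sub>R e)) \<le> 2 * \<delta>"
      by linarith
    then have "z \<in> cball (y + (real j * \<delta>) *\<^sub>R e) (2 * \<delta>)" by (simp add: dist_norm norm_minus_commute)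
    then show "z \<in> (\<Union>j\<in>{..m}. cball (y + (real j * \<delta>) *\<^sub>R e) (2 * \<delta>))" using \<open>j \<le> m\<close> by blast
  qed
  have "emeasure lborel {z \<in> K. P z \<in> cball y \<delta>} \<le> emeasure lborel (\<Union>j\<in>{..m}. cball (y + (real j * \<delta>) *\<^sub>R e) (2 * \<delta>))"
    by (rule emeasure_mono[OF cov]) auto
  also have "\<dots> \<le> (\<Sum>j\<in>{..m}. emeasure lborel (cball (y + (real j * \<delta>) *\<^sub>R e) (2 * \<delta>)))"
    by (rule emeasure_subadditive_finite) auto
  also have "\<dots> = (\<Sum>j\<in>{..m}. ennreal (V * (2 * \<delta>) ^ CARD('n)))"
    using \<delta> by (simp add: emeasure_balls)
  also have "\<dots> = ennreal ((real m + 1) * (V * (2 * \<delta>) ^ CARD('n)))"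
    using \<delta> V by (subst sum_ennreal) (auto intro: less_imp_le)
  also have "\<dots> \<le> ennreal (c1 * \<delta> ^ d)"
  proof (rule ennreal_leI)
    have "1 \<le> T / \<delta>" using \<delta> by simp
    moreover have "real m \<le> T / \<delta> + 1" using \<delta> T unfolding m_def by (simp add: of_nat_ceiling)
    ultimately have "real m + 1 \<le> 3 * (T / \<delta>)" by linarith
    then have "(real m + 1) * (V * (2 * \<delta>) ^ CARD('n)) \<le> 3 * (T / \<delta>) * (V * (2 * \<delta>) ^ CARD('n))"
      using V \<delta> by (intro mult_right_mono) auto
    also have "3 * (T / \<delta>) * (V * (2 * \<delta>) ^ CARD('n)) = c1 * \<delta> ^ d"
      unfolding card_eq using \<delta> by (simp add: c1_def power_mult_distrib)
    finally show "(real m + 1) * (V * (2 * \<delta>) ^ CARD('n)) \<le> c1 * \<delta> ^ d" .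
  qed
  finally show ?thesis .
qed

text \<open>Covers in the Hausdorff premeasure may contain single points, of diameter 0; this radius
  is reached from positive ones in the limit, where \<open>d\<close> being nonzero makes the bound
  vanish.\<close>

lemma column_cball:
  assumes \<delta>: "0 \<le> \<delta>" "\<delta> \<le> T"
  shows "emeasure lborel {z \<in> K. P z \<in> cball y \<delta>} \<le> ennreal (c1 * \<delta> ^ d)"
proof (cases "\<delta> = 0")
  case True
  have "emeasure lborel {z \<in> K. P z \<in> cball y 0} \<le> 0"
  proof (rule tendsto_lowerbound)
    have "((\<lambda>s. c1 * s ^ d) \<longlongrightarrow> c1 * 0 ^ d) (at_right 0)" by (intro tendsto_intros)
    then have "((\<lambda>s. ennreal (c1 * s ^ d)) \<longlongrightarrow> ennreal (c1 * 0 ^ d)) (at_right 0)" by (rule tendsto_ennrealI)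
    then show "((\<lambda>s. ennreal (c1 * s ^ d)) \<longlongrightarrow> 0) (at_right 0)" using d0 by (simp add: power_0_left)
    show "\<forall>\<^sub>F s in at_right 0. emeasure lborel {z \<in> K. P z \<in> cball y 0} \<le> ennreal (c1 * s ^ d)"
      unfolding eventually_at_right_field
    proof (intro exI[of _ T] conjI allI impI T(1))
      fix s assume s: "0 < s" "s < T"
      have "emeasure lborel {z \<in> K. P z \<in> cball y 0} \<le> emeasure lborel {z \<in> K. P z \<in> cball y s}"
        using s by (intro emeasure_mono) (auto intro: preimage_borel simp del: mem_cball)
      also have "\<dots> \<le> ennreal (c1 * s ^ d)" using s by (intro column_cball_pos) auto
      finally show "emeasure lborel {z \<in> K. P z \<in> cball y 0} \<le> ennreal (c1 * s ^ d)" .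
    qed
  qed simp
  then show ?thesis using True by simp
qed (use \<delta> in \<open>intro column_cball_pos, auto\<close>)

definition "c2 = c1 * 2 ^ d / unit_ball_vol (real d)"

lemma c2: "0 < c2" unfolding c2_def using c1 by simp

text \<open>A cover of \<open>A\<close> of mesh \<open>T\<close> lifts to a cover of the column, and
  each covering set lies in a ball around one of its points whose radius is the diameter of the set.
  The factor \<open>2 ^ d\<close> in \<open>c2\<close> accounts for the half diameters in the
  premeasure.\<close>

lemma column_le_hausdorff:
  fixes A :: "(real^'n) set"
  assumes A: "A \<in> sets borel"
  shows "emeasure lborel {z \<in> K. P z \<in> A} \<le> ennreal c2 * emeasure surface_measure A"
proof -
  have "emeasure lborel {z \<in> K. P z \<in> A} \<le> ennreal c2 * hausdorff_premeasure d T A"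
  proof -
    have "ennreal (1 / c2) * emeasure lborel {z \<in> K. P z \<in> A} \<le> hausdorff_premeasure d T A"
      unfolding hausdorff_premeasure_def
    proof (rule INF_greatest, clarsimp)
      fix E :: "nat \<Rightarrow> (real^'n) set"
      assume cov: "A \<subseteq> \<Union> (range E)" and E: "\<forall>i. bounded (E i) \<and> diameter (E i) \<le> T"
      define y where "y i = (SOME y. y \<in> E i)" for i
      define W where "W i = (if E i = {} then {} else {z \<in> K. P z \<in> cball (y i) (diameter (E i))})" for i
      have Ecb: "E i \<subseteq> cball (y i) (diameter (E i))" for i
      proof
        fix x assume x: "x \<in> E i"
        then have "y i \<in> E i" unfolding y_def by (rule someI)
        then show "x \<in> cball (y i) (diameter (E i))" using diameter_bounded_bound[of "E i" "y i" x] E x by simp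
      qed
      have "{z \<in> K. P z \<in> A} \<subseteq> (\<Union>i. W i)"
      proof
        fix z assume z: "z \<in> {z \<in> K. P z \<in> A}"
        then obtain i where "P z \<in> E i" using cov by blast
        then have "z \<in> W i" using z Ecb[of i] by (auto simp: W_def)
        then show "z \<in> (\<Union>i. W i)" by blast
      qed
      moreover have W: "W i \<in> sets lborel" for i unfolding W_def by (auto intro: preimage_borel simp del: mem_cball)
      ultimately have "emeasure lborel {z \<in> K. P z \<in> A} \<le> emeasure lborel (\<Union>i. W i)"
        by (intro emeasure_mono) auto
      also have "\<dots> \<le> (suminf (\<lambda>i. emeasure lborel (W i)))" using W by (intro emeasure_subadditive_countably) auto
      also have "\<dots> \<le> (suminf (\<lambda>i. ennreal c2 * (if E i = {} then 0 else ennreal (unit_ball_vol (real d) * (diameter (E i) / 2) ^ d))))"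
      proof (rule suminf_le)
        fix i
        show "emeasure lborel (W i) \<le> ennreal c2 * (if E i = {} then 0 else ennreal (unit_ball_vol (real d) * (diameter (E i) / 2) ^ d))"
        proof (cases "E i = {}")
          case False
          have dm: "0 \<le> diameter (E i)" using E by (intro diameter_ge_0) auto
          have u0: "unit_ball_vol (real d) \<noteq> 0" using unit_ball_vol_pos[of "real d"] by (metis less_irrefl of_nat_0_le_iff)
          have "emeasure lborel (W i) \<le> ennreal (c1 * diameter (E i) ^ d)"
            unfolding W_def using False E dm by (auto intro!: column_cball simp del: mem_cball)
          also have "c1 * diameter (E i) ^ d = c2 * (unit_ball_vol (real d) * (diameter (E i) / 2) ^ d)"
            using u0 by (simp add: c2_def power_divide)
          finally show ?thesis using False c2 dm by (simp add: ennreal_mult)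
        qed (simp add: W_def)
      qed auto
      also have "\<dots> = ennreal c2 * (suminf (\<lambda>i. if E i = {} then 0 else ennreal (unit_ball_vol (real d) * (diameter (E i) / 2) ^ d)))"
        by simp
      finally have "ennreal (1 / c2) * emeasure lborel {z \<in> K. P z \<in> A} \<le> ennreal (1 / c2) * (ennreal c2 * (suminf (\<lambda>i. if E i = {} then 0 else ennreal (unit_ball_vol (real d) * (diameter (E i) / 2) ^ d))))"
        by (rule mult_left_mono) simp
      then show "ennreal (1 / c2) * emeasure lborel {z \<in> K. P z \<in> A} \<le> (suminf (\<lambda>i. if E i = {} then 0 else ennreal (unit_ball_vol (real d) * (diameter (E i) / 2) ^ d)))"
        using c2 by (simp add: mult.assoc[symmetric] ennreal_mult[symmetric])
    qed
    then have "ennreal c2 * (ennreal (1 / c2) * emeasure lborel {z \<in> K. P z \<in> A}) \<le> ennreal c2 * hausdorff_premeasure d T A"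
      by (rule mult_left_mono) simp
    then show ?thesis using c2 by (simp add: mult.assoc[symmetric] ennreal_mult[symmetric])
  qed
  also have "\<dots> \<le> ennreal c2 * emeasure surface_measure A"
    using T(1) A hausdorff_premeasure_le_outer[of T d A]
    by (intro mult_left_mono) (auto simp: surface_measure_eq emeasure_hausdorff_measure)
  finally show ?thesis .
qed

definition "c3 = T / 8 * V / (L + 3) ^ d"

lemma c3: "0 < c3" unfolding c3_def using T V L by simp

text \<open>About \<open>T / (4 * \<eta>)\<close> disjoint balls of radius \<eta> are stacked along
  \<open>e\<close> above \<open>x\<close>, centred at heights between \<open>T / 4\<close> and
  \<open>3 * T / 4\<close>. With \<open>\<eta> = \<rho> / (L + 3)\<close> the Lipschitz variation of
  the height keeps \<open>P z\<close> within \<rho> of \<open>x\<close>.\<close>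

lemma column_ball_ge:
  assumes x: "x \<in> S" and \<rho>: "0 < \<rho>" "\<rho> \<le> T / 4"
  shows "ennreal (c3 * \<rho> ^ d) \<le> emeasure lborel {z \<in> K. P z \<in> ball x \<rho>}"
proof -
  define \<eta> where "\<eta> = \<rho> / (L + 3)"
  have \<eta>: "0 < \<eta>" "(L + 3) * \<eta> = \<rho>" using \<rho> L by (auto simp: \<eta>_def)
  have \<eta>L: "L * \<eta> + 3 * \<eta> = \<rho>" "0 \<le> L * \<eta>" using \<eta> L by (auto simp: algebra_simps)
  have xs: "\<gamma> x = 0" "x \<in> ball x0 (a / 2)" using x by (auto simp: S_def)
  define n where "n = nat \<lfloor>T / (4 * \<eta>)\<rfloor>"
  have n1: "real n \<le> T / (4 * \<eta>)" using T \<eta> by (simp add: n_def)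
  \<comment> \<open>A real number that is at least 1 is at most twice its floor.\<close>
  have n2: "T / (8 * \<eta>) \<le> real n"
  proof -
    have "4 * \<eta> \<le> T" using \<eta>L \<eta>(1) \<rho>(2) by linarith
    then have "1 \<le> T / (4 * \<eta>)" using \<eta>(1) by (subst pos_le_divide_eq) auto
    then have fl: "1 \<le> \<lfloor>T / (4 * \<eta>)\<rfloor>" by simp
    then have rn: "real n = of_int \<lfloor>T / (4 * \<eta>)\<rfloor>" by (simp add: n_def)
    have "real n \<ge> 1" unfolding rn using fl by linarith
    moreover have "T / (4 * \<eta>) < real n + 1" unfolding rn by linarith
    moreover have "T / (8 * \<eta>) = T / (4 * \<eta>) / 2" by simp
    ultimately show ?thesis by linarith
  qed
  define c where "c j = x + (T / 4 + 2 * \<eta> * real j) *\<^sub>R e" for j :: nat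
  have sub: "ball (c j) \<eta> \<subseteq> {z \<in> K. P z \<in> ball x \<rho>}" if j: "j < n" for j
  proof
    fix z assume z: "z \<in> ball (c j) \<eta>"
    define t where "t = T / 4 + 2 * \<eta> * real j"
    define w where "w = z - c j"
    have w: "norm w < \<eta>" using z by (simp add: w_def dist_norm norm_minus_commute)
    have zt: "z = (x + w) + t *\<^sub>R e" by (simp add: w_def c_def t_def)
    have "2 * \<eta> * real j \<le> 2 * \<eta> * (T / (4 * \<eta>))" using j n1 \<eta>(1) by (intro mult_left_mono) auto
    then have t: "T / 4 \<le> t" "t \<le> 3 * T / 4" using \<eta>(1) by (auto simp: t_def)
    have "\<eta> \<le> r / 8" using \<eta>L \<eta>(1) \<rho> T(1,2) by linarith
    then have "x + w \<in> ball x0 r"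
      using w r by (intro ball_near[OF xs(2), of _ \<eta>]) (simp_all add: a_def)
    moreover have "x \<in> ball x0 r" using xs(2) r by (simp add: a_def)
    ultimately have "\<bar>\<gamma> (x + w) - \<gamma> x\<bar> \<le> (L + 1) * norm w" using boundary_chart_lipschitz[OF ch, of "x + w" x] by simp
    also have "\<dots> \<le> (L + 1) * \<eta>" using w L by (intro mult_left_mono) auto
    finally have g: "\<bar>\<gamma> z - t\<bar> \<le> L * \<eta> + \<eta>" using xs zt shift[of "x + w" t] by (simp add: algebra_simps)
    have "L * \<eta> + \<eta> < T / 4" using \<eta>L \<eta>(1) \<rho>(2) by linarith
    then have gz: "0 < \<gamma> z" "\<gamma> z < T" using g t by linarith+
    have "norm (z - x) \<le> norm w + norm (t *\<^sub>R e)" unfolding zt using norm_triangle_ineq[of w "t *\<^sub>R e"] by (simp add: algebra_simps)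
    then have "norm (z - x) < \<eta> + 3 * T / 4" using w t T e by simp
    moreover have "\<eta> < T / 4" using \<eta>L \<eta>(1) \<rho>(2) by linarith
    ultimately have "z \<in> ball x0 a" using T(4,5) by (intro ball_near[OF xs(2), of z T]) simp_all
    moreover have "norm (P z - x) \<le> norm w + norm ((t - \<gamma> z) *\<^sub>R e)"
    proof -
      have "P z - x = w + (t - \<gamma> z) *\<^sub>R e" unfolding P_def by (subst zt) (simp add: algebra_simps)
      then show ?thesis by (simp only: norm_triangle_ineq)
    qed
    then have "norm (P z - x) < \<rho>" using w g e \<eta>L(1) \<eta>(1) by (simp add: abs_minus_commute)
    ultimately show "z \<in> {z \<in> K. P z \<in> ball x \<rho>}" using gz by (simp add: K_def dist_norm norm_minus_commute)
  qed
  have disj: "disjoint_family_on (\<lambda>j. ball (c j) \<eta>) {..<n}"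
    unfolding disjoint_family_on_def
  proof (intro ballI impI)
    fix i j assume ij: "i \<noteq> (j::nat)"
    show "ball (c i) \<eta> \<inter> ball (c j) \<eta> = {}"
    proof (rule disjoint_ballI)
      have "c i - c j = (2 * \<eta> * (real i - real j)) *\<^sub>R e" by (simp add: c_def algebra_simps)
      then have "dist (c i) (c j) = 2 * \<eta> * \<bar>real i - real j\<bar>" using e \<eta>(1) by (simp add: dist_norm abs_mult)
      moreover have "1 \<le> \<bar>real i - real j\<bar>" using ij by linarith
      ultimately show "\<eta> + \<eta> \<le> dist (c i) (c j)" using \<eta>(1) by simp
    qed
  qed
  have "ennreal (c3 * \<rho> ^ d) = ennreal (T / (8 * \<eta>) * (V * \<eta> ^ CARD('n)))"
  proof -
    have "\<eta> ^ CARD('n) = \<eta> * \<eta> ^ d" by (simp add: card_eq)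
    moreover have "\<eta> ^ d = \<rho> ^ d / (L + 3) ^ d" by (simp add: \<eta>_def power_divide)
    ultimately show ?thesis using \<eta>(1) by (simp add: c3_def mult.assoc)
  qed
  also have "\<dots> \<le> ennreal (real n * (V * \<eta> ^ CARD('n)))"
    using n2 V \<eta>(1) by (intro ennreal_leI mult_right_mono) auto
  also have "\<dots> = (\<Sum>j<n. emeasure lborel (ball (c j) \<eta>))"
    using \<eta>(1) V by (simp add: emeasure_balls ennreal_mult ennreal_of_nat_eq_real_of_nat)
  also have "\<dots> = emeasure lborel (\<Union>j<n. ball (c j) \<eta>)"
    by (rule sum_emeasure) (use disj in auto)
  also have "\<dots> \<le> emeasure lborel {z \<in> K. P z \<in> ball x \<rho>}"
    using sub by (intro emeasure_mono) (auto intro: preimage_borel simp del: mem_ball)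
  finally show ?thesis .
qed

section \<open>Packing of boundary points and local finiteness of the surface measure\<close>

definition "K0 = {z \<in> ball x0 (a / 8). 0 < \<gamma> z \<and> \<gamma> z < T}"

lemma K0: "K0 \<subseteq> K" "z \<in> K0 \<Longrightarrow> P z \<in> S" "open K0" "K0 \<noteq> {}"
proof -
  show "K0 \<subseteq> K" using T by (auto simp: K0_def K_def)
  show "P z \<in> S" if "z \<in> K0" for z
  proof -
    have z: "z \<in> ball x0 (a / 8)" using that unfolding K0_def by blast
    have "norm (P z - z) < T" using that unfolding norm_P_diff K0_def by simp
    then have "P z \<in> ball x0 (a / 2)" by (rule ball_near[OF z]) (use T(4,5) in simp)
    then show ?thesis unfolding S_def by simp
  qed
  have "K0 = ball x0 (a / 8) \<inter> {z. 0 < \<gamma> z} \<inter> {z. \<gamma> z < T}" by (auto simp: K0_def)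
  moreover have "open (ball x0 (a / 8) \<inter> {z. 0 < \<gamma> z} \<inter> {z. \<gamma> z < T})"
    using cont by (intro open_Int open_Collect_less continuous_on_const) auto
  ultimately show "open K0" by simp
  define t where "t = min (a / 16) (T / 2)"
  have t: "0 < t" "t < a / 8" "t < T" using T by (auto simp: t_def)
  have "\<gamma> x0 = 0" using frontier_zero[OF _ fr] r by simp
  then have "x0 + t *\<^sub>R e \<in> K0" using t e shift[of x0 t] by (simp add: K0_def dist_norm)
  then show "K0 \<noteq> {}" by blast
qed

lemma K_finite: "emeasure lborel K < \<infinity>"
  by (rule emeasure_bounded_finite) (rule bounded_subset[OF bounded_ball[of x0 a]], auto simp: K_def)

definition "m0 = measure lborel K0"

lemma m0: "0 < m0" "emeasure lborel K0 = ennreal m0"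
proof -
  have fin: "emeasure lborel K0 < \<infinity>" using K_finite emeasure_mono[OF K0(1), of lborel] by (simp add: le_less_trans)
  show eq: "emeasure lborel K0 = ennreal m0" unfolding m0_def using fin by (intro emeasure_eq_ennreal_measure) auto
  obtain x s where "0 < s" "ball x s \<subseteq> K0" using K0(3,4) unfolding open_contains_ball by blast
  then have "emeasure lborel (ball x s) \<le> emeasure lborel K0" using K0(3) by (intro emeasure_mono) auto
  moreover have "0 < emeasure lborel (ball x s)" using \<open>0 < s\<close> V by (simp add: emeasure_balls)
  ultimately show "0 < m0" unfolding eq by (metis ennreal_less_zero_iff leD not_gr_zero order_less_le_trans)
qed

text \<open>Greedy choice by volume: as long as the columns over balls of radius
  \<open>2 * \<rho>\<close> around the chosen points have total volume below that of
  \<open>K0\<close>, some \<open>z\<close> in \<open>K0\<close> escapes them, and \<open>P z\<close>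
  is the next point.\<close>

lemma packing:
  assumes \<rho>: "0 < \<rho>" "2 * \<rho> \<le> T" and k: "real k * (c1 * (2 * \<rho>) ^ d) < m0"
  shows "\<exists>X. finite X \<and> X \<subseteq> S \<and> card X = k \<and> (\<forall>x\<in>X. \<forall>y\<in>X. x \<noteq> y \<longrightarrow> 2 * \<rho> \<le> dist x y)"
  using k
proof (induction k)
  case 0 then show ?case by (intro exI[of _ "{}"]) auto
next
  case (Suc k)
  have nn: "0 \<le> c1 * (2 * \<rho>) ^ d" using c1 \<rho> by simp
  then have lt: "real k * (c1 * (2 * \<rho>) ^ d) < m0" using Suc.prems by (simp add: algebra_simps)
  then obtain X where X: "finite X" "X \<subseteq> S" "card X = k" "\<forall>x\<in>X. \<forall>y\<in>X. x \<noteq> y \<longrightarrow> 2 * \<rho> \<le> dist x y"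
    using Suc.IH by blast
  let ?W = "\<lambda>x. {z \<in> K. P z \<in> cball x (2 * \<rho>)}"
  have "\<not> K0 \<subseteq> (\<Union>x\<in>X. ?W x)"
  proof
    assume "K0 \<subseteq> (\<Union>x\<in>X. ?W x)"
    then have "emeasure lborel K0 \<le> emeasure lborel (\<Union>x\<in>X. ?W x)"
      using X by (intro emeasure_mono) (auto intro!: sets.finite_UN preimage_borel simp del: mem_cball)
    also have "\<dots> \<le> (\<Sum>x\<in>X. emeasure lborel (?W x))"
      using X by (intro emeasure_subadditive_finite) (auto intro!: preimage_borel simp del: mem_cball)
    also have "\<dots> \<le> (\<Sum>x\<in>X. ennreal (c1 * (2 * \<rho>) ^ d))"
      using \<rho> by (intro sum_mono column_cball) auto
    also have "\<dots> = ennreal (real k * (c1 * (2 * \<rho>) ^ d))"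
      using nn X(3) by (simp add: sum_ennreal ennreal_mult ennreal_of_nat_eq_real_of_nat)
    also have "\<dots> < ennreal m0" using lt nn by (intro ennreal_lessI) (use m0 in auto)
    finally show False using m0 by simp
  qed
  then obtain z where z: "z \<in> K0" "\<And>x. x \<in> X \<Longrightarrow> 2 * \<rho> < dist x (P z)" using K0(1) by fastforce
  have "P z \<notin> X" using z(2)[of "P z"] \<rho> by auto
  then show ?case using X z K0(2)[OF z(1)]
    by (intro exI[of _ "insert (P z) X"]) (auto simp: dist_commute less_imp_le)
qed

text \<open>The columns over disjoint balls are disjoint and fit into \<open>K\<close>.\<close>

lemma separated_card_bound:
  assumes \<rho>: "0 < \<rho>" "\<rho> \<le> T / 4" and X: "finite X" "X \<subseteq> S" "\<And>x y. x \<in> X \<Longrightarrow> y \<in> X \<Longrightarrow> x \<noteq> y \<Longrightarrow> 2 * \<rho> \<le> dist x y"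
  shows "real (card X) * (c3 * \<rho> ^ d) \<le> measure lborel K"
proof -
  let ?W = "\<lambda>x. {z \<in> K. P z \<in> ball x \<rho>}"
  have disj: "disjoint_family_on ?W X"
    unfolding disjoint_family_on_def
  proof (intro ballI impI)
    fix x y assume "x \<in> X" "y \<in> X" "x \<noteq> y"
    then have "ball x \<rho> \<inter> ball y \<rho> = {}" using X(3) by (intro disjoint_ballI) fastforce
    then show "?W x \<inter> ?W y = {}" by blast
  qed
  have "ennreal (real (card X) * (c3 * \<rho> ^ d)) = (\<Sum>x\<in>X. ennreal (c3 * \<rho> ^ d))"
    using c3 \<rho> by (simp add: sum_ennreal ennreal_mult ennreal_of_nat_eq_real_of_nat)
  also have "\<dots> \<le> (\<Sum>x\<in>X. emeasure lborel (?W x))"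
    using X \<rho> by (intro sum_mono column_ball_ge) auto
  also have "\<dots> = emeasure lborel (\<Union>x\<in>X. ?W x)"
    by (rule sum_emeasure) (use disj X in \<open>auto intro!: preimage_borel simp del: mem_ball\<close>)
  also have "\<dots> \<le> emeasure lborel K" by (intro emeasure_mono) auto
  also have "\<dots> = ennreal (measure lborel K)" using K_finite by (intro emeasure_eq_ennreal_measure) auto
  finally show ?thesis by (simp add: ennreal_le_iff)
qed

text \<open>Balls of radius \<open>2 * \<rho>\<close> around a maximal separated set cover
  \<open>S\<close>, and by volume their number is at most a constant over \<open>\<rho> ^ d\<close>.
  The resulting bound \<open>M\<close> on the premeasure is the same for all meshes.\<close>

lemma surface_measure_S_finite: "hausdorff_outer d S < \<infinity>"
proof -
  define M where "M = measure lborel K / c3 * (unit_ball_vol (real d) * 2 ^ d)"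
  have small: "hausdorff_premeasure d (4 * \<rho>) S \<le> ennreal M" if \<rho>: "0 < \<rho>" "\<rho> \<le> T / 4" for \<rho>
  proof -
    define Q where "Q X \<longleftrightarrow> finite X \<and> X \<subseteq> S \<and> (\<forall>x\<in>X. \<forall>y\<in>X. x \<noteq> y \<longrightarrow> 2 * \<rho> \<le> dist x y)" for X
    have pos: "0 < c3 * \<rho> ^ d" using c3 \<rho> by simp
    have bd: "card X \<le> nat \<lceil>measure lborel K / (c3 * \<rho> ^ d)\<rceil>" if "Q X" for X
    proof -
      have "real (card X) * (c3 * \<rho> ^ d) \<le> measure lborel K"
        by (rule separated_card_bound[OF \<rho>]) (use that in \<open>auto simp: Q_def\<close>)
      then have "real (card X) \<le> measure lborel K / (c3 * \<rho> ^ d)" using pos by (simp add: pos_le_divide_eq)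
      then show ?thesis by linarith
    qed
    have "Q {}" by (simp add: Q_def)
    then have "\<exists>X. Q X \<and> (\<forall>Y. Q Y \<longrightarrow> card Y \<le> card X)"
    proof (rule ex_has_greatest_nat)
      show "\<forall>Y. Q Y \<longrightarrow> card Y < Suc (nat \<lceil>measure lborel K / (c3 * \<rho> ^ d)\<rceil>)"
        using bd by (simp only: less_Suc_eq_le) simp
    qed
    then obtain X where X: "Q X" "\<And>Y. Q Y \<Longrightarrow> card Y \<le> card X" by blast
    have cov: "S \<subseteq> (\<Union>x\<in>X. cball x (2 * \<rho>))"
    proof (rule ccontr)
      assume "\<not> S \<subseteq> (\<Union>x\<in>X. cball x (2 * \<rho>))"
      then obtain y where y: "y \<in> S" "\<And>x. x \<in> X \<Longrightarrow> 2 * \<rho> < dist x y" by fastforce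
      then have "y \<notin> X" using \<rho> by fastforce
      moreover have "Q (insert y X)" using X(1) y by (auto simp: Q_def dist_commute less_imp_le)
      ultimately show False using X(2)[of "insert y X"] X(1) by (simp add: Q_def)
    qed
    obtain f where f: "bij_betw f {0..<card X} X" using ex_bij_betw_nat_finite[of X] X(1) by (auto simp: Q_def)
    define E where "E i = (if i < card X then cball (f i) (2 * \<rho>) else {})" for i
    have "hausdorff_premeasure d (4 * \<rho>) S \<le> (suminf (\<lambda>i. if E i = {} then 0 else ennreal (unit_ball_vol (real d) * (diameter (E i) / 2) ^ d)))"
      unfolding hausdorff_premeasure_def
    proof (rule INF_lower, simp, intro conjI allI)
      show "S \<subseteq> \<Union> (range E)"
      proof
        fix y assume "y \<in> S"
        then obtain x where "x \<in> X" "y \<in> cball x (2 * \<rho>)" using cov by blast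
        moreover have "x \<in> f ` {0..<card X}" using f \<open>x \<in> X\<close> by (simp add: bij_betw_def)
        then obtain i where "i < card X" "x = f i" by auto
        ultimately have "y \<in> E i" by (simp add: E_def)
        then show "y \<in> \<Union> (range E)" by blast
      qed
      show "bounded (E i)" for i by (simp add: E_def)
      show "diameter (E i) \<le> 4 * \<rho>" for i using \<rho> by (simp add: E_def)
    qed
    also have "\<dots> = (\<Sum>i\<in>{..<card X}. if E i = {} then 0 else ennreal (unit_ball_vol (real d) * (diameter (E i) / 2) ^ d))"
      by (rule suminf_finite) (auto simp: E_def)
    also have "\<dots> = (\<Sum>i\<in>{..<card X}. ennreal (unit_ball_vol (real d) * (2 * \<rho>) ^ d))"
      using \<rho> by (intro sum.cong) (auto simp: E_def)
    also have "\<dots> = ennreal (real (card X) * (unit_ball_vol (real d) * (2 * \<rho>) ^ d))"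
      using \<rho> by (simp add: sum_ennreal ennreal_mult ennreal_of_nat_eq_real_of_nat)
    also have "\<dots> \<le> ennreal M"
    proof (rule ennreal_leI)
      have "real (card X) * (c3 * \<rho> ^ d) \<le> measure lborel K"
        by (rule separated_card_bound[OF \<rho>]) (use X(1) in \<open>auto simp: Q_def\<close>)
      then have "real (card X) * \<rho> ^ d \<le> measure lborel K / c3" using c3 by (simp add: field_simps)
      then have "(real (card X) * \<rho> ^ d) * (unit_ball_vol (real d) * 2 ^ d) \<le> M" unfolding M_def
        by (intro mult_right_mono) auto
      then show "real (card X) * (unit_ball_vol (real d) * (2 * \<rho>) ^ d) \<le> M" by (simp add: power_mult_distrib ac_simps)
    qed
    finally show ?thesis .
  qed
  have "hausdorff_outer d S \<le> ennreal M"
    unfolding hausdorff_outer_def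
  proof (rule SUP_least)
    fix \<delta> :: real assume \<delta>: "\<delta> \<in> {0<..}"
    define \<rho> where "\<rho> = min (\<delta> / 4) (T / 4)"
    have \<rho>: "0 < \<rho>" "\<rho> \<le> T / 4" "4 * \<rho> \<le> \<delta>" using \<delta> T by (auto simp: \<rho>_def)
    have "hausdorff_premeasure d \<delta> S \<le> hausdorff_premeasure d (4 * \<rho>) S"
      by (rule hausdorff_premeasure_antimono[OF \<rho>(3)])
    also have "\<dots> \<le> ennreal M" by (rule small[OF \<rho>(1,2)])
    finally show "hausdorff_premeasure d \<delta> S \<le> ennreal M" .
  qed
  then show ?thesis by (rule le_less_trans) simp
qed

lemma frontier_near_finite: "emeasure surface_measure (frontier \<Omega> \<inter> ball x0 (a / 2)) < \<infinity>"
proof -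
  have "frontier \<Omega> \<inter> ball x0 (a / 2) \<subseteq> S" using frontier_zero T r by (auto simp: S_def a_def)
  then have "hausdorff_outer d (frontier \<Omega> \<inter> ball x0 (a / 2)) \<le> hausdorff_outer d S"
    unfolding hausdorff_outer_def by (intro SUP_mono') (rule hausdorff_premeasure_mono)
  then show ?thesis using surface_measure_S_finite
    by (simp add: surface_measure_eq emeasure_hausdorff_measure)
qed

end

section \<open>The Borsuk-Ulam theorem\<close>

lemma topspace_nsphere: "topspace (nsphere n) = {x. (\<Sum>i\<le>n. (x i)\<^sup>2) = 1 \<and> (\<forall>i>n. x i = 0)}"
  by (simp add: nsphere)

lemma nsphere_top_of_set: "nsphere n = top_of_set (topspace (nsphere n))"
  by (simp add: nsphere euclidean_product_topology)

text \<open>The sphere sits in an infinite product of real lines; it is a closed subset of a cube,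
  which is compact by Tychonoff's theorem.\<close>

lemma compact_topspace_nsphere: "compact (topspace (nsphere n))"
proof -
  have cl: "closed (topspace (nsphere n))"
  proof -
    have "topspace (nsphere n) = {x. (\<Sum>i\<le>n. (x i)\<^sup>2) = 1} \<inter> (\<Inter>i\<in>{n<..}. {x. x i = 0})"
      by (auto simp: topspace_nsphere)
    moreover have "closed {x :: nat \<Rightarrow> real. (\<Sum>i\<le>n. (x i)\<^sup>2) = 1}"
      by (intro closed_Collect_eq continuous_on_sum continuous_on_power continuous_on_product_coordinates continuous_on_const)
    moreover have "closed {x :: nat \<Rightarrow> real. x i = 0}" for i
      by (intro closed_Collect_eq continuous_on_product_coordinates continuous_on_const)
    ultimately show ?thesis by (auto intro!: closed_Int closed_INT)
  qed
  have "compactin (powertop_real UNIV) (PiE UNIV (\<lambda>_. {-1..1}))"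
    by (simp add: compactin_PiE)
  then have "compact (PiE UNIV (\<lambda>_::nat. {-1..1::real}))" by (simp add: euclidean_product_topology)
  then have "compact (PiE UNIV (\<lambda>_::nat. {-1..1::real}) \<inter> topspace (nsphere n))"
    using cl by (rule compact_Int_closed)
  moreover have "topspace (nsphere n) \<subseteq> PiE UNIV (\<lambda>_. {-1..1})"
  proof
    fix x assume x: "x \<in> topspace (nsphere n)"
    have "x i \<in> {-1..1}" for i
    proof (cases "i \<le> n")
      case True
      then have "(x i)\<^sup>2 \<le> (\<Sum>i\<le>n. (x i)\<^sup>2)" by (intro member_le_sum) auto
      then have "(x i)\<^sup>2 \<le> 1\<^sup>2" using x by (simp add: topspace_nsphere)
      then show ?thesis using abs_le_square_iff[of "x i" 1] by auto
    qed (use x in \<open>simp add: topspace_nsphere\<close>)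
    then show "x \<in> PiE UNIV (\<lambda>_. {-1..1})" by (simp add: PiE_UNIV_domain)
  qed
  ultimately show ?thesis by (simp add: Int_absorb1)
qed

lemma uminus_topspace_nsphere: "x \<in> topspace (nsphere n) \<Longrightarrow> (\<lambda>i. - x i) \<in> topspace (nsphere n)"
  by (simp add: topspace_nsphere)

definition sphere_normalize :: "nat \<Rightarrow> ('a \<Rightarrow> nat \<Rightarrow> real) \<Rightarrow> 'a \<Rightarrow> nat \<Rightarrow> real" where
  "sphere_normalize n f x i = (if i \<le> n then f x i / sqrt (\<Sum>j\<le>n. (f x j)\<^sup>2) else 0)"

lemma sum_squares_pos: "(i::nat) \<le> n \<Longrightarrow> y i \<noteq> 0 \<Longrightarrow> 0 < (\<Sum>j\<le>n. (y j :: real)\<^sup>2)"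
  by (rule sum_pos2[of "{..n}" i]) auto

lemma sphere_normalize_in: "\<exists>i\<le>n. f x i \<noteq> 0 \<Longrightarrow> sphere_normalize n f x \<in> topspace (nsphere n)"
  using sum_squares_pos[of _ n "f x"]
  by (auto simp: topspace_nsphere sphere_normalize_def power_divide sum_divide_distrib[symmetric] sum_nonneg)

lemma continuous_map_sphere_normalize:
  assumes c: "\<And>i. i \<le> n \<Longrightarrow> continuous_map X euclideanreal (\<lambda>x. f x i)"
    and nz: "\<And>x. x \<in> topspace X \<Longrightarrow> \<exists>i\<le>n. f x i \<noteq> 0"
  shows "continuous_map X (nsphere n) (sphere_normalize n f)"
proof -
  have "continuous_map X euclideanreal (\<lambda>x. sphere_normalize n f x i)" for i
  proof (cases "i \<le> n")
    case True
    have "continuous_map X euclideanreal (\<lambda>x. f x i / sqrt (\<Sum>j\<le>n. (f x j)\<^sup>2))"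
    proof (intro continuous_map_real_divide continuous_map_sqrt continuous_map_sum continuous_map_real_pow c True)
      show "sqrt (\<Sum>j\<le>n. (f x j)\<^sup>2) \<noteq> 0" if "x \<in> topspace X" for x
        using nz[OF that] sum_squares_pos[of _ n "f x"] by auto
    qed auto
    then show ?thesis using True by (simp add: sphere_normalize_def)
  qed (simp add: sphere_normalize_def)
  then have "continuous_map X (powertop_real UNIV) (sphere_normalize n f)"
    by (simp add: continuous_map_componentwise_UNIV)
  moreover have "sphere_normalize n f \<in> topspace X \<rightarrow> {x. (\<Sum>i\<le>n. (x i)\<^sup>2) = 1 \<and> (\<forall>i>n. x i = 0)}"
    using sphere_normalize_in[OF nz] unfolding topspace_nsphere by (rule Pi_I)
  ultimately show ?thesis
    unfolding nsphere continuous_map_in_subtopology by (rule conjI)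
qed

text \<open>A straight-line homotopy without zeros can be normalised pointwise. All deformations in
  the degree argument have this form.\<close>

lemma homotopic_sphere_normalize:
  assumes F: "\<And>i. i \<le> n \<Longrightarrow> continuous_map X euclideanreal (\<lambda>x. F x i)"
    and G: "\<And>i. i \<le> n \<Longrightarrow> continuous_map X euclideanreal (\<lambda>x. G x i)"
    and nz: "\<And>x t. x \<in> topspace X \<Longrightarrow> 0 \<le> t \<Longrightarrow> t \<le> 1 \<Longrightarrow> \<exists>i\<le>n. (1 - t) * F x i + t * G x i \<noteq> 0"
  shows "homotopic_with (\<lambda>x. True) X (nsphere n) (sphere_normalize n F) (sphere_normalize n G)"
proof -
  define H where "H z i = (1 - fst z) * F (snd z) i + fst z * G (snd z) i" for z i
  let ?P = "prod_topology (top_of_set {0..1::real}) X"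
  have fst: "continuous_map ?P euclideanreal fst"
    by (rule continuous_map_into_fulltopology[OF continuous_map_fst])
  have "continuous_map ?P (nsphere n) (sphere_normalize n H)"
  proof (rule continuous_map_sphere_normalize)
    fix i assume "i \<le> n"
    have "continuous_map ?P euclideanreal (\<lambda>z. F (snd z) i)" "continuous_map ?P euclideanreal (\<lambda>z. G (snd z) i)"
      using continuous_map_compose[OF continuous_map_snd F[OF \<open>i \<le> n\<close>]] continuous_map_compose[OF continuous_map_snd G[OF \<open>i \<le> n\<close>]]
      by (simp_all add: o_def)
    then show "continuous_map ?P euclideanreal (\<lambda>z. H z i)"
      unfolding H_def by (intro continuous_intros fst) auto
  next
    fix z assume "z \<in> topspace ?P"
    then show "\<exists>i\<le>n. H z i \<noteq> 0" using nz[of "snd z" "fst z"] by (auto simp: H_def)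
  qed
  moreover have "sphere_normalize n H (0, x) = sphere_normalize n F x" "sphere_normalize n H (1, x) = sphere_normalize n G x" for x
    by (auto simp: sphere_normalize_def H_def fun_eq_iff)
  ultimately show ?thesis unfolding homotopic_with_def by (intro exI[of _ "sphere_normalize n H"]) auto
qed

section \<open>Lipschitz maps on a sphere miss a direction\<close>

definition coord_dist :: "nat \<Rightarrow> (nat \<Rightarrow> real) \<Rightarrow> (nat \<Rightarrow> real) \<Rightarrow> real" where
  "coord_dist n x y = (\<Sum>i\<le>n. \<bar>x i - y i\<bar>)"

lemma coord_dist_nonneg: "0 \<le> coord_dist n x y"
  by (simp add: coord_dist_def sum_nonneg)

text \<open>Lipschitz functions on the compact sphere are bounded and hence form an algebra, and the
  coordinates separate points, so Stone-Weierstrass applies. The later count of grid points rests on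
  a Lipschitz bound, which a continuous map does not provide.\<close>

lemma lipschitz_approximation:
  assumes f: "continuous_map (nsphere n) euclideanreal f" and e: "0 < e"
  shows "\<exists>g C. 0 \<le> C \<and> (\<forall>x\<in>topspace (nsphere n). \<bar>f x - g x\<bar> < e) \<and>
    (\<forall>x\<in>topspace (nsphere n). \<forall>y\<in>topspace (nsphere n). \<bar>g x - g y\<bar> \<le> C * coord_dist n x y) \<and>
    continuous_map (nsphere n) euclideanreal g"
proof -
  let ?S = "topspace (nsphere n)"
  define R where "R = {g. continuous_on ?S g \<and> (\<exists>C\<ge>0. \<forall>x\<in>?S. \<forall>y\<in>?S. \<bar>g x - g y\<bar> \<le> C * coord_dist n x y)}"
  interpret function_ring_on R ?S
  proof
    show "compact ?S" by (rule compact_topspace_nsphere)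
    show "continuous_on ?S f" if "f \<in> R" for f using that by (simp add: R_def)
    show "(\<lambda>x. f x + g x) \<in> R" if fg: "f \<in> R" "g \<in> R" for f g
    proof -
      obtain C D where "0 \<le> C" "0 \<le> D" and C: "\<And>x y. x \<in> ?S \<Longrightarrow> y \<in> ?S \<Longrightarrow> \<bar>f x - f y\<bar> \<le> C * coord_dist n x y"
        and D: "\<And>x y. x \<in> ?S \<Longrightarrow> y \<in> ?S \<Longrightarrow> \<bar>g x - g y\<bar> \<le> D * coord_dist n x y" using fg unfolding R_def by blast
      have "\<bar>(f x + g x) - (f y + g y)\<bar> \<le> (C + D) * coord_dist n x y" if "x \<in> ?S" "y \<in> ?S" for x y
        using C[OF that] D[OF that] by (simp add: distrib_right)
      moreover have "continuous_on ?S (\<lambda>x. f x + g x)" using fg by (intro continuous_on_add) (auto simp: R_def)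
      ultimately show ?thesis unfolding R_def using \<open>0 \<le> C\<close> \<open>0 \<le> D\<close> by (auto intro!: exI[of _ "C + D"])
    qed
    show "(\<lambda>x. f x * g x) \<in> R" if fg: "f \<in> R" "g \<in> R" for f g
    proof -
      obtain C D where C0: "0 \<le> C" and D0: "0 \<le> D" and C: "\<And>x y. x \<in> ?S \<Longrightarrow> y \<in> ?S \<Longrightarrow> \<bar>f x - f y\<bar> \<le> C * coord_dist n x y"
        and D: "\<And>x y. x \<in> ?S \<Longrightarrow> y \<in> ?S \<Longrightarrow> \<bar>g x - g y\<bar> \<le> D * coord_dist n x y" using fg unfolding R_def by blast
      have "bounded (f ` ?S)" "bounded (g ` ?S)"
        using fg compact_topspace_nsphere by (auto intro!: compact_imp_bounded compact_continuous_image simp: R_def)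
      then obtain A B where "\<forall>y\<in>f ` ?S. norm y \<le> A" "\<forall>y\<in>g ` ?S. norm y \<le> B" unfolding bounded_iff by blast
      then have A: "\<bar>f x\<bar> \<le> max 0 A" and B: "\<bar>g x\<bar> \<le> max 0 B" if "x \<in> ?S" for x using that by force+
      have "\<bar>f x * g x - f y * g y\<bar> \<le> (max 0 A * D + max 0 B * C) * coord_dist n x y" if xy: "x \<in> ?S" "y \<in> ?S" for x y
      proof -
        have "f x * g x - f y * g y = f x * (g x - g y) + g y * (f x - f y)" by (simp add: algebra_simps)
        then have "\<bar>f x * g x - f y * g y\<bar> \<le> \<bar>f x\<bar> * \<bar>g x - g y\<bar> + \<bar>g y\<bar> * \<bar>f x - f y\<bar>"
          by (metis abs_mult abs_triangle_ineq)
        also have "\<dots> \<le> max 0 A * (D * coord_dist n x y) + max 0 B * (C * coord_dist n x y)"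
          using A B C D xy C0 D0 by (intro add_mono mult_mono mult_nonneg_nonneg coord_dist_nonneg) auto
        finally show ?thesis by (simp add: algebra_simps)
      qed
      moreover have "continuous_on ?S (\<lambda>x. f x * g x)" using fg by (intro continuous_on_mult) (auto simp: R_def)
      ultimately show ?thesis unfolding R_def using C0 D0
        by (intro CollectI conjI exI[of _ "max 0 A * D + max 0 B * C"]) auto
    qed
    show "(\<lambda>_. c) \<in> R" for c by (auto simp: R_def coord_dist_nonneg intro!: exI[of _ 0])
    show "\<exists>f\<in>R. f x \<noteq> f y" if xy: "x \<in> ?S" "y \<in> ?S" "x \<noteq> y" for x y
    proof -
      obtain i where i: "x i \<noteq> y i" using xy(3) by blast
      then have "i \<le> n" using xy by (metis (mono_tags, lifting) mem_Collect_eq not_le topspace_nsphere)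
      then have "\<bar>x i - y i\<bar> \<le> 1 * coord_dist n x y" for x y
        using member_le_sum[of i "{..n}" "\<lambda>i. \<bar>x i - y i\<bar>"] unfolding coord_dist_def by simp
      moreover have "continuous_on ?S (\<lambda>x. x i)" by (rule continuous_on_subset[OF continuous_on_product_coordinates]) simp
      ultimately have "(\<lambda>x. x i) \<in> R" unfolding R_def by (intro CollectI conjI exI[of _ 1]) auto
      then show ?thesis by (rule bexI[rotated]) (rule i)
    qed
  qed
  have cm: "continuous_map (nsphere n) euclideanreal h \<longleftrightarrow> continuous_on ?S h" for h
    by (subst nsphere_top_of_set) simp
  have "continuous_on ?S f" using f cm by simp
  then obtain g where "g \<in> R" "\<forall>x\<in>?S. \<bar>f x - g x\<bar> < e" using Stone_Weierstrass_basic[of f e] e by blast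
  then show ?thesis unfolding R_def using cm by blast
qed

text \<open>A Lipschitz image of the sphere of dimension \<open>n\<close> in the space of directions of \<open>\<real>\<^sup>n\<^sup>+\<^sup>2\<close> is
  too small to contain a cube of dimension \<open>n + 1\<close>: count the points of a fine grid.\<close>

lemma separated_in_sphere_card:
  assumes F: "finite F" and x: "\<And>c. c \<in> F \<Longrightarrow> x c \<in> topspace (nsphere n)"
    and sep: "\<And>c c'. c \<in> F \<Longrightarrow> c' \<in> F \<Longrightarrow> c \<noteq> c' \<Longrightarrow> s \<le> coord_dist n (x c) (x c')" and s: "0 < s"
    and Z: "4 * (real n + 1)\<^sup>2 / s \<le> real Z"
  shows "card F \<le> (n + 1) * (2 * (2 * Z + 2) ^ n)"
proof -
  define m where "m = real n + 1"
  have m: "1 \<le> m" by (simp add: m_def)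
  \<comment> \<open>With cells of side \<tau>, two points with equal codes will be closer than
    \<open>4 * \<tau>\<close> times the square of \<open>m\<close>, which is
    \<open>s\<close>.\<close>
  define \<tau> where "\<tau> = s / (4 * m\<^sup>2)"
  have \<tau>: "0 < \<tau>" using s m by (simp add: \<tau>_def)
  have Z': "1 / \<tau> \<le> real Z" using Z by (simp add: \<tau>_def m_def)
  have ex: "\<exists>j\<le>n. 1 / m \<le> \<bar>y j\<bar>" if y: "y \<in> topspace (nsphere n)" for y
  proof (rule ccontr)
    assume "\<not> ?thesis"
    then have lt: "\<bar>y j\<bar> < 1 / m" if "j \<le> n" for j using that by force
    have "(\<Sum>j\<le>n. (y j)\<^sup>2) < (\<Sum>j\<le>n. 1 / m)"
    proof (rule sum_strict_mono)
      fix j assume "j \<in> {..n}"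
      then have "\<bar>y j\<bar>\<^sup>2 < (1 / m)\<^sup>2" using lt m by (intro power_strict_mono) auto
      also have "(1 / m)\<^sup>2 \<le> 1 / m" using m by (simp add: power2_eq_square field_simps)
      finally show "(y j)\<^sup>2 < 1 / m" by simp
    qed auto
    then show False using y m by (simp add: topspace_nsphere m_def)
  qed
  define j where "j c = (SOME j. j \<le> n \<and> 1 / m \<le> \<bar>x c j\<bar>)" for c
  have j: "j c \<le> n" "1 / m \<le> \<bar>x c (j c)\<bar>" if "c \<in> F" for c
    using someI_ex[OF ex[OF x[OF that]]] by (auto simp: j_def)
  \<comment> \<open>The code records a coordinate of modulus at least \<open>1 / m\<close>, its
    sign, and the cells of side \<tau> that contain the other coordinates. The sphere equation
    recovers the omitted coordinate up to a multiple of \<tau>, its sign selecting the root and its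
    size controlling the error, so equal codes mean close points. Omitting it saves one dimension in
    the count.\<close>
  define code where "code c = (j c, (0 < x c (j c), restrict (\<lambda>i. if i = j c then 0 else \<lfloor>x c i / \<tau>\<rfloor>) {..n}))" for c
  define B where "B k = PiE {..n} (\<lambda>i. if i = k then {0} else {- int Z - 1..int Z})" for k
  have inj: "inj_on code F"
  proof (rule inj_onI, rule ccontr)
    fix c c' assume c: "c \<in> F" "c' \<in> F" "code c = code c'" "c \<noteq> c'"
    define k where "k = j c"
    have k: "j c' = k" "k \<le> n" "1 / m \<le> \<bar>x c k\<bar>" "1 / m \<le> \<bar>x c' k\<bar>" "(0 < x c k) = (0 < x c' k)"
      using c j[of c] j[of c'] by (auto simp: code_def k_def)
    have fl: "\<lfloor>x c i / \<tau>\<rfloor> = \<lfloor>x c' i / \<tau>\<rfloor>" if "i \<le> n" "i \<noteq> k" for i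
    proof -
      have "restrict (\<lambda>i. if i = k then 0 else \<lfloor>x c i / \<tau>\<rfloor>) {..n} i = restrict (\<lambda>i. if i = k then 0 else \<lfloor>x c' i / \<tau>\<rfloor>) {..n} i"
        using c(3) k(1) by (simp add: code_def k_def)
      then show ?thesis using that by simp
    qed
    have close: "\<bar>x c i - x c' i\<bar> \<le> \<tau>" if "i \<le> n" "i \<noteq> k" for i
    proof -
      have "\<bar>x c i / \<tau> - x c' i / \<tau>\<bar> \<le> 1" using fl[OF that] by linarith
      then have "\<bar>x c i - x c' i\<bar> / \<tau> \<le> 1" using \<tau> by (simp add: diff_divide_distrib[symmetric] abs_divide)
      then show ?thesis using \<tau> by (simp add: pos_divide_le_eq)
    qed
    have xs: "x c \<in> topspace (nsphere n)" "x c' \<in> topspace (nsphere n)" using x c by auto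
    have le1: "\<bar>y i\<bar> \<le> 1" if "y \<in> topspace (nsphere n)" "i \<le> n" for y i
    proof -
      have "(y i)\<^sup>2 \<le> (\<Sum>i\<le>n. (y i)\<^sup>2)" using that by (intro member_le_sum) auto
      then have "(y i)\<^sup>2 \<le> 1\<^sup>2" using that by (simp add: topspace_nsphere)
      then show ?thesis using abs_le_square_iff[of "y i" 1] by auto
    qed
    have rem: "(\<Sum>i\<in>{..n} - {k}. f i) + f k = (\<Sum>i\<le>n. f i)" for f :: "nat \<Rightarrow> real"
      using k(2) by (subst sum.remove[of "{..n}" k]) auto
    have "(x c k)\<^sup>2 - (x c' k)\<^sup>2 = (\<Sum>i\<in>{..n} - {k}. (x c' i)\<^sup>2 - (x c i)\<^sup>2)"
      using rem[of "\<lambda>i. (x c i)\<^sup>2"] rem[of "\<lambda>i. (x c' i)\<^sup>2"] xs by (simp add: topspace_nsphere sum_subtractf)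
    also have "\<bar>\<dots>\<bar> \<le> (\<Sum>i\<in>{..n} - {k}. 2 * \<tau>)"
    proof (rule order_trans[OF sum_abs sum_mono])
      fix i assume i: "i \<in> {..n} - {k}"
      have "(x c' i)\<^sup>2 - (x c i)\<^sup>2 = (x c' i - x c i) * (x c' i + x c i)" by (simp add: power2_eq_square algebra_simps)
      then have "\<bar>(x c' i)\<^sup>2 - (x c i)\<^sup>2\<bar> = \<bar>x c' i - x c i\<bar> * \<bar>x c' i + x c i\<bar>" by (simp only: abs_mult)
      also have "\<dots> \<le> \<tau> * 2"
        using close[of i] le1[OF xs(1), of i] le1[OF xs(2), of i] i \<tau> by (intro mult_mono) auto
      finally show "\<bar>(x c' i)\<^sup>2 - (x c i)\<^sup>2\<bar> \<le> 2 * \<tau>" by simp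
    qed
    also have "\<dots> \<le> 2 * \<tau> * m - 2 * \<tau>" using k(2) by (simp add: m_def algebra_simps)
    finally have sq: "\<bar>(x c k)\<^sup>2 - (x c' k)\<^sup>2\<bar> \<le> 2 * \<tau> * m - 2 * \<tau>" .
    have "1 / m \<le> \<bar>x c k + x c' k\<bar>" using k(3,4,5) m by (smt (verit, best) divide_pos_pos)
    then have "\<bar>x c k - x c' k\<bar> * (1 / m) \<le> \<bar>x c k - x c' k\<bar> * \<bar>x c k + x c' k\<bar>" by (rule mult_left_mono) simp
    also have "\<dots> = \<bar>(x c k)\<^sup>2 - (x c' k)\<^sup>2\<bar>" by (simp add: abs_mult[symmetric] power2_eq_square algebra_simps)
    finally have "\<bar>x c k - x c' k\<bar> * (1 / m) \<le> 2 * \<tau> * m - 2 * \<tau>" using sq by linarith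
    then have ck: "\<bar>x c k - x c' k\<bar> \<le> (2 * \<tau> * m - 2 * \<tau>) * m" using m by (simp add: pos_divide_le_eq)
    have "coord_dist n (x c) (x c') = (\<Sum>i\<in>{..n} - {k}. \<bar>x c i - x c' i\<bar>) + \<bar>x c k - x c' k\<bar>"
      unfolding coord_dist_def using rem[of "\<lambda>i. \<bar>x c i - x c' i\<bar>"] by simp
    also have "\<dots> \<le> (\<Sum>i\<in>{..n} - {k}. \<tau>) + (2 * \<tau> * m - 2 * \<tau>) * m"
      using close ck by (intro add_mono sum_mono) auto
    also have "(\<Sum>i\<in>{..n} - {k}. \<tau>) \<le> \<tau> * m" using \<tau> k(2) by (simp add: m_def algebra_simps)
    finally have "coord_dist n (x c) (x c') \<le> \<tau> * m + (2 * \<tau> * m - 2 * \<tau>) * m" by simp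
    also have "\<dots> = 2 * (\<tau> * m\<^sup>2) - \<tau> * m" by (simp add: power2_eq_square algebra_simps)
    also have "\<dots> < 4 * (\<tau> * m\<^sup>2)" using \<tau> m by (smt (verit) mult_pos_pos zero_less_power)
    also have "\<dots> = s" using m by (simp add: \<tau>_def)
    finally show False using sep[OF c(1,2,4)] by simp
  qed
  have code: "code ` F \<subseteq> (SIGMA k:{..n}. UNIV \<times> B k)"
  proof
    fix z assume "z \<in> code ` F"
    then obtain c where c: "c \<in> F" "z = code c" by blast
    have "\<lfloor>x c i / \<tau>\<rfloor> \<in> {- int Z - 1..int Z}" if "i \<le> n" for i
    proof -
      have "(x c i)\<^sup>2 \<le> (\<Sum>i\<le>n. (x c i)\<^sup>2)" using that by (intro member_le_sum) auto
      then have "(x c i)\<^sup>2 \<le> 1\<^sup>2" using x[OF c(1)] by (simp add: topspace_nsphere)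
      then have "\<bar>x c i\<bar> \<le> 1" using abs_le_square_iff[of "x c i" 1] by auto
      then have "\<bar>x c i / \<tau>\<bar> \<le> 1 / \<tau>" using \<tau> by (simp add: abs_divide divide_right_mono)
      then have "\<bar>x c i / \<tau>\<bar> \<le> real Z" using Z' by linarith
      then have "- real Z \<le> x c i / \<tau>" "x c i / \<tau> \<le> real Z" by linarith+
      then show ?thesis by (auto simp: le_floor_iff floor_le_iff)
    qed
    then have "restrict (\<lambda>i. if i = j c then 0 else \<lfloor>x c i / \<tau>\<rfloor>) {..n} \<in> B (j c)"
      unfolding B_def by (intro restrict_PiE_iff[THEN iffD2] ballI) auto
    then show "z \<in> (SIGMA k:{..n}. UNIV \<times> B k)" using c j(1)[OF c(1)] by (simp add: code_def)
  qed
  have fB: "finite (B k)" for k unfolding B_def by (intro finite_PiE) auto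
  have cB: "card (B k) = (2 * Z + 2) ^ n" if "k \<le> n" for k
  proof -
    have "card (B k) = (\<Prod>i\<in>{..n}. card (if i = k then {0} else {- int Z - 1..int Z}))"
      unfolding B_def by (rule card_PiE) simp
    also have "\<dots> = (\<Prod>i\<in>{..n} - {k}. card (if i = k then {0} else {- int Z - 1..int Z}))"
      using that by (subst prod.remove[of "{..n}" k]) auto
    also have "\<dots> = (\<Prod>i\<in>{..n} - {k}. 2 * Z + 2)" by (intro prod.cong) auto
    also have "\<dots> = (2 * Z + 2) ^ n" using that by simp
    finally show ?thesis .
  qed
  have "card F = card (code ` F)" by (rule card_image[OF inj, symmetric])
  also have "\<dots> \<le> card (SIGMA k:{..n}. (UNIV :: bool set) \<times> B k)"
    using fB by (intro card_mono code finite_SigmaI finite_cartesian_product) auto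
  also have "\<dots> = (\<Sum>k\<in>{..n}. card ((UNIV :: bool set) \<times> B k))"
    using fB by (intro card_SigmaI) auto
  also have "\<dots> = (\<Sum>k\<in>{..n}. 2 * (2 * Z + 2) ^ n)" using cB by (intro sum.cong) (auto simp: card_cartesian_product)
  finally show ?thesis by simp
qed

text \<open>If every line spanned by a vector \<open>(c, 1)\<close> were hit, the grid of vectors
  \<open>c\<close> with \<open>(M + 1) ^ (n + 1)\<close> elements would select points of the sphere
  separated at scale \<open>1 / M\<close>, because \<open>h\<close> is Lipschitz and bounded away
  from zero. The sphere of dimension \<open>n\<close> has room for only a multiple of
  \<open>M ^ n\<close> such points.\<close>

lemma missed_direction:
  fixes h :: "(nat \<Rightarrow> real) \<Rightarrow> nat \<Rightarrow> real"
  assumes C: "0 \<le> C" and lip: "\<And>i x y. i \<le> Suc n \<Longrightarrow> x \<in> topspace (nsphere n) \<Longrightarrow> y \<in> topspace (nsphere n) \<Longrightarrow> \<bar>h x i - h y i\<bar> \<le> C * coord_dist n x y"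
    and \<beta>: "0 < \<beta>" and big: "\<And>x. x \<in> topspace (nsphere n) \<Longrightarrow> \<exists>i\<le>Suc n. \<beta> \<le> \<bar>h x i\<bar>"
  shows "\<exists>c. \<forall>x\<in>topspace (nsphere n). \<exists>i\<le>n. h x i \<noteq> c i * h x (Suc n)"
proof (rule ccontr)
  assume neg: "\<not> ?thesis"
  then have "\<forall>c. \<exists>x\<in>topspace (nsphere n). \<forall>i\<le>n. h x i = c i * h x (Suc n)" by blast
  then obtain X where X: "\<And>c. X c \<in> topspace (nsphere n)" "\<And>c i. i \<le> n \<Longrightarrow> h (X c) i = c i * h (X c) (Suc n)" by metis
  define D where "D = nat \<lceil>8 * (real n + 1)\<^sup>2 * (C + 1) / \<beta>\<rceil>"
  \<comment> \<open>This is the factor in front of \<open>M ^ n\<close> in the resulting bound,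
    which thereby becomes exactly \<open>M ^ (n + 1)\<close>.\<close>
  define M where "M = (n + 1) * (2 * (2 * D + 2) ^ n)"
  have "0 < M" by (simp add: M_def)
  then have M1: "1 \<le> M" by simp
  define Z where "Z = D * M"
  define G where "G = PiE {..n} (\<lambda>_. {0..M})"
  define s where "s = \<beta> / (2 * (C + 1) * real M)"
  have s: "0 < s" using \<beta> C M1 by (simp add: s_def)
  define cc where "cc k i = real (k i) / real M" for k :: "nat \<Rightarrow> nat" and i
  have sep: "s \<le> coord_dist n (X (cc k)) (X (cc k'))" if k: "k \<in> G" "k' \<in> G" "k \<noteq> k'" for k k'
  proof -
    let ?x = "X (cc k)" and ?y = "X (cc k')"
    have "\<exists>i\<le>n. k i \<noteq> k' i"
    proof (rule ccontr)
      assume "\<not> ?thesis"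
      then have "k = k'" using PiE_ext[OF k(1)[unfolded G_def] k(2)[unfolded G_def]] by simp
      then show False using k(3) by simp
    qed
    then obtain i where i: "i \<le> n" "k i \<noteq> k' i" by blast
    have cb: "\<bar>cc k i\<bar> \<le> 1" if "k \<in> G" "i \<le> n" for k i
      using that M1 by (auto simp: G_def cc_def PiE_iff)
    \<comment> \<open>On such a line the last coordinate is the largest in modulus, since the
      entries of the grid vector are at most 1.\<close>
    have hb: "\<beta> \<le> \<bar>h ?x (Suc n)\<bar>"
    proof -
      obtain l where l: "l \<le> Suc n" "\<beta> \<le> \<bar>h ?x l\<bar>" using big[OF X(1)] by blast
      show ?thesis
      proof (cases "l = Suc n")
        case False
        then have "l \<le> n" using l by simp
        then have "\<bar>h ?x l\<bar> = \<bar>cc k l\<bar> * \<bar>h ?x (Suc n)\<bar>" by (simp add: X(2) abs_mult)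
        also have "\<dots> \<le> 1 * \<bar>h ?x (Suc n)\<bar>" by (intro mult_right_mono cb k(1) \<open>l \<le> n\<close>) simp
        finally show ?thesis using l(2) by simp
      qed (use l in simp)
    qed
    have "1 \<le> \<bar>real (k i) - real (k' i)\<bar>" using i(2) by linarith
    then have "1 / real M \<le> \<bar>real (k i) - real (k' i)\<bar> / real M" by (intro divide_right_mono) auto
    also have "\<dots> = \<bar>cc k i - cc k' i\<bar>" by (simp add: cc_def diff_divide_distrib[symmetric])
    finally have cd: "1 / real M \<le> \<bar>cc k i - cc k' i\<bar>" .
    have "\<beta> * (1 / real M) \<le> \<bar>h ?x (Suc n)\<bar> * \<bar>cc k i - cc k' i\<bar>"
      using hb cd \<beta> by (intro mult_mono) auto
    also have "\<dots> = \<bar>(cc k i - cc k' i) * h ?x (Suc n)\<bar>" by (simp add: abs_mult mult.commute)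
    also have "(cc k i - cc k' i) * h ?x (Suc n) = (h ?x i - h ?y i) + cc k' i * (h ?y (Suc n) - h ?x (Suc n))"
      by (simp add: X(2)[OF i(1)] algebra_simps)
    also have "\<bar>\<dots>\<bar> \<le> \<bar>h ?x i - h ?y i\<bar> + \<bar>cc k' i\<bar> * \<bar>h ?x (Suc n) - h ?y (Suc n)\<bar>"
      by (metis abs_minus_commute abs_mult abs_triangle_ineq)
    also have "\<dots> \<le> C * coord_dist n ?x ?y + 1 * (C * coord_dist n ?x ?y)"
      using lip[of i ?x ?y] lip[of "Suc n" ?x ?y] X(1) i(1) cb[OF k(2) i(1)] by (intro add_mono mult_mono) auto
    also have "\<dots> \<le> 2 * (C + 1) * coord_dist n ?x ?y" using coord_dist_nonneg[of n ?x ?y] by (simp add: algebra_simps)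
    finally have "\<beta> / real M \<le> 2 * (C + 1) * coord_dist n ?x ?y" by simp
    then have "\<beta> / real M / (2 * (C + 1)) \<le> coord_dist n ?x ?y" using C by (subst pos_divide_le_eq) (auto simp: mult.commute)
    moreover have "s = \<beta> / real M / (2 * (C + 1))" by (simp add: s_def)
    ultimately show ?thesis by simp
  qed
  have Zb: "4 * (real n + 1)\<^sup>2 / s \<le> real Z"
  proof -
    have "4 * (real n + 1)\<^sup>2 / s = (8 * (real n + 1)\<^sup>2 * (C + 1) / \<beta>) * real M" using \<beta> by (simp add: s_def)
    also have "\<dots> \<le> real D * real M" by (intro mult_right_mono) (auto simp: D_def, linarith)
    finally show ?thesis by (simp add: Z_def)
  qed
  have fG: "finite G" unfolding G_def by (intro finite_PiE) auto
  have "card G \<le> (n + 1) * (2 * (2 * Z + 2) ^ n)"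
    by (rule separated_in_sphere_card[OF fG _ sep s Zb]) (use X(1) in auto)
  moreover have "card G = (M + 1) ^ (n + 1)" unfolding G_def by (subst card_PiE) auto
  moreover have "(2 * Z + 2) ^ n \<le> ((2 * D + 2) * M) ^ n" using M1 by (intro power_mono) (auto simp: Z_def algebra_simps)
  ultimately have "(M + 1) ^ (n + 1) \<le> (n + 1) * (2 * ((2 * D + 2) * M) ^ n)"
    using order_trans[OF _ mult_le_mono2[OF mult_le_mono2]] by metis
  also have "\<dots> = ((n + 1) * (2 * (2 * D + 2) ^ n)) * M ^ n" by (simp only: power_mult_distrib mult_ac)
  also have "\<dots> = M * M ^ n" by (simp only: M_def[symmetric])
  also have "\<dots> = M ^ (n + 1)" by simp
  also have "\<dots> < (M + 1) ^ (n + 1)" by (intro power_strict_mono) auto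
  finally show False by simp
qed

text \<open>The degree modulo two is computed by induction on the dimension: an odd map is deformed through
  nowhere vanishing maps until it preserves the equator.\<close>

theorem odd_map_odd_degree:
  assumes "continuous_map (nsphere m) (nsphere m) g"
    and "\<And>x. x \<in> topspace (nsphere m) \<Longrightarrow> g (\<lambda>i. - x i) = (\<lambda>i. - g x i)"
  shows "odd (Brouwer_degree2 m g)"
  using assms
proof (induction m arbitrary: g)
  case 0
  define e0 :: "nat \<Rightarrow> real" where "e0 = (\<lambda>i. if i = 0 then 1 else 0)"
  have ts: "x = e0 \<or> x = (\<lambda>i. - e0 i)" if "x \<in> topspace (nsphere 0)" for x
    using that by (auto simp: topspace_nsphere e0_def fun_eq_iff power2_eq_1_iff)
  have e0: "e0 \<in> topspace (nsphere 0)" by (auto simp: topspace_nsphere e0_def)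
  then have "g e0 \<in> topspace (nsphere 0)" using 0(1) continuous_map_image_subset_topspace by blast
  then consider "g e0 = e0" | "g e0 = (\<lambda>i. - e0 i)" using ts by blast
  then show ?case
  proof cases
    case 1
    have "g x = id x" if "x \<in> topspace (nsphere 0)" for x
      using ts[OF that] 1 0(2)[OF e0] by auto
    then have "Brouwer_degree2 0 g = Brouwer_degree2 0 id" by (rule Brouwer_degree2_eq)
    then show ?thesis by simp
  next
    case 2
    have "g x = (\<lambda>i. if i = 0 then - x i else x i)" if x: "x \<in> topspace (nsphere 0)" for x
    proof -
      have flip: "(\<lambda>i. if i = 0 then - x i else x i) = (\<lambda>i. - x i)" using x by (auto simp: topspace_nsphere fun_eq_iff)
      from ts[OF x] have "g x = (\<lambda>i. - x i)"
      proof
        assume "x = (\<lambda>i. - e0 i)"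
        then show ?thesis using 0(2)[OF e0] 2 by simp
      qed (use 2 in simp)
      then show ?thesis unfolding flip .
    qed
    then have "Brouwer_degree2 0 g = Brouwer_degree2 0 (\<lambda>x i. if i = 0 then - x i else x i)" by (rule Brouwer_degree2_eq)
    then show ?thesis by (simp add: Brouwer_degree2_reflection)
  qed
next
  case (Suc n)
  define S where "S = topspace (nsphere (Suc n))"
  have comp: "continuous_map (nsphere (Suc n)) euclideanreal (\<lambda>x. g x i)" for i
    using continuous_map_compose[OF Suc.prems(1) continuous_map_nsphere_projection] by (simp add: o_def)
  \<comment> \<open>A unit vector with n + 2 entries has one of modulus at least 1 / (n + 2), which
    is \<open>4 * \<eta>\<close>; errors up to \<eta> therefore create no zeros.\<close>
  define \<eta> where "\<eta> = 1 / (4 * (real n + 2))"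
  have \<eta>: "0 < \<eta>" by (simp add: \<eta>_def)
  obtain k C where C: "\<And>i. 0 \<le> C i" and k: "\<And>i x. x \<in> S \<Longrightarrow> \<bar>g x i - k i x\<bar> < \<eta>"
    and lip: "\<And>i x y. x \<in> S \<Longrightarrow> y \<in> S \<Longrightarrow> \<bar>k i x - k i y\<bar> \<le> C i * coord_dist (Suc n) x y"
    and kc: "\<And>i. continuous_map (nsphere (Suc n)) euclideanreal (k i)"
    using lipschitz_approximation[OF comp \<eta>] unfolding S_def by metis
  have neg: "(\<lambda>i. - x i) \<in> S" if "x \<in> S" for x using that uminus_topspace_nsphere by (simp add: S_def)
  \<comment> \<open>Antisymmetrising restores oddness and preserves both the Lipschitz bound and the
    approximation error.\<close>
  define h where "h x i = (k i x - k i (\<lambda>i. - x i)) / 2" for x i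
  have hodd: "h (\<lambda>i. - x i) i = - h x i" for x i by (simp add: h_def field_simps)
  have hg: "\<bar>g x i - h x i\<bar> < \<eta>" if x: "x \<in> S" for x i
  proof -
    have "g (\<lambda>i. - x i) i = - g x i" using Suc.prems(2) x by (simp add: S_def)
    then have "\<bar>- g x i - k i (\<lambda>i. - x i)\<bar> < \<eta>" using k[OF neg[OF x], of i] by simp
    moreover have "\<bar>a - (b - b') / 2\<bar> < \<eta>" if "\<bar>- a - b'\<bar> < \<eta>" "\<bar>a - b\<bar> < \<eta>" for a b b' :: real
      using that unfolding abs_less_iff by (intro conjI) (simp_all add: field_simps)
    ultimately show ?thesis using k[OF x, of i] unfolding h_def by blast
  qed
  have negc: "continuous_map (nsphere (Suc n)) (nsphere (Suc n)) (\<lambda>x i. - x i)"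
  proof -
    have "continuous_map (nsphere (Suc n)) (powertop_real UNIV) (\<lambda>x i. - x i)"
      by (simp add: continuous_map_componentwise_UNIV continuous_map_nsphere_projection continuous_map_minus)
    then show ?thesis
      using uminus_topspace_nsphere[of _ "Suc n"] by (subst (2) nsphere, subst continuous_map_in_subtopology) (auto simp: topspace_nsphere)
  qed
  have hc: "continuous_map (nsphere (Suc n)) euclideanreal (\<lambda>x. h x i)" for i
    unfolding h_def using kc[of i] continuous_map_compose[OF negc kc[of i]]
    by (intro continuous_intros) (auto simp: o_def)
  have gbig: "\<exists>i\<le>Suc n. 4 * \<eta> \<le> \<bar>g x i\<bar>" if x: "x \<in> S" for x
  proof (rule ccontr)
    assume "\<not> ?thesis"
    then have lt: "\<bar>g x i\<bar> < 4 * \<eta>" if "i \<le> Suc n" for i using that by force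
    have l1: "4 * \<eta> \<le> 1" by (simp add: \<eta>_def)
    have "(\<Sum>i\<le>Suc n. (g x i)\<^sup>2) < (\<Sum>i\<le>Suc n. 4 * \<eta>)"
    proof (rule sum_strict_mono)
      fix i assume "i \<in> {..Suc n}"
      then have "\<bar>g x i\<bar>\<^sup>2 < (4 * \<eta>)\<^sup>2" using lt by (intro power_strict_mono) auto
      also have "\<dots> \<le> 4 * \<eta>" using l1 \<eta> by (simp add: power2_eq_square mult_left_le)
      finally show "(g x i)\<^sup>2 < 4 * \<eta>" by simp
    qed auto
    also have "\<dots> = 1" by (simp add: \<eta>_def field_simps)
    finally have "(\<Sum>i\<le>Suc n. (g x i)\<^sup>2) < 1" .
    moreover have "g x \<in> topspace (nsphere (Suc n))"
      using Suc.prems(1) x continuous_map_image_subset_topspace unfolding S_def by blast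
    ultimately show False by (simp add: topspace_nsphere)
  qed
  have hbig: "\<exists>i\<le>Suc n. \<eta> \<le> \<bar>h x i\<bar>" if x: "x \<in> S" for x
  proof -
    obtain i where "i \<le> Suc n" "4 * \<eta> \<le> \<bar>g x i\<bar>" using gbig[OF x] by blast
    then show ?thesis using hg[OF x, of i] \<eta> by (intro exI[of _ i]) linarith
  qed
  have eqS: "topspace (nsphere n) \<subseteq> S" "\<And>x. x \<in> topspace (nsphere n) \<Longrightarrow> x (Suc n) = 0" by (auto simp: S_def topspace_nsphere)
  define C' where "C' = Max (C ` {..Suc n})"
  have C': "C i \<le> C'" if "i \<le> Suc n" for i unfolding C'_def using that by (intro Max_ge) auto
  have "\<exists>c. \<forall>x\<in>topspace (nsphere n). \<exists>i\<le>n. h x i \<noteq> c i * h x (Suc n)"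
  proof (rule missed_direction[of C' n h \<eta>])
    show "0 \<le> C'" using C[of 0] C'[of 0] by simp
    fix i x y assume i: "i \<le> Suc n" and x: "x \<in> topspace (nsphere n)" and y: "y \<in> topspace (nsphere n)"
    have cd: "coord_dist (Suc n) x y = coord_dist n x y" "coord_dist (Suc n) (\<lambda>i. - x i) (\<lambda>i. - y i) = coord_dist n x y"
      using eqS(2)[OF x] eqS(2)[OF y] by (auto simp: coord_dist_def abs_minus_commute)
    have xy: "x \<in> S" "y \<in> S" using x y eqS(1) by auto
    have ar: "\<bar>(a - a') / 2 - (b - b') / 2\<bar> \<le> c" if "\<bar>a - b\<bar> \<le> c" "\<bar>a' - b'\<bar> \<le> c" for a a' b b' c :: real
      using that unfolding abs_le_iff by (intro conjI) (simp_all add: field_simps)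
    have "\<bar>h x i - h y i\<bar> \<le> C i * coord_dist n x y"
      using lip[OF xy, of i] lip[OF neg[OF xy(1)] neg[OF xy(2)], of i] unfolding cd h_def by (intro ar)
    also have "\<dots> \<le> C' * coord_dist n x y" by (intro mult_right_mono C'[OF i] coord_dist_nonneg)
    finally show "\<bar>h x i - h y i\<bar> \<le> C' * coord_dist n x y" .
  qed (use \<eta> hbig eqS(1) in auto)
  then obtain c where c: "\<And>x. x \<in> topspace (nsphere n) \<Longrightarrow> \<exists>i\<le>n. h x i \<noteq> c i * h x (Suc n)" by blast
  \<comment> \<open>The shear carries the direction missed on the equator to the last axis. It fixes
    the last coordinate, so the linear deformation into it has no zeros.\<close>
  define F2 where "F2 x i = (if i \<le> n then h x i - c i * h x (Suc n) else h x i)" for x i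
  \<comment> \<open>The even factor \<open>\<bar>x (Suc n)\<bar>\<close> kills the last coordinate
    on the equator and keeps the map odd. No zero arises there, because on the equator the sheared
    coordinates up to \<open>n\<close> do not all vanish.\<close>
  define F3 where "F3 x i = (if i \<le> n then h x i - c i * h x (Suc n) else \<bar>x (Suc n)\<bar> * h x i)" for x i
  have F2c: "continuous_map (nsphere (Suc n)) euclideanreal (\<lambda>x. F2 x i)" for i
    unfolding F2_def by (cases "i \<le> n") (auto intro!: continuous_intros hc)
  have F3c: "continuous_map (nsphere (Suc n)) euclideanreal (\<lambda>x. F3 x i)" for i
    unfolding F3_def by (cases "i \<le> n") (auto intro!: continuous_intros hc continuous_map_nsphere_projection)
  have hnz: "h x (Suc n) \<noteq> 0 \<or> (\<exists>i\<le>n. h x i \<noteq> 0)" if "x \<in> S" for x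
    using hbig[OF that] \<eta> by (metis abs_zero le_SucE not_le)
  have H1: "homotopic_with (\<lambda>x. True) (nsphere (Suc n)) (nsphere (Suc n)) (sphere_normalize (Suc n) g) (sphere_normalize (Suc n) h)"
  proof (rule homotopic_sphere_normalize[OF comp hc])
    fix x t assume x: "x \<in> topspace (nsphere (Suc n))" and t: "0 \<le> t" "t \<le> (1::real)"
    then obtain i where i: "i \<le> Suc n" "4 * \<eta> \<le> \<bar>g x i\<bar>" using gbig[of x] by (auto simp: S_def)
    have "(1 - t) * g x i + t * h x i = g x i - t * (g x i - h x i)" by (simp add: algebra_simps)
    moreover have "\<bar>t * (g x i - h x i)\<bar> \<le> 1 * \<eta>"
      unfolding abs_mult using hg[of x i] x t by (intro mult_mono) (auto simp: S_def)
    ultimately have "(1 - t) * g x i + t * h x i \<noteq> 0" using i(2) \<eta> by linarith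
    then show "\<exists>i\<le>Suc n. (1 - t) * g x i + t * h x i \<noteq> 0" using i(1) by blast
  qed
  have H2: "homotopic_with (\<lambda>x. True) (nsphere (Suc n)) (nsphere (Suc n)) (sphere_normalize (Suc n) h) (sphere_normalize (Suc n) F2)"
  proof (rule homotopic_sphere_normalize[OF hc F2c])
    fix x t assume x: "x \<in> topspace (nsphere (Suc n))" and t: "0 \<le> t" "t \<le> (1::real)"
    show "\<exists>i\<le>Suc n. (1 - t) * h x i + t * F2 x i \<noteq> 0"
    proof (cases "h x (Suc n) = 0")
      case True
      then obtain i where "i \<le> n" "h x i \<noteq> 0" using hnz[of x] x by (auto simp: S_def)
      then show ?thesis using True by (intro exI[of _ i]) (simp add: F2_def algebra_simps)
    next
      case False
      then show ?thesis by (intro exI[of _ "Suc n"]) (simp add: F2_def algebra_simps)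
    qed
  qed
  have F3nz: "\<exists>i\<le>Suc n. (1 - t) * F2 x i + t * F3 x i \<noteq> 0" if x: "x \<in> S" and t: "0 \<le> t" "t \<le> (1::real)" for x t
  proof (cases "\<exists>i\<le>n. h x i \<noteq> c i * h x (Suc n)")
    case True
    then obtain i where i: "i \<le> n" "h x i \<noteq> c i * h x (Suc n)" by blast
    have "(1 - t) * F2 x i + t * F3 x i = h x i - c i * h x (Suc n)" using i(1) by (simp add: F2_def F3_def algebra_simps)
    then show ?thesis using i by (intro exI[of _ i]) simp
  next
    case False
    then have "x \<notin> topspace (nsphere n)" using c by blast
    then have xn: "x (Suc n) \<noteq> 0" using topspace_nsphere_minus1[of x "Suc n"] x by (auto simp: S_def)
    have hn: "h x (Suc n) \<noteq> 0"
    proof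
      assume z: "h x (Suc n) = 0"
      then obtain i where "i \<le> n" "h x i \<noteq> 0" using hnz[OF x] by blast
      then show False using False z by auto
    qed
    have "0 < (1 - t) + t * \<bar>x (Suc n)\<bar>" using t xn by (cases "t = 1") (auto intro: add_pos_nonneg)
    moreover have "(1 - t) * F2 x (Suc n) + t * F3 x (Suc n) = ((1 - t) + t * \<bar>x (Suc n)\<bar>) * h x (Suc n)"
      by (simp add: F2_def F3_def algebra_simps)
    ultimately show ?thesis using hn by (intro exI[of _ "Suc n"]) simp
  qed
  have H3: "homotopic_with (\<lambda>x. True) (nsphere (Suc n)) (nsphere (Suc n)) (sphere_normalize (Suc n) F2) (sphere_normalize (Suc n) F3)"
    by (rule homotopic_sphere_normalize[OF F2c F3c F3nz]) (auto simp: S_def)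
  define G where "G = sphere_normalize (Suc n) F3"
  have Gc: "continuous_map (nsphere (Suc n)) (nsphere (Suc n)) G"
    unfolding G_def by (rule continuous_map_sphere_normalize[OF F3c]) (use F3nz[of _ 1] in \<open>simp add: S_def\<close>)
  have Godd: "G (\<lambda>i. - x i) = (\<lambda>i. - G x i)" for x
  proof -
    have "F3 (\<lambda>i. - x i) j = - F3 x j" for j by (simp add: F3_def hodd algebra_simps)
    then show ?thesis by (simp add: G_def sphere_normalize_def fun_eq_iff)
  qed
  have Geq: "G x \<in> topspace (nsphere n)" if "x \<in> topspace (nsphere n)" for x
  proof -
    have "G x \<in> topspace (nsphere (Suc n))" using Gc that eqS(1) continuous_map_image_subset_topspace unfolding S_def by blast
    moreover have "G x (Suc n) = 0" using eqS(2)[OF that] by (simp add: G_def sphere_normalize_def F3_def)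
    ultimately show ?thesis using topspace_nsphere_minus1[of "G x" "Suc n"] by simp
  qed
  have "Brouwer_degree2 (Suc n) g = Brouwer_degree2 (Suc n) (sphere_normalize (Suc n) g)"
  proof (rule Brouwer_degree2_eq)
    fix x assume "x \<in> topspace (nsphere (Suc n))"
    then have "g x \<in> topspace (nsphere (Suc n))" using Suc.prems(1) continuous_map_image_subset_topspace by blast
    then have s1: "(\<Sum>j\<le>Suc n. (g x j)\<^sup>2) = 1" and z: "\<And>i. Suc n < i \<Longrightarrow> g x i = 0" by (auto simp: topspace_nsphere)
    show "g x = sphere_normalize (Suc n) g x"
      unfolding fun_eq_iff sphere_normalize_def s1 using z by auto
  qed
  also have "\<dots> = Brouwer_degree2 (Suc n) G"
    unfolding G_def using H1 H2 H3 Brouwer_degree2_homotopic by metis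
  finally have deg: "Brouwer_degree2 (Suc n) g = Brouwer_degree2 (Suc n) G" .
  \<comment> \<open>\<open>G\<close> is odd and maps the equator into itself, so its degree has the
    parity of the degree of its restriction to the equator.\<close>
  have "even (Brouwer_degree2 (Suc n) G - Brouwer_degree2 (Suc n - Suc 0) G)"
    by (rule Borsuk_odd_mapping_degree_step[OF Gc]) (use Godd Geq in \<open>auto simp: o_def\<close>)
  moreover have "odd (Brouwer_degree2 n G)"
  proof (rule Suc.IH)
    have "nsphere n = subtopology (nsphere (Suc n)) {x. x (Suc n) = 0}" by (rule subtopology_nsphere_equator[symmetric])
    moreover have "continuous_map (subtopology (nsphere (Suc n)) {x. x (Suc n) = 0}) (subtopology (nsphere (Suc n)) {x. x (Suc n) = 0}) G"
      unfolding continuous_map_in_subtopology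
    proof
      show "continuous_map (subtopology (nsphere (Suc n)) {x. x (Suc n) = 0}) (nsphere (Suc n)) G"
        by (rule continuous_map_from_subtopology[OF Gc])
      show "G \<in> topspace (subtopology (nsphere (Suc n)) {x. x (Suc n) = 0}) \<rightarrow> {x. x (Suc n) = 0}"
        using Geq eqS(2) unfolding subtopology_nsphere_equator by blast
    qed
    ultimately show "continuous_map (nsphere n) (nsphere n) G" by simp
    show "G (\<lambda>i. - x i) = (\<lambda>i. - G x i)" for x by (rule Godd)
  qed
  ultimately show ?case unfolding deg by simp
qed

text \<open>Normalising gives an odd self-map of the sphere whose coordinate \<open>n\<close>
  vanishes because \<open>m \<le> n\<close>. It misses a pole, so its degree is 0, which is
  even.\<close>

theorem Borsuk_Ulam_nsphere:
  assumes mn: "m \<le> n" and f: "continuous_map (nsphere n) (subtopology (Euclidean_space m) (- {\<lambda>i. 0})) f"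
    and odd: "\<And>x. x \<in> topspace (nsphere n) \<Longrightarrow> f (\<lambda>i. - x i) = (\<lambda>i. - f x i)"
  shows False
proof -
  have img: "f x \<in> topspace (Euclidean_space m) \<and> f x \<noteq> (\<lambda>i. 0)" if "x \<in> topspace (nsphere n)" for x
  proof -
    have "f x \<in> topspace (subtopology (Euclidean_space m) (- {\<lambda>i. 0}))"
      using continuous_map_image_subset_topspace[OF f] that by blast
    then show ?thesis by simp
  qed
  have z: "f x i = 0" if "x \<in> topspace (nsphere n)" "m \<le> i" for x i
    using img[OF that(1)] that(2) by (simp add: topspace_Euclidean_space)
  have nz: "\<exists>i\<le>n. f x i \<noteq> 0" if "x \<in> topspace (nsphere n)" for x
    using img[OF that] z[OF that] mn by (metis (mono_tags) ext less_imp_le linorder_not_le order_trans)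
  have fc: "continuous_map (nsphere n) euclideanreal (\<lambda>x. f x i)" for i
  proof -
    have "continuous_map (nsphere n) (powertop_real UNIV) f"
      using f by (simp add: Euclidean_space_def continuous_map_in_subtopology)
    then show ?thesis by (simp add: continuous_map_componentwise_UNIV)
  qed
  define F where "F = sphere_normalize n f"
  have Fc: "continuous_map (nsphere n) (nsphere n) F" unfolding F_def by (rule continuous_map_sphere_normalize[OF fc nz])
  have "odd (Brouwer_degree2 n F)"
  proof (rule odd_map_odd_degree[OF Fc])
    fix x assume "x \<in> topspace (nsphere n)"
    then show "F (\<lambda>i. - x i) = (\<lambda>i. - F x i)" by (auto simp: F_def sphere_normalize_def odd fun_eq_iff)
  qed
  moreover have "Brouwer_degree2 n F = 0"
  proof (rule Brouwer_degree2_nonsurjective[OF Fc])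
    define y :: "nat \<Rightarrow> real" where "y = (\<lambda>i. if i = n then 1 else 0)"
    have "y \<in> topspace (nsphere n)" by (auto simp: topspace_nsphere y_def if_distrib[of "\<lambda>t. t\<^sup>2"] cong: if_cong)
    moreover have "y \<notin> F ` topspace (nsphere n)"
    proof
      assume "y \<in> F ` topspace (nsphere n)"
      then obtain x where "x \<in> topspace (nsphere n)" "y = F x" by blast
      then have "y n = 0" using z[of x n] mn by (simp add: F_def sphere_normalize_def)
      then show False by (simp add: y_def)
    qed
    ultimately show "F ` topspace (nsphere n) \<noteq> topspace (nsphere n)" by blast
  qed
  ultimately show False by simp
qed

section \<open>Traces of smooth functions\<close>

text \<open>Finitely many chart patches cover the compact boundary. Finite measure is what makes
  continuous functions \<open>p\<close>-integrable on it.\<close>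

lemma frontier_surface_finite:
  fixes \<Omega> :: "(real^'n::finite) set"
  assumes dom: "bounded_C1_domain \<Omega>" and N: "2 \<le> CARD('n)"
  shows "emeasure surface_measure (frontier \<Omega>) < \<infinity>"
proof -
  have om: "open \<Omega>" and bd: "bounded \<Omega>" and C1: "C1_boundary \<Omega>" using dom by (auto simp: bounded_C1_domain_def)
  have "\<exists>s>0. emeasure surface_measure (frontier \<Omega> \<inter> ball x0 s) < \<infinity>" if x0: "x0 \<in> frontier \<Omega>" for x0
  proof -
    obtain r e \<gamma> L where ch: "boundary_chart \<Omega> x0 r e \<gamma> L" using C1_boundary_chart[OF C1 x0] by blast
    interpret chart \<Omega> x0 r e \<gamma> L 1 "CARD('n) - 1" "unit_ball_vol (real CARD('n))"
      by unfold_locales (use ch om x0 N in auto)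
    show ?thesis using frontier_near_finite T(5) by (intro exI[of _ "a / 2"]) simp
  qed
  then obtain s where s: "\<And>x0. x0 \<in> frontier \<Omega> \<Longrightarrow> 0 < s x0" "\<And>x0. x0 \<in> frontier \<Omega> \<Longrightarrow> emeasure surface_measure (frontier \<Omega> \<inter> ball x0 (s x0)) < \<infinity>"
    by metis
  have frb: "frontier \<Omega> \<in> sets borel" by (simp add: frontier_def)
  have cpt: "compact (frontier \<Omega>)" using bd by (rule compact_frontier_bounded)
  have op: "open (ball x0 (s x0))" if "x0 \<in> frontier \<Omega>" for x0 by simp
  have cov: "frontier \<Omega> \<subseteq> (\<Union>x0\<in>frontier \<Omega>. ball x0 (s x0))" using s(1) by force
  obtain X where X: "X \<subseteq> frontier \<Omega>" "finite X" "frontier \<Omega> \<subseteq> (\<Union>x0\<in>X. ball x0 (s x0))"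
    by (rule compactE_image[OF cpt op cov])
  have "emeasure surface_measure (frontier \<Omega>) \<le> emeasure surface_measure (\<Union>x0\<in>X. frontier \<Omega> \<inter> ball x0 (s x0))"
    using X frb by (intro emeasure_mono) (auto simp: surface_measure_def intro!: sets.finite_UN)
  also have "\<dots> \<le> (\<Sum>x0\<in>X. emeasure surface_measure (frontier \<Omega> \<inter> ball x0 (s x0)))"
    using X frb by (intro emeasure_subadditive_finite) (auto simp: surface_measure_def)
  also have "\<dots> < \<infinity>" using X s(2) by (simp add: subset_iff)
  finally show ?thesis .
qed

lemma sets_surface_measure [simp, measurable_cong]: "sets (surface_measure :: (real^'n::finite) measure) = sets borel"
  by (simp add: surface_measure_def)

lemma space_surface_measure [simp]: "space (surface_measure :: (real^'n::finite) measure) = UNIV"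
  by (simp add: surface_measure_def)

lemma in_Lp_frontier_continuous:
  fixes f :: "real^'n::finite \<Rightarrow> real"
  assumes dom: "bounded_C1_domain \<Omega>" and N: "2 \<le> CARD('n)" and p: "0 < p" and f: "continuous_on UNIV f"
  shows "in_Lp p (restrict_space surface_measure (frontier \<Omega>)) f"
proof -
  have bd: "bounded \<Omega>" using dom by (auto simp: bounded_C1_domain_def)
  have m[measurable]: "f \<in> borel_measurable borel" by (rule borel_measurable_continuous_onI[OF f])
  have mr: "f \<in> borel_measurable (restrict_space surface_measure (frontier \<Omega>))"
    by (rule measurable_restrict_space1) simp
  have "compact (frontier \<Omega>)" using bd by (rule compact_frontier_bounded)
  then have "bounded (f ` frontier \<Omega>)" using f
    by (intro compact_imp_bounded compact_continuous_image) (auto intro: continuous_on_subset)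
  then obtain B where "\<forall>y\<in>f ` frontier \<Omega>. norm y \<le> B" unfolding bounded_iff by blast
  then have B: "\<bar>f x\<bar> \<le> B" if "x \<in> frontier \<Omega>" for x using that by force
  have "integrable (restrict_space surface_measure (frontier \<Omega>)) (\<lambda>x. norm (f x) powr p)"
  proof (rule Bochner_Integration.integrable_bound)
    have "integrable (restrict_space surface_measure (frontier \<Omega>)) (\<lambda>x. 1 * B powr p)"
    proof -
      have "emeasure (restrict_space surface_measure (frontier \<Omega>)) (space (restrict_space surface_measure (frontier \<Omega>))) < \<infinity>"
        using frontier_surface_finite[OF dom N] by (simp add: emeasure_restrict_space space_restrict_space)
      then have "finite_measure (restrict_space surface_measure (frontier \<Omega>))"
        by (intro finite_measureI) (auto simp: less_top)
      then show ?thesis by (rule finite_measure.integrable_const)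
    qed
    then show "integrable (restrict_space surface_measure (frontier \<Omega>)) (\<lambda>x. B powr p)" by simp
    show "(\<lambda>x. norm (f x) powr p) \<in> borel_measurable (restrict_space surface_measure (frontier \<Omega>))"
      using mr by measurable
    show "AE x in restrict_space surface_measure (frontier \<Omega>). norm (norm (f x) powr p) \<le> norm (B powr p)"
      using B p by (intro AE_I2) (auto simp: space_restrict_space intro!: powr_mono2)
  qed
  then show ?thesis using mr by (simp add: in_Lp_def)
qed

lemma sobolev_norm_zero_fun:
  assumes "0 < p" "open \<Omega>" "u \<in> sobolev p \<Omega>"
  shows "sobolev_norm p \<Omega> (\<lambda>x. u x - u x) = 0"
  using sobolev_energy_scale[OF assms(2) _ assms(3), of 0] assms(1) by (simp add: sobolev_norm_energy)

text \<open>The constant sequence shows that a smooth function is one of its own traces, so the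
  choice in \<open>trace_fun\<close> has something to choose from.\<close>

lemma smooth_is_trace:
  fixes u :: "real^'n::finite \<Rightarrow> real"
  assumes dom: "bounded_C1_domain \<Omega>" and N: "2 \<le> CARD('n)" and p: "0 < p" and u: "smooth_fun u"
  shows "is_trace p \<Omega> u (trace_fun p \<Omega> u)"
proof -
  have om: "open \<Omega>" "bounded \<Omega>" using dom by (auto simp: bounded_C1_domain_def)
  have "is_trace p \<Omega> u u"
    unfolding is_trace_def
  proof (intro conjI exI[of _ "\<lambda>n. u"] allI u)
    show "in_Lp p (restrict_space surface_measure (frontier \<Omega>)) u"
      by (rule in_Lp_frontier_continuous[OF dom N p smooth_fun_continuous[OF u]])
    show "(\<lambda>n::nat. sobolev_norm p \<Omega> (\<lambda>x. u x - u x)) \<longlonglongrightarrow> 0"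
      by (simp only: sobolev_norm_zero_fun[OF p om(1) smooth_sobolev(1)[OF p om u]] tendsto_const)
  qed simp
  then show ?thesis unfolding trace_fun_def by (metis someI)
qed

lemma sobolev_energy_smooth:
  fixes w :: "real^'n::finite \<Rightarrow> real"
  assumes om: "open \<Omega>" "bounded \<Omega>" and p: "0 < p" and w: "smooth_fun w"
  shows "ennreal (sobolev_energy p \<Omega> w) = (\<integral>\<^sup>+x. indicator \<Omega> x * ennreal (\<bar>w x\<bar> powr p) \<partial>lborel)
     + (\<integral>\<^sup>+x. indicator \<Omega> x * ennreal (norm (gradient w x) powr p) \<partial>lborel)"
proof -
  have [measurable]: "w \<in> borel_measurable borel" by (rule borel_measurable_continuous_onI[OF smooth_fun_continuous[OF w]])
  have [measurable]: "gradient w \<in> borel_measurable borel" by (rule borel_measurable_gradient[OF w])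
  have [measurable]: "\<Omega> \<in> sets borel" using om by simp
  note sw = smooth_sobolev[OF p om w]
  note U = sobolev_wgrad[OF om(1) sw(1)]
  have *: "ennreal (LINT x|lebesgue_on \<Omega>. f x) = (\<integral>\<^sup>+x. indicator \<Omega> x * ennreal (f0 x) \<partial>lborel)"
    if f0[measurable]: "f0 \<in> borel_measurable borel" and ae: "AE x in lebesgue. x \<in> \<Omega> \<longrightarrow> f x = f0 x"
      and i: "integrable (lebesgue_on \<Omega>) f" and nn: "\<And>x. 0 \<le> f0 x" for f f0 :: "real^'n \<Rightarrow> real"
  proof -
    have ae': "AE x in lebesgue. x \<in> \<Omega> \<longrightarrow> f x = indicator \<Omega> x * f0 x" using ae by eventually_elim auto
    have m: "(\<lambda>x. indicator \<Omega> x * f0 x) \<in> borel_measurable borel" by measurable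
    note t = lebesgue_on_borel_transfer[OF om(1) m _ ae']
    have "ennreal (LINT x|lebesgue_on \<Omega>. f x) = ennreal (LINT x|lborel. indicator \<Omega> x * f0 x)" using t(2) by simp
    also have "\<dots> = (\<integral>\<^sup>+x. ennreal (indicator \<Omega> x * f0 x) \<partial>lborel)"
      using t(1) i nn by (intro nn_integral_eq_integral[symmetric]) auto
    also have "\<dots> = (\<integral>\<^sup>+x. indicator \<Omega> x * ennreal (f0 x) \<partial>lborel)"
      by (intro nn_integral_cong) (auto split: split_indicator)
    finally show ?thesis .
  qed
  have 1: "ennreal (LINT x|lebesgue_on \<Omega>. \<bar>w x\<bar> powr p) = (\<integral>\<^sup>+x. indicator \<Omega> x * ennreal (\<bar>w x\<bar> powr p) \<partial>lborel)"
    by (rule *) (use U(2) in \<open>auto simp: in_Lp_def\<close>)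
  have 2: "ennreal (LINT x|lebesgue_on \<Omega>. norm (wgrad \<Omega> w x) powr p) = (\<integral>\<^sup>+x. indicator \<Omega> x * ennreal (norm (gradient w x) powr p) \<partial>lborel)"
  proof (rule *)
    show "AE x in lebesgue. x \<in> \<Omega> \<longrightarrow> norm (wgrad \<Omega> w x) powr p = norm (gradient w x) powr p"
      using sw(2) unfolding AE_lebesgue_on_iff[OF om(1)] by eventually_elim auto
  qed (use U(3) in \<open>auto simp: in_Lp_def\<close>)
  show ?thesis unfolding sobolev_energy_def 1[symmetric] 2[symmetric]
    by (rule ennreal_plus) (auto intro!: integral_nonneg_AE)
qed

lemma three_powr_le:
  assumes "1 \<le> (p::real)"
  shows "\<bar>x\<bar> powr p \<le> 4 powr p * (\<bar>x - y\<bar> powr p + \<bar>y - z\<bar> powr p + \<bar>z\<bar> powr p)"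
proof -
  have "\<bar>x\<bar> powr p \<le> (\<bar>x - y\<bar> + (\<bar>y - z\<bar> + \<bar>z\<bar>)) powr p" using assms by (intro powr_mono2) auto
  also have "\<dots> \<le> 2 powr p * (\<bar>x - y\<bar> powr p + (\<bar>y - z\<bar> + \<bar>z\<bar>) powr p)"
    using assms by (intro powr_add_le) auto
  also have "\<dots> \<le> 2 powr p * (\<bar>x - y\<bar> powr p + 2 powr p * (\<bar>y - z\<bar> powr p + \<bar>z\<bar> powr p))"
    using assms by (intro mult_left_mono add_left_mono powr_add_le) auto
  also have "\<dots> \<le> 2 powr p * (2 powr p * (\<bar>x - y\<bar> powr p) + 2 powr p * (\<bar>y - z\<bar> powr p + \<bar>z\<bar> powr p))"
  proof (intro mult_left_mono add_right_mono)
    have "1 \<le> 2 powr p" using assms by (simp add: ge_one_powr_ge_zero)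
    then show "\<bar>x - y\<bar> powr p \<le> 2 powr p * (\<bar>x - y\<bar> powr p)" using mult_right_mono[of 1 "2 powr p" "\<bar>x - y\<bar> powr p"] by simp
  qed simp
  also have "\<dots> = (2 powr p * 2 powr p) * (\<bar>x - y\<bar> powr p + \<bar>y - z\<bar> powr p + \<bar>z\<bar> powr p)" by (simp add: algebra_simps)
  also have "2 powr p * 2 powr p = (4::real) powr p" by (simp add: powr_mult[symmetric])
  finally show ?thesis .
qed

context chart
begin

text \<open>The value at \<open>P z\<close> is compared with the value at \<open>z\<close> along the
  segment of length \<open>\<gamma> z < T\<close> between them, by absorption. Integrating over the
  collar leaves only volume integrals over \<Omega>.\<close>

lemma trace_inequality:
  assumes w: "smooth_fun w"
  shows "(\<integral>\<^sup>+z. indicator K z * ennreal (\<bar>w (P z)\<bar> powr p) \<partial>lborel)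
    \<le> 4 * ((\<integral>\<^sup>+x. indicator \<Omega> x * ennreal (\<bar>w x\<bar> powr p) \<partial>lborel) + (\<integral>\<^sup>+x. indicator \<Omega> x * ennreal (norm (gradient w x) powr p) \<partial>lborel))"
proof -
  have [measurable]: "w \<in> borel_measurable borel" by (rule borel_measurable_continuous_onI[OF smooth_fun_continuous[OF w]])
  have [measurable]: "gradient w \<in> borel_measurable borel" by (rule borel_measurable_gradient[OF w])
  have [measurable]: "\<Omega> \<in> sets borel" using om by simp
  define h where "h x = indicator \<Omega> x * ennreal (norm (gradient w x) powr p)" for x
  have [measurable]: "h \<in> borel_measurable borel" unfolding h_def[abs_def] by measurable
  \<comment> \<open>The range of \<sigma> does not depend on the height of \<open>z\<close>, so
    Fubini applies directly to the sweep.\<close>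
  define Sh where "Sh z = (\<integral>\<^sup>+\<sigma>. indicator {-T..T} \<sigma> * h (z + \<sigma> *\<^sub>R e) \<partial>lborel)" for z
  have [measurable]: "Sh \<in> borel_measurable borel" unfolding Sh_def[abs_def] by measurable
  have pt: "ennreal (\<bar>w (P z)\<bar> powr p) \<le> 3 * ennreal (\<bar>w z\<bar> powr p) + ennreal (4 * p) * Sh z" if z: "z \<in> K" for z
  proof -
    define c where "c = \<gamma> z"
    have c: "0 < c" "c < T" using z by (auto simp: K_def c_def)
    have zP: "P z + c *\<^sub>R e = z" by (simp add: P_def c_def)
    have pc: "p * c \<le> 1 / 2" using c T(3) p mult_left_mono[of c T p] by linarith
    have "ennreal \<bar>w z - w (P z)\<bar> \<le> ennreal c * (\<integral>\<^sup>+s. indicator {0..1} s * ennreal (norm (gradient w (P z + s *\<^sub>R c *\<^sub>R e))) \<partial>lborel)"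
    proof -
      have eq: "w z - w (P z) = (LINT s|lborel. indicator {0..1} s * (gradient w (P z + s *\<^sub>R c *\<^sub>R e) \<bullet> (c *\<^sub>R e)))"
        by (simp only: smooth_line_FTC[OF w] zP)
      have "ennreal \<bar>LINT s|lborel. indicator {0..1} s * (gradient w (P z + s *\<^sub>R c *\<^sub>R e) \<bullet> (c *\<^sub>R e))\<bar>
        \<le> (\<integral>\<^sup>+s. ennreal \<bar>indicator {0..1} s * (gradient w (P z + s *\<^sub>R c *\<^sub>R e) \<bullet> (c *\<^sub>R e))\<bar> \<partial>lborel)"
      proof (cases "integrable lborel (\<lambda>s. indicator {0..1} s * (gradient w (P z + s *\<^sub>R c *\<^sub>R e) \<bullet> (c *\<^sub>R e)))")
        case True from integral_norm_bound_ennreal[OF this] show ?thesis by simp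
      qed (simp add: not_integrable_integral_eq)
      also have "\<dots> \<le> (\<integral>\<^sup>+s. ennreal c * (indicator {0..1} s * ennreal (norm (gradient w (P z + s *\<^sub>R c *\<^sub>R e)))) \<partial>lborel)"
      proof (rule nn_integral_mono)
        fix s
        have "\<bar>gradient w (P z + s *\<^sub>R c *\<^sub>R e) \<bullet> (c *\<^sub>R e)\<bar> \<le> c * norm (gradient w (P z + s *\<^sub>R c *\<^sub>R e))"
          using Cauchy_Schwarz_ineq2[of "gradient w (P z + s *\<^sub>R c *\<^sub>R e)" "c *\<^sub>R e"] e c by (simp add: mult.commute)
        then show "ennreal \<bar>indicator {0..1} s * (gradient w (P z + s *\<^sub>R c *\<^sub>R e) \<bullet> (c *\<^sub>R e))\<bar> \<le> ennreal c * (indicator {0..1} s * ennreal (norm (gradient w (P z + s *\<^sub>R c *\<^sub>R e))))"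
          using c by (cases "s \<in> {0..1}") (auto simp: ennreal_mult[symmetric] intro!: ennreal_leI simp del: inner_scaleR_right)
      qed
      also have "\<dots> = ennreal c * (\<integral>\<^sup>+s. indicator {0..1} s * ennreal (norm (gradient w (P z + s *\<^sub>R c *\<^sub>R e))) \<partial>lborel)"
        by (rule nn_integral_cmult) measurable
      finally show ?thesis unfolding eq .
    qed
    then have "ennreal (\<bar>w (P z)\<bar> powr p) \<le> 3 * ennreal (\<bar>w z\<bar> powr p) +
      ennreal (4 * p) * (ennreal c * (\<integral>\<^sup>+s. indicator {0..1} s * ennreal (norm (gradient w (P z + s *\<^sub>R c *\<^sub>R e)) powr p) \<partial>lborel))"
      using c pc by (intro pointwise_powr_absorb[OF p, where f="\<lambda>s. norm (gradient w (P z + s *\<^sub>R c *\<^sub>R e))"]) auto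
    also have "ennreal c * (\<integral>\<^sup>+s. indicator {0..1} s * ennreal (norm (gradient w (P z + s *\<^sub>R c *\<^sub>R e)) powr p) \<partial>lborel) \<le> Sh z"
    proof -
      let ?f = "\<lambda>x. ennreal (norm (gradient w x) powr p)"
      have "(\<integral>\<^sup>+\<sigma>. indicator {-c..0} \<sigma> * ?f (z + \<sigma> *\<^sub>R e) \<partial>lborel) = \<bar>c\<bar> * (\<integral>\<^sup>+s. indicator {-c..0} (-c + c * s) * ?f (z + (-c + c * s) *\<^sub>R e) \<partial>lborel)"
        by (rule nn_integral_real_affine) (use c in auto)
      also have "(\<integral>\<^sup>+s. indicator {-c..0} (-c + c * s) * ?f (z + (-c + c * s) *\<^sub>R e) \<partial>lborel) = (\<integral>\<^sup>+s. indicator {0..1} s * ?f (P z + s *\<^sub>R c *\<^sub>R e) \<partial>lborel)"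
      proof (rule nn_integral_cong)
        fix s :: real
        have "z + (-c + c * s) *\<^sub>R e = P z + s *\<^sub>R c *\<^sub>R e" by (simp add: P_def c_def algebra_simps)
        moreover have "- c + c * s \<in> {-c..0} \<longleftrightarrow> s \<in> {0..1}" using c by (auto simp: zero_le_mult_iff mult_le_cancel_left1)
        ultimately show "indicator {-c..0} (-c + c * s) * ?f (z + (-c + c * s) *\<^sub>R e) = indicator {0..1} s * ?f (P z + s *\<^sub>R c *\<^sub>R e)"
          by (simp only: indicator_def)
      qed
      finally have "ennreal c * (\<integral>\<^sup>+s. indicator {0..1} s * ?f (P z + s *\<^sub>R c *\<^sub>R e) \<partial>lborel) = (\<integral>\<^sup>+\<sigma>. indicator {-c..0} \<sigma> * ?f (z + \<sigma> *\<^sub>R e) \<partial>lborel)"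
        using c by simp
      also have "\<dots> \<le> Sh z"
        unfolding Sh_def
      proof (rule nn_integral_mono_AE)
        \<comment> \<open>The value \<sigma> = -c gives the boundary point \<open>P z\<close>
          itself, which is not in the open set \<Omega>; a single value is negligible.\<close>
        show "AE \<sigma> in lborel. indicator {-c..0} \<sigma> * ?f (z + \<sigma> *\<^sub>R e) \<le> indicator {-T..T} \<sigma> * h (z + \<sigma> *\<^sub>R e)"
          using AE_lborel_singleton[of "- c"]
        proof eventually_elim
          case (elim \<sigma>)
          show ?case
          proof (cases "\<sigma> \<in> {-c..0}")
            case True
            have "P z + (\<sigma> + c) *\<^sub>R e \<in> \<Omega>" using True elim c by (intro line_in_om[OF z]) auto
            moreover have "P z + (\<sigma> + c) *\<^sub>R e = z + \<sigma> *\<^sub>R e" by (simp add: P_def c_def algebra_simps)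
            ultimately have "z + \<sigma> *\<^sub>R e \<in> \<Omega>" by simp
            then show ?thesis using True c by (simp add: h_def)
          qed simp
        qed
      qed
      finally show ?thesis .
    qed
    finally show ?thesis by (simp add: mult_left_mono add_left_mono)
  qed
  have KO: "z \<in> K \<Longrightarrow> z \<in> \<Omega>" for z using line_in_om[of z "\<gamma> z"] by (auto simp: K_def P_def)
  have "(\<integral>\<^sup>+z. indicator K z * ennreal (\<bar>w (P z)\<bar> powr p) \<partial>lborel)
    \<le> (\<integral>\<^sup>+z. 3 * (indicator \<Omega> z * ennreal (\<bar>w z\<bar> powr p)) + ennreal (4 * p) * Sh z \<partial>lborel)"
    using pt KO by (intro nn_integral_mono) (auto split: split_indicator)
  also have "\<dots> = 3 * (\<integral>\<^sup>+z. indicator \<Omega> z * ennreal (\<bar>w z\<bar> powr p) \<partial>lborel) + ennreal (4 * p) * (\<integral>\<^sup>+z. Sh z \<partial>lborel)"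
    by (subst nn_integral_add, measurable, subst nn_integral_cmult, measurable, subst nn_integral_cmult, measurable)
  also have "(\<integral>\<^sup>+z. Sh z \<partial>lborel) = (\<integral>\<^sup>+\<sigma>. \<integral>\<^sup>+z. indicator {-T..T} \<sigma> * h (z + \<sigma> *\<^sub>R e) \<partial>lborel \<partial>lborel)"
    unfolding Sh_def by (rule lborel_pair.Fubini') measurable
  also have "\<dots> = (\<integral>\<^sup>+\<sigma>. (\<integral>\<^sup>+z. h z \<partial>lborel) * indicator {-T..T} \<sigma> \<partial>lborel)"
  proof (rule nn_integral_cong)
    fix \<sigma> :: real
    have "(\<integral>\<^sup>+z. indicator {-T..T} \<sigma> * h (z + \<sigma> *\<^sub>R e) \<partial>lborel) = indicator {-T..T} \<sigma> * (\<integral>\<^sup>+z. h (z + \<sigma> *\<^sub>R e) \<partial>lborel)"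
      by (rule nn_integral_cmult) measurable
    then show "(\<integral>\<^sup>+z. indicator {-T..T} \<sigma> * h (z + \<sigma> *\<^sub>R e) \<partial>lborel) = (\<integral>\<^sup>+z. h z \<partial>lborel) * indicator {-T..T} \<sigma>"
      by (simp add: nn_integral_lborel_shift mult.commute)
  qed
  also have "\<dots> = (\<integral>\<^sup>+z. h z \<partial>lborel) * ennreal (2 * T)"
    using T(1) by (subst nn_integral_cmult_indicator) auto
  also have "ennreal (4 * p) * ((\<integral>\<^sup>+z. h z \<partial>lborel) * ennreal (2 * T)) = ennreal (8 * (p * T)) * (\<integral>\<^sup>+z. h z \<partial>lborel)"
  proof -
    have "ennreal (4 * p) * ennreal (2 * T) = ennreal (8 * (p * T))" using p T(1) by (subst ennreal_mult[symmetric]) auto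
    then show ?thesis by (metis mult.assoc mult.commute)
  qed
  also have "\<dots> \<le> ennreal 4 * (\<integral>\<^sup>+z. h z \<partial>lborel)" using T(3) by (intro mult_right_mono ennreal_leI) auto
  finally have "(\<integral>\<^sup>+z. indicator K z * ennreal (\<bar>w (P z)\<bar> powr p) \<partial>lborel)
     \<le> 3 * (\<integral>\<^sup>+z. indicator \<Omega> z * ennreal (\<bar>w z\<bar> powr p) \<partial>lborel) + 4 * (\<integral>\<^sup>+z. h z \<partial>lborel)" by (simp add: add_left_mono)
  also have "\<dots> \<le> 4 * (\<integral>\<^sup>+z. indicator \<Omega> z * ennreal (\<bar>w z\<bar> powr p) \<partial>lborel) + 4 * (\<integral>\<^sup>+z. h z \<partial>lborel)"
    by (intro add_right_mono mult_right_mono) auto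
  finally show ?thesis by (simp add: h_def distrib_left)
qed

text \<open>By \<open>column_le_hausdorff\<close> the image under \<open>P\<close> of the volume on
  \<open>K\<close> is at most \<open>c2\<close> times the surface measure, as measures; integrals
  inherit the comparison.\<close>

lemma push_to_frontier:
  fixes h :: "real^'n \<Rightarrow> ennreal"
  assumes h[measurable]: "h \<in> borel_measurable borel"
  shows "(\<integral>\<^sup>+z. indicator K z * h (P z) \<partial>lborel) \<le> ennreal c2 * (\<integral>\<^sup>+x. indicator (frontier \<Omega>) x * h x \<partial>surface_measure)"
proof -
  have fr[measurable]: "frontier \<Omega> \<in> sets borel" by (simp add: frontier_def)
  let ?N1 = "distr (density lborel (indicator K)) borel P"
  let ?N2 = "scale_measure (ennreal c2) (surface_measure :: (real^'n) measure)"
  have le: "?N1 \<le> ?N2"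
  proof (subst le_measure, simp, intro ballI)
    fix A :: "(real^'n) set"
    assume "A \<in> sets ?N1"
    then have True: "A \<in> sets borel" by simp
      have "emeasure ?N1 A = emeasure (density lborel (indicator K)) (P -` A)"
        using True by (subst emeasure_distr) auto
      also have "\<dots> = emeasure lborel {z \<in> K. P z \<in> A}"
      proof -
        have "P -` A \<in> sets borel" using measurable_sets_borel[OF P_meas True] .
        then have "emeasure (density lborel (indicator K)) (P -` A) = (\<integral>\<^sup>+z. indicator K z * indicator (P -` A) z \<partial>lborel)"
          by (subst emeasure_density) auto
        also have "\<dots> = (\<integral>\<^sup>+z. indicator {z \<in> K. P z \<in> A} z \<partial>lborel)"
          by (intro nn_integral_cong) (auto split: split_indicator)
        also have "\<dots> = emeasure lborel {z \<in> K. P z \<in> A}" using preimage_borel[OF True] by simp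
        finally show ?thesis .
      qed
      also have "\<dots> \<le> ennreal c2 * emeasure surface_measure A" by (rule column_le_hausdorff[OF True])
      finally show "emeasure ?N1 A \<le> emeasure ?N2 A" by simp
  qed
  have "(\<integral>\<^sup>+z. indicator K z * h (P z) \<partial>lborel) = (\<integral>\<^sup>+z. indicator K z * (indicator (frontier \<Omega>) (P z) * h (P z)) \<partial>lborel)"
    using P_frontier by (intro nn_integral_cong) (auto split: split_indicator)
  also have "\<dots> = (\<integral>\<^sup>+z. indicator (frontier \<Omega>) (P z) * h (P z) \<partial>density lborel (indicator K))"
    by (rule nn_integral_density[symmetric]) measurable
  also have "\<dots> = (\<integral>\<^sup>+x. indicator (frontier \<Omega>) x * h x \<partial>?N1)"
    by (rule nn_integral_distr[symmetric]) measurable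
  also have "\<dots> \<le> (\<integral>\<^sup>+x. indicator (frontier \<Omega>) x * h x \<partial>?N2)"
    by (rule nn_integral_mono_measure[OF _ le]) simp
  also have "\<dots> = ennreal c2 * (\<integral>\<^sup>+x. indicator (frontier \<Omega>) x * h x \<partial>surface_measure)"
    by (rule nn_integral_scale_measure) measurable
  finally show ?thesis .
qed

text \<open>\<^const>\<open>trace_fun\<close> is some trace of \<open>u\<close>, not known to be the restriction of \<open>u\<close>. The smooth
  functions that witness the trace are inserted; the trace inequality controls their distance to \<open>u\<close>
  and pushing forward to \<open>\<partial>\<Omega>\<close> their distance to the trace.\<close>

lemma H_functional_lower:
  assumes dom: "bounded_C1_domain \<Omega>" and u: "smooth_fun u"
  shows "(\<integral>\<^sup>+z. indicator K z * ennreal (\<bar>u (P z)\<bar> powr p) \<partial>lborel) \<le> ennreal (4 powr p * c2) * ennreal (H_functional p \<Omega> u)"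
proof -
  have p0: "0 < p" using p by simp
  have bd: "bounded \<Omega>" using dom by (auto simp: bounded_C1_domain_def)
  let ?R = "restrict_space surface_measure (frontier \<Omega>) :: (real^'n) measure"
  have frb[measurable]: "frontier \<Omega> \<in> sets borel" by (simp add: frontier_def)
  have fr': "frontier \<Omega> \<inter> space (surface_measure :: (real^'n) measure) \<in> sets surface_measure" by simp
  define g where "g = trace_fun p \<Omega> u"
  have "is_trace p \<Omega> u g" unfolding g_def by (rule smooth_is_trace[OF dom N p0 u])
  then obtain f where gL: "in_Lp p ?R g" and f: "\<And>n. smooth_fun (f n)"
    and fn: "(\<lambda>n. sobolev_norm p \<Omega> (\<lambda>x. f n x - u x)) \<longlonglongrightarrow> 0"
    and fg: "(\<lambda>n. LINT x|?R. \<bar>f n x - g x\<bar> powr p) \<longlonglongrightarrow> 0"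
    unfolding is_trace_def by blast
  \<comment> \<open>The chosen trace is measurable on the restricted space only; its extension by
    zero is Borel on the whole space and can be composed with \<open>P\<close>.\<close>
  define gB where "gB x = indicator (frontier \<Omega>) x *\<^sub>R g x" for x
  have [measurable]: "gB \<in> borel_measurable borel"
  proof -
    have "gB \<in> borel_measurable (surface_measure :: (real^'n) measure)"
      using gL borel_measurable_restrict_space_iff[OF fr', of g] by (simp add: in_Lp_def gB_def[abs_def])
    then show ?thesis by (simp cong: measurable_cong_sets)
  qed
  have [measurable]: "u \<in> borel_measurable borel" "\<And>n. f n \<in> borel_measurable borel"
    using u f by (auto intro!: borel_measurable_continuous_onI smooth_fun_continuous)
  have push: "(\<integral>\<^sup>+z. indicator K z * ennreal (\<bar>k (P z) - gB (P z)\<bar> powr p) \<partial>lborel) \<le> ennreal c2 * ennreal (LINT x|?R. \<bar>k x - g x\<bar> powr p)"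
    if k[measurable]: "k \<in> borel_measurable borel" and kL: "in_Lp p ?R k" for k
  proof -
    have i: "integrable ?R (\<lambda>x. \<bar>k x - g x\<bar> powr p)"
      using in_Lp_lincomb[OF _ kL gL, of 1 "-1"] p0 by (simp add: in_Lp_def)
    have "(\<integral>\<^sup>+z. indicator K z * ennreal (\<bar>k (P z) - gB (P z)\<bar> powr p) \<partial>lborel) \<le> ennreal c2 * (\<integral>\<^sup>+x. indicator (frontier \<Omega>) x * ennreal (\<bar>k x - gB x\<bar> powr p) \<partial>surface_measure)"
      by (rule push_to_frontier) measurable
    also have "(\<integral>\<^sup>+x. indicator (frontier \<Omega>) x * ennreal (\<bar>k x - gB x\<bar> powr p) \<partial>surface_measure) = (\<integral>\<^sup>+x. ennreal (\<bar>k x - g x\<bar> powr p) \<partial>?R)"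
      unfolding nn_integral_restrict_space[OF fr']
      by (intro nn_integral_cong) (auto simp: gB_def split: split_indicator)
    also have "\<dots> = ennreal (LINT x|?R. \<bar>k x - g x\<bar> powr p)" using i by (intro nn_integral_eq_integral) auto
    finally show ?thesis .
  qed
  define A where "A n = 4 * ennreal (sobolev_energy p \<Omega> (\<lambda>x. f n x - u x))" for n
  define B where "B n = ennreal c2 * ennreal (LINT x|?R. \<bar>f n x - g x\<bar> powr p)" for n
  have smd: "smooth_fun (\<lambda>x. f n x - u x)" for n
  proof -
    have "smooth_fun (\<lambda>x. f n x + (-1) * u x)" by (intro smooth_fun_add smooth_fun_mult smooth_fun_const f u)
    then show ?thesis by simp
  qed
  have "(\<integral>\<^sup>+z. indicator K z * ennreal (\<bar>u (P z)\<bar> powr p) \<partial>lborel) \<le> ennreal (4 powr p) * (A n + B n + ennreal c2 * ennreal (H_functional p \<Omega> u))" for n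
  proof -
    have "(\<integral>\<^sup>+z. indicator K z * ennreal (\<bar>u (P z)\<bar> powr p) \<partial>lborel) \<le> (\<integral>\<^sup>+z. ennreal (4 powr p) * (indicator K z * ennreal (\<bar>f n (P z) - u (P z)\<bar> powr p)
       + indicator K z * ennreal (\<bar>f n (P z) - gB (P z)\<bar> powr p) + indicator K z * ennreal (\<bar>0 - gB (P z)\<bar> powr p)) \<partial>lborel)"
    proof (rule nn_integral_mono)
      fix z
      have "ennreal (\<bar>u (P z)\<bar> powr p) \<le> ennreal (4 powr p * (\<bar>u (P z) - f n (P z)\<bar> powr p + \<bar>f n (P z) - gB (P z)\<bar> powr p + \<bar>gB (P z)\<bar> powr p))"
        by (rule ennreal_leI[OF three_powr_le[OF p]])
      also have "\<dots> = ennreal (4 powr p) * (ennreal (\<bar>f n (P z) - u (P z)\<bar> powr p) + ennreal (\<bar>f n (P z) - gB (P z)\<bar> powr p) + ennreal (\<bar>0 - gB (P z)\<bar> powr p))"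
        by (simp add: ennreal_mult abs_minus_commute)
      finally show "indicator K z * ennreal (\<bar>u (P z)\<bar> powr p) \<le> ennreal (4 powr p) * (indicator K z * ennreal (\<bar>f n (P z) - u (P z)\<bar> powr p)
       + indicator K z * ennreal (\<bar>f n (P z) - gB (P z)\<bar> powr p) + indicator K z * ennreal (\<bar>0 - gB (P z)\<bar> powr p))"
        by (cases "z \<in> K") simp_all
    qed
    also have "\<dots> = ennreal (4 powr p) * ((\<integral>\<^sup>+z. indicator K z * ennreal (\<bar>f n (P z) - u (P z)\<bar> powr p) \<partial>lborel)
       + (\<integral>\<^sup>+z. indicator K z * ennreal (\<bar>f n (P z) - gB (P z)\<bar> powr p) \<partial>lborel) + (\<integral>\<^sup>+z. indicator K z * ennreal (\<bar>0 - gB (P z)\<bar> powr p) \<partial>lborel))"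
      by (subst nn_integral_cmult, measurable, subst nn_integral_add, measurable, subst nn_integral_add, measurable)
    also have "\<dots> \<le> ennreal (4 powr p) * (A n + B n + ennreal c2 * ennreal (H_functional p \<Omega> u))"
    proof (intro mult_left_mono add_mono)
      show "(\<integral>\<^sup>+z. indicator K z * ennreal (\<bar>f n (P z) - u (P z)\<bar> powr p) \<partial>lborel) \<le> A n"
        using trace_inequality[OF smd[of n]] unfolding A_def sobolev_energy_smooth[OF om bd p0 smd] .
      show "(\<integral>\<^sup>+z. indicator K z * ennreal (\<bar>f n (P z) - gB (P z)\<bar> powr p) \<partial>lborel) \<le> B n"
        unfolding B_def by (rule push) (auto intro: in_Lp_frontier_continuous[OF dom N p0 smooth_fun_continuous[OF f]])
      have "in_Lp p ?R (\<lambda>x. 0 :: real)" by (rule in_Lp_frontier_continuous[OF dom N p0]) simp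
      from push[OF _ this]
      show "(\<integral>\<^sup>+z. indicator K z * ennreal (\<bar>0 - gB (P z)\<bar> powr p) \<partial>lborel) \<le> ennreal c2 * ennreal (H_functional p \<Omega> u)"
        by (simp add: H_functional_def g_def)
    qed simp
    finally show ?thesis .
  qed
  moreover have "(\<lambda>n. ennreal (4 powr p) * (A n + B n + ennreal c2 * ennreal (H_functional p \<Omega> u))) \<longlonglongrightarrow> ennreal (4 powr p) * (4 * ennreal 0 + ennreal c2 * ennreal 0 + ennreal c2 * ennreal (H_functional p \<Omega> u))"
  proof -
    have "(\<lambda>n. sobolev_norm p \<Omega> (\<lambda>x. f n x - u x) powr p) \<longlonglongrightarrow> 0"
      using p0 by (intro tendsto_zero_powrI[OF fn tendsto_const]) (auto simp: sobolev_norm_def)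
    moreover have "sobolev_norm p \<Omega> (\<lambda>x. f n x - u x) powr p = sobolev_energy p \<Omega> (\<lambda>x. f n x - u x)" for n
      using p0 sobolev_energy_nonneg[of p \<Omega> "\<lambda>x. f n x - u x"] by (simp add: sobolev_norm_energy powr_powr)
    ultimately have "(\<lambda>n. sobolev_energy p \<Omega> (\<lambda>x. f n x - u x)) \<longlonglongrightarrow> 0" by simp
    then have 1: "(\<lambda>n. ennreal (sobolev_energy p \<Omega> (\<lambda>x. f n x - u x))) \<longlonglongrightarrow> ennreal 0" by (rule tendsto_ennrealI)
    have 2: "(\<lambda>n. ennreal (LINT x|?R. \<bar>f n x - g x\<bar> powr p)) \<longlonglongrightarrow> ennreal 0" using fg by (rule tendsto_ennrealI)
    show ?thesis unfolding A_def B_def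
      by (intro ennreal_tendsto_cmult tendsto_add tendsto_const 1 2) auto
  qed
  ultimately have "(\<integral>\<^sup>+z. indicator K z * ennreal (\<bar>u (P z)\<bar> powr p) \<partial>lborel) \<le> ennreal (4 powr p) * (4 * ennreal 0 + ennreal c2 * ennreal 0 + ennreal c2 * ennreal (H_functional p \<Omega> u))"
    by (intro LIMSEQ_le_const) auto
  then show ?thesis using c2 by (simp add: ennreal_mult mult.assoc)
qed

end

section \<open>Symmetric sets of large genus\<close>

definition ball_bump :: "real^'n::finite \<Rightarrow> real \<Rightarrow> real^'n \<Rightarrow> real" where
  "ball_bump y s x = bump_exp 0 (1 - ((x - y) \<bullet> (x - y)) / s\<^sup>2)"

lemma smooth_ball_bump: "smooth_fun (ball_bump y s)"
proof -
  have eq: "1 - ((x - y) \<bullet> (x - y)) / s\<^sup>2 = 1 + (- (1 / s\<^sup>2)) * (\<Sum>i\<in>UNIV. (x \<bullet> axis i 1 + - y $ i) * (x \<bullet> axis i 1 + - y $ i))" for x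
  proof -
    have "(x - y) \<bullet> (x - y) = (\<Sum>i\<in>UNIV. (x $ i + - y $ i) * (x $ i + - y $ i))" by (simp add: inner_vec_def)
    then show ?thesis by (simp add: inner_axis)
  qed
  show ?thesis
    unfolding ball_bump_def eq
    by (intro smooth_fun_bump_exp smooth_fun_add smooth_fun_mult smooth_fun_const smooth_fun_sum smooth_fun_inner)
qed

lemma ball_bump_range: "0 \<le> ball_bump y s x" "ball_bump y s x \<le> 1"
  unfolding ball_bump_def using bump_exp_nonneg[of 0] bump_exp_le[of 0] by auto

lemma ball_bump_outside: "0 < s \<Longrightarrow> x \<notin> ball y s \<Longrightarrow> ball_bump y s x = 0"
proof -
  assume s: "0 < s" and "x \<notin> ball y s"
  then have "s\<^sup>2 \<le> (norm (x - y))\<^sup>2" by (intro power_mono) (auto simp: dist_norm norm_minus_commute)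
  then show ?thesis using s by (simp add: ball_bump_def bump_exp_def power2_norm_eq_inner)
qed

lemma ball_bump_inside: "0 < s \<Longrightarrow> x \<in> ball y (s / 2) \<Longrightarrow> exp (- 4 / 3) \<le> ball_bump y s x"
proof -
  assume s: "0 < s" and x: "x \<in> ball y (s / 2)"
  define t where "t = 1 - ((x - y) \<bullet> (x - y)) / s\<^sup>2"
  have "(norm (x - y))\<^sup>2 \<le> (s / 2)\<^sup>2" using x by (intro power_mono) (auto simp: dist_norm norm_minus_commute)
  then have t: "3 / 4 \<le> t" using s by (simp add: t_def power2_norm_eq_inner field_simps)
  then have "1 / t \<le> 4 / 3" by (simp add: field_simps)
  then show ?thesis using t unfolding ball_bump_def bump_exp_def t_def[symmetric] by simp
qed

lemma gradientI:
  fixes f :: "real^'n::finite \<Rightarrow> real"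
  assumes "(f has_derivative (\<lambda>h. g \<bullet> h)) (at x)"
  shows "gradient f x = g"
  using partial_derivI[OF assms] by (simp add: gradient_def vec_eq_iff inner_axis)

lemma gradient_ball_bump:
  assumes s: "0 < s"
  shows "norm (gradient (ball_bump y s) x) \<le> 4 / s * indicator (ball y s) x"
proof -
  define q where "q = 1 - ((x - y) \<bullet> (x - y)) / s\<^sup>2"
  have "((\<lambda>x. 1 - ((x - y) \<bullet> (x - y)) / s\<^sup>2) has_derivative (\<lambda>h. - ((x - y) \<bullet> h + h \<bullet> (x - y)) / s\<^sup>2)) (at x)"
    by (auto intro!: derivative_eq_intros simp: divide_inverse algebra_simps)
  moreover have "(bump_exp 0 has_real_derivative bump_exp 2 q) (at (1 - ((x - y) \<bullet> (x - y)) / s\<^sup>2))"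
    using bump_exp_deriv[of 0 q] by (simp add: q_def numeral_2_eq_2)
  ultimately have "(ball_bump y s has_derivative (\<lambda>h. (- ((x - y) \<bullet> h + h \<bullet> (x - y)) / s\<^sup>2) * bump_exp 2 q)) (at x)"
    unfolding ball_bump_def[abs_def] by (intro DERIV_compose_FDERIV)
  moreover have "(\<lambda>h. (- ((x - y) \<bullet> h + h \<bullet> (x - y)) / s\<^sup>2) * bump_exp 2 q) = (\<lambda>h. ((- 2 * bump_exp 2 q / s\<^sup>2) *\<^sub>R (x - y)) \<bullet> h)"
    by (rule ext) (simp add: inner_commute[of _ "x - y"])
  ultimately have eq: "gradient (ball_bump y s) x = (- 2 * bump_exp 2 q / s\<^sup>2) *\<^sub>R (x - y)" by (intro gradientI) simp
  have b: "0 \<le> bump_exp 2 q" "bump_exp 2 q \<le> 2" using bump_exp_nonneg[of 2] bump_exp_le[of 2 q] by (auto simp: fact_numeral)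
  show ?thesis
  proof (cases "x \<in> ball y s")
    case True
    have "norm (gradient (ball_bump y s) x) = 2 * bump_exp 2 q / s\<^sup>2 * norm (x - y)" using b by (simp add: eq)
    also have "\<dots> \<le> 2 * 2 / s\<^sup>2 * s" using b s True
      by (intro mult_mono divide_right_mono) (auto simp: dist_norm norm_minus_commute)
    also have "\<dots> = 4 / s" using s by (simp add: power2_eq_square)
    finally show ?thesis using True by simp
  next
    case False
    then have "s\<^sup>2 \<le> (norm (x - y))\<^sup>2" using s by (intro power_mono) (auto simp: dist_norm norm_minus_commute)
    then have "q \<le> 0" using s by (simp add: q_def power2_norm_eq_inner)
    then show ?thesis using False by (simp add: eq bump_exp_def)
  qed
qed

text \<open>At most one summand survives, so the power passes through the sum. This is how
  disjointness of the supports of the bumps enters.\<close>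

lemma norm_sum_single_powr:
  fixes f :: "'i \<Rightarrow> 'a::real_normed_vector"
  assumes fin: "finite J" and one: "\<And>i j. i \<in> J \<Longrightarrow> j \<in> J \<Longrightarrow> f i \<noteq> 0 \<Longrightarrow> f j \<noteq> 0 \<Longrightarrow> i = j"
  shows "norm (\<Sum>j\<in>J. f j) powr p = (\<Sum>j\<in>J. norm (f j) powr p)"
proof (cases "\<exists>j\<in>J. f j \<noteq> 0")
  case True
  then obtain j where j: "j \<in> J" "f j \<noteq> 0" by blast
  have z: "f i = 0" if "i \<in> J - {j}" for i using one[of i j] j that by blast
  show ?thesis
    unfolding sum.remove[OF fin j(1)] using z by simp
qed simp

definition bump_comb :: "(nat \<Rightarrow> real^'n::finite) \<Rightarrow> real \<Rightarrow> nat \<Rightarrow> (nat \<Rightarrow> real) \<Rightarrow> real^'n \<Rightarrow> real" where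
  "bump_comb X s m t x = (\<Sum>j\<le>m. t j * ball_bump (X j) s x)"

lemma smooth_bump_comb: "smooth_fun (bump_comb X s m t)"
  unfolding bump_comb_def[abs_def] by (intro smooth_fun_sum smooth_fun_mult smooth_fun_const smooth_ball_bump)

lemma gradient_bump_comb: "gradient (bump_comb X s m t) x = (\<Sum>j\<le>m. t j *\<^sub>R gradient (ball_bump (X j) s) x)"
proof (rule gradientI)
  show "(bump_comb X s m t has_derivative (\<bullet>) (\<Sum>j\<le>m. t j *\<^sub>R gradient (ball_bump (X j) s) x)) (at x)"
    unfolding bump_comb_def[abs_def]
    by (auto intro!: derivative_eq_intros has_derivative_gradient smooth_ball_bump simp: inner_sum_left)
qed

lemma disjoint_balls_unique:
  assumes sep: "\<And>i j. i \<le> (m::nat) \<Longrightarrow> j \<le> m \<Longrightarrow> i \<noteq> j \<Longrightarrow> 2 * s \<le> dist (X i) (X j)"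
    and "i \<le> m" "j \<le> m" "x \<in> ball (X i) s" "x \<in> ball (X j) s"
  shows "i = j"
  using assms dist_triangle[of "X i" "X j" x] by (force simp: dist_commute)

lemma bump_comb_powr:
  assumes s: "0 < s" and sep: "\<And>i j. i \<le> m \<Longrightarrow> j \<le> m \<Longrightarrow> i \<noteq> j \<Longrightarrow> 2 * s \<le> dist (X i) (X j)"
  shows "\<bar>bump_comb X s m t x\<bar> powr p = (\<Sum>j\<le>m. \<bar>t j * ball_bump (X j) s x\<bar> powr p)"
    "norm (gradient (bump_comb X s m t) x) powr p = (\<Sum>j\<le>m. norm (t j *\<^sub>R gradient (ball_bump (X j) s) x) powr p)"
proof -
  have in_ball: "x \<in> ball (X j) s" if "t j * ball_bump (X j) s x \<noteq> 0" for j using that ball_bump_outside[OF s] by force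
  have in_ball': "x \<in> ball (X j) s" if "t j *\<^sub>R gradient (ball_bump (X j) s) x \<noteq> 0" for j
    using that gradient_ball_bump[OF s, of "X j" x] by (cases "x \<in> ball (X j) s") auto
  have one: "i = j" if "i \<le> m" "j \<le> m" "x \<in> ball (X i) s" "x \<in> ball (X j) s" for i j
    by (rule disjoint_balls_unique[where X=X, OF sep that])
  show "\<bar>bump_comb X s m t x\<bar> powr p = (\<Sum>j\<le>m. \<bar>t j * ball_bump (X j) s x\<bar> powr p)"
    unfolding bump_comb_def real_norm_def[symmetric]
  proof (rule norm_sum_single_powr)
    fix i j assume "i \<in> {..m}" "j \<in> {..m}" "t i * ball_bump (X i) s x \<noteq> 0" "t j * ball_bump (X j) s x \<noteq> 0"
    then show "i = j" using one[of i j] in_ball[of i] in_ball[of j] by simp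
  qed simp
  show "norm (gradient (bump_comb X s m t) x) powr p = (\<Sum>j\<le>m. norm (t j *\<^sub>R gradient (ball_bump (X j) s) x) powr p)"
    unfolding gradient_bump_comb
  proof (rule norm_sum_single_powr)
    fix i j assume "i \<in> {..m}" "j \<in> {..m}" "t i *\<^sub>R gradient (ball_bump (X i) s) x \<noteq> 0" "t j *\<^sub>R gradient (ball_bump (X j) s) x \<noteq> 0"
    then show "i = j" using one[of i j] in_ball'[of i] in_ball'[of j] by simp
  qed simp
qed

text \<open>The balls are disjoint, so the energies of the single bumps add up; a bump is at most 1
  and its gradient at most \<open>4 / s\<close>, both supported in a ball of radius
  \<open>s\<close>.\<close>

lemma bump_comb_energy:
  fixes X :: "nat \<Rightarrow> real^'n::finite"
  assumes om: "open \<Omega>" "bounded \<Omega>" and p: "0 < p" and s: "0 < s"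
    and sep: "\<And>i j. i \<le> m \<Longrightarrow> j \<le> m \<Longrightarrow> i \<noteq> j \<Longrightarrow> 2 * s \<le> dist (X i) (X j)"
  shows "sobolev_energy p \<Omega> (bump_comb X s m t)
    \<le> (\<Sum>j\<le>m. \<bar>t j\<bar> powr p) * ((1 + (4 / s) powr p) * (unit_ball_vol (real CARD('n)) * s ^ CARD('n)))"
proof -
  let ?V = "unit_ball_vol (real CARD('n)) * s ^ CARD('n)"
  have pw: "\<bar>bump_comb X s m t x\<bar> powr p = (\<Sum>j\<le>m. \<bar>t j * ball_bump (X j) s x\<bar> powr p)" for x
    by (rule bump_comb_powr(1)[OF s]) (rule sep)
  have pw': "norm (gradient (bump_comb X s m t) x) powr p = (\<Sum>j\<le>m. norm (t j *\<^sub>R gradient (ball_bump (X j) s) x) powr p)" for x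
    by (rule bump_comb_powr(2)[OF s]) (rule sep)
  have V: "emeasure lborel (ball (X j) s) = ennreal ?V" for j
    using s by (simp only: emeasure_ball[OF less_imp_le] DIM_cart DIM_real mult_1_right)
  have cm: "(\<integral>\<^sup>+x. k * indicator (ball (X j) s) x \<partial>lborel) = k * ennreal ?V" for k j
    unfolding V[of j, symmetric] by (rule nn_integral_cmult_indicator) simp
  have int: "(\<integral>\<^sup>+x. (\<Sum>j\<le>m. ennreal (c * \<bar>t j\<bar> powr p) * indicator (ball (X j) s) x) \<partial>lborel) = ennreal (c * (\<Sum>j\<le>m. \<bar>t j\<bar> powr p) * ?V)"
    if c: "0 \<le> c" for c
  proof -
    have "(\<integral>\<^sup>+x. (\<Sum>j\<le>m. ennreal (c * \<bar>t j\<bar> powr p) * indicator (ball (X j) s) x) \<partial>lborel) = (\<Sum>j\<le>m. \<integral>\<^sup>+x. ennreal (c * \<bar>t j\<bar> powr p) * indicator (ball (X j) s) x \<partial>lborel)"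
      by (rule nn_integral_sum, intro borel_measurable_times_ennreal borel_measurable_const borel_measurable_indicator) simp
    also have "\<dots> = (\<Sum>j\<le>m. ennreal (c * \<bar>t j\<bar> powr p) * ennreal ?V)" by (simp only: cm)
    also have "\<dots> = (\<Sum>j\<le>m. ennreal (c * \<bar>t j\<bar> powr p * ?V))"
      using c s by (intro sum.cong refl ennreal_mult[symmetric]) auto
    also have "\<dots> = ennreal (\<Sum>j\<le>m. c * \<bar>t j\<bar> powr p * ?V)" using c s by (intro sum_ennreal) auto
    also have "(\<Sum>j\<le>m. c * \<bar>t j\<bar> powr p * ?V) = c * (\<Sum>j\<le>m. \<bar>t j\<bar> powr p) * ?V" by (simp add: sum_distrib_left sum_distrib_right mult.assoc)
    finally show ?thesis .
  qed
  have dom: "indicator \<Omega> x * ennreal (\<Sum>j\<le>m. a j) \<le> (\<Sum>j\<le>m. ennreal (c * \<bar>t j\<bar> powr p) * indicator (ball (X j) s) x)"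
    if "\<And>j. 0 \<le> a j" "\<And>j. a j \<le> c * \<bar>t j\<bar> powr p * indicator (ball (X j) s) x" for a c and x :: "real^'n"
  proof -
    have "indicator \<Omega> x * ennreal (\<Sum>j\<le>m. a j) \<le> ennreal (\<Sum>j\<le>m. a j)" by (auto split: split_indicator)
    also have "\<dots> = (\<Sum>j\<le>m. ennreal (a j))" using that(1) by (simp add: sum_ennreal)
    also have "\<dots> \<le> (\<Sum>j\<le>m. ennreal (c * \<bar>t j\<bar> powr p * indicator (ball (X j) s) x))" by (intro sum_mono ennreal_leI that(2))
    also have "\<dots> = (\<Sum>j\<le>m. ennreal (c * \<bar>t j\<bar> powr p) * indicator (ball (X j) s) x)"
      by (intro sum.cong) (auto split: split_indicator)
    finally show ?thesis .
  qed
  have 1: "(\<integral>\<^sup>+x. indicator \<Omega> x * ennreal (\<bar>bump_comb X s m t x\<bar> powr p) \<partial>lborel) \<le> ennreal (1 * (\<Sum>j\<le>m. \<bar>t j\<bar> powr p) * ?V)"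
    unfolding int[OF zero_le_one, symmetric] pw
  proof (rule nn_integral_mono, rule dom)
    fix x j
    have "\<bar>ball_bump (X j) s x\<bar> powr p \<le> indicator (ball (X j) s) x"
      using ball_bump_range[of "X j" s x] ball_bump_outside[OF s, of x "X j"] p powr_mono2[of p "\<bar>ball_bump (X j) s x\<bar>" 1]
      by (cases "x \<in> ball (X j) s") auto
    then show "\<bar>t j * ball_bump (X j) s x\<bar> powr p \<le> 1 * \<bar>t j\<bar> powr p * indicator (ball (X j) s) x"
      by (simp add: abs_mult powr_mult mult_left_mono)
  qed simp
  have 2: "(\<integral>\<^sup>+x. indicator \<Omega> x * ennreal (norm (gradient (bump_comb X s m t) x) powr p) \<partial>lborel) \<le> ennreal ((4 / s) powr p * (\<Sum>j\<le>m. \<bar>t j\<bar> powr p) * ?V)"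
    unfolding int[OF powr_ge_zero, symmetric] pw'
  proof (rule nn_integral_mono, rule dom)
    fix x j
    have "norm (gradient (ball_bump (X j) s) x) powr p \<le> (4 / s) powr p * indicator (ball (X j) s) x"
      using gradient_ball_bump[OF s, of "X j" x] p powr_mono2[of p "norm (gradient (ball_bump (X j) s) x)" "4 / s"]
      by (cases "x \<in> ball (X j) s") auto
    then show "norm (t j *\<^sub>R gradient (ball_bump (X j) s) x) powr p \<le> (4 / s) powr p * \<bar>t j\<bar> powr p * indicator (ball (X j) s) x"
      by (auto simp: powr_mult mult_left_mono mult.assoc mult.left_commute)
  qed simp
  have nn: "0 \<le> (\<Sum>j\<le>m. \<bar>t j\<bar> powr p)" "0 \<le> ?V" using s by (auto intro: sum_nonneg)
  have "ennreal (sobolev_energy p \<Omega> (bump_comb X s m t)) \<le> ennreal (1 * (\<Sum>j\<le>m. \<bar>t j\<bar> powr p) * ?V) + ennreal ((4 / s) powr p * (\<Sum>j\<le>m. \<bar>t j\<bar> powr p) * ?V)"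
    unfolding sobolev_energy_smooth[OF om p smooth_bump_comb] by (intro add_mono 1 2)
  also have "\<dots> = ennreal (1 * (\<Sum>j\<le>m. \<bar>t j\<bar> powr p) * ?V + (4 / s) powr p * (\<Sum>j\<le>m. \<bar>t j\<bar> powr p) * ?V)"
    using nn s by (intro ennreal_plus[symmetric] mult_nonneg_nonneg) auto
  also have "1 * (\<Sum>j\<le>m. \<bar>t j\<bar> powr p) * ?V + (4 / s) powr p * (\<Sum>j\<le>m. \<bar>t j\<bar> powr p) * ?V = (\<Sum>j\<le>m. \<bar>t j\<bar> powr p) * ((1 + (4 / s) powr p) * ?V)"
    by (simp add: algebra_simps)
  finally show ?thesis using nn s by (subst (asm) ennreal_le_iff) auto
qed

text \<open>On the ball of half the radius each bump is at least \<open>exp (- 4 / 3)\<close>, and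
  the column over that ball has volume at least \<open>c3 * (s / 2) ^ d\<close>. The bound
  \<open>H_functional_lower\<close> carries this volume estimate over to the boundary integral of
  the trace.\<close>

lemma (in chart) bump_comb_H:
  assumes dom: "bounded_C1_domain \<Omega>" and s: "0 < s" "2 * s \<le> T" and X: "\<And>j. j \<le> m \<Longrightarrow> X j \<in> S"
    and sep: "\<And>i j. i \<le> m \<Longrightarrow> j \<le> m \<Longrightarrow> i \<noteq> j \<Longrightarrow> 2 * s \<le> dist (X i) (X j)"
  shows "(\<Sum>j\<le>m. \<bar>t j\<bar> powr p) * (exp (- 4 / 3) powr p * (c3 * (s / 2) ^ d)) \<le> 4 powr p * c2 * H_functional p \<Omega> (bump_comb X s m t)"
proof -
  let ?E = "exp (- 4 / 3) powr p"
  have pw: "\<bar>bump_comb X s m t x\<bar> powr p = (\<Sum>j\<le>m. \<bar>t j * ball_bump (X j) s x\<bar> powr p)" for x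
    by (rule bump_comb_powr(1)[OF s(1)]) (rule sep)
  have H0: "0 \<le> H_functional p \<Omega> (bump_comb X s m t)" unfolding H_functional_def by (intro integral_nonneg_AE) auto
  have meas: "{z \<in> K. P z \<in> ball (X j) (s / 2)} \<in> sets borel" for j by (rule preimage_borel) simp
  have "ennreal ((\<Sum>j\<le>m. \<bar>t j\<bar> powr p) * (?E * (c3 * (s / 2) ^ d))) = (\<Sum>j\<le>m. ennreal (\<bar>t j\<bar> powr p * ?E) * ennreal (c3 * (s / 2) ^ d))"
    using c3 s by (simp add: sum_distrib_right mult.assoc ennreal_mult[symmetric] sum_ennreal)
  also have "\<dots> \<le> (\<Sum>j\<le>m. ennreal (\<bar>t j\<bar> powr p * ?E) * emeasure lborel {z \<in> K. P z \<in> ball (X j) (s / 2)})"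
    using X s by (intro sum_mono mult_left_mono column_ball_ge) auto
  also have "\<dots> = (\<integral>\<^sup>+z. (\<Sum>j\<le>m. ennreal (\<bar>t j\<bar> powr p * ?E) * indicator {z \<in> K. P z \<in> ball (X j) (s / 2)} z) \<partial>lborel)"
    using meas by (subst nn_integral_sum) (auto simp: nn_integral_cmult_indicator simp del: mem_ball)
  also have "\<dots> \<le> (\<integral>\<^sup>+z. indicator K z * ennreal (\<bar>bump_comb X s m t (P z)\<bar> powr p) \<partial>lborel)"
    unfolding pw
  proof (rule nn_integral_mono)
    fix z
    have "(\<Sum>j\<le>m. ennreal (\<bar>t j\<bar> powr p * ?E) * indicator {z \<in> K. P z \<in> ball (X j) (s / 2)} z)
      \<le> (\<Sum>j\<le>m. indicator K z * ennreal (\<bar>t j * ball_bump (X j) s (P z)\<bar> powr p))"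
    proof (rule sum_mono)
      fix j
      show "ennreal (\<bar>t j\<bar> powr p * ?E) * indicator {z \<in> K. P z \<in> ball (X j) (s / 2)} z \<le> indicator K z * ennreal (\<bar>t j * ball_bump (X j) s (P z)\<bar> powr p)"
      proof (cases "z \<in> K \<and> P z \<in> ball (X j) (s / 2)")
        case True
        have "?E \<le> \<bar>ball_bump (X j) s (P z)\<bar> powr p"
          using ball_bump_inside[OF s(1), of "P z" "X j"] True p by (intro powr_mono2) auto
        then have "\<bar>t j\<bar> powr p * ?E \<le> \<bar>t j * ball_bump (X j) s (P z)\<bar> powr p" by (simp add: abs_mult powr_mult mult_left_mono)
        then show ?thesis using True by (simp add: ennreal_leI del: mem_ball)
      qed (auto split: split_indicator)
    qed
    also have "\<dots> = indicator K z * ennreal (\<Sum>j\<le>m. \<bar>t j * ball_bump (X j) s (P z)\<bar> powr p)"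
      by (simp add: sum_ennreal sum_distrib_left[symmetric])
    finally show "(\<Sum>j\<le>m. ennreal (\<bar>t j\<bar> powr p * ?E) * indicator {z \<in> K. P z \<in> ball (X j) (s / 2)} z) \<le> indicator K z * ennreal (\<Sum>j\<le>m. \<bar>t j * ball_bump (X j) s (P z)\<bar> powr p)" .
  qed
  also have "\<dots> \<le> ennreal (4 powr p * c2) * ennreal (H_functional p \<Omega> (bump_comb X s m t))"
    by (rule H_functional_lower[OF dom smooth_bump_comb])
  also have "\<dots> = ennreal (4 powr p * c2 * H_functional p \<Omega> (bump_comb X s m t))" using c2 H0 by (simp add: ennreal_mult)
  finally show ?thesis using c2 H0 by (subst (asm) ennreal_le_iff) auto
qed

text \<open>A centre with nonzero coefficient lies on the boundary, so the open set where the
  combination is nonzero meets \<Omega> in a nonempty open set, which is not negligible.\<close>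

lemma bump_comb_nonzero:
  fixes X :: "nat \<Rightarrow> real^'n::finite"
  assumes om: "open \<Omega>" and s: "0 < s" and X: "\<And>j. j \<le> m \<Longrightarrow> X j \<in> frontier \<Omega>"
    and sep: "\<And>i j. i \<le> m \<Longrightarrow> j \<le> m \<Longrightarrow> i \<noteq> j \<Longrightarrow> 2 * s \<le> dist (X i) (X j)"
    and t: "j \<le> m" "t j \<noteq> 0"
  shows "\<not> (AE x in lebesgue_on \<Omega>. bump_comb X s m t x = 0)"
proof
  assume ae: "AE x in lebesgue_on \<Omega>. bump_comb X s m t x = 0"
  let ?u = "bump_comb X s m t"
  have cont: "continuous_on UNIV ?u" by (rule smooth_fun_continuous[OF smooth_bump_comb])
  have "?u (X j) \<noteq> 0"
  proof -
    have "\<bar>t j * ball_bump (X j) s (X j)\<bar> powr 1 \<le> (\<Sum>i\<le>m. \<bar>t i * ball_bump (X i) s (X j)\<bar> powr 1)"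
      using t by (intro member_le_sum) auto
    also have "\<dots> = \<bar>?u (X j)\<bar> powr 1" by (rule bump_comb_powr(1)[symmetric, OF s]) (rule sep)
    finally have "\<bar>t j * ball_bump (X j) s (X j)\<bar> \<le> \<bar>?u (X j)\<bar>" by simp
    moreover have "0 < ball_bump (X j) s (X j)" by (rule less_le_trans[OF exp_gt_zero ball_bump_inside[OF s]]) (use s in simp)
    ultimately show ?thesis using t by auto
  qed
  have op: "open {x. ?u x \<noteq> 0}" using cont by (intro open_Collect_neq continuous_on_const) 
  have "X j \<in> closure \<Omega>" using X[OF t(1)] by (simp add: frontier_def)
  then have "{x. ?u x \<noteq> 0} \<inter> \<Omega> \<noteq> {}" using open_Int_closure_eq_empty[OF op, of \<Omega>] \<open>?u (X j) \<noteq> 0\<close> by blast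
  moreover have "negligible ({x. ?u x \<noteq> 0} \<inter> \<Omega>)"
  proof -
    have "AE x in lebesgue. x \<notin> {x. ?u x \<noteq> 0} \<inter> \<Omega>" using ae unfolding AE_lebesgue_on_iff[OF om] by eventually_elim auto
    then show ?thesis using op om by (subst negligible_iff_null_sets) (simp add: AE_iff_null_sets)
  qed
  moreover have "open ({x. ?u x \<noteq> 0} \<inter> \<Omega>)" using op om by auto
  ultimately show False using open_not_negligible by blast
qed

lemma topspace_sobolev_topology: "topspace (sobolev_topology p \<Omega>) = sobolev p \<Omega>"
proof
  show "topspace (sobolev_topology p \<Omega>) \<subseteq> sobolev p \<Omega>"
    using openin_topspace[of "sobolev_topology p \<Omega>"] unfolding openin_sobolev_topology by blast
  have "openin (sobolev_topology p \<Omega>) (sobolev p \<Omega>)"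
    unfolding openin_sobolev_topology by (auto intro: exI[of _ 1])
  then show "sobolev p \<Omega> \<subseteq> topspace (sobolev_topology p \<Omega>)" by (rule openin_subset)
qed

lemma nsphere_nonzero: "t \<in> topspace (nsphere m) \<Longrightarrow> \<exists>j\<le>m. t j \<noteq> 0"
  by (rule ccontr) (simp add: topspace_nsphere)

lemma bump_comb_minus: "bump_comb X s m (\<lambda>i. - t i) x = - bump_comb X s m t x"
  by (simp add: bump_comb_def sum_negf)

lemma bump_comb_diff: "bump_comb X s m t x - bump_comb X s m t' x = bump_comb X s m (\<lambda>i. t i - t' i) x"
  by (simp add: bump_comb_def sum_subtractf left_diff_distrib)

text \<open>The combination is linear in its coefficients, so the energy bound applied to a
  difference of coefficients controls the Sobolev distance.\<close>

lemma continuous_map_bump_comb: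
  fixes X :: "nat \<Rightarrow> real^'n::finite"
  assumes om: "open \<Omega>" "bounded \<Omega>" and p: "0 < p" and s: "0 < s"
    and sep: "\<And>i j. i \<le> m \<Longrightarrow> j \<le> m \<Longrightarrow> i \<noteq> j \<Longrightarrow> 2 * s \<le> dist (X i) (X j)"
  shows "continuous_map (nsphere m) (sobolev_topology p \<Omega>) (bump_comb X s m)"
proof -
  define M where "M = (1 + (4 / s) powr p) * (unit_ball_vol (real CARD('n)) * s ^ CARD('n))"
  let ?S = "topspace (nsphere m)"
  have sob: "bump_comb X s m t \<in> sobolev p \<Omega>" for t by (rule smooth_sobolev(1)[OF p om smooth_bump_comb])
  have dist: "sobolev_norm p \<Omega> (\<lambda>x. bump_comb X s m t x - bump_comb X s m t' x) \<le> ((\<Sum>j\<le>m. \<bar>t j - t' j\<bar> powr p) * M) powr (1 / p)" for t t'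
    unfolding sobolev_norm_energy bump_comb_diff M_def
    by (rule powr_mono2[OF _ sobolev_energy_nonneg], use p in simp, rule bump_comb_energy[OF om p s]) (rule sep)
  have "openin (nsphere m) {t \<in> ?S. bump_comb X s m t \<in> U}" if U: "openin (sobolev_topology p \<Omega>) U" for U
  proof (subst openin_subopen, intro ballI)
    fix t assume t: "t \<in> {t \<in> ?S. bump_comb X s m t \<in> U}"
    then obtain r where r: "0 < r" "\<And>v. v \<in> sobolev p \<Omega> \<Longrightarrow> sobolev_norm p \<Omega> (\<lambda>x. v x - bump_comb X s m t x) < r \<Longrightarrow> v \<in> U"
      using U unfolding openin_sobolev_topology by blast
    define W where "W = {t'. ((\<Sum>j\<le>m. \<bar>t' j - t j\<bar> powr p) * M) powr (1 / p) < r}"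
    have ct: "continuous_on UNIV (\<lambda>t' :: nat \<Rightarrow> real. \<bar>t' j - t j\<bar> powr p)" for j
      using p by (intro continuous_on_powr' continuous_intros continuous_on_product_coordinates) auto
    have "continuous_on UNIV (\<lambda>t'. (\<Sum>j\<le>m. \<bar>t' j - t j\<bar> powr p) * M)"
      by (intro continuous_on_mult_right continuous_on_sum ct)
    moreover have "0 \<le> (\<Sum>j\<le>m. \<bar>t' j - t j\<bar> powr p) * M" for t'
      unfolding M_def using s by (intro mult_nonneg_nonneg sum_nonneg) auto
    ultimately have "continuous_on UNIV (\<lambda>t'. ((\<Sum>j\<le>m. \<bar>t' j - t j\<bar> powr p) * M) powr (1 / p))"
      using p by (intro continuous_on_powr' continuous_on_const) auto
    then have "open W" unfolding W_def by (intro open_Collect_less continuous_on_const)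
    then have "openin (nsphere m) (?S \<inter> W)" by (subst nsphere_top_of_set) (auto simp: openin_open)
    moreover have "t \<in> ?S \<inter> W" using t r(1) p by (auto simp: W_def)
    moreover have "?S \<inter> W \<subseteq> {t \<in> ?S. bump_comb X s m t \<in> U}"
    proof
      fix t' assume t': "t' \<in> ?S \<inter> W"
      then have "sobolev_norm p \<Omega> (\<lambda>x. bump_comb X s m t' x - bump_comb X s m t x) < r"
        using dist[of t' t] by (simp add: W_def)
      then show "t' \<in> {t \<in> ?S. bump_comb X s m t \<in> U}" using t' r(2)[OF sob] by blast
    qed
    ultimately show "\<exists>V. openin (nsphere m) V \<and> t \<in> V \<and> V \<subseteq> {t \<in> ?S. bump_comb X s m t \<in> U}" by blast
  qed
  then show ?thesis
    unfolding continuous_map_def topspace_sobolev_topology using sob by blast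
qed

text \<open>An odd map on the image, composed with the parametrisation by coefficients, is an odd
  map on the sphere of dimension \<open>m\<close>; Borsuk-Ulam excludes target dimensions up to
  \<open>m\<close>.\<close>

lemma bump_comb_Gamma:
  fixes X :: "nat \<Rightarrow> real^'n::finite"
  assumes om: "open \<Omega>" "bounded \<Omega>" and p: "0 < p" and s: "0 < s" and X: "\<And>j. j \<le> m \<Longrightarrow> X j \<in> frontier \<Omega>"
    and sep: "\<And>i j. i \<le> m \<Longrightarrow> j \<le> m \<Longrightarrow> i \<noteq> j \<Longrightarrow> 2 * s \<le> dist (X i) (X j)"
  shows "bump_comb X s m ` topspace (nsphere m) \<in> Gamma_family p \<Omega> (Suc m)"
proof -
  let ?S = "topspace (nsphere m)" and ?T = "sobolev_topology p \<Omega>"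
  let ?C = "bump_comb X s m ` ?S"
  have cm: "continuous_map (nsphere m) ?T (bump_comb X s m)"
    by (rule continuous_map_bump_comb[OF om p s]) (rule sep)
  have neg: "(\<lambda>i. - t i) \<in> ?S" if "t \<in> ?S" for t using that by (simp add: topspace_nsphere)
  have neg': "bump_comb X s m (\<lambda>i. - t i) = (\<lambda>x. - bump_comb X s m t x)" for t by (rule ext) (rule bump_comb_minus)
  have "compactin (nsphere m) ?S"
    using compact_topspace_nsphere[of m] by (subst (1) nsphere_top_of_set) (simp add: compactin_subtopology)
  then have 1: "compactin ?T ?C" using cm by (rule image_compactin)
  have 2: "\<not> (AE x in lebesgue_on \<Omega>. u x = 0)" if u: "u \<in> ?C" for u
  proof -
    obtain t where t: "t \<in> ?S" "u = bump_comb X s m t" using u by blast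
    then obtain j where "j \<le> m" "t j \<noteq> 0" using nsphere_nonzero by blast
    then show ?thesis unfolding t(2) using bump_comb_nonzero[where X=X and m=m, OF om(1) s X] sep by blast
  qed
  have 3: "(\<lambda>u x. - u x) ` ?C = ?C"
  proof
    show "(\<lambda>u x. - u x) ` ?C \<subseteq> ?C" 
    proof (intro subsetI, elim imageE, hypsubst)
      fix t assume "t \<in> ?S"
      then show "(\<lambda>x. - bump_comb X s m t x) \<in> ?C" unfolding neg'[symmetric] by (intro imageI neg)
    qed
    show "?C \<subseteq> (\<lambda>u x. - u x) ` ?C"
    proof
      fix u assume "u \<in> ?C"
      then obtain t where t: "t \<in> ?S" "u = bump_comb X s m t" by blast
      have "(\<lambda>x. - bump_comb X s m t x) \<in> ?C" unfolding neg'[symmetric] by (intro imageI neg t(1))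
      from imageI[OF this, of "\<lambda>u x. - u x"] show "u \<in> (\<lambda>u x. - u x) ` ?C" using t(2) by simp
    qed
  qed
  have "enat (Suc m) \<le> genus ?T ?C"
    unfolding genus_def
  proof (rule INF_greatest)
    fix m' assume "m' \<in> {m'. \<exists>f. continuous_map (subtopology ?T ?C) (subtopology (Euclidean_space m') (- {\<lambda>i. 0})) f \<and>
        (\<forall>u\<in>?C. f (\<lambda>x. - u x) = (\<lambda>i. - f u i))}"
    then obtain f where f: "continuous_map (subtopology ?T ?C) (subtopology (Euclidean_space m') (- {\<lambda>i. 0})) f"
      and odd: "\<And>u. u \<in> ?C \<Longrightarrow> f (\<lambda>x. - u x) = (\<lambda>i. - f u i)" by blast
    have "continuous_map (nsphere m) (subtopology ?T ?C) (bump_comb X s m)"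
      using cm by (auto simp: continuous_map_in_subtopology)
    from continuous_map_compose[OF this f] have c: "continuous_map (nsphere m) (subtopology (Euclidean_space m') (- {\<lambda>i. 0})) (f \<circ> bump_comb X s m)" .
    have "Suc m \<le> m'"
    proof (rule ccontr)
      assume "\<not> Suc m \<le> m'"
      then have "m' \<le> m" by simp
      from Borsuk_Ulam_nsphere[OF this c] show False using odd by (simp add: neg')
    qed
    then show "enat (Suc m) \<le> enat m'" by simp
  qed
  with 1 2 3 show ?thesis by (simp add: Gamma_family_def)
qed

context chart
begin

text \<open>The radius \<open>s\<close> will be \<kappa> times \<open>k\<close> to the power -1 / d,
  for which \<open>real k * (2 * s) ^ d\<close> equals \<open>(2 * \<kappa>) ^ d\<close>; one
  \<kappa> below the volume threshold \<open>m0\<close> thus serves all \<open>k\<close>. The last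
  factor 2 makes the inequality in \<open>packing\<close> strict.\<close>

definition "\<kappa> = min 1 (min (T / 2) (m0 / (c1 * 2 ^ d * 2)))"

lemma kappa: "0 < \<kappa>" "\<kappa> \<le> 1" "2 * \<kappa> \<le> T" "c1 * (2 * \<kappa>) ^ d < m0"
proof -
  show pos: "0 < \<kappa>" using T(1) m0(1) c1 by (simp add: \<kappa>_def)
  show 1: "\<kappa> \<le> 1" by (simp add: \<kappa>_def)
  have "\<kappa> \<le> T / 2" by (simp add: \<kappa>_def)
  then show "2 * \<kappa> \<le> T" by simp
  have "\<kappa> ^ d \<le> \<kappa> ^ 1" using pos 1 d0 by (intro power_decreasing) auto
  also have "\<dots> \<le> m0 / (c1 * 2 ^ d * 2)" by (simp add: \<kappa>_def)
  finally have "c1 * 2 ^ d * 2 * \<kappa> ^ d \<le> m0" using c1 by (simp add: pos_le_divide_eq mult.commute)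
  moreover have "0 < c1 * 2 ^ d * \<kappa> ^ d" using c1 pos by simp
  ultimately show "c1 * (2 * \<kappa>) ^ d < m0" by (simp add: power_mult_distrib mult.assoc)
qed

text \<open>The volume of a ball is split as \<open>s\<close> times \<open>s ^ d\<close>: the single
  factor pairs with the gradient bound to give \<open>s powr (1 - p)\<close>, and
  \<open>s ^ d\<close> is paid for by the boundary integral. The same sum of powers of the
  coefficients appears on both sides and drops out.\<close>

lemma Gamma_test_sets:
  assumes dom: "bounded_C1_domain \<Omega>"
  shows "\<exists>C0\<ge>0. \<forall>k\<ge>1. \<exists>C\<in>Gamma_family p \<Omega> k. \<forall>u\<in>C. 0 < H_functional p \<Omega> u \<and>
    sobolev_energy p \<Omega> u \<le> C0 * real k powr ((p - 1) / real d) * H_functional p \<Omega> u"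
proof -
  have bd: "bounded \<Omega>" using dom by (simp add: bounded_C1_domain_def)
  have p0: "0 < p" using p by simp
  define E where "E = exp (- 4 / 3) powr p"
  define B where "B = 4 powr p * c2 * 2 ^ d / (E * c3)"
  define C0 where "C0 = B * V * 2 * 4 powr p * \<kappa> powr (1 - p)"
  have E0: "0 < E" by (simp add: E_def)
  have B0: "0 < B" using c2 c3 E0 by (simp add: B_def)
  have C0: "0 \<le> C0" using B0 V by (simp add: C0_def)
  have "\<exists>C\<in>Gamma_family p \<Omega> k. \<forall>u\<in>C. 0 < H_functional p \<Omega> u \<and>
    sobolev_energy p \<Omega> u \<le> C0 * real k powr ((p - 1) / real d) * H_functional p \<Omega> u" if k: "1 \<le> k" for k
  proof -
    define s where "s = \<kappa> * real k powr (- 1 / real d)"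
    have s0: "0 < s" using kappa(1) k by (simp add: s_def)
    have "real k powr (- 1 / real d) \<le> real k powr 0" using k by (intro powr_mono) auto
    then have sk: "s \<le> \<kappa>" using kappa(1) k by (simp add: s_def mult_left_le)
    have "(real k powr (- 1 / real d)) ^ d = real k powr (- 1)" using k d0 by (simp add: powr_powr powr_realpow[symmetric])
    moreover have "(2 * s) ^ d = (2 * \<kappa>) ^ d * (real k powr (- 1 / real d)) ^ d"
      unfolding s_def mult.assoc[symmetric] by (rule power_mult_distrib)
    ultimately have "(2 * s) ^ d = (2 * \<kappa>) ^ d * (1 / real k)" using k by (simp add: powr_minus_divide)
    then have "real k * (c1 * (2 * s) ^ d) = c1 * (2 * \<kappa>) ^ d" using k by simp
    from this[symmetric] have pk: "real k * (c1 * (2 * s) ^ d) < m0" using kappa(4) by (rule ord_eq_less_trans[OF sym])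
    obtain Y where Y: "finite Y" "Y \<subseteq> S" "card Y = k" "\<And>x y. x \<in> Y \<Longrightarrow> y \<in> Y \<Longrightarrow> x \<noteq> y \<Longrightarrow> 2 * s \<le> dist x y"
      using packing[OF s0 _ pk] sk kappa(3) by auto
    obtain m where m: "k = Suc m" using k by (cases k) auto
    obtain X where X: "bij_betw X {..m} Y"
      using ex_bij_betw_nat_finite[OF Y(1)] by (auto simp: Y(3) m atLeast0LessThan lessThan_Suc_atMost)
    have XS: "X j \<in> S" if "j \<le> m" for j using X that Y(2) by (auto simp: bij_betw_def)
    have Xf: "X j \<in> frontier \<Omega>" if "j \<le> m" for j
      by (rule zero_in_frontier) (use XS[OF that] T in \<open>auto simp: S_def a_def\<close>)
    have sep: "2 * s \<le> dist (X i) (X j)" if "i \<le> m" "j \<le> m" "i \<noteq> j" for i j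
      using X that by (intro Y(4)) (auto simp: bij_betw_def inj_on_def)
    have mem: "bump_comb X s m ` topspace (nsphere m) \<in> Gamma_family p \<Omega> k"
      unfolding m by (rule bump_comb_Gamma[OF om bd p0 s0]) (rule Xf, simp, rule sep)
    moreover have "0 < H_functional p \<Omega> (bump_comb X s m t) \<and> sobolev_energy p \<Omega> (bump_comb X s m t) \<le> C0 * real k powr ((p - 1) / real d) * H_functional p \<Omega> (bump_comb X s m t)"
      if t: "t \<in> topspace (nsphere m)" for t
    proof
      let ?H = "H_functional p \<Omega> (bump_comb X s m t)"
      define A where "A = (\<Sum>j\<le>m. \<bar>t j\<bar> powr p)"
      obtain j where j: "j \<le> m" "t j \<noteq> 0" using nsphere_nonzero[OF t] by blast
      have A0: "0 < A" unfolding A_def by (rule sum_pos2[of _ j]) (use j in auto)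
      have H: "A * (E * (c3 * (s / 2) ^ d)) \<le> 4 powr p * c2 * ?H"
        unfolding A_def E_def by (rule bump_comb_H[OF dom s0]) (use sk kappa in simp, rule XS, simp, rule sep)
      have "0 < A * (E * (c3 * (s / 2) ^ d))" using A0 E0 c3 s0 by simp
      with H have "0 < (4 powr p * c2) * ?H" by linarith
      then show H0: "0 < ?H" by (rule zero_less_mult_pos) (use c2 in simp)
      have H': "A * s ^ d \<le> B * ?H"
      proof -
        have "A * s ^ d = (A * (E * (c3 * (s / 2) ^ d))) * (2 ^ d / (E * c3))" using E0 c3 by (simp add: power_divide)
        also have "\<dots> \<le> (4 powr p * c2 * ?H) * (2 ^ d / (E * c3))" using H E0 c3 by (intro mult_right_mono) auto
        also have "\<dots> = B * ?H" by (simp add: B_def)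
        finally show ?thesis .
      qed
      have fs: "(1 + (4 / s) powr p) * s \<le> 2 * 4 powr p * s powr (1 - p)"
      proof -
        \<comment> \<open>Since \<open>s \<le> \<kappa> \<le> 1\<close>, the gradient term dominates
          the mass term.\<close>
        have "1 \<le> (4 / s) powr p" using s0 sk kappa p by (intro ge_one_powr_ge_zero) auto
        then have "(1 + (4 / s) powr p) * s \<le> (2 * (4 / s) powr p) * s" using s0 by (intro mult_right_mono) auto
        also have "\<dots> = 2 * 4 powr p * (s powr (- p) * s powr 1)" using s0 by (simp add: powr_divide powr_minus_divide)
        also have "s powr (- p) * s powr 1 = s powr (1 - p)" by (simp only: powr_add[symmetric]) simp
        finally show ?thesis .
      qed
      have "sobolev_energy p \<Omega> (bump_comb X s m t) \<le> A * ((1 + (4 / s) powr p) * (V * s ^ CARD('n)))"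
        unfolding A_def V_def by (rule bump_comb_energy[OF om bd p0 s0]) (rule sep)
      also have "\<dots> = ((1 + (4 / s) powr p) * s) * V * (A * s ^ d)" by (simp add: card_eq)
      also have "\<dots> \<le> (2 * 4 powr p * s powr (1 - p)) * V * (B * ?H)"
        by (rule mult_mono[OF mult_right_mono[OF fs] H']) (use V A0 s0 in auto)
      also have "s powr (1 - p) = \<kappa> powr (1 - p) * real k powr ((p - 1) / real d)"
      proof -
        have "- 1 / real d * (1 - p) = (p - 1) / real d" using d0 by (simp add: field_simps)
        then show ?thesis using kappa(1) k by (simp add: s_def powr_mult powr_powr del: minus_divide_left)
      qed
      also have "(2 * 4 powr p * (\<kappa> powr (1 - p) * real k powr ((p - 1) / real d))) * V * (B * ?H) = C0 * real k powr ((p - 1) / real d) * ?H"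
        by (simp add: C0_def)
      finally show "sobolev_energy p \<Omega> (bump_comb X s m t) \<le> C0 * real k powr ((p - 1) / real d) * ?H" .
    qed
    ultimately show ?thesis by blast
  qed
  then show ?thesis using C0 by blast
qed

end

lemma frontier_nonempty_bounded_open:
  fixes \<Omega> :: "'a::euclidean_space set"
  assumes "open \<Omega>" "bounded \<Omega>" "\<Omega> \<noteq> {}"
  shows "frontier \<Omega> \<noteq> {}"
  using assms frontier_not_empty not_bounded_UNIV by metis

theorem Gamma_family_test_sets:
  fixes \<Omega> :: "(real^'n::finite) set"
  assumes dom: "bounded_C1_domain \<Omega>" and p: "1 \<le> p" and N: "2 \<le> CARD('n)"
  shows "\<exists>C0\<ge>0. \<forall>k\<ge>1. \<exists>C\<in>Gamma_family p \<Omega> k. \<forall>u\<in>C. 0 < H_functional p \<Omega> u \<and>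
    sobolev_energy p \<Omega> u \<le> C0 * real k powr ((p - 1) / (real CARD('n) - 1)) * H_functional p \<Omega> u"
proof -
  have om: "open \<Omega>" "bounded \<Omega>" "\<Omega> \<noteq> {}" "C1_boundary \<Omega>" using dom by (auto simp: bounded_C1_domain_def)
  obtain x0 where x0: "x0 \<in> frontier \<Omega>" using frontier_nonempty_bounded_open[OF om(1-3)] by blast
  obtain r e \<gamma> L where ch: "boundary_chart \<Omega> x0 r e \<gamma> L" using C1_boundary_chart[OF om(4) x0] by blast
  interpret chart \<Omega> x0 r e \<gamma> L p "CARD('n) - 1" "unit_ball_vol (real CARD('n))"
    by unfold_locales (use ch om x0 N p in auto)
  show ?thesis using Gamma_test_sets[OF dom] N by (simp add: of_nat_diff)
qed

section \<open>Comparison of the minimax values\<close>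

text \<open>Composition with simple functions is measurable, and continuity in the second variable
  passes to the limit. It holds only for almost every \<open>x\<close>, so the values on the
  exceptional set are replaced by 0, which completeness of the measure permits.\<close>

lemma caratheodory_comp_measurable:
  fixes \<Phi> :: "real^'n::finite \<Rightarrow> real^'n \<Rightarrow> real"
  assumes om: "open \<Omega>" and \<Phi>: "caratheodory_fun \<Omega> \<Phi>" and g: "g \<in> borel_measurable (lebesgue_on \<Omega>)"
  shows "(\<lambda>x. \<Phi> x (g x)) \<in> borel_measurable (lebesgue_on \<Omega>)"
proof -
  let ?M = "lebesgue_on \<Omega>"
  have cont: "AE x in ?M. continuous_on UNIV (\<Phi> x)" and meas: "\<And>\<xi>. (\<lambda>x. \<Phi> x \<xi>) \<in> borel_measurable ?M"
    using \<Phi> by (auto simp: caratheodory_fun_def)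
  obtain F where F: "\<And>i. simple_function ?M (F i)" "\<And>x. x \<in> space ?M \<Longrightarrow> (\<lambda>i. F i x) \<longlonglongrightarrow> g x"
    using borel_measurable_implies_sequence_metric[OF g, of 0] by blast
  have FM: "(\<lambda>x. \<Phi> x (F i x)) \<in> borel_measurable ?M" for i
  proof -
    have fin: "finite (F i ` space ?M)" using F(1) by (rule simple_functionD(1))
    have A: "(\<lambda>x. \<Sum>y\<in>F i ` space ?M. indicator (F i -` {y} \<inter> space ?M) x * \<Phi> x y) \<in> borel_measurable ?M"
      using simple_functionD(2)[OF F(1)] by (intro borel_measurable_sum borel_measurable_times meas borel_measurable_indicator)
    have B: "(\<Sum>y\<in>F i ` space ?M. indicator (F i -` {y} \<inter> space ?M) x * \<Phi> x y) = \<Phi> x (F i x)" if x: "x \<in> space ?M" for x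
    proof -
      have "(\<Sum>y\<in>F i ` space ?M. indicator (F i -` {y} \<inter> space ?M) x * \<Phi> x y) = (\<Sum>y\<in>F i ` space ?M. if y = F i x then \<Phi> x y else 0)"
        using x by (intro sum.cong) (auto simp: indicator_def)
      also have "\<dots> = \<Phi> x (F i x)" using fin x by simp
      finally show ?thesis .
    qed
    show ?thesis by (rule iffD1[OF measurable_cong A]) (rule B)
  qed
  define h where "h x = (if continuous_on UNIV (\<Phi> x) then \<Phi> x (g x) else 0)" for x
  define hi where "hi i x = (if continuous_on UNIV (\<Phi> x) then \<Phi> x (F i x) else 0)" for i x
  have "hi i \<in> borel_measurable ?M" for i
    by (rule measurable_lebesgue_on_AE[OF om FM[of i]]) (use cont in \<open>eventually_elim, simp add: hi_def\<close>)
  moreover have "(\<lambda>i. hi i x) \<longlonglongrightarrow> h x" if x: "x \<in> space ?M" for x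
  proof (cases "continuous_on UNIV (\<Phi> x)")
    case True
    then have "(\<lambda>i. \<Phi> x (F i x)) \<longlonglongrightarrow> \<Phi> x (g x)" using F(2)[OF x] by (rule continuous_on_tendsto_compose) auto
    then show ?thesis using True by (simp add: h_def hi_def)
  qed (simp add: h_def hi_def)
  ultimately have "h \<in> borel_measurable ?M" by (rule borel_measurable_LIMSEQ_metric)
  then show ?thesis
    by (rule measurable_lebesgue_on_AE[OF om]) (use cont in \<open>eventually_elim, simp add: h_def\<close>)
qed

lemma integral_weight_bounds:
  fixes f w :: "'a \<Rightarrow> real"
  assumes f: "integrable M f" "\<And>x. 0 \<le> f x" and w: "w \<in> borel_measurable M" and b: "AE x in M. l \<le> w x \<and> w x \<le> h"
  shows "l * (LINT x|M. f x) \<le> (LINT x|M. w x * f x)" "(LINT x|M. w x * f x) \<le> h * (LINT x|M. f x)"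
proof -
  have bd: "AE x in M. l * f x \<le> w x * f x \<and> w x * f x \<le> h * f x"
    using b by eventually_elim (use f(2) in \<open>auto intro: mult_right_mono\<close>)
  have i: "integrable M (\<lambda>x. w x * f x)"
  proof (rule Bochner_Integration.integrable_bound)
    show "integrable M (\<lambda>x. (\<bar>l\<bar> + \<bar>h\<bar>) * f x)" using f(1) by simp
    show "(\<lambda>x. w x * f x) \<in> borel_measurable M" using w f(1) by measurable
    show "AE x in M. norm (w x * f x) \<le> norm ((\<bar>l\<bar> + \<bar>h\<bar>) * f x)"
      using b by eventually_elim (use f(2) in \<open>auto simp: abs_mult intro!: mult_right_mono\<close>)
  qed
  show "l * (LINT x|M. f x) \<le> (LINT x|M. w x * f x)"
    using integral_mono_AE[of M "\<lambda>x. l * f x" "\<lambda>x. w x * f x"] i f(1) bd by fastforce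
  show "(LINT x|M. w x * f x) \<le> h * (LINT x|M. f x)"
    using integral_mono_AE[of M "\<lambda>x. w x * f x" "\<lambda>x. h * f x"] i f(1) bd by fastforce
qed

definition admissible_weight :: "(real^'n::finite) set \<Rightarrow> real \<Rightarrow> real \<Rightarrow> (real^'n \<Rightarrow> real) \<Rightarrow> bool" where
  "admissible_weight \<Omega> l h w \<longleftrightarrow> w \<in> borel_measurable (lebesgue_on \<Omega>) \<and> (AE x in lebesgue_on \<Omega>. l \<le> w x \<and> w x \<le> h)"

lemma admissible_rescale:
  fixes f :: "real^'n::finite \<Rightarrow> real"
  assumes om: "open \<Omega>" and f: "f \<in> borel_measurable lebesgue" and b: "AE x in lebesgue. l \<le> f x \<and> f x \<le> h" and eps: "0 < \<epsilon>"
  shows "admissible_weight \<Omega> l h (rescale \<epsilon> f)"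
proof -
  have m: "rescale \<epsilon> f \<in> borel_measurable lebesgue"
    unfolding rescale_def[abs_def] by (rule measurable_compose[OF lebesgue_measurable_scaling f])
  have "AE x in lborel. l \<le> f x \<and> f x \<le> h" using b by (simp add: AE_completion_iff)
  then have "AE x in lborel. l \<le> rescale \<epsilon> f x \<and> rescale \<epsilon> f x \<le> h"
    unfolding rescale_def using eps by (intro AE_lborel_scale) auto
  then have "AE x in lebesgue. x \<in> \<Omega> \<longrightarrow> l \<le> rescale \<epsilon> f x \<and> rescale \<epsilon> f x \<le> h"
    unfolding AE_completion_iff by eventually_elim auto
  then show ?thesis
    using measurable_restrict_space1[OF m] unfolding admissible_weight_def AE_lebesgue_on_iff[OF om] by blast
qed

lemma Q_mean_bounds:
  fixes f :: "real^'n::finite \<Rightarrow> real"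
  assumes f: "f \<in> borel_measurable lebesgue" and b: "AE x in lebesgue. l \<le> f x \<and> f x \<le> h"
  shows "l \<le> Q_mean f" "Q_mean f \<le> h"
proof -
  let ?M = "lebesgue_on (cbox 0 1 :: (real^'n) set)"
  have "measure lebesgue (cbox 0 1 :: (real^'n) set) = 1"
  proof -
    have "(0 :: real^'n) \<in> cbox 0 1" by (simp add: mem_box_cart)
    then have "measure lborel (cbox 0 1 :: (real^'n) set) = 1" by (subst content_cbox_cart) auto
    then show ?thesis by simp
  qed
  then have "measure ?M (space ?M) = 1" by (simp add: measure_restrict_space)
  moreover have fin: "finite_measure ?M" by (rule finite_measure_lebesgue_on) simp
  ultimately have one: "(LINT x|?M. (1 :: real)) = 1" "integrable ?M (\<lambda>x. 1 :: real)"
    using finite_measure.integrable_const[OF fin] by auto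
  have "AE x in ?M. l \<le> f x \<and> f x \<le> h" using b by (simp add: AE_restrict_space_iff) (auto elim: eventually_mono)
  from integral_weight_bounds[OF one(2) _ measurable_restrict_space1[OF f] this]
  show "l \<le> Q_mean f" "Q_mean f \<le> h" using one(1) by (simp_all add: Q_mean_def)
qed

lemma admissible_const: "l \<le> c \<Longrightarrow> c \<le> h \<Longrightarrow> admissible_weight \<Omega> l h (\<lambda>x. c)"
  by (simp add: admissible_weight_def)

lemma genus_empty: "genus T {} = 0"
proof -
  have "continuous_map (subtopology T {}) (subtopology (Euclidean_space 0) (- {\<lambda>i. 0})) (\<lambda>u i. 0)"
    by (simp add: continuous_map_def)
  then have "genus T {} \<le> enat 0" unfolding genus_def by (intro INF_lower) auto
  then show ?thesis by (simp add: enat_0)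
qed

text \<open>The empty set has genus 0, so \<open>k \<ge> 1\<close> excludes it; a real supremum over
  it would be an arbitrary value.\<close>

lemma Gamma_family_nonempty: "C \<in> Gamma_family p \<Omega> k \<Longrightarrow> 1 \<le> k \<Longrightarrow> C \<noteq> {}"
  by (auto simp: Gamma_family_def genus_empty enat_0[symmetric])

lemma Gamma_family_sobolev: "C \<in> Gamma_family p \<Omega> k \<Longrightarrow> C \<subseteq> sobolev p \<Omega>"
  using compactin_subset_topspace by (fastforce simp: Gamma_family_def topspace_sobolev_topology)

lemma Lp_integral_pos:
  assumes om: "open \<Omega>" and u: "u \<in> sobolev p \<Omega>" and nz: "\<not> (AE x in lebesgue_on \<Omega>. u x = 0)"
  shows "0 < (LINT x|lebesgue_on \<Omega>. \<bar>u x\<bar> powr p)"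
proof -
  have i: "integrable (lebesgue_on \<Omega>) (\<lambda>x. \<bar>u x\<bar> powr p)" using sobolev_wgrad(2)[OF om u] by (simp add: in_Lp_def)
  have "(LINT x|lebesgue_on \<Omega>. \<bar>u x\<bar> powr p) \<noteq> 0" using integral_nonneg_eq_0_iff_AE[OF i] nz by auto
  moreover have "0 \<le> (LINT x|lebesgue_on \<Omega>. \<bar>u x\<bar> powr p)" by (intro integral_nonneg_AE) auto
  ultimately show ?thesis by linarith
qed

text \<open>The sets \<open>U n\<close>, where the Sobolev norm is bounded and the
  \<open>L^p\<close> norm is bounded away from 0, are open, increasing and cover \<open>C\<close>,
  so by compactness one of them contains it. The quotients are then bounded above on
  \<open>C\<close>, since the weighted mass bounds the denominator from below.\<close>

lemma Gamma_family_energy_bound: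
  fixes \<Omega> :: "(real^'n::finite) set"
  assumes om: "open \<Omega>" and p: "1 \<le> p" and C: "C \<in> Gamma_family p \<Omega> k"
  shows "\<exists>M\<ge>0. \<forall>u\<in>C. sobolev_energy p \<Omega> u \<le> M * (LINT x|lebesgue_on \<Omega>. \<bar>u x\<bar> powr p)"
proof -
  let ?N = "sobolev_norm p \<Omega>" and ?L = "Lp_norm p \<Omega>"
  have p0: "0 < p" using p by simp
  define U where "U n = {v \<in> sobolev p \<Omega>. ?N v < real (Suc n) \<and> 1 / real (Suc n) < ?L v}" for n :: nat
  have sym: "?N (\<lambda>x. v x - w x) = ?N (\<lambda>x. w x - v x)" if "v \<in> sobolev p \<Omega>" "w \<in> sobolev p \<Omega>" for v w
    using sobolev_energy_scale[OF om _ sobolev_diff[OF om _ that], of "-1"] p0 by (simp add: sobolev_norm_energy)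
  have op: "openin (sobolev_topology p \<Omega>) (U n)" for n
    unfolding openin_sobolev_topology
  proof (intro conjI ballI)
    show "U n \<subseteq> sobolev p \<Omega>" by (auto simp: U_def)
    fix v assume v: "v \<in> U n"
    then have vs: "v \<in> sobolev p \<Omega>" by (simp add: U_def)
    define r where "r = min (real (Suc n) - ?N v) (?L v - 1 / real (Suc n))"
    have "w \<in> U n" if w: "w \<in> sobolev p \<Omega>" "?N (\<lambda>x. w x - v x) < r" for w
    proof -
      have "?N (\<lambda>x. v x + (w x - v x)) \<le> ?N v + ?N (\<lambda>x. w x - v x)"
        using p0 by (intro sobolev_norm_triangle om p vs sobolev_diff w) auto
      then have 1: "?N w < real (Suc n)" using w(2) by (simp add: r_def)
      have "?L (\<lambda>x. w x + (v x - w x)) \<le> ?L w + ?L (\<lambda>x. v x - w x)"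
        using p0 by (intro Lp_norm_triangle om p vs sobolev_diff w) auto
      moreover have "?L (\<lambda>x. v x - w x) \<le> ?N (\<lambda>x. w x - v x)"
        using Lp_norm_le_sobolev_norm[OF p0] sym[OF vs w(1)] by metis
      ultimately have "1 / real (Suc n) < ?L w" using w(2) unfolding r_def by simp
      with 1 show ?thesis using w(1) by (simp add: U_def)
    qed
    moreover have "0 < r" using v by (simp add: r_def U_def)
    ultimately show "\<exists>r>0. \<forall>w\<in>sobolev p \<Omega>. ?N (\<lambda>x. w x - v x) < r \<longrightarrow> w \<in> U n" by blast
  qed
  have mono: "U n \<subseteq> U m" if "n \<le> m" for n m
  proof -
    have "real (Suc n) \<le> real (Suc m)" "1 / real (Suc m) \<le> 1 / real (Suc n)" using that by (auto intro: divide_left_mono)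
    then show ?thesis unfolding U_def by fastforce
  qed
  have "C \<subseteq> (\<Union>n. U n)"
  proof
    fix v assume v: "v \<in> C"
    then have vs: "v \<in> sobolev p \<Omega>" using Gamma_family_sobolev[OF C] by blast
    have "0 < (LINT x|lebesgue_on \<Omega>. \<bar>v x\<bar> powr p)" using Lp_integral_pos[OF om vs] C v by (simp add: Gamma_family_def)
    then have L: "0 < ?L v" by (simp add: Lp_norm_def)
    obtain n1 where n1: "?N v < real n1" using reals_Archimedean2 by blast
    obtain n2 where n2: "inverse (real (Suc n2)) < ?L v" using reals_Archimedean[OF L] by blast
    have "real n1 \<le> real (Suc (max n1 n2))" by simp
    moreover have "1 / real (Suc (max n1 n2)) \<le> inverse (real (Suc n2))" by (simp add: inverse_eq_divide frac_le)
    ultimately have "v \<in> U (max n1 n2)" unfolding U_def using vs n1 n2 by simp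
    then show "v \<in> (\<Union>n. U n)" by blast
  qed
  then have "C \<subseteq> \<Union>(range U)" by simp
  moreover have "\<forall>V\<in>range U. openin (sobolev_topology p \<Omega>) V" using op by blast
  moreover have "compactin (sobolev_topology p \<Omega>) C" using C by (simp add: Gamma_family_def)
  ultimately have "\<exists>\<F>. finite \<F> \<and> \<F> \<subseteq> range U \<and> C \<subseteq> \<Union>\<F>"
    unfolding compactin_def by (elim conjE allE[of _ "range U"]) blast
  then obtain \<F> where F: "finite \<F>" "\<F> \<subseteq> range U" "C \<subseteq> \<Union>\<F>" by blast
  obtain J where J: "finite J" "\<F> = U ` J" using finite_subset_image[OF F(1,2)] by blast
  obtain n where n: "J \<subseteq> {..n}" using J(1) finite_nat_set_iff_bounded_le by (metis atMost_iff subsetI)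
  have CU: "C \<subseteq> U n"
  proof
    fix v assume "v \<in> C"
    then obtain j where "j \<in> J" "v \<in> U j" using F(3) J(2) by blast
    then show "v \<in> U n" using mono[of j n] n by blast
  qed
  define q where "q = real (Suc n) powr p"
  have "sobolev_energy p \<Omega> u \<le> (q * q) * (LINT x|lebesgue_on \<Omega>. \<bar>u x\<bar> powr p)" if "u \<in> C" for u
  proof -
    let ?I = "LINT x|lebesgue_on \<Omega>. \<bar>u x\<bar> powr p"
    have b: "?N u < real (Suc n)" "1 / real (Suc n) < ?L u" using that CU by (auto simp: U_def)
    have I0: "0 \<le> ?I" by (intro integral_nonneg_AE) auto
    have "sobolev_energy p \<Omega> u = ?N u powr p" using p0 sobolev_energy_nonneg[of p \<Omega> u] by (simp add: sobolev_norm_energy powr_powr)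
    also have "\<dots> \<le> q" unfolding q_def using b(1) p0 by (intro powr_mono2) (auto simp: sobolev_norm_def)
    finally have 1: "sobolev_energy p \<Omega> u \<le> q" .
    have "(1 / real (Suc n)) powr p \<le> ?L u powr p" using b(2) p0 by (intro powr_mono2) auto
    also have "\<dots> = ?I" using p0 I0 by (simp add: Lp_norm_def powr_powr)
    finally have "1 / q \<le> ?I" by (simp add: q_def powr_divide)
    then have "1 \<le> q * ?I" by (simp add: q_def pos_divide_le_eq mult.commute)
    then have "q * 1 \<le> q * (q * ?I)" by (intro mult_left_mono) (auto simp: q_def)
    then show ?thesis using 1 by (simp add: mult.assoc)
  qed
  then show ?thesis by (intro exI[of _ "q * q"]) (auto simp: q_def)
qed

text \<open>A set that is nearly optimal for \<open>R\<close> is tested with \<open>R'\<close>. The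
  function r + c (1 + r)^2 increases for r \<ge> 0, so the pointwise bound passes to the supremum;
  then the slack \<eta> tends to 0.\<close>

lemma minimax_perturbation:
  fixes R R' :: "'a \<Rightarrow> real" and \<Gamma> :: "'a set set"
  assumes ne: "\<Gamma> \<noteq> {}" "\<And>C. C \<in> \<Gamma> \<Longrightarrow> C \<noteq> {}"
    and R: "\<And>C u. C \<in> \<Gamma> \<Longrightarrow> u \<in> C \<Longrightarrow> 0 \<le> R u" "\<And>C. C \<in> \<Gamma> \<Longrightarrow> bdd_above (R ` C)"
    and R': "\<And>C u. C \<in> \<Gamma> \<Longrightarrow> u \<in> C \<Longrightarrow> 0 \<le> R' u" "\<And>C. C \<in> \<Gamma> \<Longrightarrow> bdd_above (R' ` C)"
    and close: "\<And>C u. C \<in> \<Gamma> \<Longrightarrow> u \<in> C \<Longrightarrow> R' u \<le> R u + c * (1 + R u)\<^sup>2" and c: "0 \<le> c"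
  shows "(INF C\<in>\<Gamma>. SUP u\<in>C. R' u) \<le> (INF C\<in>\<Gamma>. SUP u\<in>C. R u) + c * (1 + (INF C\<in>\<Gamma>. SUP u\<in>C. R u))\<^sup>2"
proof -
  define l where "l = (INF C\<in>\<Gamma>. SUP u\<in>C. R u)"
  define l' where "l' = (INF C\<in>\<Gamma>. SUP u\<in>C. R' u)"
  have pos: "0 \<le> (SUP u\<in>C. R u)" if C: "C \<in> \<Gamma>" for C
  proof -
    obtain u where "u \<in> C" using ne(2)[OF C] by blast
    then show ?thesis using R(1)[OF C] cSUP_upper[OF _ R(2)[OF C]] by force
  qed
  have pos': "0 \<le> (SUP u\<in>C. R' u)" if C: "C \<in> \<Gamma>" for C
  proof -
    obtain u where "u \<in> C" using ne(2)[OF C] by blast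
    then show ?thesis using R'(1)[OF C] cSUP_upper[OF _ R'(2)[OF C]] by force
  qed
  have bb: "bdd_below ((\<lambda>C. SUP u\<in>C. R u) ` \<Gamma>)" "bdd_below ((\<lambda>C. SUP u\<in>C. R' u) ` \<Gamma>)"
    using pos pos' by (auto intro!: bdd_belowI2[where m=0])
  have step: "l' \<le> l + \<eta> + c * (1 + (l + \<eta>))\<^sup>2" if \<eta>: "0 < \<eta>" for \<eta>
  proof -
    have "(INF C\<in>\<Gamma>. SUP u\<in>C. R u) < l + \<eta>" using \<eta> by (simp add: l_def)
    then obtain C where C: "C \<in> \<Gamma>" "(SUP u\<in>C. R u) < l + \<eta>"
      using cINF_less_iff[OF ne(1) bb(1)] by blast
    have "l' \<le> (SUP u\<in>C. R' u)" unfolding l'_def by (rule cINF_lower[OF bb(2) C(1)])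
    also have "\<dots> \<le> l + \<eta> + c * (1 + (l + \<eta>))\<^sup>2"
    proof (rule cSUP_least[OF ne(2)[OF C(1)]])
      fix u assume u: "u \<in> C"
      have Ru: "R u \<le> l + \<eta>" using cSUP_upper[OF u R(2)[OF C(1)]] C(2) by linarith
      have "R' u \<le> R u + c * (1 + R u)\<^sup>2" by (rule close[OF C(1) u])
      also have "\<dots> \<le> l + \<eta> + c * (1 + (l + \<eta>))\<^sup>2"
        using Ru R(1)[OF C(1) u] c by (intro add_mono mult_left_mono power_mono) auto
      finally show "R' u \<le> l + \<eta> + c * (1 + (l + \<eta>))\<^sup>2" .
    qed
    finally show ?thesis .
  qed
  have "((\<lambda>\<eta>. l + \<eta> + c * (1 + (l + \<eta>))\<^sup>2) \<longlongrightarrow> l + 0 + c * (1 + (l + 0))\<^sup>2) (at_right 0)"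
    by (intro tendsto_intros)
  moreover have "\<forall>\<^sub>F \<eta> in at_right 0. l' \<le> l + \<eta> + c * (1 + (l + \<eta>))\<^sup>2"
    using step by (auto simp: eventually_at_right_less intro: eventually_mono[OF eventually_at_right_less])
  ultimately have "l' \<le> l + 0 + c * (1 + (l + 0))\<^sup>2" by (rule tendsto_lowerbound) simp
  then show ?thesis by (simp add: l_def l'_def)
qed

text \<open>With \<open>R = A / D\<close>, the difference of the quotients is
  \<open>((A' - A) + R * (D - D')) / D'\<close>, and
  \<open>E \<le> q * A = q * R * D \<le> q * R * m * D'\<close> bounds the error relative to
  \<open>D'\<close> by a multiple of \<open>R\<close>.\<close>

lemma quotient_perturbation:
  fixes A A' D D' E q m \<kappa> :: real
  assumes D: "0 < D" "0 < D'" and A: "0 \<le> A" and dA: "\<bar>A - A'\<bar> \<le> \<kappa> * E" and dD: "\<bar>D - D'\<bar> \<le> \<kappa> * E"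
    and E: "0 \<le> E" "E \<le> q * A" and m: "D \<le> m * D'" "0 \<le> m" and \<kappa>: "0 \<le> \<kappa>" and q: "0 \<le> q"
  shows "A' / D' \<le> A / D + \<kappa> * q * m * (1 + A / D)\<^sup>2"
proof -
  define R where "R = A / D"
  have R: "0 \<le> R" "A = R * D" using A D by (auto simp: R_def)
  have ED: "E / D' \<le> q * m * R"
  proof -
    have "E \<le> q * (R * D)" using E R by simp
    also have "\<dots> \<le> q * (R * (m * D'))" using R q m by (intro mult_left_mono) auto
    finally show ?thesis using D by (simp add: pos_divide_le_eq mult_ac)
  qed
  have "A' / D' - R = ((A' - A) + R * (D - D')) / D'" using D R(2) by (simp add: field_simps)
  also have "\<dots> \<le> (\<kappa> * E + R * (\<kappa> * E)) / D'"
    using D R dA dD by (intro divide_right_mono add_mono mult_left_mono) auto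
  also have "\<dots> = \<kappa> * (1 + R) * (E / D')" by (simp add: field_simps)
  also have "\<dots> \<le> \<kappa> * (1 + R) * (q * m * R)" using ED \<kappa> R by (intro mult_left_mono) auto
  also have "\<dots> \<le> \<kappa> * (1 + R) * (q * m * (1 + R))" using \<kappa> R q m by (intro mult_left_mono) auto
  also have "\<dots> = \<kappa> * q * m * (1 + R)\<^sup>2" by (simp add: power2_eq_square mult_ac)
  finally show ?thesis unfolding R_def by simp
qed

section \<open>Bounds for the eigenvalues and their dependence on the weights\<close>

locale eigenvalue_problem =
  fixes \<Omega> :: "(real^'n::finite) set" and a :: "real^'n \<Rightarrow> real^'n \<Rightarrow> real^'n"
    and \<Phi> :: "real^'n \<Rightarrow> real^'n \<Rightarrow> real" and p \<alpha> \<beta> :: real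
  assumes dom: "bounded_C1_domain \<Omega>" and p: "1 < p" and N: "2 \<le> CARD('n)" and \<alpha>: "0 < \<alpha>" and \<beta>: "0 < \<beta>"
    and pot: "is_potential p \<alpha> \<beta> \<Omega> a \<Phi>"
begin

abbreviation "mass u \<equiv> (LINT x|lebesgue_on \<Omega>. \<bar>u x\<bar> powr p)"
abbreviation "Num W u \<equiv> G_functional \<Omega> \<Phi> u + F_functional p \<Omega> u W"
abbreviation "Den w u \<equiv> H_functional p \<Omega> u + F_functional p \<Omega> u w"

lemma om: "open \<Omega>" "bounded \<Omega>" using dom by (auto simp: bounded_C1_domain_def)

lemma mass_nonneg: "0 \<le> mass u" by (intro integral_nonneg_AE) auto

lemma H_nonneg: "0 \<le> H_functional p \<Omega> u" unfolding H_functional_def by (intro integral_nonneg_AE) auto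

lemma G_bounds:
  assumes u: "u \<in> sobolev p \<Omega>"
  shows "\<alpha> * (LINT x|lebesgue_on \<Omega>. norm (wgrad \<Omega> u x) powr p) \<le> G_functional \<Omega> \<Phi> u"
    "G_functional \<Omega> \<Phi> u \<le> \<beta> * (LINT x|lebesgue_on \<Omega>. norm (wgrad \<Omega> u x) powr p)"
proof -
  let ?M = "lebesgue_on \<Omega>" and ?g = "\<lambda>x. norm (wgrad \<Omega> u x) powr p"
  note U = sobolev_wgrad(3)[OF om(1) u]
  have ig: "integrable ?M ?g" using U by (simp add: in_Lp_def)
  have bd: "AE x in ?M. \<alpha> * ?g x \<le> \<Phi> x (wgrad \<Omega> u x) \<and> \<Phi> x (wgrad \<Omega> u x) \<le> \<beta> * ?g x"
    using pot unfolding is_potential_def by (auto elim: eventually_mono)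
  have i: "integrable ?M (\<lambda>x. \<Phi> x (wgrad \<Omega> u x))"
  proof (rule Bochner_Integration.integrable_bound)
    show "integrable ?M (\<lambda>x. \<beta> * ?g x)" using ig by simp
    show "(\<lambda>x. \<Phi> x (wgrad \<Omega> u x)) \<in> borel_measurable ?M"
      using pot U by (intro caratheodory_comp_measurable om(1)) (auto simp: is_potential_def in_Lp_def)
    show "AE x in ?M. norm (\<Phi> x (wgrad \<Omega> u x)) \<le> norm (\<beta> * ?g x)"
      using bd
    proof eventually_elim
      case (elim x)
      moreover have "0 \<le> \<alpha> * ?g x" using \<alpha> by simp
      ultimately show ?case by auto
    qed
  qed
  show "\<alpha> * (LINT x|?M. ?g x) \<le> G_functional \<Omega> \<Phi> u"
    unfolding G_functional_def using integral_mono_AE[of ?M "\<lambda>x. \<alpha> * ?g x" "\<lambda>x. \<Phi> x (wgrad \<Omega> u x)"] i ig bd by fastforce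
  show "G_functional \<Omega> \<Phi> u \<le> \<beta> * (LINT x|?M. ?g x)"
    unfolding G_functional_def using integral_mono_AE[of ?M "\<lambda>x. \<Phi> x (wgrad \<Omega> u x)" "\<lambda>x. \<beta> * ?g x"] i ig bd by fastforce
qed

lemma F_bounds:
  assumes u: "u \<in> sobolev p \<Omega>" and w: "admissible_weight \<Omega> l h w"
  shows "l * mass u \<le> F_functional p \<Omega> u w" "F_functional p \<Omega> u w \<le> h * mass u"
  unfolding F_functional_def
  by (rule integral_weight_bounds; use sobolev_wgrad(2)[OF om(1) u] w in \<open>auto simp: in_Lp_def admissible_weight_def\<close>)+

lemma Num_bounds:
  assumes u: "u \<in> sobolev p \<Omega>" and W: "admissible_weight \<Omega> l h W"
  shows "min \<alpha> l * sobolev_energy p \<Omega> u \<le> Num W u" "Num W u \<le> max \<beta> h * sobolev_energy p \<Omega> u"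
proof -
  let ?D = "LINT x|lebesgue_on \<Omega>. norm (wgrad \<Omega> u x) powr p"
  have D0: "0 \<le> ?D" by (intro integral_nonneg_AE) auto
  have "min \<alpha> l * ?D \<le> \<alpha> * ?D" "min \<alpha> l * mass u \<le> l * mass u" "\<beta> * ?D \<le> max \<beta> h * ?D" "h * mass u \<le> max \<beta> h * mass u"
    using D0 mass_nonneg by (auto intro!: mult_right_mono)
  then show "min \<alpha> l * sobolev_energy p \<Omega> u \<le> Num W u" "Num W u \<le> max \<beta> h * sobolev_energy p \<Omega> u"
    using G_bounds[OF u] F_bounds[OF u W] unfolding sobolev_energy_def by (simp_all add: distrib_left)
qed

lemma Gamma_mass_pos:
  assumes C: "C \<in> Gamma_family p \<Omega> k" "u \<in> C"
  shows "0 < mass u"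
proof (rule Lp_integral_pos[OF om(1)])
  show "u \<in> sobolev p \<Omega>" using Gamma_family_sobolev[OF C(1)] C(2) by blast
  show "\<not> (AE x in lebesgue_on \<Omega>. u x = 0)" using C by (simp add: Gamma_family_def)
qed

lemma Den_pos:
  assumes C: "C \<in> Gamma_family p \<Omega> k" "u \<in> C" and w: "admissible_weight \<Omega> l h w" "0 < l"
  shows "l * mass u \<le> Den w u" "0 < Den w u"
proof -
  have u: "u \<in> sobolev p \<Omega>" using Gamma_family_sobolev C by blast
  show "l * mass u \<le> Den w u" using F_bounds(1)[OF u w(1)] H_nonneg[of u] by linarith
  moreover have "0 < l * mass u" using w(2) Gamma_mass_pos[OF C] by simp
  ultimately show "0 < Den w u" by linarith
qed

lemma quotient_nonneg:
  assumes C: "C \<in> Gamma_family p \<Omega> k" "u \<in> C" and w: "admissible_weight \<Omega> l h w" "0 < l"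
    and W: "admissible_weight \<Omega> L H W" "0 < L"
  shows "0 \<le> Num W u" "0 \<le> Num W u / Den w u"
proof -
  have u: "u \<in> sobolev p \<Omega>" using Gamma_family_sobolev C by blast
  have "0 \<le> min \<alpha> L * sobolev_energy p \<Omega> u" using \<alpha> W(2) by (intro mult_nonneg_nonneg sobolev_energy_nonneg) simp
  then show n: "0 \<le> Num W u" using Num_bounds(1)[OF u W(1)] by linarith
  show "0 \<le> Num W u / Den w u" by (rule divide_nonneg_pos[OF n Den_pos(2)[OF C w]])
qed

lemma quotient_bdd_above:
  assumes C: "C \<in> Gamma_family p \<Omega> k" and w: "admissible_weight \<Omega> l h w" "0 < l" and W: "admissible_weight \<Omega> L H W"
  shows "bdd_above ((\<lambda>u. Num W u / Den w u) ` C)"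
proof -
  obtain M where M: "0 \<le> M" "\<And>u. u \<in> C \<Longrightarrow> sobolev_energy p \<Omega> u \<le> M * mass u"
    using Gamma_family_energy_bound[OF om(1) less_imp_le[OF p] C] by blast
  have "Num W u / Den w u \<le> max \<beta> H * M / l" if uC: "u \<in> C" for u
  proof -
    have u: "u \<in> sobolev p \<Omega>" using Gamma_family_sobolev C uC by blast
    have "Num W u \<le> max \<beta> H * sobolev_energy p \<Omega> u" by (rule Num_bounds(2)[OF u W])
    also have "\<dots> \<le> max \<beta> H * (M * mass u)" using M(2)[OF uC] \<beta> by (intro mult_left_mono) auto
    also have "\<dots> = max \<beta> H * M / l * (l * mass u)" using w(2) by simp
    also have "\<dots> \<le> max \<beta> H * M / l * Den w u"
      using \<beta> M(1) w(2) by (intro mult_left_mono[OF Den_pos(1)[OF C uC w]] divide_nonneg_pos mult_nonneg_nonneg) auto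
    finally show ?thesis using Den_pos(2)[OF C uC w] by (simp add: pos_divide_le_eq)
  qed
  then show ?thesis by (rule bdd_aboveI2)
qed

text \<open>\<open>C0\<close> is fixed before the weights are, so the bound is uniform in \<epsilon>
  and covers the limit problem as well. The test sets also show that the families are
  nonempty.\<close>

lemma eigenvalue_nonneg_upper:
  "\<exists>C0\<ge>0. \<forall>k\<ge>1. Gamma_family p \<Omega> k \<noteq> {} \<and> (\<forall>l h w L H W. admissible_weight \<Omega> l h w \<longrightarrow> 0 < l \<longrightarrow> admissible_weight \<Omega> L H W \<longrightarrow> 0 < L \<longrightarrow>
     0 \<le> eigenvalue_B p \<Omega> \<Phi> k w W \<and> eigenvalue_B p \<Omega> \<Phi> k w W \<le> max \<beta> H * C0 * real k powr ((p - 1) / (real CARD('n) - 1)))"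
proof -
  obtain C0 where C0: "0 \<le> C0" and test: "\<And>k. 1 \<le> k \<Longrightarrow> \<exists>C\<in>Gamma_family p \<Omega> k. \<forall>u\<in>C. 0 < H_functional p \<Omega> u \<and>
    sobolev_energy p \<Omega> u \<le> C0 * real k powr ((p - 1) / (real CARD('n) - 1)) * H_functional p \<Omega> u"
    using Gamma_family_test_sets[OF dom less_imp_le[OF p] N] by blast
  have "0 \<le> eigenvalue_B p \<Omega> \<Phi> k w W \<and> eigenvalue_B p \<Omega> \<Phi> k w W \<le> max \<beta> H * C0 * real k powr ((p - 1) / (real CARD('n) - 1))"
    if k: "1 \<le> k" and w: "admissible_weight \<Omega> l h w" "0 < l" and W: "admissible_weight \<Omega> L H W" "0 < L" for k l h w L H W
  proof -
    let ?S = "\<lambda>C. SUP u\<in>C. Num W u / Den w u" and ?\<Lambda> = "max \<beta> H * C0 * real k powr ((p - 1) / (real CARD('n) - 1))"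
    obtain C where C: "C \<in> Gamma_family p \<Omega> k" and Cu: "\<And>u. u \<in> C \<Longrightarrow> 0 < H_functional p \<Omega> u"
      "\<And>u. u \<in> C \<Longrightarrow> sobolev_energy p \<Omega> u \<le> C0 * real k powr ((p - 1) / (real CARD('n) - 1)) * H_functional p \<Omega> u"
      using test[OF k] by blast
    have S0: "0 \<le> ?S C'" if C': "C' \<in> Gamma_family p \<Omega> k" for C'
    proof -
      obtain u where u: "u \<in> C'" using Gamma_family_nonempty[OF C' k] by blast
      show ?thesis
        using quotient_nonneg(2)[OF C' u w W] cSUP_upper[OF u quotient_bdd_above[OF C' w W(1)]] by linarith
    qed
    have "?S C \<le> ?\<Lambda>"
    proof (rule cSUP_least[OF Gamma_family_nonempty[OF C k]])
      fix u assume uC: "u \<in> C"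
      have u: "u \<in> sobolev p \<Omega>" using Gamma_family_sobolev C uC by blast
      have "Num W u \<le> max \<beta> H * sobolev_energy p \<Omega> u" by (rule Num_bounds(2)[OF u W(1)])
      also have "\<dots> \<le> max \<beta> H * (C0 * real k powr ((p - 1) / (real CARD('n) - 1)) * H_functional p \<Omega> u)"
        using Cu(2)[OF uC] \<beta> by (intro mult_left_mono) auto
      also have "\<dots> = ?\<Lambda> * H_functional p \<Omega> u" by simp
      also have "\<dots> \<le> ?\<Lambda> * Den w u"
      proof (rule mult_left_mono)
        have "0 \<le> l * mass u" using w(2) mass_nonneg by simp
        then show "H_functional p \<Omega> u \<le> Den w u" using F_bounds(1)[OF u w(1)] by linarith
        show "0 \<le> ?\<Lambda>" using \<beta> C0 by (intro mult_nonneg_nonneg) auto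
      qed
      finally show "Num W u / Den w u \<le> ?\<Lambda>" using Den_pos(2)[OF C uC w] by (simp add: pos_divide_le_eq)
    qed
    moreover have "bdd_below (?S ` Gamma_family p \<Omega> k)" using S0 by (intro bdd_belowI2[where m=0])
    ultimately have "(INF C\<in>Gamma_family p \<Omega> k. ?S C) \<le> ?\<Lambda>" using cINF_lower2[OF _ C] by blast
    moreover have "0 \<le> (INF C\<in>Gamma_family p \<Omega> k. ?S C)" using S0 C by (intro cINF_greatest) auto
    ultimately show ?thesis by (simp add: eigenvalue_B_def)
  qed
  moreover have "Gamma_family p \<Omega> k \<noteq> {}" if "1 \<le> k" for k using test[OF that] by blast
  ultimately show ?thesis using C0 by blast
qed

text \<open>The estimate is one-sided and symmetric in its hypotheses up to exchanging the two pairs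
  of weights, so a second application gives the other side.\<close>

lemma eigenvalue_perturbation:
  assumes k: "1 \<le> k" and ne: "Gamma_family p \<Omega> k \<noteq> {}"
    and w: "admissible_weight \<Omega> l h w" "admissible_weight \<Omega> l h w'" "0 < l" "0 < h"
    and W: "admissible_weight \<Omega> L H W" "admissible_weight \<Omega> L H W'" "0 < L"
    and \<kappa>: "0 \<le> \<kappa>" and diff: "\<And>u. u \<in> sobolev p \<Omega> \<Longrightarrow> \<bar>F_functional p \<Omega> u w - F_functional p \<Omega> u w'\<bar> \<le> \<kappa> * sobolev_energy p \<Omega> u"
      "\<And>u. u \<in> sobolev p \<Omega> \<Longrightarrow> \<bar>F_functional p \<Omega> u W - F_functional p \<Omega> u W'\<bar> \<le> \<kappa> * sobolev_energy p \<Omega> u"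
  shows "eigenvalue_B p \<Omega> \<Phi> k w' W' \<le> eigenvalue_B p \<Omega> \<Phi> k w W + \<kappa> * (1 / min \<alpha> L) * max 1 (h / l) * (1 + eigenvalue_B p \<Omega> \<Phi> k w W)\<^sup>2"
  unfolding eigenvalue_B_def
proof (rule minimax_perturbation[OF ne])
  show "C \<noteq> {}" if "C \<in> Gamma_family p \<Omega> k" for C by (rule Gamma_family_nonempty[OF that k])
  show "0 \<le> Num W u / Den w u" "0 \<le> Num W' u / Den w' u" if "C \<in> Gamma_family p \<Omega> k" "u \<in> C" for C u
    using quotient_nonneg(2)[OF that w(1,3) W(1,3)] quotient_nonneg(2)[OF that w(2,3) W(2,3)] by auto
  show "bdd_above ((\<lambda>u. Num W u / Den w u) ` C)" "bdd_above ((\<lambda>u. Num W' u / Den w' u) ` C)" if "C \<in> Gamma_family p \<Omega> k" for C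
    using quotient_bdd_above[OF that w(1,3) W(1)] quotient_bdd_above[OF that w(2,3) W(2)] by auto
  have mn: "0 < min \<alpha> L" using \<alpha> W(3) by simp
  then show "0 \<le> \<kappa> * (1 / min \<alpha> L) * max 1 (h / l)" using \<kappa> by (intro mult_nonneg_nonneg) auto
  fix C u assume C: "C \<in> Gamma_family p \<Omega> k" "u \<in> C"
  then have u: "u \<in> sobolev p \<Omega>" using Gamma_family_sobolev by blast
  show "Num W' u / Den w' u \<le> Num W u / Den w u + \<kappa> * (1 / min \<alpha> L) * max 1 (h / l) * (1 + Num W u / Den w u)\<^sup>2"
  proof (rule quotient_perturbation[where E = "sobolev_energy p \<Omega> u"])
    show "0 < Den w u" "0 < Den w' u" by (rule Den_pos(2)[OF C w(1,3)] Den_pos(2)[OF C w(2,3)])+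
    show "0 \<le> Num W u" by (rule quotient_nonneg(1)[OF C w(1,3) W(1,3)])
    show "\<bar>Num W u - Num W' u\<bar> \<le> \<kappa> * sobolev_energy p \<Omega> u" "\<bar>Den w u - Den w' u\<bar> \<le> \<kappa> * sobolev_energy p \<Omega> u"
      using diff[OF u] by auto
    show "sobolev_energy p \<Omega> u \<le> 1 / min \<alpha> L * Num W u"
      using Num_bounds(1)[OF u W(1)] mn by (simp add: pos_le_divide_eq mult.commute)
    \<comment> \<open>The boundary terms agree, with factor 1, and the weighted masses are
      comparable with factor \<open>h / l\<close>.\<close>
    show "Den w u \<le> max 1 (h / l) * Den w' u"
    proof -
      have "F_functional p \<Omega> u w \<le> (h / l) * (l * mass u)" using F_bounds(2)[OF u w(1)] w(3) by simp
      also have "\<dots> \<le> (h / l) * F_functional p \<Omega> u w'" using F_bounds(1)[OF u w(2)] w(3,4) by (intro mult_left_mono) auto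
      also have "\<dots> \<le> max 1 (h / l) * F_functional p \<Omega> u w'"
      proof (rule mult_right_mono)
        have "0 \<le> l * mass u" using w(3) mass_nonneg by simp
        then show "0 \<le> F_functional p \<Omega> u w'" using F_bounds(1)[OF u w(2)] by linarith
      qed simp
      finally have "F_functional p \<Omega> u w \<le> max 1 (h / l) * F_functional p \<Omega> u w'" .
      moreover have "1 * H_functional p \<Omega> u \<le> max 1 (h / l) * H_functional p \<Omega> u" by (rule mult_right_mono[OF _ H_nonneg]) simp
      ultimately show ?thesis by (simp add: distrib_left)
    qed
  qed (use sobolev_energy_nonneg \<kappa> mn in auto)
qed

end

theorem mainTheorem3:
  fixes \<Omega> :: "(real^'n::finite) set"
    and a :: "real^'n \<Rightarrow> real^'n \<Rightarrow> real^'n"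
    and \<Phi> :: "real^'n \<Rightarrow> real^'n \<Rightarrow> real"
    and \<rho> V :: "real^'n \<Rightarrow> real"
    and p \<alpha> \<beta>\<^sub>0 c \<rho>_min \<rho>_max V_min :: real
  assumes "bounded_C1_domain \<Omega>"
    and "1 < p" and "p < real CARD('n)"
    and "\<alpha> > 0" and "\<beta>\<^sub>0 > 0" and "c > 0"
    and "structural_hyps p \<alpha> \<beta>\<^sub>0 c \<Omega> a"
    and "is_potential p \<alpha> \<beta>\<^sub>0 \<Omega> a \<Phi>"
    and "in_Linf \<rho>" and "in_Linf V"
    and "Q_periodic \<rho>" and "Q_periodic V"
    and "0 < \<rho>_min" and "AE x in lebesgue. \<rho>_min \<le> \<rho> x \<and> \<rho> x \<le> \<rho>_max"
    and "0 < V_min" and "AE x in lebesgue. V_min \<le> V x"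
  shows "\<exists>C>0. \<forall>\<epsilon>>0. \<forall>k\<ge>1.
    \<bar>eigenvalue_B p \<Omega> \<Phi> k (rescale \<epsilon> \<rho>) (rescale \<epsilon> V)
       - eigenvalue_B p \<Omega> \<Phi> k (\<lambda>x. Q_mean \<rho>) (\<lambda>x. Q_mean V)\<bar>
      \<le> C * real k powr (2 * (p - 1) / (real CARD('n) - 1)) * \<epsilon>"
proof -
  have N: "2 \<le> CARD('n)" using assms(2,3) by simp
  interpret eigenvalue_problem \<Omega> a \<Phi> p \<alpha> \<beta>\<^sub>0
    by unfold_locales (use assms N in auto)
  define \<theta> where "\<theta> = (p - 1) / (real CARD('n) - 1)"
  have \<theta>: "0 \<le> \<theta>" using assms(2) N by (simp add: \<theta>_def)
  have m: "\<rho> \<in> borel_measurable lebesgue" "V \<in> borel_measurable lebesgue" using assms(9,10) by (auto simp: in_Linf_def)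
  obtain M where M: "AE x in lebesgue. \<bar>V x\<bar> \<le> M" using assms(10) by (auto simp: in_Linf_def)
  \<comment> \<open>The maximum with 1 gives a positive upper bound, as
    \<open>eigenvalue_perturbation\<close> asks.\<close>
  define h where "h = max 1 \<bar>\<rho>_max\<bar>"
  define B where "B = max h \<bar>M\<bar>"
  have h: "0 < h" by (simp add: h_def)
  have \<rho>b: "AE x in lebesgue. \<rho>_min \<le> \<rho> x \<and> \<rho> x \<le> h" using assms(14) by eventually_elim (auto simp: h_def)
  have Vb: "AE x in lebesgue. V_min \<le> V x \<and> V x \<le> B" using assms(16) M by eventually_elim (auto simp: B_def)
  have Bb: "AE x in lebesgue. \<bar>\<rho> x\<bar> \<le> B" "AE x in lebesgue. \<bar>V x\<bar> \<le> B"
  proof -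
    show "AE x in lebesgue. \<bar>\<rho> x\<bar> \<le> B" using \<rho>b by eventually_elim (use assms(13) in \<open>auto simp: B_def\<close>)
    show "AE x in lebesgue. \<bar>V x\<bar> \<le> B" using M by eventually_elim (auto simp: B_def)
  qed
  have B0: "0 \<le> B" by (simp add: B_def)
  obtain C1 where C1: "0 \<le> C1" and osc: "\<And>u f \<epsilon>. u \<in> sobolev p \<Omega> \<Longrightarrow> f \<in> borel_measurable lebesgue \<Longrightarrow> AE x in lebesgue. \<bar>f x\<bar> \<le> B \<Longrightarrow>
      Q_periodic f \<Longrightarrow> 0 < \<epsilon> \<Longrightarrow>
      \<bar>F_functional p \<Omega> u (rescale \<epsilon> f) - F_functional p \<Omega> u (\<lambda>x. Q_mean f)\<bar> \<le> B * C1 * \<epsilon> * sobolev_energy p \<Omega> u"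
    using oscillation_estimate[OF dom less_imp_le[OF p]] B0 by meson
  obtain C0 where C0: "0 \<le> C0" and ne: "\<And>k. 1 \<le> k \<Longrightarrow> Gamma_family p \<Omega> k \<noteq> {}"
    and ev: "\<And>k l h w L H W. 1 \<le> k \<Longrightarrow> admissible_weight \<Omega> l h w \<Longrightarrow> 0 < l \<Longrightarrow> admissible_weight \<Omega> L H W \<Longrightarrow> 0 < L \<Longrightarrow>
     0 \<le> eigenvalue_B p \<Omega> \<Phi> k w W \<and> eigenvalue_B p \<Omega> \<Phi> k w W \<le> max \<beta>\<^sub>0 H * C0 * real k powr \<theta>"
    using eigenvalue_nonneg_upper unfolding \<theta>_def by meson
  define c where "c = B * C1 * (1 / min \<alpha> V_min) * max 1 (h / \<rho>_min)"
  define c' where "c' = (1 + max \<beta>\<^sub>0 B * C0)\<^sup>2"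
  have c0: "0 \<le> c" unfolding c_def using B0 C1 assms(4,15) by (intro mult_nonneg_nonneg) auto
  have "\<bar>eigenvalue_B p \<Omega> \<Phi> k (rescale \<epsilon> \<rho>) (rescale \<epsilon> V) - eigenvalue_B p \<Omega> \<Phi> k (\<lambda>x. Q_mean \<rho>) (\<lambda>x. Q_mean V)\<bar>
      \<le> (c * c' + 1) * real k powr (2 * (p - 1) / (real CARD('n) - 1)) * \<epsilon>" if eps: "0 < \<epsilon>" and k: "1 \<le> k" for \<epsilon> k
  proof -
    let ?le = "eigenvalue_B p \<Omega> \<Phi> k (rescale \<epsilon> \<rho>) (rescale \<epsilon> V)" and ?l = "eigenvalue_B p \<Omega> \<Phi> k (\<lambda>x. Q_mean \<rho>) (\<lambda>x. Q_mean V)"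
    note aw = admissible_rescale[OF om(1) m(1) \<rho>b eps] admissible_const[OF Q_mean_bounds[OF m(1) \<rho>b], of \<Omega>]
    note aW = admissible_rescale[OF om(1) m(2) Vb eps] admissible_const[OF Q_mean_bounds[OF m(2) Vb], of \<Omega>]
    have \<kappa>: "0 \<le> B * C1 * \<epsilon>" using B0 C1 eps by simp
    note d\<rho> = osc[OF _ m(1) Bb(1) assms(11) eps] and dV = osc[OF _ m(2) Bb(2) assms(12) eps]
    have kk: "B * C1 * \<epsilon> * (1 / min \<alpha> V_min) * max 1 (h / \<rho>_min) = c * \<epsilon>" by (simp add: c_def)
    \<comment> \<open>The comparison is used in both directions, with the oscillating and the
      averaged weights exchanged.\<close>
    have pert: "?l \<le> ?le + c * \<epsilon> * (1 + ?le)\<^sup>2" "?le \<le> ?l + c * \<epsilon> * (1 + ?l)\<^sup>2"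
      unfolding kk[symmetric]
      using eigenvalue_perturbation[OF k ne[OF k] aw assms(13) h aW assms(15) \<kappa> d\<rho> dV]
        eigenvalue_perturbation[OF k ne[OF k] aw(2,1) assms(13) h aW(2,1) assms(15) \<kappa>] d\<rho> dV
      by (simp_all add: abs_minus_commute)
    \<comment> \<open>For \<open>k \<ge> 1\<close> the summand 1 is absorbed into the power of
      \<open>k\<close>; squaring then doubles the exponent \<theta>.\<close>
    have sq: "(1 + l)\<^sup>2 \<le> c' * real k powr (2 * (p - 1) / (real CARD('n) - 1))"
      if l: "0 \<le> l \<and> l \<le> max \<beta>\<^sub>0 B * C0 * real k powr \<theta>" for l
    proof -
      have "1 \<le> real k powr \<theta>" using k \<theta> by (intro ge_one_powr_ge_zero) auto
      then have "1 + l \<le> (1 + max \<beta>\<^sub>0 B * C0) * real k powr \<theta>" using l by (simp add: distrib_right)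
      then have "(1 + l)\<^sup>2 \<le> ((1 + max \<beta>\<^sub>0 B * C0) * real k powr \<theta>)\<^sup>2" using l by (intro power_mono) auto
      also have "\<dots> = c' * (real k powr \<theta> * real k powr \<theta>)" by (simp add: c'_def power_mult_distrib power2_eq_square)
      also have "real k powr \<theta> * real k powr \<theta> = real k powr (2 * (p - 1) / (real CARD('n) - 1))"
        unfolding powr_add[symmetric] \<theta>_def by (simp add: add_divide_distrib[symmetric])
      finally show ?thesis .
    qed
    have "c * \<epsilon> * (1 + ?le)\<^sup>2 \<le> c * \<epsilon> * (c' * real k powr (2 * (p - 1) / (real CARD('n) - 1)))"
      "c * \<epsilon> * (1 + ?l)\<^sup>2 \<le> c * \<epsilon> * (c' * real k powr (2 * (p - 1) / (real CARD('n) - 1)))"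
      using c0 eps sq[OF ev[OF k aw(1) assms(13) aW(1) assms(15)]] sq[OF ev[OF k aw(2) assms(13) aW(2) assms(15)]]
      by (auto intro!: mult_left_mono)
    then have "\<bar>?le - ?l\<bar> \<le> c * \<epsilon> * (c' * real k powr (2 * (p - 1) / (real CARD('n) - 1)))" using pert by linarith
    also have "\<dots> \<le> (c * c' + 1) * real k powr (2 * (p - 1) / (real CARD('n) - 1)) * \<epsilon>"
      using eps by (simp add: algebra_simps)
    finally show ?thesis .
  qed
  \<comment> \<open>The product \<open>c * c'\<close> is only known to be nonnegative, so the added
    1 makes the constant positive.\<close>
  moreover have "0 < c * c' + 1" using c0 by (simp add: c'_def add_nonneg_pos)
  ultimately show ?thesis by blast
qed

end
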